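(* Let $f\in L^2(\Omega)$, let $u\in H_0^1(\Omega)$ be the solution of $(\nabla u,\nabla v)=(f,v)$ for all $v\in H_0^1(\Omega)$, and let $u_h\in V_h^c$ be the solution of $(\nabla u_h,\nabla v_h)=(f,v_h)$ for all $v_h\in V_h^c$. With $$\mathfrak E_h(f):=C_{0,h}\|f-\Pi_h^0f\|_{L^2(\Omega)}+\kappa_{M,h}\|\Pi_h^0f\|_{L^2(\Omega)},\qquad M_h:=\sqrt{C_{0,h}^2+\kappa_{M,h}^2},$$ one has $$\|u-u_h\|_{L^2(\Omega)}\le M_h|u-u_h|_{H^1(\Omega)}\le M_h\mathfrak E_h(f)\le M_h^2\|f\|_{L^2(\Omega)}.$$ Equivalently, for every $u\in H_0^1(\Omega)$ whose distributional Laplacian satisfies $\Delta u\in L^2(\Omega)$, $$\|u-P_hu\|_{L^2(\Omega)}\le M_h^2\|\Delta u\|_{L^2(\Omega)},$$ where $P_h:H_0^1(\Omega)\to V_h^c$ is the Ritz projection, $(\nabla P_hu,\nabla v_h)=(\nabla u,\nabla v_h)$ for all $v_h\in V_h^c$.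
   Context: Let $d\in\{2,3\}$, let $\Omega\subset\mathbb R^d$ be a bounded polyhedral Lipschitz domain, and let $\mathbb T_h$ be a finite conforming triangulation of $\overline\Omega$ into non-degenerate closed $d$-simplices (the intersection of two distinct elements is empty or a common subsimplex); no shape regularity is assumed. $(\cdot,\cdot)$ is the $L^2(\Omega)$ inner product (scalar or vector valued), $|v|_{H^1(\Omega)}:=\|\nabla v\|_{L^2(\Omega)^d}$, and $\nabla_h$ is the elementwise (broken) gradient. $X_h$ is the space of functions constant on each $T\in\mathbb T_h$, and $\Pi_h^0:L^2(\Omega)\to X_h$ is the $L^2$-orthogonal projection (elementwise mean). $V_h^c:=\{v\in H_0^1(\Omega): v|_T \text{ affine } \forall T\in\mathbb T_h\}$. The Crouzeix--Raviart space $V_{h,0}^{\mathrm{CR}}$ consists of the elementwise affine functions $v$ such that $\int_F[\![v]\!]\,ds=0$ for all faces $F$, where $[\![v]\!]$ is the jump across an interior face and the trace of $v$ on a boundary face. For $g_h\in X_h$: $z_h^c(g_h)\in V_h^c$ is the unique solution of $(\nabla z_h^c(g_h),\nabla v_h)=(g_h,v_h)$ for all $v_h\in V_h^c$; $z_h^{\mathrm{CR}}(g_h)\in V_{h,0}^{\mathrm{CR}}$ is the unique solution of $(\nabla_h z_h^{\mathrm{CR}}(g_h),\nabla_h v_h)=(g_h,v_h)$ for all $v_h\in V_{h,0}^{\mathrm{CR}}$; the Marini flux is $\bm\sigma_h^M(g_h)|_T:=\nabla_h z_h^{\mathrm{CR}}(g_h)|_T-\frac{g_h|_T}{d}(\bm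 x-\bm x_T)$, with $\bm x_T$ the barycentre of $T$; and $$\kappa_{M,h}:=\sup_{0\ne g_h\in X_h}\frac{\|\bm\sigma_h^M(g_h)-\nabla z_h^c(g_h)\|_{L^2(\Omega)^d}}{\|g_h\|_{L^2(\Omega)}}.$$ The optimal Poincaré constants are $C_0(T):=\sup\{\|v\|_{L^2(T)}/\|\nabla v\|_{L^2(T)^d}: 0\ne v\in H^1(T),\ \int_Tv\,dx=0\}$ and $C_{0,h}:=\max_{T\in\mathbb T_h}C_0(T)$. *)

theory Defs
  imports "HOL-Analysis.Analysis"
begin

text \<open>Functions are total on \<open>real ^ 'n\<close> and stand for their Lebesgue-a.e. classes on the set under
  consideration. Except for test functions, membership in the spaces below depends only on that class.\<close>


section \<open>Lebesgue and Sobolev spaces\<close>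

definition L2_space :: "'a::euclidean_space set \<Rightarrow> ('a \<Rightarrow> 'b::euclidean_space) set" where
  "L2_space S = {v. set_borel_measurable lebesgue S v \<and> set_integrable lebesgue S (\<lambda>x. (norm (v x))\<^sup>2)}"

definition L2_inner ::
  "'a::euclidean_space set \<Rightarrow> ('a \<Rightarrow> 'b::euclidean_space) \<Rightarrow> ('a \<Rightarrow> 'b) \<Rightarrow> real" where
  "L2_inner S v w = (LINT x:S|lebesgue. v x \<bullet> w x)"

definition L2_norm :: "'a::euclidean_space set \<Rightarrow> ('a \<Rightarrow> 'b::euclidean_space) \<Rightarrow> real" where
  "L2_norm S v = sqrt (L2_inner S v v)"

definition partial_deriv :: "'n::finite \<Rightarrow> (real ^ 'n \<Rightarrow> real) \<Rightarrow> real ^ 'n \<Rightarrow> real" where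
  "partial_deriv i \<phi> x = frechet_derivative \<phi> (at x) (axis i 1)"

primrec C_k :: "nat \<Rightarrow> (real ^ 'n \<Rightarrow> real) \<Rightarrow> bool" where
  "C_k 0 \<phi> = continuous_on UNIV \<phi>"
| "C_k (Suc k) \<phi> = ((\<forall>x. \<phi> differentiable (at x)) \<and> (\<forall>i. C_k k (partial_deriv i \<phi>)))"

definition test_functions :: "(real ^ 'n) set \<Rightarrow> (real ^ 'n \<Rightarrow> real) set" where
  "test_functions U = {\<phi>. (\<forall>k. C_k k \<phi>) \<and> compact (closure {x. \<phi> x \<noteq> 0}) \<and> closure {x. \<phi> x \<noteq> 0} \<subseteq> U}"

definition has_weak_gradient ::
  "(real ^ 'n) set \<Rightarrow> (real ^ 'n \<Rightarrow> real) \<Rightarrow> (real ^ 'n \<Rightarrow> real ^ 'n) \<Rightarrow> bool" where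
  "has_weak_gradient U v G \<longleftrightarrow> (\<forall>\<phi>\<in>test_functions U. \<forall>i.
     (LINT x:U|lebesgue. v x * partial_deriv i \<phi> x) = - (LINT x:U|lebesgue. G x $ i * \<phi> x))"

definition H1_space :: "(real ^ 'n) set \<Rightarrow> (real ^ 'n \<Rightarrow> real) set" where
  "H1_space U = {v \<in> L2_space U. \<exists>G \<in> L2_space U. has_weak_gradient U v G}"

text \<open>The weak gradient is unique only up to null sets; \<open>wgrad\<close> picks a representative.\<close>

definition wgrad :: "(real ^ 'n) set \<Rightarrow> (real ^ 'n \<Rightarrow> real) \<Rightarrow> real ^ 'n \<Rightarrow> real ^ 'n" where
  "wgrad U v = (SOME G. G \<in> L2_space U \<and> has_weak_gradient U v G)"

definition H1_seminorm :: "(real ^ 'n) set \<Rightarrow> (real ^ 'n \<Rightarrow> real) \<Rightarrow> real" where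
  "H1_seminorm U v = L2_norm U (wgrad U v)"

definition H1_norm :: "(real ^ 'n) set \<Rightarrow> (real ^ 'n \<Rightarrow> real) \<Rightarrow> real" where
  "H1_norm U v = sqrt ((L2_norm U v)\<^sup>2 + (H1_seminorm U v)\<^sup>2)"

definition H10_space :: "(real ^ 'n) set \<Rightarrow> (real ^ 'n \<Rightarrow> real) set" where
  "H10_space U = {v \<in> H1_space U.
     \<exists>\<phi>. (\<forall>k::nat. \<phi> k \<in> test_functions U) \<and> (\<lambda>k. H1_norm U (\<lambda>x. v x - \<phi> k x)) \<longlonglongrightarrow> 0}"

definition has_distr_laplacian ::
  "(real ^ 'n) set \<Rightarrow> (real ^ 'n \<Rightarrow> real) \<Rightarrow> (real ^ 'n \<Rightarrow> real) \<Rightarrow> bool" where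
  "has_distr_laplacian U v w \<longleftrightarrow> (\<forall>\<phi>\<in>test_functions U.
     (LINT x:U|lebesgue. v x * (\<Sum>i\<in>UNIV. partial_deriv i (partial_deriv i \<phi>) x))
       = (LINT x:U|lebesgue. w x * \<phi> x))"


section \<open>Domain and mesh\<close>

text \<open>Near each boundary point the domain is, for some unit vector \<open>e\<close>, the strict epigraph in
  direction \<open>e\<close> of a Lipschitz function on the hyperplane orthogonal to \<open>e\<close>.\<close>

definition polyhedral_lipschitz_domain :: "'a::euclidean_space set \<Rightarrow> bool" where
  "polyhedral_lipschitz_domain \<Omega> \<longleftrightarrow>
     open \<Omega> \<and> connected \<Omega> \<and> \<Omega> \<noteq> {} \<and> bounded \<Omega> \<and>
     (\<exists>P. finite P \<and> (\<forall>p\<in>P. polytope p) \<and> closure \<Omega> = \<Union>P) \<and>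
     (\<forall>x\<in>frontier \<Omega>. \<exists>r>0. \<exists>e L \<gamma>. norm e = 1 \<and> L-lipschitz_on {z. z \<bullet> e = 0} \<gamma> \<and>
        \<Omega> \<inter> ball x r = {y \<in> ball x r. \<gamma> (y - (y \<bullet> e) *\<^sub>R e) < y \<bullet> e})"

text \<open>The constant \<open>triangulation\<close> provides finiteness and that any two elements meet in a
  (possibly empty) common face.\<close>

definition conforming_triangulation :: "(real ^ 'n) set \<Rightarrow> (real ^ 'n) set set \<Rightarrow> bool" where
  "conforming_triangulation \<Omega> \<T> \<longleftrightarrow>
     triangulation \<T> \<and> (\<forall>T\<in>\<T>. int CARD('n) simplex T) \<and> \<Union>\<T> = closure \<Omega>"

definition barycentre :: "(real ^ 'n) set \<Rightarrow> real ^ 'n" where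
  "barycentre T = (1 / (real CARD('n) + 1)) *\<^sub>R (\<Sum>a | a extreme_point_of T. a)"

text \<open>Integral over a flat face \<open>F\<close> of codimension one with respect to surface measure. With \<open>\<nu>\<close> a
  unit normal, volume measure on the prism \<open>F + [0,1] \<nu>\<close> is surface measure on \<open>F\<close> times Lebesgue
  measure on \<open>[0,1]\<close>, so the integrand is extended constantly in direction \<open>\<nu>\<close>; on the prism,
  \<open>closest_point (affine hull F)\<close> sends \<open>y + t \<nu>\<close> to \<open>y\<close>.\<close>

definition unit_normal :: "'a::euclidean_space set \<Rightarrow> 'a" where
  "unit_normal F = (SOME \<nu>. norm \<nu> = 1 \<and> (\<forall>x\<in>F. \<forall>y\<in>F. \<nu> \<bullet> (x - y) = 0))"

definition face_integral :: "'a::euclidean_space set \<Rightarrow> ('a \<Rightarrow> real) \<Rightarrow> real" where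
  "face_integral F g =
     (LINT x:{y + t *\<^sub>R unit_normal F | y t. y \<in> F \<and> 0 \<le> t \<and> t \<le> 1}|lebesgue.
        g (closest_point (affine hull F) x))"


section \<open>Discrete spaces\<close>

definition is_affine_fun :: "('a::euclidean_space \<Rightarrow> real) \<Rightarrow> bool" where
  "is_affine_fun p \<longleftrightarrow> (\<exists>a b. \<forall>x. p x = a \<bullet> x + b)"

definition piecewise_constant :: "'a::euclidean_space set set \<Rightarrow> ('a \<Rightarrow> real) set" where
  "piecewise_constant \<T> = {g. \<forall>T\<in>\<T>. \<exists>c. AE x in lebesgue. x \<in> T \<longrightarrow> g x = c}"

definition piecewise_affine :: "'a::euclidean_space set set \<Rightarrow> ('a \<Rightarrow> real) set" where
  "piecewise_affine \<T> = {v. \<forall>T\<in>\<T>. \<exists>p. is_affine_fun p \<and> (AE x in lebesgue. x \<in> T \<longrightarrow> v x = p x)}"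

text \<open>The affine function that represents \<open>v\<close> on \<open>T\<close>; it is unique, since elements have positive
  measure, and restricts on a face of \<open>T\<close> to the trace of \<open>v\<close> from \<open>T\<close>.\<close>

definition elem_affine :: "'a::euclidean_space set \<Rightarrow> ('a \<Rightarrow> real) \<Rightarrow> 'a \<Rightarrow> real" where
  "elem_affine T v = (SOME p. is_affine_fun p \<and> (AE x in lebesgue. x \<in> T \<longrightarrow> v x = p x))"

definition broken_grad :: "(real ^ 'n) set set \<Rightarrow> (real ^ 'n \<Rightarrow> real) \<Rightarrow> real ^ 'n \<Rightarrow> real ^ 'n" where
  "broken_grad \<T> v x = (\<Sum>T\<in>\<T>. indicator (interior T) x *\<^sub>R wgrad (interior T) v x)"

definition conforming_space :: "(real ^ 'n) set \<Rightarrow> (real ^ 'n) set set \<Rightarrow> (real ^ 'n \<Rightarrow> real) set" where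
  "conforming_space \<Omega> \<T> = H10_space \<Omega> \<inter> piecewise_affine \<T>"

definition CR_space :: "(real ^ 'n) set \<Rightarrow> (real ^ 'n) set set \<Rightarrow> (real ^ 'n \<Rightarrow> real) set" where
  "CR_space \<Omega> \<T> = {v \<in> piecewise_affine \<T>.
     (\<forall>T\<in>\<T>. \<forall>T'\<in>\<T>. \<forall>F. T \<noteq> T' \<and> F facet_of T \<and> F facet_of T' \<longrightarrow>
        face_integral F (\<lambda>x. elem_affine T v x - elem_affine T' v x) = 0) \<and>
     (\<forall>T\<in>\<T>. \<forall>F. F facet_of T \<and> F \<subseteq> frontier \<Omega> \<longrightarrow> face_integral F (elem_affine T v) = 0)}"

definition L2_proj :: "(real ^ 'n) set \<Rightarrow> (real ^ 'n) set set \<Rightarrow> (real ^ 'n \<Rightarrow> real) \<Rightarrow> real ^ 'n \<Rightarrow> real" where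
  "L2_proj \<Omega> \<T> f = (SOME g. g \<in> piecewise_constant \<T> \<and>
     (\<forall>w\<in>piecewise_constant \<T>. L2_inner \<Omega> g w = L2_inner \<Omega> f w))"

definition ritz_proj :: "(real ^ 'n) set \<Rightarrow> (real ^ 'n) set set \<Rightarrow> (real ^ 'n \<Rightarrow> real) \<Rightarrow> real ^ 'n \<Rightarrow> real" where
  "ritz_proj \<Omega> \<T> u = (SOME p. p \<in> conforming_space \<Omega> \<T> \<and>
     (\<forall>v\<in>conforming_space \<Omega> \<T>.
        L2_inner \<Omega> (wgrad \<Omega> p) (wgrad \<Omega> v) = L2_inner \<Omega> (wgrad \<Omega> u) (wgrad \<Omega> v)))"


section \<open>Discrete solutions, Marini flux and constants\<close>

definition z_conf :: "(real ^ 'n) set \<Rightarrow> (real ^ 'n) set set \<Rightarrow> (real ^ 'n \<Rightarrow> real) \<Rightarrow> real ^ 'n \<Rightarrow> real" where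
  "z_conf \<Omega> \<T> g = (SOME z. z \<in> conforming_space \<Omega> \<T> \<and>
     (\<forall>v\<in>conforming_space \<Omega> \<T>. L2_inner \<Omega> (wgrad \<Omega> z) (wgrad \<Omega> v) = L2_inner \<Omega> g v))"

definition z_CR :: "(real ^ 'n) set \<Rightarrow> (real ^ 'n) set set \<Rightarrow> (real ^ 'n \<Rightarrow> real) \<Rightarrow> real ^ 'n \<Rightarrow> real" where
  "z_CR \<Omega> \<T> g = (SOME z. z \<in> CR_space \<Omega> \<T> \<and>
     (\<forall>v\<in>CR_space \<Omega> \<T>. L2_inner \<Omega> (broken_grad \<T> z) (broken_grad \<T> v) = L2_inner \<Omega> g v))"

definition marini_flux ::
  "(real ^ 'n) set \<Rightarrow> (real ^ 'n) set set \<Rightarrow> (real ^ 'n \<Rightarrow> real) \<Rightarrow> real ^ 'n \<Rightarrow> real ^ 'n" where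
  "marini_flux \<Omega> \<T> g x = broken_grad \<T> (z_CR \<Omega> \<T> g) x -
     (\<Sum>T\<in>\<T>. indicator (interior T) x *\<^sub>R ((g x / real CARD('n)) *\<^sub>R (x - barycentre T)))"

definition \<kappa>_M :: "(real ^ 'n) set \<Rightarrow> (real ^ 'n) set set \<Rightarrow> real" where
  "\<kappa>_M \<Omega> \<T> = Sup {L2_norm \<Omega> (\<lambda>x. marini_flux \<Omega> \<T> g x - wgrad \<Omega> (z_conf \<Omega> \<T> g) x) / L2_norm \<Omega> g | g.
     g \<in> piecewise_constant \<T> \<and> \<not> (AE x in lebesgue. x \<in> \<Omega> \<longrightarrow> g x = 0)}"

definition poincare_const :: "(real ^ 'n) set \<Rightarrow> real" where
  "poincare_const T = Sup {L2_norm (interior T) v / L2_norm (interior T) (wgrad (interior T) v) | v.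
     v \<in> H1_space (interior T) \<and> \<not> (AE x in lebesgue. x \<in> interior T \<longrightarrow> v x = 0) \<and>
     (LINT x:interior T|lebesgue. v x) = 0}"

definition C_0h :: "(real ^ 'n) set set \<Rightarrow> real" where
  "C_0h \<T> = Max (poincare_const ` \<T>)"

definition M_h :: "(real ^ 'n) set \<Rightarrow> (real ^ 'n) set set \<Rightarrow> real" where
  "M_h \<Omega> \<T> = sqrt ((C_0h \<T>)\<^sup>2 + (\<kappa>_M \<Omega> \<T>)\<^sup>2)"

definition error_bound :: "(real ^ 'n) set \<Rightarrow> (real ^ 'n) set set \<Rightarrow> (real ^ 'n \<Rightarrow> real) \<Rightarrow> real" where
  "error_bound \<Omega> \<T> f = C_0h \<T> * L2_norm \<Omega> (\<lambda>x. f x - L2_proj \<Omega> \<T> f x)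
     + \<kappa>_M \<Omega> \<T> * L2_norm \<Omega> (L2_proj \<Omega> \<T> f)"

end

theory Submission
  imports Defs
begin

text \<open>Let \<open>\<sigma>\<close> and \<open>z\<close> be the Marini flux and the conforming solution for the load \<open>\<Pi> f\<close>. The mean of a
  test function over each facet depends on the facet only, so that its Crouzeix-Raviart interpolant lies in
  the discrete space; inserting it into the discrete equation shows that \<open>(\<sigma>, \<nabla>v) = (\<Pi> f, v)\<close> for all
  \<open>v\<close> in \<open>H\<^sub>0\<^sup>1\<close>. Therefore \<open>(f, e) - (\<nabla>z, \<nabla>e) = (f - \<Pi> f, e - \<Pi> e) + (\<sigma> - \<nabla>z, \<nabla>e)\<close> is at most
  \<open>E(f) |e|\<close>, where \<open>E(f)\<close> is the error bound. With \<open>e = u - z\<close> this is the energy estimate, since \<open>u\<^sub>h\<close> is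
  the best approximation. With the load \<open>f = e = u - u\<^sub>h\<close> the second term on the left vanishes, and \<open>E(e)\<close>
  is at most \<open>M\<^sub>h \<parallel>e\<parallel>\<close> by the Cauchy-Schwarz and Pythagoras theorems, which is the estimate in \<open>L\<^sup>2\<close>.\<close>


section \<open>The space of square integrable functions\<close>

text \<open>The constants \<open>\<kappa>_M\<close> and \<open>poincare_const\<close> are suprema of
  sets of reals and bound nothing unless these sets are bounded above. For the first this comes from
  a Poincare inequality on the finite-dimensional Crouzeix-Raviart space together with Friedrichs'
  inequality, for the second from the Poincare inequality on convex domains; both hold with
  unspecified constants. The discrete solutions and projections are chosen by \<open>SOME\<close>,
  so their existence has to be proved as well. The means over facets are volume integrals: on a
  simplex with vertex a, the field \<phi>(x) (x - a) has no flux through the facets that contain a,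
  and through the facet opposite to a its flux is the height times the integral of \<phi>. Hence the
  integral of its divergence determines the mean of \<phi> over that facet. Two properties of this
  integral carry the argument: it vanishes if \<phi> vanishes on the facet, and after normalisation
  it agrees for two simplices that share the facet. Only test functions are interpolated; the
  identity for the flux passes to all of H_0^1 by density.\<close>

lemma L2_space_iff:
  "v \<in> L2_space S \<longleftrightarrow> (\<lambda>x. indicator S x *\<^sub>R v x) \<in> borel_measurable lebesgue \<and>
     integrable lebesgue (\<lambda>x. indicator S x * (norm (v x))\<^sup>2)"
  by (simp add: L2_space_def set_borel_measurable_def set_integrable_def)

lemma L2_space_cong_AE:
  assumes v: "v \<in> L2_space S" and eq: "AE x in lebesgue. x \<in> S \<longrightarrow> v x = w x"
  shows "w \<in> L2_space S"
proof -
  have m: "(\<lambda>x. indicator S x *\<^sub>R w x) \<in> borel_measurable lebesgue"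
    by (rule borel_measurable_AE[where f="\<lambda>x. indicator S x *\<^sub>R v x"])
      (use v eq in \<open>auto simp: L2_space_iff indicator_def elim: eventually_mono\<close>)
  have e: "indicator S x * (norm (w x))\<^sup>2 = (norm (indicator S x *\<^sub>R w x))\<^sup>2" for x
    by (simp add: indicator_def)
  have "(\<lambda>x. indicator S x * (norm (w x))\<^sup>2) \<in> borel_measurable lebesgue"
    unfolding e using m by measurable
  moreover have "AE x in lebesgue. indicator S x * (norm (v x))\<^sup>2 = indicator S x * (norm (w x))\<^sup>2"
    using eq by (auto simp: indicator_def elim: eventually_mono)
  moreover have "(\<lambda>x. indicator S x * (norm (v x))\<^sup>2) \<in> borel_measurable lebesgue"
    using v by (auto simp: L2_space_iff dest: borel_measurable_integrable)
  ultimately show ?thesis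
    using v m integrable_cong_AE unfolding L2_space_iff by blast
qed

lemma L2_inner_cong_AE:
  fixes v w v' w' :: "'a::euclidean_space \<Rightarrow> 'b::euclidean_space"
  assumes "AE x in lebesgue. x \<in> S \<longrightarrow> v x \<bullet> w x = v' x \<bullet> w' x"
    and "v \<in> L2_space S" "w \<in> L2_space S" "v' \<in> L2_space S" "w' \<in> L2_space S"
  shows "L2_inner S v w = L2_inner S v' w'"
proof -
  have e: "indicator S x *\<^sub>R (f x \<bullet> g x) = (indicator S x *\<^sub>R f x) \<bullet> (indicator S x *\<^sub>R g x)"
    for f g :: "'a \<Rightarrow> 'b" and x
    by (simp add: indicator_def)
  show ?thesis
    unfolding L2_inner_def set_lebesgue_integral_def
  proof (rule integral_cong_AE)
    show "(\<lambda>x. indicator S x *\<^sub>R (v x \<bullet> w x)) \<in> borel_measurable lebesgue"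
      unfolding e using assms unfolding L2_space_iff by (intro borel_measurable_inner) blast+
    show "(\<lambda>x. indicator S x *\<^sub>R (v' x \<bullet> w' x)) \<in> borel_measurable lebesgue"
      unfolding e using assms unfolding L2_space_iff by (intro borel_measurable_inner) blast+
    show "AE x in lebesgue. indicator S x *\<^sub>R (v x \<bullet> w x) = indicator S x *\<^sub>R (v' x \<bullet> w' x)"
      using assms(1) by (auto simp: indicator_def elim: eventually_mono)
  qed
qed

lemma L2_inner_commute: "L2_inner S v w = L2_inner S w v"
  by (simp add: L2_inner_def inner_commute)

lemma L2_inner_integrable:
  assumes "v \<in> L2_space S" "w \<in> L2_space S"
  shows "set_integrable lebesgue S (\<lambda>x. v x \<bullet> w x)"
  unfolding set_integrable_def
proof (rule Bochner_Integration.integrable_bound)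
  show "integrable lebesgue (\<lambda>x. indicator S x * (norm (v x))\<^sup>2 + indicator S x * (norm (w x))\<^sup>2)"
    using assms by (auto simp: L2_space_iff)
  have e: "indicator S x *\<^sub>R (v x \<bullet> w x) = (indicator S x *\<^sub>R v x) \<bullet> (indicator S x *\<^sub>R w x)" for x
    by (simp add: indicator_def)
  show "(\<lambda>x. indicator S x *\<^sub>R (v x \<bullet> w x)) \<in> borel_measurable lebesgue"
    unfolding e using assms unfolding L2_space_iff by (intro borel_measurable_inner) blast+
  have "\<bar>v x \<bullet> w x\<bar> \<le> (norm (v x))\<^sup>2 + (norm (w x))\<^sup>2" for x
  proof -
    have "2 * (norm (v x) * norm (w x)) \<le> (norm (v x))\<^sup>2 + (norm (w x))\<^sup>2"
      using sum_squares_bound[of "norm (v x)" "norm (w x)"] by simp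
    moreover have "\<bar>v x \<bullet> w x\<bar> \<le> norm (v x) * norm (w x)" by (rule Cauchy_Schwarz_ineq2)
    moreover have "0 \<le> norm (v x) * norm (w x)" by simp
    ultimately show ?thesis by linarith
  qed
  then have "norm (indicator S x *\<^sub>R (v x \<bullet> w x))
      \<le> norm (indicator S x * (norm (v x))\<^sup>2 + indicator S x * (norm (w x))\<^sup>2)" for x
    by (cases "x \<in> S") simp_all
  then show "AE x in lebesgue. norm (indicator S x *\<^sub>R (v x \<bullet> w x))
      \<le> norm (indicator S x * (norm (v x))\<^sup>2 + indicator S x * (norm (w x))\<^sup>2)"
    by (rule AE_I2)
qed

text \<open>The form v + c w recurs for all spaces below: with c = 1, c = -1 or v = 0 it yields
  sums, differences and multiples from one computation.\<close>

lemma L2_space_add_scaled: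
  assumes "v \<in> L2_space S" "w \<in> L2_space S"
  shows "(\<lambda>x. v x + c *\<^sub>R w x) \<in> L2_space S"
  unfolding L2_space_iff
proof
  have "(\<lambda>x. indicator S x *\<^sub>R v x + c *\<^sub>R (indicator S x *\<^sub>R w x)) \<in> borel_measurable lebesgue"
    using assms unfolding L2_space_iff
    by (intro borel_measurable_add borel_measurable_scaleR[OF borel_measurable_const]) blast+
  then show "(\<lambda>x. indicator S x *\<^sub>R (v x + c *\<^sub>R w x)) \<in> borel_measurable lebesgue"
    by (simp add: algebra_simps)
  have "integrable lebesgue (\<lambda>x. indicator S x * (norm (v x))\<^sup>2 + 2 * c * (indicator S x *\<^sub>R (v x \<bullet> w x))
      + c\<^sup>2 * (indicator S x * (norm (w x))\<^sup>2))"
    using assms L2_inner_integrable[OF assms] unfolding L2_space_iff set_integrable_def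
    by (intro Bochner_Integration.integrable_add integrable_mult_right) auto
  moreover have "indicator S x * (norm (v x))\<^sup>2 + 2 * c * (indicator S x *\<^sub>R (v x \<bullet> w x))
      + c\<^sup>2 * (indicator S x * (norm (w x))\<^sup>2) = indicator S x * (norm (v x + c *\<^sub>R w x))\<^sup>2" for x
  proof -
    have "(norm (v x + c *\<^sub>R w x))\<^sup>2 = (norm (v x))\<^sup>2 + 2 * c * (v x \<bullet> w x) + c\<^sup>2 * (norm (w x))\<^sup>2"
      unfolding power2_norm_eq_inner
      by (simp add: inner_add_left inner_add_right inner_commute[of "w x" "v x"] power2_eq_square algebra_simps)
    then show ?thesis by (simp add: algebra_simps)
  qed
  ultimately show "integrable lebesgue (\<lambda>x. indicator S x * (norm (v x + c *\<^sub>R w x))\<^sup>2)"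
    by simp
qed

lemma L2_space_zero [simp]: "(\<lambda>x. 0) \<in> L2_space S"
  by (simp add: L2_space_iff)

lemma L2_space_scaled: "w \<in> L2_space S \<Longrightarrow> (\<lambda>x. c *\<^sub>R w x) \<in> L2_space S"
  using L2_space_add_scaled[OF L2_space_zero, of w S c] by simp

lemma L2_space_add: "v \<in> L2_space S \<Longrightarrow> w \<in> L2_space S \<Longrightarrow> (\<lambda>x. v x + w x) \<in> L2_space S"
  using L2_space_add_scaled[of v S w 1] by simp

lemma L2_space_diff: "v \<in> L2_space S \<Longrightarrow> w \<in> L2_space S \<Longrightarrow> (\<lambda>x. v x - w x) \<in> L2_space S"
  using L2_space_add_scaled[of v S w "-1"] by simp

lemma L2_inner_add_scaled:
  assumes "v \<in> L2_space S" "w \<in> L2_space S" "u \<in> L2_space S"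
  shows "L2_inner S (\<lambda>x. v x + c *\<^sub>R w x) u = L2_inner S v u + c * L2_inner S w u"
  using L2_inner_integrable[OF assms(1,3)] L2_inner_integrable[OF assms(2,3)]
  by (simp add: L2_inner_def inner_add_left)

lemma L2_inner_add_scaled_right:
  assumes "v \<in> L2_space S" "w \<in> L2_space S" "u \<in> L2_space S"
  shows "L2_inner S u (\<lambda>x. v x + c *\<^sub>R w x) = L2_inner S u v + c * L2_inner S u w"
  using L2_inner_add_scaled[OF assms] by (simp add: L2_inner_commute[of S u])

lemma L2_inner_diff:
  assumes "v \<in> L2_space S" "w \<in> L2_space S" "u \<in> L2_space S"
  shows "L2_inner S (\<lambda>x. v x - w x) u = L2_inner S v u - L2_inner S w u"
  using L2_inner_add_scaled[OF assms, of "-1"] by simp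

lemma L2_inner_diff_right:
  assumes "v \<in> L2_space S" "w \<in> L2_space S" "u \<in> L2_space S"
  shows "L2_inner S u (\<lambda>x. v x - w x) = L2_inner S u v - L2_inner S u w"
  using L2_inner_diff[OF assms] by (simp add: L2_inner_commute[of S u])

lemma L2_inner_scaled: "L2_inner S (\<lambda>x. c *\<^sub>R w x) u = c * L2_inner S w u"
  by (simp add: L2_inner_def)

lemma L2_inner_nonneg [simp]: "0 \<le> L2_inner S v v"
  unfolding L2_inner_def set_lebesgue_integral_def by (rule integral_nonneg_AE) simp

lemma L2_norm_nonneg [simp]: "0 \<le> L2_norm S v"
  by (simp add: L2_norm_def)

lemma L2_norm_square: "(L2_norm S v)\<^sup>2 = L2_inner S v v"
  by (simp add: L2_norm_def)

text \<open>Functions are not identified up to null sets, so the form is only semidefinite. The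
  inequality expresses that t \<mapsto> \<open>L2_inner\<close> of v + t w with itself is a
  nonnegative polynomial; if w has norm zero, the polynomial is affine and has to be
  constant.\<close>

lemma L2_Cauchy_Schwarz:
  assumes v: "v \<in> L2_space S" and w: "w \<in> L2_space S"
  shows "\<bar>L2_inner S v w\<bar> \<le> L2_norm S v * L2_norm S w"
proof -
  let ?a = "L2_inner S v v" and ?b = "L2_inner S v w" and ?c = "L2_inner S w w"
  have q: "0 \<le> ?a + 2 * t * ?b + t\<^sup>2 * ?c" for t
  proof -
    have "0 \<le> L2_inner S (\<lambda>x. v x + t *\<^sub>R w x) (\<lambda>x. v x + t *\<^sub>R w x)" by simp
    also have "\<dots> = ?a + 2 * t * ?b + t\<^sup>2 * ?c"
      using v w L2_space_add_scaled[OF v w, of t]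
      by (simp add: L2_inner_add_scaled L2_inner_add_scaled_right L2_inner_commute[of S w v]
          algebra_simps power2_eq_square)
    finally show ?thesis .
  qed
  have "?b\<^sup>2 \<le> ?a * ?c"
  proof (cases "?c = 0")
    case True
    have "?b = 0"
    proof (rule ccontr)
      assume "?b \<noteq> 0"
      \<comment> \<open>At this t the affine polynomial takes the value -1.\<close>
      with q[of "- (?a + 1) / (2 * ?b)"] True show False by (simp add: field_simps)
    qed
    then show ?thesis by simp
  next
    case False
    then have "?c > 0" using L2_inner_nonneg[of S w] by linarith
    \<comment> \<open>The minimiser of the quadratic polynomial.\<close>
    with q[of "- ?b / ?c"] show ?thesis by (simp add: field_simps power2_eq_square)
  qed
  then have "sqrt (?b\<^sup>2) \<le> sqrt (?a * ?c)" by (rule real_sqrt_le_mono)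
  then show ?thesis by (simp add: L2_norm_def real_sqrt_mult)
qed

lemma L2_inner_le: "v \<in> L2_space S \<Longrightarrow> w \<in> L2_space S \<Longrightarrow> L2_inner S v w \<le> L2_norm S v * L2_norm S w"
  using L2_Cauchy_Schwarz[of v S w] by linarith

lemma L2_norm_triangle:
  assumes v: "v \<in> L2_space S" and w: "w \<in> L2_space S"
  shows "L2_norm S (\<lambda>x. v x + w x) \<le> L2_norm S v + L2_norm S w"
proof (rule power2_le_imp_le)
  have "(L2_norm S (\<lambda>x. v x + w x))\<^sup>2 = (L2_norm S v)\<^sup>2 + 2 * L2_inner S v w + (L2_norm S w)\<^sup>2"
    using L2_inner_add_scaled[OF v w L2_space_add[OF v w], of 1]
      L2_inner_add_scaled_right[OF v w v, of 1] L2_inner_add_scaled_right[OF v w w, of 1]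
    by (simp add: L2_norm_square L2_inner_commute[of S w v])
  also have "\<dots> \<le> (L2_norm S v + L2_norm S w)\<^sup>2"
    using L2_inner_le[OF v w] by (simp add: power2_sum)
  finally show "(L2_norm S (\<lambda>x. v x + w x))\<^sup>2 \<le> (L2_norm S v + L2_norm S w)\<^sup>2" .
qed simp

lemma L2_norm_scaled: "L2_norm S (\<lambda>x. c *\<^sub>R v x) = \<bar>c\<bar> * L2_norm S v"
proof -
  have "L2_inner S (\<lambda>x. c *\<^sub>R v x) (\<lambda>x. c *\<^sub>R v x) = c\<^sup>2 * L2_inner S v v"
    using L2_inner_scaled[of S c v "\<lambda>x. c *\<^sub>R v x"] L2_inner_scaled[of S c v v]
      L2_inner_commute[of S v "\<lambda>x. c *\<^sub>R v x"] by (simp add: power2_eq_square)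
  then show ?thesis by (simp add: L2_norm_def real_sqrt_mult)
qed

lemma L2_norm_diff_le:
  assumes v: "v \<in> L2_space S" and w: "w \<in> L2_space S"
  shows "L2_norm S (\<lambda>x. v x - w x) \<le> L2_norm S v + L2_norm S w"
  using L2_norm_triangle[OF v L2_space_scaled[OF w, of "-1"]] L2_norm_scaled[of S "-1" w] by simp

lemma L2_norm_diff_commute: "L2_norm S (\<lambda>x. v x - w x) = L2_norm S (\<lambda>x. w x - v x)"
  using L2_norm_scaled[of S "-1" "\<lambda>x. w x - v x"] by simp

lemma L2_norm_cong_AE:
  assumes "AE x in lebesgue. x \<in> S \<longrightarrow> v x = w x" "v \<in> L2_space S"
  shows "L2_norm S v = L2_norm S w"
proof -
  have w: "w \<in> L2_space S" by (rule L2_space_cong_AE[OF assms(2,1)])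
  have "AE x in lebesgue. x \<in> S \<longrightarrow> v x \<bullet> v x = w x \<bullet> w x"
    using assms(1) by eventually_elim simp
  then have "L2_inner S v v = L2_inner S w w"
    using assms(2) w by (intro L2_inner_cong_AE)
  then show ?thesis by (simp add: L2_norm_def)
qed

lemma L2_norm_eq_0_iff:
  assumes v: "v \<in> L2_space S"
  shows "L2_norm S v = 0 \<longleftrightarrow> (AE x in lebesgue. x \<in> S \<longrightarrow> v x = 0)"
proof -
  have "L2_norm S v = 0 \<longleftrightarrow> (AE x in lebesgue. indicator S x *\<^sub>R (v x \<bullet> v x) = 0)"
    unfolding L2_norm_def L2_inner_def set_lebesgue_integral_def real_sqrt_eq_zero_cancel_iff
    by (rule integral_nonneg_eq_0_iff_AE)
      (use L2_inner_integrable[OF v v] in \<open>auto simp: set_integrable_def\<close>)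
  also have "\<dots> \<longleftrightarrow> (AE x in lebesgue. x \<in> S \<longrightarrow> v x = 0)"
    by (intro arg_cong2[where f=eventually] ext) (auto simp: indicator_def)
  finally show ?thesis .
qed

section \<open>Restriction to subsets and criteria for square integrability\<close>

lemma L2_space_subset:
  assumes "v \<in> L2_space S" "R \<subseteq> S" "R \<in> sets lebesgue"
  shows "v \<in> L2_space R"
  unfolding L2_space_iff
proof
  have "(\<lambda>x. indicator R x *\<^sub>R (indicator S x *\<^sub>R v x)) \<in> borel_measurable lebesgue"
    by (rule borel_measurable_scaleR[OF borel_measurable_indicator])
      (use assms in \<open>auto simp: L2_space_iff simp del: scaleR_scaleR\<close>)
  also have "(\<lambda>x. indicator R x *\<^sub>R (indicator S x *\<^sub>R v x)) = (\<lambda>x. indicator R x *\<^sub>R v x)"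
    using assms(2) by (auto simp: indicator_def fun_eq_iff)
  finally show "(\<lambda>x. indicator R x *\<^sub>R v x) \<in> borel_measurable lebesgue" .
  have "set_integrable lebesgue R (\<lambda>x. (norm (v x))\<^sup>2)"
    by (rule set_integrable_subset[where A=S])
      (use assms in \<open>auto simp: L2_space_def\<close>)
  then show "integrable lebesgue (\<lambda>x. indicator R x * (norm (v x))\<^sup>2)"
    by (simp add: set_integrable_def)
qed

lemma L2_space_bounded:
  fixes v :: "'a::euclidean_space \<Rightarrow> 'b::euclidean_space"
  assumes S: "S \<in> lmeasurable" and m: "(\<lambda>x. indicator S x *\<^sub>R v x) \<in> borel_measurable lebesgue"
    and b: "\<And>x. x \<in> S \<Longrightarrow> norm (v x) \<le> B"
  shows "v \<in> L2_space S"
  unfolding L2_space_iff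
proof
  have e: "indicator S x * (norm (v x))\<^sup>2 = (norm (indicator S x *\<^sub>R v x))\<^sup>2" for x
    by (simp add: indicator_def)
  show "integrable lebesgue (\<lambda>x. indicator S x * (norm (v x))\<^sup>2)"
  proof (rule Bochner_Integration.integrable_bound)
    show "integrable lebesgue (\<lambda>x. B\<^sup>2 * indicator S x)"
      using S by (intro integrable_mult_right) (auto simp: integrable_indicator_iff fmeasurable_def)
    show "(\<lambda>x. indicator S x * (norm (v x))\<^sup>2) \<in> borel_measurable lebesgue"
      unfolding e using m by measurable
    show "AE x in lebesgue. norm (indicator S x * (norm (v x))\<^sup>2) \<le> norm (B\<^sup>2 * indicator S x)"
      using b by (auto simp: indicator_def intro!: power_mono)
  qed
qed (rule m)

lemma L2_space_continuous:
  fixes v :: "'a::euclidean_space \<Rightarrow> 'b::euclidean_space"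
  assumes S: "bounded S" "S \<in> sets lebesgue" and c: "continuous_on UNIV v"
  shows "v \<in> L2_space S"
proof -
  have "bounded (v ` closure S)"
    using S c by (intro compact_imp_bounded compact_continuous_image)
      (auto intro: continuous_on_subset)
  then obtain B where "\<And>x. x \<in> closure S \<Longrightarrow> norm (v x) \<le> B"
    by (auto simp: bounded_iff)
  then have B: "\<And>x. x \<in> S \<Longrightarrow> norm (v x) \<le> B" using closure_subset by blast
  have "v \<in> borel_measurable borel" using c by (rule borel_measurable_continuous_onI)
  then have "v \<in> borel_measurable lebesgue" by (simp add: measurable_completion)
  then show ?thesis
    using S B by (intro L2_space_bounded[where B=B] bounded_set_imp_lmeasurable) auto
qed

lemma L2_integrable:
  assumes v: "v \<in> L2_space S" and S: "S \<in> lmeasurable"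
  shows "set_integrable lebesgue S (v :: 'a::euclidean_space \<Rightarrow> real)"
proof -
  have "(\<lambda>x. 1::real) \<in> L2_space S"
    using S by (intro L2_space_bounded[where B=1]) auto
  from L2_inner_integrable[OF v this] show ?thesis by simp
qed

section \<open>Smooth functions and test functions\<close>

text \<open>The mean value inequality bounds the difference quotients by w, so that dominated
  convergence applies along every sequence that tends to t0.\<close>

lemma has_real_derivative_integral:
  fixes f :: "real \<Rightarrow> 'a \<Rightarrow> real"
  assumes e: "e > 0"
    and int: "\<And>t. \<bar>t - t0\<bar> < e \<Longrightarrow> integrable M (f t)"
    and der: "\<And>t x. \<bar>t - t0\<bar> < e \<Longrightarrow> x \<in> space M \<Longrightarrow> ((\<lambda>t. f t x) has_real_derivative f' t x) (at t)"
    and bnd: "\<And>t x. \<bar>t - t0\<bar> < e \<Longrightarrow> x \<in> space M \<Longrightarrow> \<bar>f' t x\<bar> \<le> w x"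
    and w: "integrable M w"
  shows "((\<lambda>t. \<integral>x. f t x \<partial>M) has_real_derivative (\<integral>x. f' t0 x \<partial>M)) (at t0)"
  unfolding has_field_derivative_iff tendsto_at_iff_sequentially
proof (intro allI impI)
  fix X :: "nat \<Rightarrow> real" assume X: "\<forall>i. X i \<in> UNIV - {t0}" "X \<longlonglongrightarrow> t0"
  \<comment> \<open>Quotients at points outside the e-neighbourhood are replaced by 0, so that the
    bound by w holds for every n; along the sequence this affects finitely many terms.\<close>
  let ?s = "\<lambda>n x. if \<bar>X n - t0\<bar> < e then (f (X n) x - f t0 x) / (X n - t0) else 0"
  have ev: "\<forall>\<^sub>F n in sequentially. \<bar>X n - t0\<bar> < e"
    using X(2) e by (auto simp: tendsto_iff dist_real_def)
  have meas: "?s n \<in> borel_measurable M" for n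
    using int[of "X n"] int[of t0] e by (cases "\<bar>X n - t0\<bar> < e") auto
  have lim: "(\<lambda>n. ?s n x) \<longlonglongrightarrow> f' t0 x" if x: "x \<in> space M" for x
  proof -
    have "((\<lambda>y. (f y x - f t0 x) / (y - t0)) \<longlongrightarrow> f' t0 x) (at t0)"
      using der[OF _ x, of t0] e by (simp add: has_field_derivative_iff)
    then have "(\<lambda>n. (f (X n) x - f t0 x) / (X n - t0)) \<longlonglongrightarrow> f' t0 x"
      using X unfolding tendsto_at_iff_sequentially by (auto simp: o_def)
    moreover have "\<forall>\<^sub>F n in sequentially. (f (X n) x - f t0 x) / (X n - t0) = ?s n x"
      using ev by eventually_elim simp
    ultimately show ?thesis by (rule Lim_transform_eventually)
  qed
  have bound: "norm (?s n x) \<le> w x" if x: "x \<in> space M" for n x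
  proof (cases "\<bar>X n - t0\<bar> < e")
    case True
    have "norm (f (X n) x - f t0 x) \<le> w x * norm (X n - t0)"
      by (rule field_differentiable_bound[where S="ball t0 e"])
        (use True e bnd[OF _ x] der[OF _ x] in
          \<open>auto simp: dist_real_def abs_minus_commute intro: has_field_derivative_at_within\<close>)
    then show ?thesis using X(1) True by (simp add: field_simps)
  next
    case False
    then show ?thesis using bnd[OF _ x, of t0] e by (simp add: order_trans[OF abs_ge_zero])
  qed
  have "(\<lambda>n. integral\<^sup>L M (?s n)) \<longlonglongrightarrow> integral\<^sup>L M (f' t0)"
    by (rule integral_dominated_convergence[where w=w])
      (use meas lim bound w borel_measurable_LIMSEQ_real[OF lim meas] in auto)
  moreover have "\<forall>\<^sub>F n in sequentially. integral\<^sup>L M (?s n) =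
      ((\<lambda>y. ((\<integral>x. f y x \<partial>M) - (\<integral>x. f t0 x \<partial>M)) / (y - t0)) \<circ> X) n"
    using ev by eventually_elim (use int e in simp)
  ultimately show "((\<lambda>y. ((\<integral>x. f y x \<partial>M) - (\<integral>x. f t0 x \<partial>M)) / (y - t0)) \<circ> X) \<longlonglongrightarrow> integral\<^sup>L M (f' t0)"
    by (rule Lim_transform_eventually)
qed

section \<open>Classical derivatives and the classes C^k\<close>

lemma partial_deriv_eqI: "(\<phi> has_derivative D) (at x) \<Longrightarrow> partial_deriv i \<phi> x = D (axis i 1)"
  unfolding partial_deriv_def using frechet_derivative_at[of \<phi> D x] by simp

definition gradient :: "(real ^ 'n::finite \<Rightarrow> real) \<Rightarrow> real ^ 'n \<Rightarrow> real ^ 'n" where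
  "gradient \<phi> x = (\<chi> i. partial_deriv i \<phi> x)"

lemma gradient_nth [simp]: "gradient \<phi> x $ i = partial_deriv i \<phi> x"
  by (simp add: gradient_def)

lemma has_derivative_gradient:
  assumes "\<phi> differentiable (at x)"
  shows "(\<phi> has_derivative (\<lambda>h. gradient \<phi> x \<bullet> h)) (at x)"
proof -
  have D: "(\<phi> has_derivative frechet_derivative \<phi> (at x)) (at x)"
    using assms frechet_derivative_works by blast
  then have lin: "linear (frechet_derivative \<phi> (at x))"
    by (simp add: has_derivative_linear)
  have "frechet_derivative \<phi> (at x) h = gradient \<phi> x \<bullet> h" for h
  proof -
    have "frechet_derivative \<phi> (at x) h = frechet_derivative \<phi> (at x) (\<Sum>i\<in>UNIV. h $ i *\<^sub>R axis i 1)"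
      using basis_expansion[of h] by (simp add: scalar_mult_eq_scaleR)
    also have "\<dots> = (\<Sum>i\<in>UNIV. h $ i * partial_deriv i \<phi> x)"
      using lin by (simp add: linear_sum linear_scale partial_deriv_def)
    also have "\<dots> = gradient \<phi> x \<bullet> h"
      by (simp add: inner_vec_def mult.commute)
    finally show ?thesis .
  qed
  then have "frechet_derivative \<phi> (at x) = (\<lambda>h. gradient \<phi> x \<bullet> h)" by (rule ext)
  then show ?thesis using D by metis
qed

abbreviation smooth :: "(real ^ 'n::finite \<Rightarrow> real) \<Rightarrow> bool" where
  "smooth \<phi> \<equiv> \<forall>k. C_k k \<phi>"

lemma C_k_SucD: "C_k (Suc k) \<phi> \<Longrightarrow> C_k k \<phi>"
proof (induction k arbitrary: \<phi>)
  case 0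
  then show ?case
    by (auto intro!: differentiable_imp_continuous_on simp: differentiable_on_def)
qed auto

lemma smooth_differentiable: "smooth \<phi> \<Longrightarrow> \<phi> differentiable (at x)"
  by (metis C_k.simps(2))

lemma smooth_partial_deriv: "smooth \<phi> \<Longrightarrow> smooth (partial_deriv i \<phi>)"
  by (metis C_k.simps(2))

lemma smooth_continuous: "smooth \<phi> \<Longrightarrow> continuous_on UNIV \<phi>"
  by (metis C_k.simps(1))

lemma partial_deriv_add:
  assumes "f differentiable (at x)" "g differentiable (at x)"
  shows "partial_deriv i (\<lambda>x. f x + g x) x = partial_deriv i f x + partial_deriv i g x"
  using partial_deriv_eqI[OF has_derivative_add[OF assms[THEN has_derivative_gradient]], of i]
  by (simp add: inner_axis)

lemma partial_deriv_mult:
  assumes "f differentiable (at x)" "g differentiable (at x)"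
  shows "partial_deriv i (\<lambda>x. f x * g x) x = f x * partial_deriv i g x + partial_deriv i f x * g x"
  using partial_deriv_eqI[OF has_derivative_mult[OF assms[THEN has_derivative_gradient]], of i]
  by (simp add: inner_axis)

lemma partial_deriv_affine [simp]: "partial_deriv i (\<lambda>x. a \<bullet> x + b) x = a $ i"
proof -
  have "((\<lambda>x. a \<bullet> x + b) has_derivative (\<lambda>h. a \<bullet> h)) (at x)"
    by (auto intro!: derivative_eq_intros)
  from partial_deriv_eqI[OF this] show ?thesis by (simp add: inner_axis)
qed

lemma partial_deriv_const [simp]: "partial_deriv i (\<lambda>x. c) x = 0"
  using partial_deriv_affine[of i 0 c x] by simp

lemma C_k_const: "C_k k (\<lambda>x. c)"
proof (induction k arbitrary: c)
  case (Suc k)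
  have "partial_deriv i (\<lambda>x. c) = (\<lambda>x. 0)" for i :: 'a by (rule ext) simp
  then show ?case using Suc by simp
qed simp

lemma C_k_affine: "C_k k (\<lambda>x. a \<bullet> x + b)"
proof (cases k)
  case 0
  then show ?thesis by (auto intro!: continuous_intros)
next
  case (Suc k)
  have "partial_deriv i (\<lambda>x. a \<bullet> x + b) = (\<lambda>x. a $ i)" for i by (rule ext) simp
  then show ?thesis using Suc C_k_const by (auto intro!: derivative_intros)
qed

lemma C_k_add: "C_k k f \<Longrightarrow> C_k k g \<Longrightarrow> C_k k (\<lambda>x. f x + g x)"
proof (induction k arbitrary: f g)
  case (Suc k)
  then have "partial_deriv i (\<lambda>x. f x + g x) = (\<lambda>x. partial_deriv i f x + partial_deriv i g x)" for i
    by (intro ext partial_deriv_add) auto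
  then show ?case using Suc by (auto intro!: derivative_intros)
qed (auto intro: continuous_on_add)

lemma C_k_mult: "C_k k f \<Longrightarrow> C_k k g \<Longrightarrow> C_k k (\<lambda>x. f x * g x)"
proof (induction k arbitrary: f g)
  case (Suc k)
  then have "partial_deriv i (\<lambda>x. f x * g x) = (\<lambda>x. f x * partial_deriv i g x + partial_deriv i f x * g x)" for i
    by (intro ext partial_deriv_mult) auto
  moreover have "C_k k f" "C_k k g" using Suc.prems by (blast intro: C_k_SucD)+
  ultimately show ?case using Suc by (auto intro!: derivative_intros C_k_add)
qed (auto intro: continuous_on_mult)

lemma C_k_cmult: "C_k k f \<Longrightarrow> C_k k (\<lambda>x. c * f x)"
  by (rule C_k_mult[OF C_k_const])

lemma C_k_prod: "finite A \<Longrightarrow> (\<And>i. i \<in> A \<Longrightarrow> C_k k (f i)) \<Longrightarrow> C_k k (\<lambda>x. \<Prod>i\<in>A. f i x)"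
  by (induction rule: finite_induct) (auto intro: C_k_const C_k_mult)

lemma partial_deriv_homothety:
  assumes "f differentiable (at (p + s *\<^sub>R x))"
  shows "partial_deriv i (\<lambda>x. f (p + s *\<^sub>R x)) x = s * partial_deriv i f (p + s *\<^sub>R x)"
proof -
  have "((\<lambda>x. p + s *\<^sub>R x) has_derivative (\<lambda>h. s *\<^sub>R h)) (at x)"
    by (auto intro!: derivative_eq_intros)
  from has_derivative_compose[OF this has_derivative_gradient[OF assms]]
  show ?thesis using partial_deriv_eqI by (fastforce simp: inner_axis)
qed

lemma C_k_homothety: "C_k k f \<Longrightarrow> C_k k (\<lambda>x. f (p + s *\<^sub>R x))"
proof (induction k arbitrary: f)
  case 0
  then have f: "continuous_on UNIV f" by simp
  have "continuous_on UNIV (\<lambda>x. f (p + s *\<^sub>R x))"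
    by (rule continuous_on_compose2[OF f]) (auto intro!: continuous_intros)
  then show ?case by simp
next
  case (Suc k)
  then have "partial_deriv i (\<lambda>x. f (p + s *\<^sub>R x)) = (\<lambda>x. s * partial_deriv i f (p + s *\<^sub>R x))" for i
    by (intro ext partial_deriv_homothety) auto
  moreover have "(\<lambda>x. f (p + s *\<^sub>R x)) differentiable (at x)" for x
    by (rule differentiable_compose[of f]) (use Suc.prems in \<open>auto intro!: derivative_intros\<close>)
  ultimately show ?case using Suc by (auto intro!: C_k_cmult)
qed

section \<open>Smooth bump functions on boxes\<close>

text \<open>The derivatives of \<open>exp (- 1 / t)\<close>, extended by \<open>0\<close> to \<open>t \<le> 0\<close>, stay in the following family.\<close>

definition flat_exp :: "real poly \<Rightarrow> real \<Rightarrow> real" where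
  "flat_exp P t = (if t > 0 then poly P (1 / t) * exp (- 1 / t) else 0)"

lemma poly_times_exp_tendsto_0: "((\<lambda>s. poly P s * exp (- s)) \<longlongrightarrow> (0::real)) at_top"
proof -
  have "((\<lambda>s. \<Sum>i\<le>degree P. coeff P i * (s ^ i / exp s)) \<longlongrightarrow> 0) at_top"
    by (intro tendsto_null_sum tendsto_mult_right_zero tendsto_power_div_exp_0)
  moreover have "poly P s * exp (- s) = (\<Sum>i\<le>degree P. coeff P i * (s ^ i / exp s))" for s
    by (simp add: poly_altdef sum_distrib_right exp_minus field_simps sum_divide_distrib)
  ultimately show ?thesis by simp
qed

text \<open>For t > 0 the derivative of P(1/t) exp(-1/t) is (P - P')(1/t) exp(-1/t) / t^2, which
  explains the factor \<open>[:0, 0, 1:]\<close>. At t = 0 both one-sided difference quotients tend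
  to 0.\<close>

lemma flat_exp_has_derivative:
  "(flat_exp P has_real_derivative flat_exp ([:0, 0, 1:] * (P - pderiv P)) t) (at t)"
proof -
  consider "t > 0" | "t < 0" | "t = 0" by linarith
  then show ?thesis
  proof cases
    case 1
    have "((\<lambda>t. poly P (1 / t) * exp (- 1 / t)) has_real_derivative
       flat_exp ([:0, 0, 1:] * (P - pderiv P)) t) (at t)"
      using 1 by (auto intro!: derivative_eq_intros DERIV_chain2[OF poly_DERIV]
          simp: flat_exp_def field_simps power2_eq_square)
    then show ?thesis
      by (rule DERIV_cong_ev[THEN iffD1, rotated -1])
        (use 1 in \<open>auto simp: flat_exp_def intro: eventually_mono[OF eventually_gt_at_top]
          eventually_nhds_in_open[of "{0<..}" t, THEN eventually_mono]\<close>)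
  next
    case 2
    have "((\<lambda>t. 0) has_real_derivative flat_exp ([:0, 0, 1:] * (P - pderiv P)) t) (at t)"
      using 2 by (simp add: flat_exp_def)
    then show ?thesis
      by (rule DERIV_cong_ev[THEN iffD1, rotated -1])
        (use 2 in \<open>auto simp: flat_exp_def intro: eventually_nhds_in_open[of "{..<0}" t, THEN eventually_mono]\<close>)
  next
    case 3
    \<comment> \<open>With s = 1/t the quotient becomes s P(s) exp(-s) as s tends to
      infinity.\<close>
    have "((\<lambda>t. flat_exp P t / t) \<longlongrightarrow> 0) (at_right 0)"
    proof (rule Lim_transform_eventually)
      show "((\<lambda>t. poly ([:0, 1:] * P) (inverse t) * exp (- inverse t)) \<longlongrightarrow> (0::real)) (at_right 0)"
        by (rule filterlim_compose[OF poly_times_exp_tendsto_0 filterlim_inverse_at_top_right])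
      show "\<forall>\<^sub>F t in at_right 0. poly ([:0, 1:] * P) (inverse t) * exp (- inverse t) = flat_exp P t / t"
        using eventually_at_right_less[of "0::real"]
        by eventually_elim (simp add: flat_exp_def field_simps)
    qed
    moreover have "((\<lambda>t. flat_exp P t / t) \<longlongrightarrow> 0) (at_left 0)"
    proof (rule Lim_transform_eventually)
      show "\<forall>\<^sub>F t in at_left 0. 0 = flat_exp P t / t"
        using eventually_at_left_real[of "-1" 0] by (auto simp: flat_exp_def elim!: eventually_mono)
    qed simp
    ultimately show ?thesis
      using 3 by (simp add: has_field_derivative_iff flat_exp_def filterlim_at_split)
  qed
qed

text \<open>The induction on k has to range over all P at once, since each differentiation changes
  the polynomial.\<close>

lemma C_k_flat_exp: "C_k k (\<lambda>x. flat_exp P (a \<bullet> x + b))"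
proof (induction k arbitrary: P)
  case 0
  have "isCont (flat_exp P) t" for t
    using flat_exp_has_derivative[of P t] by (rule DERIV_isCont)
  then have f: "continuous_on UNIV (flat_exp P)" by (simp add: continuous_at_imp_continuous_on)
  have "continuous_on UNIV (\<lambda>x. flat_exp P (a \<bullet> x + b))"
    by (rule continuous_on_compose2[OF f]) (auto intro!: continuous_intros)
  then show ?case by simp
next
  case (Suc k)
  let ?Q = "[:0, 0, 1:] * (P - pderiv P)"
  have D: "((\<lambda>x. flat_exp P (a \<bullet> x + b)) has_derivative (\<lambda>h. flat_exp ?Q (a \<bullet> x + b) * (a \<bullet> h))) (at x)" for x
  proof -
    have "((\<lambda>x. a \<bullet> x + b) has_derivative (\<lambda>h. a \<bullet> h)) (at x)"
      by (auto intro!: derivative_eq_intros)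
    from has_derivative_compose[OF this flat_exp_has_derivative[unfolded has_field_derivative_def]]
    show ?thesis by simp
  qed
  have "partial_deriv i (\<lambda>x. flat_exp P (a \<bullet> x + b)) = (\<lambda>x. a $ i * flat_exp ?Q (a \<bullet> x + b))" for i
    using partial_deriv_eqI[OF D] by (auto simp: inner_axis)
  moreover have "(\<lambda>x. flat_exp P (a \<bullet> x + b)) differentiable (at x)" for x
    using D differentiable_def by blast
  ultimately show ?case using Suc by (auto intro!: C_k_cmult simp del: mult_pCons_left)
qed

text \<open>A product of one-dimensional profiles exp(-1/t), steepened by the factor
  \<open>Suc m\<close> so that the bumps tend pointwise to the indicator of the open box. With
  \<open>Suc m\<close> in place of m the case m = 0 is a genuine bump, too.\<close>

definition box_bump :: "nat \<Rightarrow> real ^ 'n::finite \<Rightarrow> real ^ 'n \<Rightarrow> real ^ 'n \<Rightarrow> real" where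
  "box_bump m a b x = (\<Prod>i\<in>UNIV. flat_exp 1 (Suc m * (x $ i - a $ i)) * flat_exp 1 (Suc m * (b $ i - x $ i)))"

lemma flat_exp_1: "flat_exp 1 t = (if t > 0 then exp (- 1 / t) else 0)"
  by (simp add: flat_exp_def)

lemma flat_exp_1_bounds: "0 \<le> flat_exp 1 t" "flat_exp 1 t \<le> 1"
  by (auto simp: flat_exp_1)

lemma smooth_box_bump: "smooth (box_bump m a b)"
proof
  fix k
  have "C_k k (\<lambda>x. flat_exp 1 (Suc m * (x $ i - a $ i)))"
       "C_k k (\<lambda>x. flat_exp 1 (Suc m * (b $ i - x $ i)))" for i
    using C_k_flat_exp[of k 1 "axis i (Suc m)" "- (Suc m * a $ i)"]
      C_k_flat_exp[of k 1 "axis i (- real (Suc m))" "Suc m * b $ i"]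
    by (simp_all add: inner_axis' algebra_simps)
  then show "C_k k (box_bump m a b)"
    unfolding box_bump_def[abs_def] by (intro C_k_prod C_k_mult) auto
qed

lemma mem_box_iff: "x \<in> box a b \<longleftrightarrow> (\<forall>i. a $ i < x $ i \<and> x $ i < b $ i)" for x :: "real ^ 'n"
  by (simp add: mem_box_cart)

lemma box_bump_bounds: "0 \<le> box_bump m a b x" "box_bump m a b x \<le> 1"
  unfolding box_bump_def
  by (auto intro!: prod_nonneg prod_le_1 mult_le_one simp: flat_exp_1_bounds)

lemma box_bump_pos_iff: "box_bump m a b x \<noteq> 0 \<longleftrightarrow> x \<in> box a b"
  by (auto simp: box_bump_def mem_box_iff flat_exp_1 zero_less_mult_iff split: if_splits)

lemma box_bump_tendsto: "(\<lambda>m. box_bump m a b x) \<longlonglongrightarrow> indicator (box a b) x"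
proof (cases "x \<in> box a b")
  case True
  have lim: "(\<lambda>m. flat_exp 1 (Suc m * t)) \<longlonglongrightarrow> 1" if "t > 0" for t :: real
  proof -
    have "(\<lambda>m. exp (- inverse t * inverse (Suc m))) \<longlonglongrightarrow> exp (- inverse t * 0)"
      by (intro tendsto_exp tendsto_mult tendsto_const LIMSEQ_inverse_real_of_nat)
    moreover have "flat_exp 1 (Suc m * t) = exp (- inverse t * inverse (Suc m))" for m
      using that by (simp add: flat_exp_1 divide_inverse)
    ultimately show ?thesis by simp
  qed
  have "(\<lambda>m. box_bump m a b x) \<longlonglongrightarrow> (\<Prod>i\<in>(UNIV::'a set). 1 * 1)"
    unfolding box_bump_def using True
    by (intro tendsto_prod tendsto_mult lim) (auto simp: mem_box_iff)
  then show ?thesis using True by simp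
next
  case False
  then have "box_bump m a b x = 0" for m using box_bump_pos_iff by blast
  then show ?thesis using False by simp
qed

text \<open>Instead of the closed support, any compact subset of U outside of which the function
  vanishes will do; such a set is easily found for sums, products, derivatives and
  rescalings.\<close>

lemma test_functions_iff:
  "\<phi> \<in> test_functions U \<longleftrightarrow> smooth \<phi> \<and> (\<exists>K. compact K \<and> K \<subseteq> U \<and> (\<forall>x. x \<notin> K \<longrightarrow> \<phi> x = 0))"
proof
  assume "\<phi> \<in> test_functions U"
  moreover have "\<phi> x = 0" if "x \<notin> closure {x. \<phi> x \<noteq> 0}" for x
    using that closure_subset[of "{x. \<phi> x \<noteq> 0}"] by auto
  ultimately show "smooth \<phi> \<and> (\<exists>K. compact K \<and> K \<subseteq> U \<and> (\<forall>x. x \<notin> K \<longrightarrow> \<phi> x = 0))"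
    unfolding test_functions_def
    by (intro conjI exI[of _ "closure {x. \<phi> x \<noteq> 0}"]) blast+
next
  assume "smooth \<phi> \<and> (\<exists>K. compact K \<and> K \<subseteq> U \<and> (\<forall>x. x \<notin> K \<longrightarrow> \<phi> x = 0))"
  then obtain K where K: "smooth \<phi>" "compact K" "K \<subseteq> U" "\<forall>x. x \<notin> K \<longrightarrow> \<phi> x = 0" by blast
  then have "closure {x. \<phi> x \<noteq> 0} \<subseteq> K"
    by (intro closure_minimal compact_imp_closed) auto
  moreover from this have "compact (closure {x. \<phi> x \<noteq> 0})"
    using K(2) by (meson bounded_subset closed_closure compact_eq_bounded_closed)
  ultimately show "\<phi> \<in> test_functions U"
    using K by (auto simp: test_functions_def)
qed

lemma test_functions_support:
  assumes "\<phi> \<in> test_functions U"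
  obtains K where "compact K" "K \<subseteq> U" "\<And>x. x \<notin> K \<Longrightarrow> \<phi> x = 0"
  using assms by (auto simp: test_functions_iff)

lemma test_functions_smooth: "\<phi> \<in> test_functions U \<Longrightarrow> smooth \<phi>"
  by (simp add: test_functions_def)

lemma test_functions_differentiable: "\<phi> \<in> test_functions U \<Longrightarrow> \<phi> differentiable (at x)"
  by (rule smooth_differentiable[OF test_functions_smooth])

lemma test_functions_continuous: "\<phi> \<in> test_functions U \<Longrightarrow> continuous_on UNIV \<phi>"
  by (rule smooth_continuous[OF test_functions_smooth])

lemma test_functions_outside: "\<phi> \<in> test_functions U \<Longrightarrow> x \<notin> U \<Longrightarrow> \<phi> x = 0"
  by (auto simp: test_functions_iff)

lemma test_functions_mono: "\<phi> \<in> test_functions U \<Longrightarrow> U \<subseteq> V \<Longrightarrow> \<phi> \<in> test_functions V"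
  by (auto simp: test_functions_def)

lemma test_functions_partial_deriv:
  assumes "\<phi> \<in> test_functions U" shows "partial_deriv i \<phi> \<in> test_functions U"
proof -
  obtain K where K: "compact K" "K \<subseteq> U" "\<And>x. x \<notin> K \<Longrightarrow> \<phi> x = 0"
    using test_functions_support[OF assms] by blast
  have "partial_deriv i \<phi> x = 0" if x: "x \<notin> K" for x
  proof -
    have "((\<lambda>x. 0) has_derivative (\<lambda>h. 0)) (at x)" by simp
    then have "(\<phi> has_derivative (\<lambda>h. 0)) (at x)"
      by (rule has_derivative_transform_within_open[where s="- K"])
        (use K x compact_imp_closed in \<open>auto simp: open_Compl\<close>)
    from partial_deriv_eqI[OF this] show ?thesis .
  qed
  moreover have "smooth (partial_deriv i \<phi>)"
    using assms by (intro smooth_partial_deriv test_functions_smooth)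
  ultimately show ?thesis using K by (auto simp: test_functions_iff)
qed

lemma test_functions_add_scaled:
  assumes "f \<in> test_functions U" "g \<in> test_functions U"
  shows "(\<lambda>x. f x + c * g x) \<in> test_functions U"
proof -
  obtain K L where "compact K" "K \<subseteq> U" "\<And>x. x \<notin> K \<Longrightarrow> f x = 0"
    "compact L" "L \<subseteq> U" "\<And>x. x \<notin> L \<Longrightarrow> g x = 0"
    using assms by (meson test_functions_support)
  moreover have "smooth (\<lambda>x. f x + c * g x)"
    using assms[THEN test_functions_smooth] C_k_add C_k_cmult by blast
  ultimately show ?thesis
    unfolding test_functions_iff by (intro conjI exI[of _ "K \<union> L"]) auto
qed

lemma test_functions_mult:
  assumes "smooth f" "g \<in> test_functions U"
  shows "(\<lambda>x. f x * g x) \<in> test_functions U"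
proof -
  obtain L where "compact L" "L \<subseteq> U" "\<And>x. x \<notin> L \<Longrightarrow> g x = 0"
    using assms by (meson test_functions_support)
  moreover have "smooth (\<lambda>x. f x * g x)"
    using assms(1) test_functions_smooth[OF assms(2)] C_k_mult by blast
  ultimately show ?thesis
    unfolding test_functions_iff by (intro conjI exI[of _ "L"]) auto
qed

lemma test_functions_zero: "(\<lambda>x. 0) \<in> test_functions U"
  by (auto simp: test_functions_iff C_k_const)

lemma box_bump_test: "cbox a b \<subseteq> U \<Longrightarrow> box_bump m a b \<in> test_functions U"
proof -
  assume sub: "cbox a b \<subseteq> U"
  have "box_bump m a b x = 0" if "x \<notin> cbox a b" for x
    using that box_bump_pos_iff[of m a b x] box_subset_cbox[of a b] by blast
  then show ?thesis
    unfolding test_functions_iff using smooth_box_bump[of m a b] sub compact_cbox[of a b] by blast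
qed

lemma test_functions_bounded:
  assumes "\<phi> \<in> test_functions U"
  obtains B where "B \<ge> 0" "\<And>x. \<bar>\<phi> x\<bar> \<le> B"
proof -
  obtain K where K: "compact K" "K \<subseteq> U" "\<And>x. x \<notin> K \<Longrightarrow> \<phi> x = 0"
    using test_functions_support[OF assms] by blast
  have "continuous_on K \<phi>"
    using test_functions_continuous[OF assms] by (rule continuous_on_subset) simp
  then have "bounded (\<phi> ` K)"
    using K(1) by (intro compact_imp_bounded compact_continuous_image)
  then obtain B where "\<forall>y\<in>\<phi> ` K. norm y \<le> B"
    unfolding bounded_iff by (rule exE)
  then have "\<bar>\<phi> x\<bar> \<le> max B 0" for x
    using K(3)[of x] by (cases "x \<in> K") (auto simp: le_max_iff_disj)
  then show ?thesis using that[of "max B 0"] by simp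
qed

section \<open>Integrals of derivatives of test functions\<close>

lemma integral_translate_lborel:
  fixes f :: "'a::euclidean_space \<Rightarrow> real"
  assumes "f \<in> borel_measurable borel"
  shows "(\<integral>x. f (x + c) \<partial>lborel) = (\<integral>x. f x \<partial>lborel)"
proof -
  have "(\<integral>x. f x \<partial>lborel) = (\<integral>x. f x \<partial>(distr lborel borel ((+) c)))"
    by (simp add: lborel_distr_plus)
  also have "\<dots> = (\<integral>x. f (c + x) \<partial>lborel)"
    using assms by (intro integral_distr) auto
  finally show ?thesis by (simp add: add.commute)
qed

lemma test_functions_integrable:
  assumes "\<phi> \<in> test_functions U" shows "integrable lborel \<phi>"
proof -
  obtain K where K: "compact K" "K \<subseteq> U" "\<And>x. x \<notin> K \<Longrightarrow> \<phi> x = 0"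
    using test_functions_support[OF assms] by blast
  have "integrable lborel (\<lambda>x. indicator K x *\<^sub>R \<phi> x)"
    by (rule borel_integrable_compact[OF K(1)])
      (use test_functions_continuous[OF assms] continuous_on_subset in blast)
  moreover have "(\<lambda>x. indicator K x *\<^sub>R \<phi> x) = \<phi>" using K(3) by (auto simp: indicator_def fun_eq_iff)
  ultimately show ?thesis by simp
qed

lemma gradient_bounded:
  assumes "\<phi> \<in> test_functions U"
  obtains B where "B \<ge> 0" "\<And>x. norm (gradient \<phi> x) \<le> B"
proof -
  have "\<exists>B. B \<ge> 0 \<and> (\<forall>x. \<bar>partial_deriv i \<phi> x\<bar> \<le> B)" for i
    using test_functions_bounded[OF test_functions_partial_deriv[OF assms, of i]] by metis
  then obtain B where B: "\<And>i. B i \<ge> 0" "\<And>i x. \<bar>partial_deriv i \<phi> x\<bar> \<le> B i" by metis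
  have "norm (gradient \<phi> x) \<le> (\<Sum>i\<in>UNIV. B i)" for x
    using norm_le_l1_cart[of "gradient \<phi> x"] sum_mono[of UNIV "\<lambda>i. \<bar>partial_deriv i \<phi> x\<bar>" B] B(2)
    by (simp add: gradient_def)
  then show ?thesis using that[of "\<Sum>i\<in>UNIV. B i"] B(1) by (simp add: sum_nonneg)
qed

lemma has_real_derivative_along_line:
  assumes "\<phi> differentiable (at (c t))" and "(c has_vector_derivative v) (at t)"
  shows "((\<lambda>t. \<phi> (c t)) has_real_derivative gradient \<phi> (c t) \<bullet> v) (at t)"
proof -
  from has_derivative_compose[OF assms(2)[unfolded has_vector_derivative_def] has_derivative_gradient[OF assms(1)]]
  show ?thesis by (simp add: has_field_derivative_def mult.commute mult_commute_abs)
qed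

text \<open>By translation invariance the integral of \<psi>(x + t e_i) over x does not depend on t.
  Its derivative at t = 0, taken under the integral sign, is the integral in question.\<close>

lemma integral_partial_deriv_eq_0:
  assumes psi: "\<psi> \<in> test_functions U"
  shows "(\<integral>x. partial_deriv i \<psi> x \<partial>lborel) = 0"
proof -
  obtain K where K: "compact K" "\<And>x. x \<notin> K \<Longrightarrow> \<psi> x = 0"
    using psi by (meson test_functions_support)
  obtain B where B: "\<And>x. \<bar>partial_deriv i \<psi> x\<bar> \<le> B"
    using test_functions_bounded[OF test_functions_partial_deriv[OF psi]] by metis
  obtain K' where K': "compact K'" "\<And>x. x \<notin> K' \<Longrightarrow> partial_deriv i \<psi> x = 0"
    using test_functions_partial_deriv[OF psi] by (meson test_functions_support)
  obtain r where r: "\<And>x. x \<in> K' \<Longrightarrow> norm x \<le> r"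
    using compact_imp_bounded[OF K'(1)] by (auto simp: bounded_iff)
  have cm: "\<psi> \<in> borel_measurable borel"
    using test_functions_continuous[OF psi] by (rule borel_measurable_continuous_onI)
  have int: "integrable lborel (\<lambda>x. \<psi> (x + c))" for c
  proof -
    have "integrable (distr lborel borel ((+) c)) \<psi>"
      by (simp add: lborel_distr_plus test_functions_integrable[OF psi])
    then have "integrable lborel (\<lambda>x. \<psi> (c + x))"
      using cm by (subst (asm) integrable_distr_eq) auto
    then show ?thesis by (simp add: add.commute)
  qed
  have "((\<lambda>t. \<integral>x. \<psi> (x + t *\<^sub>R axis i 1) \<partial>lborel) has_real_derivative
      (\<integral>x. partial_deriv i \<psi> (x + 0 *\<^sub>R axis i 1) \<partial>lborel)) (at 0)"
  \<comment> \<open>For |t| < 1 the translates of the support of the derivative stay in the ball of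
    radius r + 1, whose indicator provides the majorant.\<close>
  proof (rule has_real_derivative_integral[where e=1 and w="\<lambda>x. B * indicator (cball 0 (r + 1)) x"])
    fix t :: real and x :: "real ^ 'a"
    assume t: "\<bar>t - 0\<bar> < 1"
    have "((\<lambda>t. \<psi> (x + t *\<^sub>R axis i 1)) has_real_derivative gradient \<psi> (x + t *\<^sub>R axis i 1) \<bullet> axis i 1) (at t)"
      by (rule has_real_derivative_along_line)
        (auto intro!: test_functions_differentiable[OF psi] derivative_eq_intros)
    then show "((\<lambda>t. \<psi> (x + t *\<^sub>R axis i 1)) has_real_derivative partial_deriv i \<psi> (x + t *\<^sub>R axis i 1)) (at t)"
      by (simp add: inner_axis)
    show "\<bar>partial_deriv i \<psi> (x + t *\<^sub>R axis i 1)\<bar> \<le> B * indicator (cball 0 (r + 1)) x"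
    proof (cases "x + t *\<^sub>R axis i 1 \<in> K'")
      case True
      have "norm x \<le> norm (x + t *\<^sub>R axis i 1) + norm (t *\<^sub>R axis i (1::real))"
        by (metis add_diff_cancel_right' norm_triangle_ineq4)
      with r[OF True] t have "norm x \<le> r + 1" by simp
      then show ?thesis using B by simp
    next
      case False
      then show ?thesis using K'(2) B order_trans[OF abs_ge_zero B] by simp
    qed
  qed (auto intro: int emeasure_lborel_cball_finite)
  moreover have "(\<lambda>t. \<integral>x. \<psi> (x + t *\<^sub>R axis i 1) \<partial>lborel) = (\<lambda>t. \<integral>x. \<psi> x \<partial>lborel)"
    using integral_translate_lborel[OF cm] by blast
  ultimately have "((\<lambda>t::real. \<integral>x. \<psi> x \<partial>lborel) has_real_derivative (\<integral>x. partial_deriv i \<psi> x \<partial>lborel)) (at 0)"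
    by simp
  then show ?thesis using DERIV_const DERIV_unique by blast
qed

text \<open>The definitions integrate over sets with respect to \<open>lebesgue\<close>;
  translations, substitutions and product measures are handled with \<open>lborel\<close>.\<close>

lemma set_integral_eq_lborel:
  fixes f :: "'a::euclidean_space \<Rightarrow> real"
  assumes "continuous_on UNIV f" "\<And>x. x \<notin> U \<Longrightarrow> f x = 0"
  shows "(LINT x:U|lebesgue. f x) = (\<integral>x. f x \<partial>lborel)"
proof -
  have "(LINT x:U|lebesgue. f x) = (\<integral>x. f x \<partial>lebesgue)"
    unfolding set_lebesgue_integral_def
    by (rule Bochner_Integration.integral_cong) (use assms(2) in \<open>auto simp: indicator_def\<close>)
  also have "\<dots> = (\<integral>x. f x \<partial>lborel)"
    using borel_measurable_continuous_onI[OF assms(1)] by (intro integral_completion) simp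
  finally show ?thesis .
qed

lemma set_integral_partial_deriv_eq_0:
  assumes "\<psi> \<in> test_functions U"
  shows "(LINT x:U|lebesgue. partial_deriv i \<psi> x) = 0"
  using integral_partial_deriv_eq_0[OF assms] test_functions_partial_deriv[OF assms]
  by (subst set_integral_eq_lborel) (auto intro: test_functions_continuous test_functions_outside)

lemma continuous_L2:
  fixes v :: "real ^ 'n \<Rightarrow> 'b::euclidean_space"
  assumes "open U" "bounded U" "continuous_on UNIV v"
  shows "v \<in> L2_space U"
  using assms by (intro L2_space_continuous) auto

lemma test_functions_L2: "\<phi> \<in> test_functions U \<Longrightarrow> open S \<Longrightarrow> bounded S \<Longrightarrow> \<phi> \<in> L2_space S"
  by (intro continuous_L2 test_functions_continuous)

lemma continuous_gradient: "\<phi> \<in> test_functions U \<Longrightarrow> continuous_on UNIV (gradient \<phi>)"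
  unfolding gradient_def[abs_def]
  by (intro continuous_on_vec_lambda test_functions_continuous[OF test_functions_partial_deriv])

lemma gradient_L2: "\<phi> \<in> test_functions U \<Longrightarrow> open S \<Longrightarrow> bounded S \<Longrightarrow> gradient \<phi> \<in> L2_space S"
  by (intro continuous_L2 continuous_gradient)

text \<open>The product of p with a test function is a test function, whose partial derivatives have
  integral zero; the product rule turns this into integration by parts.\<close>

lemma has_weak_gradient_smooth:
  assumes U: "open U" "bounded U" and p: "smooth p"
  shows "has_weak_gradient U p (gradient p)"
  unfolding has_weak_gradient_def
proof (intro ballI allI)
  fix \<phi> i assume phi: "\<phi> \<in> test_functions U"
  have L2: "p \<in> L2_space U" "partial_deriv i p \<in> L2_space U" "\<phi> \<in> L2_space U" "partial_deriv i \<phi> \<in> L2_space U"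
    using U smooth_continuous[OF p] smooth_continuous[OF smooth_partial_deriv[OF p]] test_functions_L2[OF phi]
      test_functions_L2[OF test_functions_partial_deriv[OF phi]]
    by (auto intro!: continuous_L2)
  have "0 = (LINT x:U|lebesgue. partial_deriv i (\<lambda>x. p x * \<phi> x) x)"
    by (rule set_integral_partial_deriv_eq_0[symmetric, OF test_functions_mult[OF p phi]])
  also have "\<dots> = (LINT x:U|lebesgue. p x \<bullet> partial_deriv i \<phi> x + partial_deriv i p x \<bullet> \<phi> x)"
    using partial_deriv_mult[OF smooth_differentiable[OF p] test_functions_differentiable[OF phi]] by simp
  also have "\<dots> = (LINT x:U|lebesgue. p x * partial_deriv i \<phi> x) + (LINT x:U|lebesgue. gradient p x $ i * \<phi> x)"
    using L2_inner_integrable[OF L2(1,4)] L2_inner_integrable[OF L2(2,3)] by simp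
  finally show "(LINT x:U|lebesgue. p x * partial_deriv i \<phi> x) = - (LINT x:U|lebesgue. gradient p x $ i * \<phi> x)"
    by simp
qed

section \<open>Density of the test functions\<close>

lemma L2_space_abs:
  fixes v :: "'a::euclidean_space \<Rightarrow> real"
  assumes "v \<in> L2_space S" shows "(\<lambda>x. \<bar>v x\<bar>) \<in> L2_space S"
proof -
  have e: "indicator S x *\<^sub>R \<bar>v x\<bar> = \<bar>indicator S x *\<^sub>R v x\<bar>" for x
    by (simp add: indicator_def)
  have "(\<lambda>x. indicator S x *\<^sub>R \<bar>v x\<bar>) \<in> borel_measurable lebesgue"
    unfolding e using assms by (intro borel_measurable_abs) (simp add: L2_space_iff)
  then show ?thesis using assms by (simp add: L2_space_iff)
qed

lemma L2_dominated_convergence: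
  fixes v :: "'a::euclidean_space \<Rightarrow> real"
  assumes wn: "\<And>n. w n \<in> L2_space S" and g: "g \<in> L2_space S"
    and bnd: "\<And>n x. x \<in> S \<Longrightarrow> \<bar>w n x\<bar> \<le> g x" and lim: "\<And>x. x \<in> S \<Longrightarrow> (\<lambda>n. w n x) \<longlonglongrightarrow> v x"
  shows "v \<in> L2_space S" and "(\<lambda>n. L2_norm S (\<lambda>x. w n x - v x)) \<longlonglongrightarrow> 0"
proof -
  have vg: "\<bar>v x\<bar> \<le> g x" if "x \<in> S" for x
    by (rule LIMSEQ_le_const2[OF tendsto_rabs[OF lim[OF that]]]) (use bnd[OF that] in blast)
  have lim': "(\<lambda>n. indicator S x *\<^sub>R w n x) \<longlonglongrightarrow> indicator S x *\<^sub>R v x" for x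
    using lim by (cases "x \<in> S") auto
  have mw: "(\<lambda>x. indicator S x *\<^sub>R w n x) \<in> borel_measurable lebesgue" for n
    using wn[of n] by (simp add: L2_space_iff)
  have mv: "(\<lambda>x. indicator S x *\<^sub>R v x) \<in> borel_measurable lebesgue"
    by (rule borel_measurable_LIMSEQ_metric[OF mw lim'])
  have e: "indicator S x * (norm (f x))\<^sup>2 = (indicator S x *\<^sub>R f x)\<^sup>2" for f :: "'a \<Rightarrow> real" and x
    by (cases "x \<in> S") simp_all
  have gi: "integrable lebesgue (\<lambda>x. indicator S x * (norm (g x))\<^sup>2)"
    using g by (simp add: L2_space_iff)
  have "integrable lebesgue (\<lambda>x. indicator S x * (norm (v x))\<^sup>2)"
  proof (rule Bochner_Integration.integrable_bound[OF gi])
    show "(\<lambda>x. indicator S x * (norm (v x))\<^sup>2) \<in> borel_measurable lebesgue"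
      unfolding e using mv by measurable
    have "norm (indicator S x * (norm (v x))\<^sup>2) \<le> norm (indicator S x * (norm (g x))\<^sup>2)" for x
    proof (cases "x \<in> S")
      case True
      then have "\<bar>v x\<bar>\<^sup>2 \<le> (g x)\<^sup>2" using vg by (intro power_mono) auto
      then show ?thesis using True by simp
    qed simp
    then show "AE x in lebesgue. norm (indicator S x * (norm (v x))\<^sup>2) \<le> norm (indicator S x * (norm (g x))\<^sup>2)"
      by (rule AE_I2)
  qed
  then show v: "v \<in> L2_space S" using mv by (simp add: L2_space_iff)
  have "(\<lambda>n. \<integral>x. (indicator S x *\<^sub>R (w n x - v x))\<^sup>2 \<partial>lebesgue) \<longlonglongrightarrow> (\<integral>x. 0 \<partial>(lebesgue::'a measure))"
  \<comment> \<open>The limit inherits the bound by g, so the difference is at most 2 g and its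
    square at most 4 g^2.\<close>
  proof (rule integral_dominated_convergence[where w="\<lambda>x. 4 * (indicator S x * (norm (g x))\<^sup>2)"])
    show "(\<lambda>x. (indicator S x *\<^sub>R (w n x - v x))\<^sup>2) \<in> borel_measurable lebesgue" for n
    proof -
      have "(\<lambda>x. (indicator S x *\<^sub>R w n x - indicator S x *\<^sub>R v x)\<^sup>2) \<in> borel_measurable lebesgue"
        using mw mv by measurable
      then show ?thesis by (simp add: right_diff_distrib)
    qed
    have "(\<lambda>n. (indicator S x *\<^sub>R w n x - indicator S x *\<^sub>R v x)\<^sup>2) \<longlonglongrightarrow> (indicator S x *\<^sub>R v x - indicator S x *\<^sub>R v x)\<^sup>2" for x
      by (intro tendsto_intros lim')
    then show "AE x in lebesgue. (\<lambda>n. (indicator S x *\<^sub>R (w n x - v x))\<^sup>2) \<longlonglongrightarrow> 0"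
      by (simp add: right_diff_distrib)
    have "norm ((indicator S x *\<^sub>R (w n x - v x))\<^sup>2) \<le> 4 * (indicator S x * (norm (g x))\<^sup>2)" for n x
    proof (cases "x \<in> S")
      case True
      then have "\<bar>w n x - v x\<bar> \<le> 2 * g x" using vg[OF True] bnd[OF True, of n] by linarith
      then have "\<bar>w n x - v x\<bar>\<^sup>2 \<le> (2 * g x)\<^sup>2" by (intro power_mono) auto
      then show ?thesis using True by (simp add: power_mult_distrib)
    qed simp
    then show "AE x in lebesgue. norm ((indicator S x *\<^sub>R (w n x - v x))\<^sup>2) \<le> 4 * (indicator S x * (norm (g x))\<^sup>2)" for n
      by (intro AE_I2)
  qed (use gi in auto)
  moreover have "L2_inner S (\<lambda>x. w n x - v x) (\<lambda>x. w n x - v x) = (\<integral>x. (indicator S x *\<^sub>R (w n x - v x))\<^sup>2 \<partial>lebesgue)" for n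
    unfolding L2_inner_def set_lebesgue_integral_def
    by (rule Bochner_Integration.integral_cong) (auto simp: indicator_def power2_eq_square)
  ultimately have "(\<lambda>n. sqrt (L2_inner S (\<lambda>x. w n x - v x) (\<lambda>x. w n x - v x))) \<longlonglongrightarrow> sqrt 0"
    by (intro tendsto_real_sqrt) simp
  then show "(\<lambda>n. L2_norm S (\<lambda>x. w n x - v x)) \<longlonglongrightarrow> 0"
    by (simp add: L2_norm_def)
qed

text \<open>The closure of the test functions in L^2. It is closed under linear combinations and
  limits, so the usual passage from boxes through Borel sets and simple functions shows that it is
  the whole space.\<close>

definition test_approx :: "(real ^ 'n::finite) set \<Rightarrow> (real ^ 'n \<Rightarrow> real) set" where
  "test_approx U = {w \<in> L2_space U. \<forall>\<epsilon>>0. \<exists>\<phi>\<in>test_functions U. L2_norm U (\<lambda>x. w x - \<phi> x) < \<epsilon>}"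

context
  fixes U :: "(real ^ 'n::finite) set"
  assumes U: "open U" "bounded U"
begin

lemma test_approx_L2: "w \<in> test_approx U \<Longrightarrow> w \<in> L2_space U"
  by (simp add: test_approx_def)

lemma test_approx_add_scaled:
  assumes v: "v \<in> test_approx U" and w: "w \<in> test_approx U"
  shows "(\<lambda>x. v x + c * w x) \<in> test_approx U"
  unfolding test_approx_def
proof (intro CollectI conjI allI impI)
  have L2: "v \<in> L2_space U" "w \<in> L2_space U" using v w by (auto simp: test_approx_def)
  then show "(\<lambda>x. v x + c * w x) \<in> L2_space U"
    using L2_space_add_scaled[of v U w c] by simp
  fix \<epsilon> :: real assume e: "\<epsilon> > 0"
  \<comment> \<open>The summand 1 keeps the divisor positive for c = 0.\<close>
  let ?d = "\<epsilon> / (2 * (\<bar>c\<bar> + 1))"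
  have d: "?d > 0" using e by (simp add: add_nonneg_pos)
  obtain f g where f: "f \<in> test_functions U" "L2_norm U (\<lambda>x. v x - f x) < \<epsilon> / 2"
    and g: "g \<in> test_functions U" "L2_norm U (\<lambda>x. w x - g x) < ?d"
    using v w d half_gt_zero[OF e] unfolding test_approx_def by blast
  have L: "(\<lambda>x. v x - f x) \<in> L2_space U" "(\<lambda>x. w x - g x) \<in> L2_space U"
    using L2 f g U by (auto intro!: L2_space_diff test_functions_L2)
  have "L2_norm U (\<lambda>x. (v x + c * w x) - (f x + c * g x)) = L2_norm U (\<lambda>x. (v x - f x) + c *\<^sub>R (w x - g x))"
    by (rule arg_cong[where f="L2_norm U"]) (auto simp: algebra_simps)
  also have "\<dots> \<le> L2_norm U (\<lambda>x. v x - f x) + \<bar>c\<bar> * L2_norm U (\<lambda>x. w x - g x)"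
    using L2_norm_triangle[OF L(1) L2_space_scaled[OF L(2)], of c] L2_norm_scaled[of U c "\<lambda>x. w x - g x"] by simp
  also have "\<dots> < \<epsilon> / 2 + (\<bar>c\<bar> + 1) * ?d"
  proof (rule add_less_le_mono[OF f(2)])
    show "\<bar>c\<bar> * L2_norm U (\<lambda>x. w x - g x) \<le> (\<bar>c\<bar> + 1) * ?d"
      using g(2) d by (intro mult_mono) auto
  qed
  also have "\<dots> = \<epsilon>" by (simp add: field_simps add_nonneg_eq_0_iff)
  finally show "\<exists>\<phi>\<in>test_functions U. L2_norm U (\<lambda>x. v x + c * w x - \<phi> x) < \<epsilon>"
    using test_functions_add_scaled[OF f(1) g(1), of c] by (intro bexI[of _ "\<lambda>x. f x + c * g x"])
qed

lemma test_approx_limit: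
  assumes wn: "\<And>n. w n \<in> test_approx U" and v: "v \<in> L2_space U"
    and lim: "(\<lambda>n. L2_norm U (\<lambda>x. w n x - v x)) \<longlonglongrightarrow> 0"
  shows "v \<in> test_approx U"
  unfolding test_approx_def
proof (intro CollectI conjI allI impI v)
  fix \<epsilon> :: real assume e: "\<epsilon> > 0"
  then have "\<forall>\<^sub>F n in sequentially. L2_norm U (\<lambda>x. w n x - v x) < \<epsilon> / 2"
    by (intro order_tendstoD(2)[OF lim]) simp
  then obtain n where n: "L2_norm U (\<lambda>x. w n x - v x) < \<epsilon> / 2"
    by (auto simp: eventually_sequentially)
  obtain f where f: "f \<in> test_functions U" "L2_norm U (\<lambda>x. w n x - f x) < \<epsilon> / 2"
    using wn[of n] half_gt_zero[OF e] unfolding test_approx_def by blast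
  have L: "(\<lambda>x. v x - w n x) \<in> L2_space U" "(\<lambda>x. w n x - f x) \<in> L2_space U"
    using v wn[of n] f U by (auto intro!: L2_space_diff test_functions_L2 simp: test_approx_def)
  have "L2_norm U (\<lambda>x. v x - f x) \<le> L2_norm U (\<lambda>x. v x - w n x) + L2_norm U (\<lambda>x. w n x - f x)"
    using L2_norm_triangle[OF L] by simp
  also have "\<dots> < \<epsilon>" using n f(2) L2_norm_diff_commute[of U v "w n"] by simp
  finally show "\<exists>\<phi>\<in>test_functions U. L2_norm U (\<lambda>x. v x - \<phi> x) < \<epsilon>" using f(1) by blast
qed

lemma test_approx_test: "\<phi> \<in> test_functions U \<Longrightarrow> \<phi> \<in> test_approx U"
proof -
  assume phi: "\<phi> \<in> test_functions U"
  have "L2_norm U (\<lambda>x. \<phi> x - \<phi> x) = 0" by (simp add: L2_norm_eq_0_iff)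
  then show ?thesis
    using phi U unfolding test_approx_def by (auto intro!: test_functions_L2 bexI[of _ \<phi>])
qed

lemma one_L2: "(\<lambda>x. 1::real) \<in> L2_space U"
  using U by (intro continuous_L2) auto

lemma test_approx_dominated:
  assumes "\<And>n. w n \<in> test_approx U" "\<And>n x. \<bar>w n x\<bar> \<le> 1" "\<And>x. (\<lambda>n. w n x) \<longlonglongrightarrow> v x"
  shows "v \<in> test_approx U"
  using L2_dominated_convergence[of w U "\<lambda>x. 1" v] assms one_L2 test_approx_L2
  by (intro test_approx_limit[of w v]) auto

lemma test_approx_box:
  assumes "cbox a b \<subseteq> U" shows "indicator (box a b) \<in> test_approx U"
proof (rule test_approx_dominated)
  show "box_bump n a b \<in> test_approx U" for n
    using box_bump_test[OF assms] by (rule test_approx_test)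
  show "\<bar>box_bump n a b x\<bar> \<le> 1" for n x
    using box_bump_bounds[of n a b x] by simp
qed (rule box_bump_tendsto)

text \<open>Dynkin's argument: open boxes generate the Borel sets and are stable under intersection.
  Within the fixed box, whose indicator is already approximable, complements become differences and
  disjoint unions become dominated limits of sums.\<close>

lemma test_approx_borel_in_box:
  assumes ab: "cbox a b \<subseteq> U" and E: "E \<in> sets borel"
  shows "indicator (E \<inter> box a b) \<in> test_approx U"
proof -
  let ?G = "range (\<lambda>(a, b). box a b :: (real ^ 'n) set)"
  have "Int_stable ?G" by (auto simp: Int_stable_def box_Int_box)
  moreover have "?G \<subseteq> Pow UNIV" by simp
  moreover have "E \<in> sigma_sets UNIV ?G" using E unfolding borel_eq_box by simp
  ultimately show ?thesis
  proof (induction rule: sigma_sets_induct_disjoint)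
    case (basic A)
    then obtain c d where A: "A = box c d" by auto
    obtain p q where pq: "box c d \<inter> box a b = box p q" by (simp add: box_Int_box)
    have "indicator (box p q) \<in> test_approx U"
    \<comment> \<open>An empty open box may belong to a closed box that leaves U; only for a
      nonempty one is the closed box the closure of the open one.\<close>
    proof (cases "box p q = {}")
      case True
      then have "(indicator (box p q) :: real ^ 'n \<Rightarrow> real) = (\<lambda>x. 0)" by auto
      then show ?thesis using test_approx_test[OF test_functions_zero] by simp
    next
      case False
      then have "cbox p q = closure (box p q)" by (simp add: closure_box)
      also have "\<dots> \<subseteq> closure (box a b)" using pq by (metis closure_mono inf_le2)
      also have "\<dots> \<subseteq> cbox a b" by (rule closure_minimal[OF box_subset_cbox closed_cbox])
      finally show ?thesis using ab by (intro test_approx_box) simp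
    qed
    then show ?case using A pq by simp
  next
    case empty
    have "(indicator {} :: real ^ 'n \<Rightarrow> real) = (\<lambda>x. 0)" by auto
    then show ?case using test_approx_test[OF test_functions_zero] by simp
  next
    case (compl A)
    have "(indicator ((UNIV - A) \<inter> box a b) :: real ^ 'n \<Rightarrow> real) =
        (\<lambda>x. indicator (box a b) x + (-1) * indicator (A \<inter> box a b) x)"
      by (auto simp: indicator_def fun_eq_iff)
    then show ?case using test_approx_add_scaled[OF test_approx_box[OF ab] compl.IH, of "-1"] by simp
  next
    case (union A)
    have part: "indicator ((\<Union>i<n. A i) \<inter> box a b) \<in> test_approx U" for n
    proof (induction n)
      case 0
      have "(indicator {} :: real ^ 'n \<Rightarrow> real) = (\<lambda>x. 0)" by auto
      then show ?case using test_approx_test[OF test_functions_zero] by simp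
    next
      case (Suc n)
      have "disjoint_family A" using union by blast
      then have "A n \<inter> A i = {}" if "i < n" for i
        using that by (simp add: disjoint_family_on_def)
      then have "A n \<inter> (\<Union>i<n. A i) = {}" by blast
      then have "(indicator ((\<Union>i<Suc n. A i) \<inter> box a b) :: real ^ 'n \<Rightarrow> real) =
          (\<lambda>x. indicator ((\<Union>i<n. A i) \<inter> box a b) x + 1 * indicator (A n \<inter> box a b) x)"
        by (auto simp: indicator_def fun_eq_iff lessThan_Suc)
      then show ?case using test_approx_add_scaled[OF Suc union.IH[of n], of 1] by simp
    qed
    show ?case
    proof (rule test_approx_dominated[OF part])
      show "(\<lambda>n. indicator ((\<Union>i<n. A i) \<inter> box a b) x :: real) \<longlonglongrightarrow> indicator (\<Union> (range A) \<inter> box a b) x" for x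
      proof (cases "\<exists>i. x \<in> A i")
        case True
        then obtain i where "x \<in> A i" by blast
        then have "\<forall>n\<ge>Suc i. (indicator ((\<Union>i<n. A i) \<inter> box a b) x :: real) = indicator (\<Union> (range A) \<inter> box a b) x"
          by (auto simp: indicator_def Suc_le_eq)
        then show ?thesis by (intro tendsto_eventually) (auto simp: eventually_sequentially)
      next
        case False
        then show ?thesis by (simp add: indicator_def)
      qed
    qed (simp add: indicator_def)
  qed
qed

text \<open>By Lindelof's theorem U is the union of countably many open boxes with closed boxes
  inside U. Adding in each step only what the next box contributes reduces to one box at a
  time.\<close>

lemma test_approx_borel:
  assumes E: "E \<in> sets borel"
  shows "indicator (E \<inter> U) \<in> test_approx U"
proof -
  let ?F = "{box a b | a b. cbox a b \<subseteq> U}"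
  obtain F where F: "F \<subseteq> ?F" "countable F" "\<Union>F = \<Union>?F"
    by (rule Lindelof[of ?F]) auto
  have "\<Union>?F = U"
  proof
    show "U \<subseteq> \<Union>?F"
    proof
      fix x assume "x \<in> U"
      then obtain a b where "x \<in> box a b" "cbox a b \<subseteq> U" using open_contains_cbox[OF U(1)] by metis
      then show "x \<in> \<Union>?F" by blast
    qed
  qed (use box_subset_cbox in blast)
  \<comment> \<open>The empty set is adjoined because \<open>from_nat_into\<close> enumerates
    nonempty families only.\<close>
  with F have FU: "\<Union>(insert {} F) = U" by simp
  let ?B = "from_nat_into (insert {} F)"
  have B: "range ?B = insert {} F" using F(2) by (intro range_from_nat_into) auto
  have memB: "?B n \<in> insert {} F" for n using B by blast
  have Bo: "?B n \<in> sets borel" for n using memB[of n] F(1) by auto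
  have one: "indicator (E' \<inter> ?B n) \<in> test_approx U" if "E' \<in> sets borel" for E' n
  proof (cases "?B n = {}")
    case True
    have "(indicator {} :: real ^ 'n \<Rightarrow> real) = (\<lambda>x. 0)" by auto
    then show ?thesis using test_approx_test[OF test_functions_zero] True by simp
  next
    case False
    then have "?B n \<in> ?F" using memB[of n] F(1) by blast
    then obtain a b where "?B n = box a b" "cbox a b \<subseteq> U" by blast
    then show ?thesis using test_approx_borel_in_box that by simp
  qed
  have part: "indicator (E \<inter> (\<Union>i<n. ?B i)) \<in> test_approx U" for n
  proof (induction n)
    case 0
    have "(indicator {} :: real ^ 'n \<Rightarrow> real) = (\<lambda>x. 0)" by auto
    then show ?case using test_approx_test[OF test_functions_zero] by simp
  next
    case (Suc n)
    have "(indicator (E \<inter> (\<Union>i<Suc n. ?B i)) :: real ^ 'n \<Rightarrow> real) =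
        (\<lambda>x. indicator (E \<inter> (\<Union>i<n. ?B i)) x + 1 * indicator ((E - (\<Union>i<n. ?B i)) \<inter> ?B n) x)"
      by (auto simp: indicator_def fun_eq_iff lessThan_Suc)
    moreover have "E - (\<Union>i<n. ?B i) \<in> sets borel" using E Bo by auto
    ultimately show ?case using test_approx_add_scaled[OF Suc one, where c=1] by simp
  qed
  show ?thesis
  proof (rule test_approx_dominated[OF part])
    show "(\<lambda>n. indicator (E \<inter> (\<Union>i<n. ?B i)) x :: real) \<longlonglongrightarrow> indicator (E \<inter> U) x" for x
    proof (cases "x \<in> U")
      case True
      then obtain i where "x \<in> ?B i" using FU B by (metis UN_iff UnionE rangeE)
      then have "\<forall>n\<ge>Suc i. (indicator (E \<inter> (\<Union>i<n. ?B i)) x :: real) = indicator (E \<inter> U) x"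
        using True by (auto simp: indicator_def Suc_le_eq)
      then show ?thesis by (intro tendsto_eventually) (auto simp: eventually_sequentially)
    next
      case False
      then have "x \<notin> ?B i" for i using FU memB[of i] by blast
      then show ?thesis using False by (simp add: indicator_def)
    qed
  qed (simp add: indicator_def)
qed

text \<open>A Borel representative g of w is the pointwise limit of simple functions bounded by 2
  |g|, and a simple function is a finite combination of indicators of Borel sets.\<close>

lemma L2_subset_test_approx:
  assumes w: "w \<in> L2_space U" shows "w \<in> test_approx U"
proof -
  have "(\<lambda>x. indicator U x *\<^sub>R w x) \<in> borel_measurable (completion lborel)"
    using w by (simp add: L2_space_iff)
  then obtain g where g: "g \<in> borel_measurable lborel" "AE x in lborel. indicator U x *\<^sub>R w x = g x"
    using completion_ex_borel_measurable_real by blast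
  have ae: "AE x in lebesgue. indicator U x *\<^sub>R w x = g x" by (rule AE_completion[OF g(2)])
  then have ae': "AE x in lebesgue. x \<in> U \<longrightarrow> w x = g x"
    by eventually_elim (auto simp: indicator_def)
  have gL: "g \<in> L2_space U" by (rule L2_space_cong_AE[OF w ae'])
  obtain s where s: "\<And>i. simple_function lborel (s i)" "\<And>x. (\<lambda>i. s i x) \<longlonglongrightarrow> g x"
    "\<And>i x. dist (s i x) 0 \<le> 2 * dist (g x) 0"
    using borel_measurable_implies_sequence_metric[OF g(1), of 0] by auto
  have sa: "(\<lambda>x. indicator U x * s i x) \<in> test_approx U" for i
  proof -
    have fin: "finite (range (s i))" using simple_functionD(1)[OF s(1)[of i]] by simp
    have m: "s i -` {y} \<in> sets borel" for y using simple_functionD(2)[OF s(1)[of i], of "{y}"] by simp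
    have "(\<lambda>x. \<Sum>y\<in>Y. y * indicator (s i -` {y} \<inter> U) x) \<in> test_approx U" if "finite Y" for Y
      using that
    proof induction
      case empty
      then show ?case using test_approx_test[OF test_functions_zero] by simp
    next
      case (insert y Y)
      then show ?case using test_approx_add_scaled[OF insert.IH test_approx_borel[OF m[of y]], of y]
        by (simp add: add.commute del: sum_mult_indicator sum_indicator_mult)
    qed
    from this[OF fin] have "(\<lambda>x. \<Sum>y\<in>range (s i). y * indicator (s i -` {y} \<inter> U) x) \<in> test_approx U" .
    moreover have "(\<Sum>y\<in>range (s i). y * indicator (s i -` {y} \<inter> U) x) = indicator U x * s i x" for x
    proof -
      have "(\<Sum>y\<in>range (s i). y * indicator (s i -` {y} \<inter> U) x) =
          (\<Sum>y\<in>range (s i). if y = s i x then indicator U x * s i x else 0)"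
        by (rule sum.cong) (auto simp: indicator_def)
      then show ?thesis using fin by simp
    qed
    ultimately show ?thesis by simp
  qed
  have "(\<lambda>x. \<bar>g x\<bar>) \<in> L2_space U" by (rule L2_space_abs[OF gL])
  then have g2: "(\<lambda>x. 2 * \<bar>g x\<bar>) \<in> L2_space U" using L2_space_scaled[of "\<lambda>x. \<bar>g x\<bar>" U 2] by simp
  have "g \<in> test_approx U"
  proof (rule test_approx_limit[OF sa gL])
    have b: "\<bar>indicator U x * s i x\<bar> \<le> 2 * \<bar>g x\<bar>" if "x \<in> U" for i x using s(3)[of i x] that by simp
    have l: "(\<lambda>i. indicator U x * s i x) \<longlonglongrightarrow> g x" if "x \<in> U" for x using s(2)[of x] that by simp
    show "(\<lambda>n. L2_norm U (\<lambda>x. indicator U x * s n x - g x)) \<longlonglongrightarrow> 0"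
      by (rule L2_dominated_convergence(2)[where w="\<lambda>i x. indicator U x * s i x" and v=g, OF test_approx_L2[OF sa] g2 b l])
  qed
  moreover have "L2_norm U (\<lambda>x. w x - \<phi> x) = L2_norm U (\<lambda>x. g x - \<phi> x)" if "\<phi> \<in> test_functions U" for \<phi>
    using ae' L2_space_diff[OF w test_functions_L2[OF that U]]
    by (intro L2_norm_cong_AE) (auto elim: eventually_mono)
  ultimately show ?thesis using w by (auto simp: test_approx_def)
qed

lemma test_functions_dense:
  assumes "w \<in> L2_space U" "\<epsilon> > 0"
  obtains \<phi> where "\<phi> \<in> test_functions U" "L2_norm U (\<lambda>x. w x - \<phi> x) < \<epsilon>"
  using L2_subset_test_approx[OF assms(1)] assms(2) that unfolding test_approx_def by blast

text \<open>If w were admissible as a test function, inserting it would give the claim. A test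
  function close to w does the same up to an arbitrarily small error.\<close>

lemma L2_norm_le_dual:
  assumes w: "w \<in> L2_space U" and K: "K \<ge> 0"
    and dual: "\<And>\<phi>. \<phi> \<in> test_functions U \<Longrightarrow> L2_inner U w \<phi> \<le> K * L2_norm U \<phi>"
  shows "L2_norm U w \<le> K"
proof -
  let ?n = "L2_norm U w"
  have "?n\<^sup>2 \<le> K * ?n + e" if e: "e > 0" for e
  proof -
    \<comment> \<open>Replacing w by \<phi> costs at most K d on the right and \<open>?n\<close> d
      on the left; this d keeps the sum below e.\<close>
    let ?d = "e / (K + ?n + 1)"
    have pos: "K + ?n + 1 > 0" using K by (simp add: add_nonneg_pos)
    then have d: "?d > 0" using e by simp
    obtain \<phi> where phi: "\<phi> \<in> test_functions U" "L2_norm U (\<lambda>x. w x - \<phi> x) < ?d"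
      using test_functions_dense[OF w d] .
    note L = test_functions_L2[OF phi(1) U]
    have D: "(\<lambda>x. w x - \<phi> x) \<in> L2_space U" by (rule L2_space_diff[OF w L])
    have "L2_norm U \<phi> \<le> ?n + ?d"
      using L2_norm_diff_le[OF w D] phi(2) by simp
    then have "L2_inner U w \<phi> \<le> K * (?n + ?d)"
      using dual[OF phi(1)] K by (meson mult_left_mono order_trans)
    moreover have "L2_inner U w (\<lambda>x. w x - \<phi> x) \<le> ?n * ?d"
      using L2_inner_le[OF w D] phi(2) by (meson L2_norm_nonneg less_imp_le mult_left_mono order_trans)
    moreover have "L2_inner U w (\<lambda>x. w x - \<phi> x) = ?n\<^sup>2 - L2_inner U w \<phi>"
      using L2_inner_diff_right[OF w L w] by (simp add: L2_norm_square)
    ultimately have "?n\<^sup>2 \<le> K * ?n + (K + ?n) * ?d" unfolding distrib_left distrib_right by linarith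
    also have "(K + ?n) * ?d \<le> e"
      using e pos K by (simp add: field_simps)
    finally show ?thesis by simp
  qed
  then have le: "?n\<^sup>2 \<le> K * ?n" by (rule field_le_epsilon)
  show ?thesis
  proof (cases "?n = 0")
    case False
    then have "?n > 0" using L2_norm_nonneg[of U w] by linarith
    then show ?thesis using le by (simp add: power2_eq_square)
  qed (use K in simp)
qed

text \<open>The fundamental lemma of the calculus of variations, as the case K = 0 of the dual
  estimate.\<close>

lemma L2_AE_eq_0:
  assumes w: "w \<in> L2_space U" and dual: "\<And>\<phi>. \<phi> \<in> test_functions U \<Longrightarrow> L2_inner U w \<phi> = 0"
  shows "AE x in lebesgue. x \<in> U \<longrightarrow> w x = 0"
  using L2_norm_le_dual[OF w, of 0] dual L2_norm_nonneg[of U w] L2_norm_eq_0_iff[OF w] by simp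

end

section \<open>Weak gradients and Sobolev spaces\<close>

lemma L2_space_component:
  fixes G :: "'a::euclidean_space \<Rightarrow> real ^ 'n"
  assumes "G \<in> L2_space S" shows "(\<lambda>x. G x $ i) \<in> L2_space S"
  unfolding L2_space_iff
proof
  have e: "indicator S x *\<^sub>R G x $ i = (indicator S x *\<^sub>R G x) \<bullet> axis i 1" for x
    by (simp add: inner_axis)
  show m: "(\<lambda>x. indicator S x *\<^sub>R G x $ i) \<in> borel_measurable lebesgue"
    unfolding e using assms by (intro borel_measurable_inner) (simp_all add: L2_space_iff)
  have e2: "indicator S x * (norm (G x $ i))\<^sup>2 = (indicator S x *\<^sub>R G x $ i)\<^sup>2" for x
    by (cases "x \<in> S") simp_all
  show "integrable lebesgue (\<lambda>x. indicator S x * (norm (G x $ i))\<^sup>2)"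
  proof (rule Bochner_Integration.integrable_bound)
    show "integrable lebesgue (\<lambda>x. indicator S x * (norm (G x))\<^sup>2)" using assms by (simp add: L2_space_iff)
    show "(\<lambda>x. indicator S x * (norm (G x $ i))\<^sup>2) \<in> borel_measurable lebesgue"
      unfolding e2 using m by measurable
    have "norm (indicator S x * (norm (G x $ i))\<^sup>2) \<le> norm (indicator S x * (norm (G x))\<^sup>2)" for x
      using power_mono[OF component_le_norm_cart[of "G x" i], of 2] by (cases "x \<in> S") simp_all
    then show "AE x in lebesgue. norm (indicator S x * (norm (G x $ i))\<^sup>2) \<le> norm (indicator S x * (norm (G x))\<^sup>2)"
      by (rule AE_I2)
  qed
qed

lemma L2_inner_eq_sum_components:
  fixes v w :: "'a::euclidean_space \<Rightarrow> real ^ 'n"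
  assumes "v \<in> L2_space S" "w \<in> L2_space S"
  shows "L2_inner S v w = (\<Sum>i\<in>UNIV. L2_inner S (\<lambda>x. v x $ i) (\<lambda>x. w x $ i))"
proof -
  have "L2_inner S v w = (LINT x|lebesgue. (\<Sum>i\<in>UNIV. indicator S x *\<^sub>R (v x $ i \<bullet> w x $ i)))"
    by (simp add: L2_inner_def set_lebesgue_integral_def inner_vec_def scaleR_sum_right sum_distrib_left del: sum_mult_indicator sum_indicator_mult)
  also have "\<dots> = (\<Sum>i\<in>UNIV. L2_inner S (\<lambda>x. v x $ i) (\<lambda>x. w x $ i))"
    unfolding L2_inner_def set_lebesgue_integral_def
    using L2_inner_integrable[OF L2_space_component[OF assms(1)] L2_space_component[OF assms(2)]]
    by (intro Bochner_Integration.integral_sum) (simp add: set_integrable_def)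
  finally show ?thesis .
qed

lemma has_weak_gradient_iff:
  "has_weak_gradient U v G \<longleftrightarrow> (\<forall>\<phi>\<in>test_functions U. \<forall>i.
     L2_inner U v (partial_deriv i \<phi>) = - L2_inner U (\<lambda>x. G x $ i) \<phi>)"
  by (simp add: has_weak_gradient_def L2_inner_def)

context
  fixes U :: "(real ^ 'n::finite) set"
  assumes U: "open U" "bounded U"
begin

lemma partial_deriv_L2: "\<phi> \<in> test_functions U \<Longrightarrow> partial_deriv i \<phi> \<in> L2_space U"
  by (rule test_functions_L2[OF test_functions_partial_deriv U])

lemma has_weak_gradient_add_scaled:
  assumes "has_weak_gradient U v G" "has_weak_gradient U w H"
    and L2: "v \<in> L2_space U" "w \<in> L2_space U" "G \<in> L2_space U" "H \<in> L2_space U"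
  shows "has_weak_gradient U (\<lambda>x. v x + c * w x) (\<lambda>x. G x + c *\<^sub>R H x)"
  unfolding has_weak_gradient_iff
proof (intro ballI allI)
  fix \<phi> i assume phi: "\<phi> \<in> test_functions U"
  have "L2_inner U (\<lambda>x. v x + c * w x) (partial_deriv i \<phi>)
      = L2_inner U v (partial_deriv i \<phi>) + c * L2_inner U w (partial_deriv i \<phi>)"
    using L2_inner_add_scaled[OF L2(1,2) partial_deriv_L2[OF phi], of c] by simp
  moreover have "L2_inner U (\<lambda>x. (G x + c *\<^sub>R H x) $ i) \<phi>
      = L2_inner U (\<lambda>x. G x $ i) \<phi> + c * L2_inner U (\<lambda>x. H x $ i) \<phi>"
    using L2_inner_add_scaled[OF L2_space_component[OF L2(3), of i] L2_space_component[OF L2(4), of i]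
      test_functions_L2[OF phi U], of c] by simp
  ultimately show "L2_inner U (\<lambda>x. v x + c * w x) (partial_deriv i \<phi>) = - L2_inner U (\<lambda>x. (G x + c *\<^sub>R H x) $ i) \<phi>"
    using assms(1,2) phi by (simp add: has_weak_gradient_iff)
qed

lemma has_weak_gradient_unique:
  assumes "has_weak_gradient U v G" "has_weak_gradient U v H"
    and L2: "G \<in> L2_space U" "H \<in> L2_space U"
  shows "AE x in lebesgue. x \<in> U \<longrightarrow> G x = H x"
proof -
  have "AE x in lebesgue. x \<in> U \<longrightarrow> G x $ i - H x $ i = 0" for i
  proof (rule L2_AE_eq_0[OF U])
    show "(\<lambda>x. G x $ i - H x $ i) \<in> L2_space U"
      using L2 by (intro L2_space_diff L2_space_component)
    fix \<phi> assume phi: "\<phi> \<in> test_functions U"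
    then show "L2_inner U (\<lambda>x. G x $ i - H x $ i) \<phi> = 0"
      using L2_inner_diff[OF L2_space_component[OF L2(1), of i] L2_space_component[OF L2(2), of i] test_functions_L2[OF phi U]] assms(1,2)
      by (simp add: has_weak_gradient_iff)
  qed
  then have "AE x in lebesgue. \<forall>i\<in>UNIV. x \<in> U \<longrightarrow> G x $ i - H x $ i = 0"
    by (intro AE_finite_allI) auto
  then show ?thesis by eventually_elim (auto simp: vec_eq_iff)
qed

text \<open>All that is ever used of the choice made by \<open>wgrad\<close>; together with
  uniqueness almost everywhere it identifies the gradient.\<close>

lemma H1_D:
  assumes "v \<in> H1_space U"
  shows "v \<in> L2_space U" "wgrad U v \<in> L2_space U" "has_weak_gradient U v (wgrad U v)"
proof -
  have "\<exists>G. G \<in> L2_space U \<and> has_weak_gradient U v G" using assms by (auto simp: H1_space_def)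
  from someI_ex[OF this] show "wgrad U v \<in> L2_space U" "has_weak_gradient U v (wgrad U v)"
    by (simp_all add: wgrad_def)
qed (use assms in \<open>simp add: H1_space_def\<close>)

lemma H1_I: "v \<in> L2_space U \<Longrightarrow> has_weak_gradient U v G \<Longrightarrow> G \<in> L2_space U \<Longrightarrow> v \<in> H1_space U"
  by (auto simp: H1_space_def)

lemma wgrad_AE_eq:
  assumes "v \<in> L2_space U" "has_weak_gradient U v G" "G \<in> L2_space U"
  shows "AE x in lebesgue. x \<in> U \<longrightarrow> wgrad U v x = G x"
  using H1_D[OF H1_I[OF assms]] assms by (intro has_weak_gradient_unique)

text \<open>The representatives that \<open>wgrad\<close> picks for v, w and v + c w are chosen
  independently, so linearity holds almost everywhere and is passed on through integrals.\<close>

lemma H1_add_scaled: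
  assumes v: "v \<in> H1_space U" and w: "w \<in> H1_space U"
  shows "(\<lambda>x. v x + c * w x) \<in> H1_space U"
    and "AE x in lebesgue. x \<in> U \<longrightarrow> wgrad U (\<lambda>x. v x + c * w x) x = wgrad U v x + c *\<^sub>R wgrad U w x"
proof -
  note D = H1_D[OF v] H1_D[OF w]
  have 1: "(\<lambda>x. v x + c * w x) \<in> L2_space U" using L2_space_add_scaled[OF D(1,4), of c] by simp
  have 2: "has_weak_gradient U (\<lambda>x. v x + c * w x) (\<lambda>x. wgrad U v x + c *\<^sub>R wgrad U w x)"
    using D by (intro has_weak_gradient_add_scaled)
  have 3: "(\<lambda>x. wgrad U v x + c *\<^sub>R wgrad U w x) \<in> L2_space U"
    using D by (intro L2_space_add_scaled)
  from 1 2 3 show "(\<lambda>x. v x + c * w x) \<in> H1_space U" by (rule H1_I)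
  from 1 2 3 show "AE x in lebesgue. x \<in> U \<longrightarrow> wgrad U (\<lambda>x. v x + c * w x) x = wgrad U v x + c *\<^sub>R wgrad U w x"
    by (rule wgrad_AE_eq)
qed

lemma L2_inner_wgrad_add_scaled:
  assumes "v \<in> H1_space U" "w \<in> H1_space U" "G \<in> L2_space U"
  shows "L2_inner U (wgrad U (\<lambda>x. v x + c * w x)) G = L2_inner U (wgrad U v) G + c * L2_inner U (wgrad U w) G"
proof -
  note D = H1_D[OF assms(1)] H1_D[OF assms(2)] H1_D[OF H1_add_scaled(1)[OF assms(1,2)], of c]
  have "L2_inner U (wgrad U (\<lambda>x. v x + c * w x)) G = L2_inner U (\<lambda>x. wgrad U v x + c *\<^sub>R wgrad U w x) G"
    using H1_add_scaled(2)[OF assms(1,2), of c] D assms(3)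
    by (intro L2_inner_cong_AE L2_space_add_scaled) (auto elim: eventually_mono)
  then show ?thesis using D assms(3) by (simp add: L2_inner_add_scaled)
qed

lemma smooth_H1:
  assumes "smooth p"
  shows "p \<in> H1_space U" and "AE x in lebesgue. x \<in> U \<longrightarrow> wgrad U p x = gradient p x"
proof -
  have 1: "p \<in> L2_space U" by (rule continuous_L2[OF U smooth_continuous[OF assms]])
  have "continuous_on UNIV (gradient p)"
    unfolding gradient_def[abs_def]
    by (intro continuous_on_vec_lambda smooth_continuous[OF smooth_partial_deriv[OF assms]])
  then have 2: "gradient p \<in> L2_space U" by (rule continuous_L2[OF U])
  note 3 = has_weak_gradient_smooth[OF U assms]
  from 1 3 2 show "p \<in> H1_space U" by (rule H1_I)
  from 1 3 2 show "AE x in lebesgue. x \<in> U \<longrightarrow> wgrad U p x = gradient p x" by (rule wgrad_AE_eq)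
qed

lemma wgrad_diff_norm:
  assumes v: "v \<in> H1_space U" and w: "w \<in> H1_space U"
  shows "(\<lambda>x. v x - w x) \<in> H1_space U"
    and "H1_seminorm U (\<lambda>x. v x - w x) = L2_norm U (\<lambda>x. wgrad U v x - wgrad U w x)"
proof -
  show *: "(\<lambda>x. v x - w x) \<in> H1_space U" using H1_add_scaled(1)[OF v w, of "-1"] by simp
  show "H1_seminorm U (\<lambda>x. v x - w x) = L2_norm U (\<lambda>x. wgrad U v x - wgrad U w x)"
    unfolding H1_seminorm_def
    using H1_add_scaled(2)[OF v w, of "-1"] H1_D(2)[OF *] by (intro L2_norm_cong_AE) simp_all
qed

section \<open>Approximation by test functions in the norm of H^1\<close>

lemma H10_H1: "v \<in> H10_space U \<Longrightarrow> v \<in> H1_space U"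
  by (simp add: H10_space_def)

lemma H10_approx:
  assumes v: "v \<in> H10_space U"
  obtains \<phi> where "\<And>k. \<phi> k \<in> test_functions U" "(\<lambda>k. L2_norm U (\<lambda>x. v x - \<phi> k x)) \<longlonglongrightarrow> 0"
    "(\<lambda>k. L2_norm U (\<lambda>x. wgrad U v x - gradient (\<phi> k) x)) \<longlonglongrightarrow> 0"
proof -
  obtain \<phi> where phi: "\<And>k::nat. \<phi> k \<in> test_functions U" "(\<lambda>k. H1_norm U (\<lambda>x. v x - \<phi> k x)) \<longlonglongrightarrow> 0"
    using v by (auto simp: H10_space_def)
  note vH = H10_H1[OF v]
  have sm: "smooth (\<phi> k)" for k by (rule test_functions_smooth[OF phi(1)])
  have "L2_norm U (\<lambda>x. v x - \<phi> k x) \<le> H1_norm U (\<lambda>x. v x - \<phi> k x)" for k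
    unfolding H1_norm_def by (rule real_le_rsqrt) simp
  then have 1: "(\<lambda>k. L2_norm U (\<lambda>x. v x - \<phi> k x)) \<longlonglongrightarrow> 0"
    by (intro tendsto_sandwich[OF _ _ tendsto_const phi(2)]) auto
  have "L2_norm U (\<lambda>x. wgrad U v x - gradient (\<phi> k) x) \<le> H1_norm U (\<lambda>x. v x - \<phi> k x)" for k
  proof -
    have "AE x in lebesgue. x \<in> U \<longrightarrow> wgrad U v x - wgrad U (\<phi> k) x = wgrad U v x - gradient (\<phi> k) x"
      using smooth_H1(2)[OF sm] by eventually_elim simp
    then have "L2_norm U (\<lambda>x. wgrad U v x - gradient (\<phi> k) x) = H1_seminorm U (\<lambda>x. v x - \<phi> k x)"
      unfolding wgrad_diff_norm(2)[OF vH smooth_H1(1)[OF sm]]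
      using H1_D(2)[OF vH] H1_D(2)[OF smooth_H1(1)[OF sm]]
      by (intro L2_norm_cong_AE[symmetric] L2_space_diff)
    then show ?thesis
      unfolding H1_norm_def by (intro real_le_rsqrt) simp
  qed
  then have 2: "(\<lambda>k. L2_norm U (\<lambda>x. wgrad U v x - gradient (\<phi> k) x)) \<longlonglongrightarrow> 0"
    by (intro tendsto_sandwich[OF _ _ tendsto_const phi(2)]) auto
  show ?thesis by (rule that[OF phi(1) 1 2])
qed

lemma H10_add_scaled:
  assumes v: "v \<in> H10_space U" and w: "w \<in> H10_space U"
  shows "(\<lambda>x. v x + c * w x) \<in> H10_space U"
proof -
  obtain f where f: "\<And>k. f k \<in> test_functions U" "(\<lambda>k. L2_norm U (\<lambda>x. v x - f k x)) \<longlonglongrightarrow> 0"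
    "(\<lambda>k. L2_norm U (\<lambda>x. wgrad U v x - gradient (f k) x)) \<longlonglongrightarrow> 0"
    using H10_approx[OF v] by blast
  obtain g where g: "\<And>k. g k \<in> test_functions U" "(\<lambda>k. L2_norm U (\<lambda>x. w x - g k x)) \<longlonglongrightarrow> 0"
    "(\<lambda>k. L2_norm U (\<lambda>x. wgrad U w x - gradient (g k) x)) \<longlonglongrightarrow> 0"
    using H10_approx[OF w] by blast
  let ?z = "\<lambda>x. v x + c * w x" and ?h = "\<lambda>k x. f k x + c * g k x"
  note vH = H10_H1[OF v] and wH = H10_H1[OF w]
  note zH = H1_add_scaled(1)[OF vH wH, of c]
  have h: "?h k \<in> test_functions U" for k by (rule test_functions_add_scaled[OF f(1) g(1)])
  have sm: "smooth (f k)" "smooth (g k)" for k by (rule test_functions_smooth[OF f(1)], rule test_functions_smooth[OF g(1)])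
  have b1: "L2_norm U (\<lambda>x. ?z x - ?h k x) \<le> L2_norm U (\<lambda>x. v x - f k x) + \<bar>c\<bar> * L2_norm U (\<lambda>x. w x - g k x)" for k
  proof -
    have "L2_norm U (\<lambda>x. ?z x - ?h k x) = L2_norm U (\<lambda>x. (v x - f k x) + c *\<^sub>R (w x - g k x))"
      by (rule arg_cong[where f="L2_norm U"]) (auto simp: algebra_simps)
    also have "\<dots> \<le> L2_norm U (\<lambda>x. v x - f k x) + L2_norm U (\<lambda>x. c *\<^sub>R (w x - g k x))"
      by (intro L2_norm_triangle L2_space_scaled L2_space_diff H1_D(1)[OF vH] H1_D(1)[OF wH] test_functions_L2[OF f(1) U] test_functions_L2[OF g(1) U])
    finally show ?thesis by (simp only: L2_norm_scaled)
  qed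
  have b2: "H1_seminorm U (\<lambda>x. ?z x - ?h k x) \<le> L2_norm U (\<lambda>x. wgrad U v x - gradient (f k) x)
      + \<bar>c\<bar> * L2_norm U (\<lambda>x. wgrad U w x - gradient (g k) x)" for k
  proof -
    note fH = smooth_H1[OF sm(1)[of k]] and gH = smooth_H1[OF sm(2)[of k]]
    have hH: "?h k \<in> H1_space U" by (rule H1_add_scaled(1)[OF fH(1) gH(1)])
    have "AE x in lebesgue. x \<in> U \<longrightarrow> wgrad U ?z x - wgrad U (?h k) x =
        (wgrad U v x - gradient (f k) x) + c *\<^sub>R (wgrad U w x - gradient (g k) x)"
      using fH(2) gH(2) H1_add_scaled(2)[OF fH(1) gH(1), of c] H1_add_scaled(2)[OF vH wH, of c]
      by eventually_elim (simp add: algebra_simps)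
    then have "H1_seminorm U (\<lambda>x. ?z x - ?h k x) = L2_norm U (\<lambda>x. (wgrad U v x - gradient (f k) x)
        + c *\<^sub>R (wgrad U w x - gradient (g k) x))"
      unfolding wgrad_diff_norm(2)[OF zH hH]
      by (rule L2_norm_cong_AE) (intro L2_space_diff H1_D(2)[OF zH] H1_D(2)[OF hH])
    also have "\<dots> \<le> L2_norm U (\<lambda>x. wgrad U v x - gradient (f k) x) + L2_norm U (\<lambda>x. c *\<^sub>R (wgrad U w x - gradient (g k) x))"
      by (intro L2_norm_triangle L2_space_scaled L2_space_diff H1_D(2)[OF vH] H1_D(2)[OF wH] gradient_L2[OF f(1) U] gradient_L2[OF g(1) U])
    finally show ?thesis by (simp only: L2_norm_scaled)
  qed
  have r1: "(\<lambda>k. L2_norm U (\<lambda>x. v x - f k x) + \<bar>c\<bar> * L2_norm U (\<lambda>x. w x - g k x)) \<longlonglongrightarrow> 0 + \<bar>c\<bar> * 0"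
    by (intro tendsto_intros f g)
  have "(\<lambda>k. L2_norm U (\<lambda>x. ?z x - ?h k x)) \<longlonglongrightarrow> 0"
    by (rule tendsto_sandwich[OF _ _ tendsto_const]) (use r1 b1 in \<open>auto intro!: always_eventually\<close>)
  moreover have r2: "(\<lambda>k. L2_norm U (\<lambda>x. wgrad U v x - gradient (f k) x)
      + \<bar>c\<bar> * L2_norm U (\<lambda>x. wgrad U w x - gradient (g k) x)) \<longlonglongrightarrow> 0 + \<bar>c\<bar> * 0"
    by (intro tendsto_intros f g)
  have "(\<lambda>k. H1_seminorm U (\<lambda>x. ?z x - ?h k x)) \<longlonglongrightarrow> 0"
    by (rule tendsto_sandwich[OF _ _ tendsto_const])
      (use r2 b2 in \<open>auto intro!: always_eventually simp: H1_seminorm_def\<close>)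
  ultimately have "(\<lambda>k. sqrt ((L2_norm U (\<lambda>x. ?z x - ?h k x))\<^sup>2 + (H1_seminorm U (\<lambda>x. ?z x - ?h k x))\<^sup>2)) \<longlonglongrightarrow> sqrt (0\<^sup>2 + 0\<^sup>2)"
    by (intro tendsto_intros)
  then have "(\<lambda>k. H1_norm U (\<lambda>x. ?z x - ?h k x)) \<longlonglongrightarrow> 0" by (simp add: H1_norm_def)
  then show ?thesis using zH h unfolding H10_space_def by (intro CollectI conjI exI[of _ ?h] allI)
qed

lemma H10_zero: "(\<lambda>x. 0) \<in> H10_space U"
proof -
  have z: "(\<lambda>x. 0) \<in> H1_space U" by (rule smooth_H1(1)) (simp add: C_k_const)
  have "L2_norm U (\<lambda>x. 0::real) = 0" by (simp add: L2_norm_eq_0_iff)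
  moreover have "AE x in lebesgue. x \<in> U \<longrightarrow> wgrad U (\<lambda>x. 0) x = 0"
    using smooth_H1(2)[of "\<lambda>x. 0"] by (auto simp: C_k_const gradient_def vec_eq_iff elim!: eventually_mono)
  then have "H1_seminorm U (\<lambda>x. 0) = 0"
    unfolding H1_seminorm_def using H1_D(2)[OF z] by (simp add: L2_norm_eq_0_iff)
  ultimately have "H1_norm U (\<lambda>x. 0 - 0) = 0" by (simp add: H1_norm_def)
  then show ?thesis
    using z test_functions_zero[of U] unfolding H10_space_def
    by (intro CollectI conjI exI[of _ "\<lambda>k x. 0"]) simp_all
qed

lemma L2_inner_tendsto:
  fixes w :: "real ^ 'n \<Rightarrow> 'b::euclidean_space"
  assumes w: "w \<in> L2_space U" and v: "v \<in> L2_space U" and f: "\<And>k. f k \<in> L2_space U"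
    and lim: "(\<lambda>k. L2_norm U (\<lambda>x. v x - f k x)) \<longlonglongrightarrow> 0"
  shows "(\<lambda>k. L2_inner U w (f k)) \<longlonglongrightarrow> L2_inner U w v"
proof -
  have "(\<lambda>k. L2_inner U w v - L2_inner U w (f k)) \<longlonglongrightarrow> 0"
  proof (rule Lim_null_comparison)
    show "\<forall>\<^sub>F k in sequentially. norm (L2_inner U w v - L2_inner U w (f k)) \<le> L2_norm U w * L2_norm U (\<lambda>x. v x - f k x)"
      using L2_Cauchy_Schwarz[OF w L2_space_diff[OF v f]] L2_inner_diff_right[OF v f w] by simp
    show "(\<lambda>k. L2_norm U w * L2_norm U (\<lambda>x. v x - f k x)) \<longlonglongrightarrow> 0"
      using tendsto_mult_right_zero[OF lim] by simp
  qed
  from tendsto_diff[OF tendsto_const this, of "L2_inner U w v"] show ?thesis by simp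
qed

text \<open>Both sides are continuous in the norm of H^1, so a weak equation needs to be verified
  for test functions only. This serves the Marini flux as well as the distributional
  Laplacian.\<close>

lemma H10_test_extension:
  assumes g: "g \<in> L2_space U" and s: "s \<in> L2_space U"
    and eq: "\<And>\<phi>. \<phi> \<in> test_functions U \<Longrightarrow> L2_inner U s (gradient \<phi>) = L2_inner U g \<phi>"
    and v: "v \<in> H10_space U"
  shows "L2_inner U s (wgrad U v) = L2_inner U g v"
proof -
  obtain \<phi> where phi: "\<And>k. \<phi> k \<in> test_functions U" "(\<lambda>k. L2_norm U (\<lambda>x. v x - \<phi> k x)) \<longlonglongrightarrow> 0"
    "(\<lambda>k. L2_norm U (\<lambda>x. wgrad U v x - gradient (\<phi> k) x)) \<longlonglongrightarrow> 0"
    using H10_approx[OF v] by blast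
  note D = H1_D[OF H10_H1[OF v]]
  have "(\<lambda>k. L2_inner U s (gradient (\<phi> k))) \<longlonglongrightarrow> L2_inner U s (wgrad U v)"
    by (rule L2_inner_tendsto[OF s D(2) gradient_L2[OF phi(1) U] phi(3)])
  moreover have "(\<lambda>k. L2_inner U g (\<phi> k)) \<longlonglongrightarrow> L2_inner U g v"
    by (rule L2_inner_tendsto[OF g D(1) test_functions_L2[OF phi(1) U] phi(2)])
  ultimately show ?thesis using eq[OF phi(1)] by (simp add: LIMSEQ_unique)
qed

section \<open>Friedrichs' inequality\<close>

lemma L2_norm_tendsto:
  fixes v :: "real ^ 'n \<Rightarrow> 'b::euclidean_space"
  assumes v: "v \<in> L2_space U" and f: "\<And>k. f k \<in> L2_space U"
    and lim: "(\<lambda>k. L2_norm U (\<lambda>x. v x - f k x)) \<longlonglongrightarrow> 0"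
  shows "(\<lambda>k. L2_norm U (f k)) \<longlonglongrightarrow> L2_norm U v"
proof -
  have "\<bar>L2_norm U (f k) - L2_norm U v\<bar> \<le> L2_norm U (\<lambda>x. v x - f k x)" for k
    using L2_norm_triangle[OF f[of k] L2_space_diff[OF v f[of k]]]
      L2_norm_diff_le[OF v L2_space_diff[OF v f[of k]]] by simp
  then have "(\<lambda>k. L2_norm U (f k) - L2_norm U v) \<longlonglongrightarrow> 0"
    by (intro Lim_null_comparison[OF _ lim]) (auto intro: always_eventually)
  then show ?thesis by (simp add: LIM_zero_iff)
qed

text \<open>Integrating \<open>\<partial>\<^sub>i (x\<^sub>i \<phi>\<^sup>2)\<close> bounds \<open>\<parallel>\<phi>\<parallel>\<^sup>2\<close> by \<open>- 2 (x\<^sub>i \<phi>, \<partial>\<^sub>i \<phi>)\<close>.\<close>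

lemma Friedrichs_test:
  assumes R: "\<And>x. x \<in> U \<Longrightarrow> norm x \<le> R" and R0: "R \<ge> 0" and phi: "\<phi> \<in> test_functions U"
  shows "L2_norm U \<phi> \<le> 2 * R * L2_norm U (gradient \<phi>)"
proof -
  \<comment> \<open>A single coordinate direction, chosen arbitrarily, is enough.\<close>
  fix i :: 'n
  let ?x = "\<lambda>x::real ^ 'n. axis i 1 \<bullet> x + 0" and ?d = "partial_deriv i \<phi>"
  have sx: "smooth ?x" using C_k_affine by blast
  have xphi: "(\<lambda>x. ?x x * \<phi> x) \<in> test_functions U" by (rule test_functions_mult[OF sx phi])
  note L = test_functions_L2[OF phi U] test_functions_L2[OF xphi U] partial_deriv_L2[OF phi, of i]
  note dif = test_functions_differentiable[OF phi]
  have "0 = (LINT x:U|lebesgue. partial_deriv i (\<lambda>x. \<phi> x * (?x x * \<phi> x)) x)"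
    by (rule set_integral_partial_deriv_eq_0[symmetric])
      (rule test_functions_mult[OF test_functions_smooth[OF phi] xphi])
  also have "\<dots> = (LINT x:U|lebesgue. 2 * (((?x x * \<phi> x) \<bullet> ?d x)) + \<phi> x \<bullet> \<phi> x)"
  proof -
    have "partial_deriv i (\<lambda>x. \<phi> x * (?x x * \<phi> x)) x = 2 * (((?x x * \<phi> x) \<bullet> ?d x)) + \<phi> x \<bullet> \<phi> x" for x
    proof -
      have "partial_deriv i (\<lambda>x. \<phi> x * (?x x * \<phi> x)) x = \<phi> x * (?x x * ?d x + partial_deriv i ?x x * \<phi> x) + ?d x * (?x x * \<phi> x)"
        using partial_deriv_mult[OF dif test_functions_differentiable[OF xphi], of i x]
          partial_deriv_mult[OF smooth_differentiable[OF sx] dif, of i x] by simp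
      also have "partial_deriv i ?x x = 1" by (subst partial_deriv_affine) (simp add: axis_def)
      finally show ?thesis by (simp add: algebra_simps)
    qed
    then show ?thesis by simp
  qed
  also have "\<dots> = 2 * L2_inner U (\<lambda>x. ?x x * \<phi> x) ?d + L2_inner U \<phi> \<phi>"
    using L2_inner_integrable[OF L(2,3)] L2_inner_integrable[OF L(1,1)] unfolding L2_inner_def
    by (subst set_integral_add(2)) auto
  finally have "(L2_norm U \<phi>)\<^sup>2 = - 2 * L2_inner U (\<lambda>x. ?x x * \<phi> x) ?d" by (simp add: L2_norm_square)
  also have "\<dots> \<le> 2 * (L2_norm U (\<lambda>x. ?x x * \<phi> x) * L2_norm U ?d)"
    using L2_Cauchy_Schwarz[OF L(2,3)] by linarith
  also have "\<dots> \<le> 2 * ((R * L2_norm U \<phi>) * L2_norm U (gradient \<phi>))"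
  proof (intro mult_left_mono mult_mono)
    show "L2_norm U (\<lambda>x. ?x x * \<phi> x) \<le> R * L2_norm U \<phi>"
    proof -
      have "L2_inner U (\<lambda>x. ?x x * \<phi> x) (\<lambda>x. ?x x * \<phi> x) \<le> L2_inner U (\<lambda>x. R *\<^sub>R \<phi> x) (\<lambda>x. R *\<^sub>R \<phi> x)"
        unfolding L2_inner_def
      proof (rule set_integral_mono)
        fix x assume "x \<in> U"
        then have "\<bar>?x x\<bar> \<le> \<bar>R\<bar>" using R[of x] component_le_norm_cart[of x i] by (simp add: inner_axis')
        then have "(?x x)\<^sup>2 \<le> R\<^sup>2" by (rule abs_le_square_iff[THEN iffD1])
        then show "(?x x * \<phi> x) \<bullet> (?x x * \<phi> x) \<le> (R *\<^sub>R \<phi> x) \<bullet> (R *\<^sub>R \<phi> x)"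
          using mult_right_mono[of "(?x x)\<^sup>2" "R\<^sup>2" "(\<phi> x)\<^sup>2"] by (simp add: power2_eq_square algebra_simps)
      qed (use L2_inner_integrable L2_space_scaled L in blast)+
      then have "(L2_norm U (\<lambda>x. ?x x * \<phi> x))\<^sup>2 \<le> (R * L2_norm U \<phi>)\<^sup>2"
        using L2_norm_scaled[of U R \<phi>] R0 by (simp flip: L2_norm_square)
      then show ?thesis by (rule power2_le_imp_le) (simp add: R0)
    qed
    show "L2_norm U ?d \<le> L2_norm U (gradient \<phi>)"
    proof -
      have "L2_inner U ?d ?d \<le> (\<Sum>i\<in>UNIV. L2_inner U (partial_deriv i \<phi>) (partial_deriv i \<phi>))"
        by (rule member_le_sum) auto
      also have "\<dots> = L2_inner U (gradient \<phi>) (gradient \<phi>)"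
        using gradient_L2[OF phi U] by (subst L2_inner_eq_sum_components) auto
      finally show ?thesis by (simp add: L2_norm_def)
    qed
  qed (use R0 in auto)
  finally have le: "L2_norm U \<phi> * L2_norm U \<phi> \<le> (2 * R * L2_norm U (gradient \<phi>)) * L2_norm U \<phi>"
    by (simp add: power2_eq_square algebra_simps)
  show ?thesis
  proof (cases "L2_norm U \<phi> = 0")
    case False
    then have "L2_norm U \<phi> > 0" using L2_norm_nonneg[of U \<phi>] by linarith
    then show ?thesis using le by simp
  qed (use R0 in simp)
qed

lemma Friedrichs:
  obtains K where "K \<ge> 0" "\<And>v. v \<in> H10_space U \<Longrightarrow> L2_norm U v \<le> K * L2_norm U (wgrad U v)"
proof -
  obtain R where R: "\<And>x. x \<in> U \<Longrightarrow> norm x \<le> R" using U(2) by (auto simp: bounded_iff)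
  \<comment> \<open>If U is empty, R may be negative; the maximum restores the sign.\<close>
  then have R': "\<And>x. x \<in> U \<Longrightarrow> norm x \<le> max R 0" by (auto simp: le_max_iff_disj)
  have "L2_norm U v \<le> 2 * max R 0 * L2_norm U (wgrad U v)" if v: "v \<in> H10_space U" for v
  proof -
    obtain \<phi> where phi: "\<And>k. \<phi> k \<in> test_functions U" "(\<lambda>k. L2_norm U (\<lambda>x. v x - \<phi> k x)) \<longlonglongrightarrow> 0"
      "(\<lambda>k. L2_norm U (\<lambda>x. wgrad U v x - gradient (\<phi> k) x)) \<longlonglongrightarrow> 0"
      using H10_approx[OF v] by blast
    note D = H1_D[OF H10_H1[OF v]]
    show ?thesis
    proof (rule LIMSEQ_le)
      show "(\<lambda>k. L2_norm U (\<phi> k)) \<longlonglongrightarrow> L2_norm U v"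
        by (rule L2_norm_tendsto[OF D(1) test_functions_L2[OF phi(1) U] phi(2)])
      show "(\<lambda>k. 2 * max R 0 * L2_norm U (gradient (\<phi> k))) \<longlonglongrightarrow> 2 * max R 0 * L2_norm U (wgrad U v)"
        by (intro tendsto_mult tendsto_const L2_norm_tendsto[OF D(2) gradient_L2[OF phi(1) U] phi(3)])
    qed (use Friedrichs_test[OF R' _ phi(1)] in auto)
  qed
  then show ?thesis using that[of "2 * max R 0"] by simp
qed

end

text \<open>A test function on V is one on U, and both integrands vanish outside V.\<close>

lemma has_weak_gradient_subset:
  assumes w: "has_weak_gradient U v G" and V: "V \<subseteq> U"
  shows "has_weak_gradient V v G"
  unfolding has_weak_gradient_def
proof (intro ballI allI)
  fix \<phi> i assume phi: "\<phi> \<in> test_functions V"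
  have restr: "(LINT x:V|lebesgue. f x * g x) = (LINT x:U|lebesgue. f x * g x)"
    if "\<And>x. x \<notin> V \<Longrightarrow> g x = 0" for f g :: "real ^ 'a \<Rightarrow> real"
    unfolding set_lebesgue_integral_def
    by (rule Bochner_Integration.integral_cong) (use that V in \<open>auto simp: indicator_def\<close>)
  show "(LINT x:V|lebesgue. v x * partial_deriv i \<phi> x) = - (LINT x:V|lebesgue. G x $ i * \<phi> x)"
    using w test_functions_mono[OF phi V] restr[of "partial_deriv i \<phi>" v] restr[of \<phi> "\<lambda>x. G x $ i"]
      test_functions_outside[OF phi] test_functions_outside[OF test_functions_partial_deriv[OF phi]]
    by (simp add: has_weak_gradient_def)
qed

lemma H1_subset:
  assumes U: "open U" "bounded U" and V: "open V" "V \<subseteq> U" and v: "v \<in> H1_space U"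
  shows "v \<in> H1_space V" and "AE x in lebesgue. x \<in> V \<longrightarrow> wgrad V v x = wgrad U v x"
proof -
  note D = H1_D[OF U v]
  have bV: "bounded V" using U(2) V(2) by (rule bounded_subset)
  have 1: "v \<in> L2_space V" "wgrad U v \<in> L2_space V"
    using D(1,2) V by (auto intro: L2_space_subset)
  note 2 = has_weak_gradient_subset[OF D(3) V(2)]
  show "v \<in> H1_space V" by (rule H1_I[OF V(1) bV 1(1) 2 1(2)])
  show "AE x in lebesgue. x \<in> V \<longrightarrow> wgrad V v x = wgrad U v x"
    by (rule wgrad_AE_eq[OF V(1) bV 1(1) 2 1(2)])
qed

section \<open>The Poincare inequality on convex domains\<close>

lemma integral_homothety:
  fixes f :: "'a::euclidean_space \<Rightarrow> real"
  assumes s: "s \<noteq> 0" and f: "f \<in> borel_measurable borel"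
  shows "(\<integral>x. f x \<partial>lborel) = \<bar>s\<bar> ^ DIM('a) * (\<integral>x. f (p + s *\<^sub>R x) \<partial>lborel)"
proof -
  have "(\<integral>x. f x \<partial>lborel) = (\<integral>x. f x \<partial>density (distr lborel borel (\<lambda>x. p + s *\<^sub>R x)) (\<lambda>_. ennreal (\<bar>s\<bar> ^ DIM('a))))"
    using lborel_affine[OF s, of p] by (simp add: ennreal_power)
  also have "\<dots> = (\<integral>x. \<bar>s\<bar> ^ DIM('a) *\<^sub>R f x \<partial>distr lborel borel (\<lambda>x. p + s *\<^sub>R x))"
    using f by (intro integral_density) auto
  also have "\<dots> = \<bar>s\<bar> ^ DIM('a) * (\<integral>x. f (p + s *\<^sub>R x) \<partial>lborel)"
    using f by (subst integral_distr) auto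
  finally show ?thesis .
qed

text \<open>The density \<phi> transported by the contraction towards y with ratio 1/s: for s at
  least 1 the support moves towards y, and the power of s preserves the integral. For s = 2 it is
  2^n \<phi>(2 x - y), in which y occurs through its reflection in x.\<close>

definition shrink :: "real ^ 'n::finite \<Rightarrow> real \<Rightarrow> (real ^ 'n \<Rightarrow> real) \<Rightarrow> real ^ 'n \<Rightarrow> real" where
  "shrink y s \<phi> x = s ^ CARD('n) * \<phi> (y + s *\<^sub>R (x - y))"

lemma shrink_eq: "shrink y s \<phi> = (\<lambda>x. s ^ CARD('n) * \<phi> ((y - s *\<^sub>R y) + s *\<^sub>R x))" for y :: "real ^ 'n"
  by (simp add: shrink_def[abs_def] algebra_simps)

lemma shrink_smooth: "smooth \<phi> \<Longrightarrow> smooth (shrink y s \<phi>)"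
  unfolding shrink_eq using C_k_cmult[OF C_k_homothety] by blast

context
  fixes U :: "(real ^ 'n::finite) set"
  assumes U: "open U" "bounded U" and cvx: "convex U"
begin

text \<open>The contraction with centre y maps the support of \<phi> to a compact set, which stays
  in U by convexity.\<close>

lemma shrink_test:
  assumes y: "y \<in> U" and s: "s \<ge> 1" and phi: "\<phi> \<in> test_functions U"
  shows "shrink y s \<phi> \<in> test_functions U"
proof -
  obtain K where K: "compact K" "K \<subseteq> U" "\<And>x. x \<notin> K \<Longrightarrow> \<phi> x = 0"
    using test_functions_support[OF phi] by blast
  let ?h = "\<lambda>k. y + (1 / s) *\<^sub>R (k - y)"
  have "compact (?h ` K)"
    using K(1) by (intro compact_continuous_image continuous_intros)
  moreover have "?h ` K \<subseteq> U"
  proof safe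
    fix k assume "k \<in> K"
    then have "(1 - 1 / s) *\<^sub>R y + (1 / s) *\<^sub>R k \<in> U"
      using K(2) y s by (intro convexD_alt[OF cvx]) auto
    then show "?h k \<in> U" by (simp add: algebra_simps)
  qed
  moreover have "shrink y s \<phi> x = 0" if x: "x \<notin> ?h ` K" for x
  proof -
    have "x = ?h (y + s *\<^sub>R (x - y))" using s by simp
    then have "y + s *\<^sub>R (x - y) \<notin> K" using x image_eqI[of x ?h] by blast
    then show ?thesis using K(3) by (simp add: shrink_def)
  qed
  ultimately show ?thesis
    using shrink_smooth[OF test_functions_smooth[OF phi]] by (auto simp: test_functions_iff)
qed

text \<open>By substitution the squared norm is multiplied by s^n, which is at most 2^n and hence at
  most the square of 2^n. The constant is generous, as only finiteness of the Poincare constant is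
  at stake.\<close>

lemma shrink_norm_le:
  assumes y: "y \<in> U" and s: "1 \<le> s" "s \<le> 2" and phi: "\<phi> \<in> test_functions U"
  shows "L2_norm U (shrink y s \<phi>) \<le> 2 ^ CARD('n) * L2_norm U \<phi>"
proof -
  let ?d = "CARD('n)"
  have c: "continuous_on UNIV (\<lambda>x. f x * f x)" if "f \<in> test_functions U" for f
    using test_functions_continuous[OF that] by (intro continuous_intros)
  have sq: "L2_inner U f f = (\<integral>x. f x * f x \<partial>lborel)" if "f \<in> test_functions U" for f
    unfolding L2_inner_def inner_real_def
    by (rule set_integral_eq_lborel[OF c[OF that]]) (simp add: test_functions_outside[OF that])
  have "(\<integral>x. \<phi> x * \<phi> x \<partial>lborel) = s ^ ?d * (\<integral>x. \<phi> ((y - s *\<^sub>R y) + s *\<^sub>R x) * \<phi> ((y - s *\<^sub>R y) + s *\<^sub>R x) \<partial>lborel)"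
    using s borel_measurable_continuous_onI[OF c[OF phi]] integral_homothety[of s "\<lambda>x. \<phi> x * \<phi> x" "y - s *\<^sub>R y"] by simp
  moreover have "(\<integral>x. shrink y s \<phi> x * shrink y s \<phi> x \<partial>lborel)
      = (\<integral>x. (s ^ ?d)\<^sup>2 * (\<phi> ((y - s *\<^sub>R y) + s *\<^sub>R x) * \<phi> ((y - s *\<^sub>R y) + s *\<^sub>R x)) \<partial>lborel)"
    unfolding shrink_eq by (rule Bochner_Integration.integral_cong) (auto simp: power2_eq_square)
  ultimately have "L2_inner U (shrink y s \<phi>) (shrink y s \<phi>) = s ^ ?d * L2_inner U \<phi> \<phi>"
    using sq[OF phi] sq[OF shrink_test[OF y s(1) phi]] s by (simp add: power2_eq_square)
  also have "\<dots> \<le> (2 ^ ?d)\<^sup>2 * L2_inner U \<phi> \<phi>"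
  proof (rule mult_right_mono)
    have "s ^ ?d \<le> 2 ^ ?d" using s by (intro power_mono) auto
    also have "\<dots> \<le> (2 ^ ?d)\<^sup>2" by (rule self_le_power) auto
    finally show "s ^ ?d \<le> (2 ^ ?d)\<^sup>2" .
  qed simp
  finally have "(L2_norm U (shrink y s \<phi>))\<^sup>2 \<le> (2 ^ ?d * L2_norm U \<phi>)\<^sup>2"
    by (simp add: L2_norm_square power_mult_distrib)
  then show ?thesis by (rule power2_le_imp_le) simp
qed

text \<open>The derivative of \<open>shrink y s \<phi>\<close> in \<open>s\<close> is \<open>1 / s\<close> times the divergence of \<open>(x - y) * shrink y s \<phi> x\<close>.\<close>

lemma shrink_derivative:
  assumes phi: "\<phi> \<in> test_functions U" and s: "s > 0"
  shows "((\<lambda>s. shrink y s \<phi> x) has_real_derivative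
      (1 / s) * (\<Sum>i\<in>UNIV. partial_deriv i (\<lambda>x. (x $ i - y $ i) * shrink y s \<phi> x) x)) (at s)"
proof -
  let ?d = "CARD('n)" and ?z = "y + s *\<^sub>R (x - y)"
  note dif = test_functions_differentiable[OF phi]
  have d0: "?d = Suc (?d - 1)" by simp
  have "((\<lambda>s. \<phi> (y + s *\<^sub>R (x - y))) has_real_derivative gradient \<phi> ?z \<bullet> (x - y)) (at s)"
    by (rule has_real_derivative_along_line[OF dif]) (auto intro!: derivative_eq_intros)
  from DERIV_mult[OF DERIV_pow[of ?d s] this]
  have D: "((\<lambda>s. shrink y s \<phi> x) has_real_derivative
      real ?d * s ^ (?d - 1) * \<phi> ?z + gradient \<phi> ?z \<bullet> (x - y) * s ^ ?d) (at s)"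
    by (simp add: shrink_def numeral_eq_Suc del: power_Suc)
  have pd: "partial_deriv i (\<lambda>x. (x $ i - y $ i) * shrink y s \<phi> x) x =
      (x $ i - y $ i) * (s ^ ?d * (s * partial_deriv i \<phi> ?z)) + s ^ ?d * \<phi> ?z" for i
  proof -
    let ?a = "\<lambda>x::real ^ 'n. axis i 1 \<bullet> x + (- y $ i)" and ?f = "\<lambda>x. \<phi> ((y - s *\<^sub>R y) + s *\<^sub>R x)"
    have f: "?f differentiable (at x)"
      using smooth_differentiable[of ?f] C_k_homothety test_functions_smooth[OF phi] by blast
    have zz: "(y - s *\<^sub>R y) + s *\<^sub>R x = ?z" by (simp add: algebra_simps)
    have 1: "partial_deriv i ?a x = 1" by (subst partial_deriv_affine) (simp add: axis_def)
    have 2: "partial_deriv i (\<lambda>x. s ^ ?d * ?f x) x = s ^ ?d * (s * partial_deriv i \<phi> ?z)"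
      using partial_deriv_mult[of "\<lambda>x. s ^ ?d" x ?f i] f partial_deriv_homothety[where f=\<phi> and i=i and s=s and p="y - s *\<^sub>R y" and x=x, OF dif]
      by (simp add: zz)
    have "partial_deriv i (\<lambda>x. ?a x * (s ^ ?d * ?f x)) x =
        ?a x * partial_deriv i (\<lambda>x. s ^ ?d * ?f x) x + partial_deriv i ?a x * (s ^ ?d * ?f x)"
    proof (intro partial_deriv_mult smooth_differentiable)
      show "smooth ?a" using C_k_affine by blast
      show "smooth (\<lambda>x. s ^ ?d * ?f x)"
        using C_k_cmult[OF C_k_homothety] test_functions_smooth[OF phi] by blast
    qed
    then show ?thesis
      unfolding 1 2 zz shrink_eq by (simp add: inner_axis')
  qed
  have "(\<Sum>i\<in>UNIV. partial_deriv i (\<lambda>x. (x $ i - y $ i) * shrink y s \<phi> x) x)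
      = s ^ ?d * s * (gradient \<phi> ?z \<bullet> (x - y)) + real ?d * (s ^ ?d * \<phi> ?z)"
  proof -
    have "(\<Sum>i\<in>UNIV. (x $ i - y $ i) * (s ^ ?d * (s * partial_deriv i \<phi> ?z))) = s ^ ?d * s * (gradient \<phi> ?z \<bullet> (x - y))"
      by (simp add: inner_vec_def sum_distrib_left mult_ac)
    then show ?thesis unfolding pd sum.distrib by simp
  qed
  moreover have "s ^ ?d = s * s ^ (?d - 1)" using d0 power_Suc by metis
  ultimately have "(1 / s) * (\<Sum>i\<in>UNIV. partial_deriv i (\<lambda>x. (x $ i - y $ i) * shrink y s \<phi> x) x)
      = real ?d * s ^ (?d - 1) * \<phi> ?z + gradient \<phi> ?z \<bullet> (x - y) * s ^ ?d"
    using s by (simp add: field_simps)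
  then show ?thesis using D by simp
qed

text \<open>Supplies the majorant for differentiation under the integral sign. The range up to 3
  contains the intervals of radius 1/2 about the points of [1, 2]. Computing the same derivative by
  the product rule makes the factor 1/s disappear.\<close>

lemma shrink_derivative_bounded:
  assumes phi: "\<phi> \<in> test_functions U" and y: "y \<in> U"
  obtains C where "\<And>s x. 0 < s \<Longrightarrow> s \<le> 3 \<Longrightarrow> x \<in> U \<Longrightarrow>
      \<bar>(1 / s) * (\<Sum>i\<in>UNIV. partial_deriv i (\<lambda>x. (x $ i - y $ i) * shrink y s \<phi> x) x)\<bar> \<le> C"
proof -
  let ?d = "CARD('n)"
  obtain B where B: "B \<ge> 0" "\<And>x. \<bar>\<phi> x\<bar> \<le> B" using test_functions_bounded[OF phi] by blast
  obtain B' where B': "B' \<ge> 0" "\<And>x. norm (gradient \<phi> x) \<le> B'" using gradient_bounded[OF phi] by blast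
  have D: "norm (x - y) \<le> diameter U" if "x \<in> U" for x
    using diameter_bounded_bound[OF U(2) that y] by (simp add: dist_norm)
  note dif = test_functions_differentiable[OF phi]
  show ?thesis
  proof (rule that)
    fix s x assume s: "0 < s" "s \<le> (3::real)" and x: "x \<in> U"
    let ?z = "y + s *\<^sub>R (x - y)"
    have "((\<lambda>s. \<phi> (y + s *\<^sub>R (x - y))) has_real_derivative gradient \<phi> ?z \<bullet> (x - y)) (at s)"
      by (rule has_real_derivative_along_line[OF dif]) (auto intro!: derivative_eq_intros)
    from DERIV_mult[OF DERIV_pow[of ?d s] this]
    have "((\<lambda>s. shrink y s \<phi> x) has_real_derivative
        real ?d * s ^ (?d - 1) * \<phi> ?z + gradient \<phi> ?z \<bullet> (x - y) * s ^ ?d) (at s)"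
      by (simp add: shrink_def numeral_eq_Suc del: power_Suc)
    from DERIV_unique[OF shrink_derivative[OF phi s(1)] this]
    have eq: "(1 / s) * (\<Sum>i\<in>UNIV. partial_deriv i (\<lambda>x. (x $ i - y $ i) * shrink y s \<phi> x) x)
      = real ?d * s ^ (?d - 1) * \<phi> ?z + gradient \<phi> ?z \<bullet> (x - y) * s ^ ?d" .
    have "\<bar>gradient \<phi> ?z \<bullet> (x - y)\<bar> \<le> B' * diameter U"
      using Cauchy_Schwarz_ineq2[of "gradient \<phi> ?z" "x - y"] mult_mono[OF B'(2) D[OF x] B'(1)] by (meson norm_ge_zero order_trans)
    moreover have "s ^ k \<le> 3 ^ k" "s ^ k \<ge> 0" for k using s by (auto intro: power_mono)
    ultimately have "\<bar>gradient \<phi> ?z \<bullet> (x - y) * s ^ ?d\<bar> \<le> B' * diameter U * 3 ^ ?d"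
      unfolding abs_mult by (intro mult_mono) (auto intro: order_trans[OF abs_ge_zero])
    moreover have "\<bar>real ?d * s ^ (?d - 1) * \<phi> ?z\<bar> \<le> real ?d * 3 ^ (?d - 1) * B"
      unfolding abs_mult using s B by (intro mult_mono power_mono) (auto intro: power_mono)
    ultimately show "\<bar>(1 / s) * (\<Sum>i\<in>UNIV. partial_deriv i (\<lambda>x. (x $ i - y $ i) * shrink y s \<phi> x) x)\<bar>
        \<le> real ?d * 3 ^ (?d - 1) * B + B' * diameter U * 3 ^ ?d"
      unfolding eq by linarith
  qed
qed

text \<open>Differentiating (v, \<open>shrink y s \<phi>\<close>) in s produces the divergence of (x
  - y) \<open>shrink y s \<phi>\<close>. The weak gradient turns this into -(1/s) times (G, (x - y)
  \<open>shrink y s \<phi>\<close>), which is bounded because |x - y| is at most the diameter; the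
  mean value inequality on [1, 2] concludes.\<close>

lemma shrink_step:
  assumes v: "v \<in> L2_space U" and G: "G \<in> L2_space U" and w: "has_weak_gradient U v G"
    and y: "y \<in> U" and phi: "\<phi> \<in> test_functions U"
  shows "\<bar>L2_inner U v \<phi> - L2_inner U v (shrink y 2 \<phi>)\<bar> \<le> diameter U * 2 ^ CARD('n) * L2_norm U G * L2_norm U \<phi>"
proof -
  let ?dv = "\<lambda>s x. (1 / s) * (\<Sum>i\<in>UNIV. partial_deriv i (\<lambda>x. (x $ i - y $ i) * shrink y s \<phi> x) x)"
  let ?F = "\<lambda>s. L2_inner U v (shrink y s \<phi>)"
  obtain C where C: "\<And>s x. 0 < s \<Longrightarrow> s \<le> 3 \<Longrightarrow> x \<in> U \<Longrightarrow> \<bar>?dv s x\<bar> \<le> C"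
    using shrink_derivative_bounded[OF phi y] by blast
  have Ulm: "U \<in> lmeasurable" using U by (simp add: lmeasurable_open)
  have F': "(?F has_real_derivative (\<integral>x. indicator U x * v x * ?dv s x \<partial>lebesgue)) (at s)"
    if s: "1 \<le> s" "s \<le> 2" for s
    unfolding L2_inner_def set_lebesgue_integral_def
  proof (rule has_real_derivative_integral[where e="1/2" and w="\<lambda>x. C * \<bar>indicator U x *\<^sub>R v x\<bar>"])
    fix t assume t: "\<bar>t - s\<bar> < 1 / 2"
    have "continuous_on UNIV (shrink y t \<phi>)"
      by (rule smooth_continuous[OF shrink_smooth[OF test_functions_smooth[OF phi]]])
    from L2_inner_integrable[OF v continuous_L2[OF U this]]
    show "integrable lebesgue (\<lambda>x. indicator U x *\<^sub>R (v x \<bullet> shrink y t \<phi> x))"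
      by (simp add: set_integrable_def)
    fix x
    have t0: "t > 0" "t \<le> 3" using t s by arith+
    show "((\<lambda>t. indicator U x *\<^sub>R (v x \<bullet> shrink y t \<phi> x)) has_real_derivative indicator U x * v x * ?dv t x) (at t)"
      using DERIV_cmult[OF shrink_derivative[OF phi t0(1)], of "indicator U x * v x"] by (simp add: mult.assoc)
    show "\<bar>indicator U x * v x * ?dv t x\<bar> \<le> C * \<bar>indicator U x *\<^sub>R v x\<bar>"
    proof (cases "x \<in> U")
      case True
      then show ?thesis using C[OF t0 True] mult_right_mono[of "\<bar>?dv t x\<bar>" C "\<bar>v x\<bar>"]
        by (simp add: abs_mult mult.commute)
    qed simp
  next
    show "integrable lebesgue (\<lambda>x. C * \<bar>indicator U x *\<^sub>R v x\<bar>)"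
      using L2_integrable[OF v Ulm] unfolding set_integrable_def by (intro integrable_mult_right integrable_abs)
  qed simp
  have bound: "\<bar>\<integral>x. indicator U x * v x * ?dv s x \<partial>lebesgue\<bar> \<le> diameter U * 2 ^ CARD('n) * L2_norm U G * L2_norm U \<phi>"
    if s: "1 \<le> s" "s \<le> 2" for s
  proof -
    let ?p = "shrink y s \<phi>" and ?psi = "\<lambda>i x. (x $ i - y $ i) * shrink y s \<phi> x"
    have p: "?p \<in> test_functions U" by (rule shrink_test[OF y s(1) phi])
    have psi: "?psi i \<in> test_functions U" for i
    proof -
      have "(\<lambda>x. (axis i 1 \<bullet> x + (- y $ i)) * ?p x) \<in> test_functions U"
        using C_k_affine by (intro test_functions_mult[OF _ p]) blast
      then show ?thesis by (simp add: inner_axis')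
    qed
    let ?q = "\<lambda>x. ?p x *\<^sub>R (x - y)"
    have q: "?q \<in> L2_space U"
      using test_functions_continuous[OF p] by (intro continuous_L2[OF U] continuous_intros)
    have "(\<integral>x. indicator U x * v x * ?dv s x \<partial>lebesgue) =
        (\<integral>x. (\<Sum>i\<in>UNIV. (1 / s) * (indicator U x *\<^sub>R (v x \<bullet> partial_deriv i (?psi i) x))) \<partial>lebesgue)"
      by (rule Bochner_Integration.integral_cong)
        (simp_all add: sum_distrib_left sum_distrib_right mult_ac del: sum_mult_indicator sum_indicator_mult)
    also have "\<dots> = (\<Sum>i\<in>UNIV. (1 / s) * L2_inner U v (partial_deriv i (?psi i)))"
      unfolding L2_inner_def set_lebesgue_integral_def
      using L2_inner_integrable[OF v partial_deriv_L2[OF U psi]]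
      by (subst Bochner_Integration.integral_sum) (auto simp: set_integrable_def)
    also have "\<dots> = (\<Sum>i\<in>UNIV. (1 / s) * - L2_inner U (\<lambda>x. G x $ i) (?psi i))"
      using w psi by (simp add: has_weak_gradient_iff)
    also have "\<dots> = - (1 / s) * (\<Sum>i\<in>UNIV. L2_inner U (\<lambda>x. G x $ i) (\<lambda>x. ?q x $ i))"
      by (simp add: sum_negf sum_distrib_left mult.commute)
    also have "\<dots> = - (1 / s) * L2_inner U G ?q"
      using L2_inner_eq_sum_components[OF G q] by simp
    finally have "\<bar>\<integral>x. indicator U x * v x * ?dv s x \<partial>lebesgue\<bar> = (1 / s) * \<bar>L2_inner U G ?q\<bar>"
      using s by (simp add: abs_mult)
    also have "\<dots> \<le> 1 * \<bar>L2_inner U G ?q\<bar>"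
      using s by (intro mult_right_mono) auto
    also have "\<dots> \<le> L2_norm U G * L2_norm U ?q"
      using L2_Cauchy_Schwarz[OF G q] by simp
    finally have le: "\<bar>\<integral>x. indicator U x * v x * ?dv s x \<partial>lebesgue\<bar> \<le> L2_norm U G * L2_norm U ?q" .
    have "L2_norm U ?q \<le> diameter U * L2_norm U ?p"
    proof -
      note pL = test_functions_L2[OF p U]
      have "L2_inner U ?q ?q \<le> L2_inner U (\<lambda>x. diameter U *\<^sub>R ?p x) (\<lambda>x. diameter U *\<^sub>R ?p x)"
        unfolding L2_inner_def
      proof (rule set_integral_mono)
        fix x assume x: "x \<in> U"
        have "norm (x - y) \<le> diameter U"
          using diameter_bounded_bound[OF U(2) x y] by (simp add: dist_norm)
        then have "(norm (x - y))\<^sup>2 \<le> (diameter U)\<^sup>2" by (intro power_mono) auto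
        from mult_left_mono[OF this, of "(?p x)\<^sup>2"]
        have "(?p x)\<^sup>2 * (norm (x - y))\<^sup>2 \<le> (?p x)\<^sup>2 * (diameter U)\<^sup>2" by simp
        moreover have "?q x \<bullet> ?q x = (?p x)\<^sup>2 * (norm (x - y))\<^sup>2"
          unfolding power2_norm_eq_inner by (simp only: inner_scaleR_left inner_scaleR_right power2_eq_square mult.assoc)
        moreover have "(diameter U *\<^sub>R ?p x) \<bullet> (diameter U *\<^sub>R ?p x) = (?p x)\<^sup>2 * (diameter U)\<^sup>2"
          by (simp add: power2_eq_square mult_ac)
        ultimately show "?q x \<bullet> ?q x \<le> (diameter U *\<^sub>R ?p x) \<bullet> (diameter U *\<^sub>R ?p x)"
          by (simp only:)
      qed (use L2_inner_integrable L2_space_scaled pL q in blast)+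
      then have "(L2_norm U ?q)\<^sup>2 \<le> (diameter U * L2_norm U ?p)\<^sup>2"
        using L2_norm_scaled[of U "diameter U" ?p] diameter_ge_0[OF U(2)] by (simp flip: L2_norm_square)
      then show ?thesis by (rule power2_le_imp_le) (simp add: diameter_ge_0[OF U(2)])
    qed
    also have "\<dots> \<le> diameter U * (2 ^ CARD('n) * L2_norm U \<phi>)"
      by (rule mult_left_mono[OF shrink_norm_le[OF y s phi] diameter_ge_0[OF U(2)]])
    finally have "L2_norm U G * L2_norm U ?q \<le> L2_norm U G * (diameter U * (2 ^ CARD('n) * L2_norm U \<phi>))"
      by (rule mult_left_mono) simp
    also have "\<dots> = diameter U * 2 ^ CARD('n) * L2_norm U G * L2_norm U \<phi>" by simp
    finally show ?thesis using le by linarith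
  qed
  have "norm (?F 2 - ?F 1) \<le> (diameter U * 2 ^ CARD('n) * L2_norm U G * L2_norm U \<phi>) * norm (2 - 1 :: real)"
    by (rule field_differentiable_bound[where S="{1..2}"])
      (use F' bound in \<open>auto intro: has_field_derivative_at_within\<close>)
  moreover have "shrink y 1 \<phi> = \<phi>" by (simp add: shrink_def[abs_def])
  ultimately show ?thesis by (simp add: abs_minus_commute)
qed

text \<open>Both sides are double integrals of v(x) 2^n \<phi>(2 x - y) \<eta>(y), up to an exchange
  of \<phi> and \<eta>. For fixed x the measure preserving involution y \<mapsto> 2 x - y performs
  this exchange.\<close>

lemma shrink_2_symmetric:
  assumes v: "v \<in> L2_space U" and phi: "\<phi> \<in> test_functions U" and eta: "\<eta> \<in> test_functions U"
  shows "integrable lborel (\<lambda>y. \<eta> y * L2_inner U v (shrink y 2 \<phi>))"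
    and "(\<integral>y. \<eta> y * L2_inner U v (shrink y 2 \<phi>) \<partial>lborel) = (\<integral>y. \<phi> y * L2_inner U v (shrink y 2 \<eta>) \<partial>lborel)"
proof -
  let ?c = "2 ^ CARD('n) :: real"
  have "(\<lambda>x. indicator U x *\<^sub>R v x) \<in> borel_measurable (completion lborel)"
    using v by (simp add: L2_space_iff)
  \<comment> \<open>Fubini's theorem is applied with the Borel \<sigma>-algebra of the product,
    hence the Borel representative g of v, cut off outside U.\<close>
  then obtain g where g[measurable]: "g \<in> borel_measurable lborel" and gv: "AE x in lborel. indicator U x *\<^sub>R v x = g x"
    using completion_ex_borel_measurable_real by blast
  have Ulm: "U \<in> lmeasurable" using U by (simp add: lmeasurable_open)
  have "integrable lebesgue (\<lambda>x. indicator U x *\<^sub>R v x)"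
    using L2_integrable[OF v Ulm] by (simp add: set_integrable_def)
  then have "integrable lebesgue g"
    using AE_completion[OF gv] g by (subst integrable_cong_AE[where g="\<lambda>x. indicator U x *\<^sub>R v x"])
      (auto elim: eventually_mono dest: borel_measurable_integrable intro: measurable_completion)
  then have gi: "integrable lborel g" using g by (simp add: integrable_completion)
  have H: "L2_inner U v (shrink y 2 f) = (\<integral>x. g x * (?c * f (2 *\<^sub>R x - y)) \<partial>lborel)"
    if f: "f \<in> test_functions U" for f y
  proof -
    have fm[measurable]: "f \<in> borel_measurable borel"
      by (rule borel_measurable_continuous_onI[OF test_functions_continuous[OF f]])
    have s2: "shrink y 2 f = (\<lambda>x. ?c * f (2 *\<^sub>R x - y))"
      by (simp add: shrink_def[abs_def] algebra_simps scaleR_2)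
    have "(\<lambda>x. indicator U x *\<^sub>R (v x \<bullet> (?c * f (2 *\<^sub>R x - y)))) \<in> borel_measurable lebesgue"
      using L2_inner_integrable[OF v continuous_L2[OF U smooth_continuous[OF shrink_smooth[OF test_functions_smooth[OF f]]]], of y 2]
      unfolding s2 set_integrable_def by (rule borel_measurable_integrable)
    moreover have bm: "(\<lambda>x. g x * (?c * f (2 *\<^sub>R x - y))) \<in> borel_measurable lborel" by measurable
    ultimately have "L2_inner U v (shrink y 2 f) = (\<integral>x. g x * (?c * f (2 *\<^sub>R x - y)) \<partial>lebesgue)"
      unfolding s2 L2_inner_def set_lebesgue_integral_def
      using AE_completion[OF gv] by (intro integral_cong_AE)
        (auto elim!: eventually_mono intro: measurable_completion simp: mult.assoc[symmetric])
    also have "\<dots> = (\<integral>x. g x * (?c * f (2 *\<^sub>R x - y)) \<partial>lborel)"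
      by (rule integral_completion[OF bm])
    finally show ?thesis .
  qed
  have key: "integrable (lborel \<Otimes>\<^sub>M lborel) (\<lambda>(x, y). g x * (?c * f (2 *\<^sub>R x - y)) * h y)"
    if f: "f \<in> test_functions U" and h: "h \<in> test_functions U" for f h
  proof -
    have [measurable]: "f \<in> borel_measurable borel" "h \<in> borel_measurable borel"
      using f h by (auto intro: borel_measurable_continuous_onI test_functions_continuous)
    obtain B where B: "B \<ge> 0" "\<And>x. \<bar>f x\<bar> \<le> B" using test_functions_bounded[OF f] by blast
    note hi = test_functions_integrable[OF h]
    have "integrable (lborel \<Otimes>\<^sub>M lborel) (\<lambda>(x, y). g x * h y)"
    proof (rule lborel_pair.Fubini_integrable)
      show "integrable lborel (\<lambda>x. \<integral>y. norm (case (x, y) of (x, y) \<Rightarrow> g x * h y) \<partial>lborel)"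
        using gi by (simp add: abs_mult)
      show "AE x in lborel. integrable lborel (\<lambda>y. case (x, y) of (x, y) \<Rightarrow> g x * h y)"
        using hi by simp
    qed measurable
    then have "integrable (lborel \<Otimes>\<^sub>M lborel) (\<lambda>p. (?c * B) * (case p of (x, y) \<Rightarrow> g x * h y))"
      by (rule integrable_mult_right)
    then show ?thesis
    proof (rule Bochner_Integration.integrable_bound)
      have "norm (g x * (?c * f (2 *\<^sub>R x - y)) * h y) \<le> norm ((?c * B) * (g x * h y))" for x y
      proof -
        have "\<bar>g x\<bar> * \<bar>h y\<bar> * ?c * \<bar>f (2 *\<^sub>R x - y)\<bar> \<le> \<bar>g x\<bar> * \<bar>h y\<bar> * ?c * B"
          using B by (intro mult_left_mono) auto
        then show ?thesis using B by (simp add: abs_mult mult_ac)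
      qed
      then show "AE p in lborel \<Otimes>\<^sub>M lborel. norm (case p of (x, y) \<Rightarrow> g x * (?c * f (2 *\<^sub>R x - y)) * h y)
          \<le> norm ((?c * B) * (case p of (x, y) \<Rightarrow> g x * h y))"
        by (intro AE_I2) (simp add: case_prod_beta)
    qed measurable
  qed
  have E: "\<eta> y * L2_inner U v (shrink y 2 \<phi>) = (\<integral>x. g x * (?c * \<phi> (2 *\<^sub>R x - y)) * \<eta> y \<partial>lborel)" for y
    unfolding H[OF phi] by (simp add: mult.commute)
  show "integrable lborel (\<lambda>y. \<eta> y * L2_inner U v (shrink y 2 \<phi>))"
    unfolding E using lborel_pair.integrable_snd[OF key[OF phi eta]] by simp
  have E': "\<phi> y * L2_inner U v (shrink y 2 \<eta>) = (\<integral>x. g x * (?c * \<eta> (2 *\<^sub>R x - y)) * \<phi> y \<partial>lborel)" for y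
    unfolding H[OF eta] by (simp add: mult.commute)
  have cm: "(\<lambda>y. \<phi> (2 *\<^sub>R x - y) * \<eta> y) \<in> borel_measurable borel" for x
    using phi eta by (intro borel_measurable_continuous_onI continuous_intros
        continuous_on_compose2[OF test_functions_continuous[OF phi]] test_functions_continuous[OF eta]) auto
  have "(\<integral>y. \<eta> y * L2_inner U v (shrink y 2 \<phi>) \<partial>lborel) = (\<integral>x. \<integral>y. g x * (?c * \<phi> (2 *\<^sub>R x - y)) * \<eta> y \<partial>lborel \<partial>lborel)"
    unfolding E by (rule lborel_pair.Fubini_integral[OF key[OF phi eta]])
  also have "\<dots> = (\<integral>x. \<integral>y. g x * (?c * \<eta> (2 *\<^sub>R x - y)) * \<phi> y \<partial>lborel \<partial>lborel)"
  proof (rule Bochner_Integration.integral_cong[OF refl])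
    fix x
    have "(\<integral>y. \<phi> (2 *\<^sub>R x - y) * \<eta> y \<partial>lborel) = (\<integral>y. \<phi> y * \<eta> (2 *\<^sub>R x - y) \<partial>lborel)"
      using integral_homothety[of "-1" "\<lambda>y. \<phi> (2 *\<^sub>R x - y) * \<eta> y" "2 *\<^sub>R x"] cm[of x] by simp
    then have "g x * ?c * (\<integral>y. \<phi> (2 *\<^sub>R x - y) * \<eta> y \<partial>lborel) = g x * ?c * (\<integral>y. \<eta> (2 *\<^sub>R x - y) * \<phi> y \<partial>lborel)"
      by (simp add: mult.commute)
    then show "(\<integral>y. g x * (?c * \<phi> (2 *\<^sub>R x - y)) * \<eta> y \<partial>lborel) = (\<integral>y. g x * (?c * \<eta> (2 *\<^sub>R x - y)) * \<phi> y \<partial>lborel)"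
      by (simp add: mult.assoc)
  qed
  also have "\<dots> = (\<integral>y. \<phi> y * L2_inner U v (shrink y 2 \<eta>) \<partial>lborel)"
    unfolding E' by (rule lborel_pair.Fubini_integral[OF key[OF eta phi], symmetric])
  finally show "(\<integral>y. \<eta> y * L2_inner U v (shrink y 2 \<phi>) \<partial>lborel) = (\<integral>y. \<phi> y * L2_inner U v (shrink y 2 \<eta>) \<partial>lborel)" .
qed

lemma normalised_bump:
  assumes "U \<noteq> {}"
  obtains \<eta> where "\<eta> \<in> test_functions U" "\<And>x. 0 \<le> \<eta> x" "(\<integral>x. \<eta> x \<partial>lborel) = 1"
proof -
  obtain p where "p \<in> U" using assms by blast
  then obtain a b where ab: "p \<in> box a b" "cbox a b \<subseteq> U" using open_contains_cbox[OF U(1)] by metis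
  let ?b = "box_bump 0 a b"
  have t: "?b \<in> test_functions U" by (rule box_bump_test[OF ab(2)])
  have nn: "0 \<le> ?b x" for x by (rule box_bump_bounds)
  have "(\<integral>x. ?b x \<partial>lborel) \<noteq> 0"
  proof
    assume "(\<integral>x. ?b x \<partial>lborel) = 0"
    then have "AE x in lborel. ?b x = 0"
      using integral_nonneg_eq_0_iff_AE[OF test_functions_integrable[OF t]] nn by simp
    then have "AE x in lborel. x \<notin> box a b" by eventually_elim (use box_bump_pos_iff in blast)
    then have "emeasure lborel (box a b) = 0"
      by (subst (asm) AE_iff_measurable[of "box a b"]) auto
    then have "negligible (box a b)"
      by (simp add: negligible_iff_null_sets null_sets_completionI null_setsI)
    then show False using ab(1) open_not_negligible[of "box a b"] by auto
  qed
  then have pos: "(\<integral>x. ?b x \<partial>lborel) > 0"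
    using integral_nonneg_AE[of ?b lborel] nn by (simp add: less_le)
  show ?thesis
  proof (rule that)
    show "(\<lambda>x. 0 + (1 / (\<integral>x. ?b x \<partial>lborel)) * ?b x) \<in> test_functions U"
      by (rule test_functions_add_scaled[OF test_functions_zero t])
  qed (use pos nn in simp_all)
qed

text \<open>By duality it suffices to compare (v, \<phi>) with (v, \<eta>) times the integral of
  \<phi>, for a fixed bump \<eta> of integral 1. Contract \<phi> by the factor 2 towards y and
  average over y with weight \<eta>; by symmetry this average is the one of \<eta> contracted
  towards y, with weight \<phi>. Each of the two contractions costs a multiple of the norm of the
  gradient.\<close>

theorem Poincare_convex:
  assumes ne: "U \<noteq> {}"
  obtains K where "K \<ge> 0" "\<And>v. v \<in> H1_space U \<Longrightarrow> (LINT x:U|lebesgue. v x) = 0 \<Longrightarrow> L2_norm U v \<le> K * L2_norm U (wgrad U v)"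
proof -
  obtain \<eta> where eta: "\<eta> \<in> test_functions U" "\<And>x. 0 \<le> \<eta> x" "(\<integral>x. \<eta> x \<partial>lborel) = 1"
    using normalised_bump[OF ne] by blast
  let ?one = "\<lambda>x::real ^ 'n. 1::real"
  let ?k = "diameter U * 2 ^ CARD('n)"
  \<comment> \<open>The summand 1 pays for contracting \<phi>. The product pays for contracting
    \<eta>, where the weight contributes the integral of |\<phi>|, at most
    \<open>L2_norm U \<phi> * L2_norm U ?one\<close>.\<close>
  let ?K = "?k * (1 + L2_norm U \<eta> * L2_norm U ?one)"
  note oneL = one_L2[OF U] and etaL = test_functions_L2[OF eta(1) U]
  have k0: "?k \<ge> 0" using diameter_ge_0[OF U(2)] by simp
  have K0: "?K \<ge> 0" using diameter_ge_0[OF U(2)] by (intro mult_nonneg_nonneg add_nonneg_nonneg) auto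
  have "L2_norm U v \<le> ?K * L2_norm U (wgrad U v)"
    if v: "v \<in> H1_space U" and mean: "(LINT x:U|lebesgue. v x) = 0" for v
  proof -
    note D = H1_D[OF U v]
    let ?G = "wgrad U v" and ?c = "L2_inner U v \<eta>"
    note step = shrink_step[OF D(1,2,3)]
    let ?w = "\<lambda>x. v x - ?c *\<^sub>R ?one x"
    have wL: "?w \<in> L2_space U" by (intro L2_space_diff L2_space_scaled D oneL)
    have "L2_norm U ?w \<le> ?K * L2_norm U ?G"
    proof (rule L2_norm_le_dual[OF U wL])
      fix \<phi> assume phi: "\<phi> \<in> test_functions U"
      note phiL = test_functions_L2[OF phi U] and phiI = test_functions_integrable[OF phi] and etaI = test_functions_integrable[OF eta(1)]
      let ?J = "\<integral>y. \<eta> y * L2_inner U v (shrink y 2 \<phi>) \<partial>lborel"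
      let ?a = "?k * L2_norm U ?G"
      have "L2_inner U v \<phi> - ?J = (\<integral>y. \<eta> y * L2_inner U v \<phi> - \<eta> y * L2_inner U v (shrink y 2 \<phi>) \<partial>lborel)"
        using eta(3) etaI shrink_2_symmetric(1)[OF D(1) phi eta(1)] by (subst Bochner_Integration.integral_diff) auto
      also have "\<bar>\<dots>\<bar> \<le> (\<integral>y. \<eta> y * (?a * L2_norm U \<phi>) \<partial>lborel)"
      proof (rule order_trans[OF integral_abs_bound integral_mono'])
        show "integrable lborel (\<lambda>y. \<eta> y * (?a * L2_norm U \<phi>))" using etaI by simp
        fix y
        show "\<bar>\<eta> y * L2_inner U v \<phi> - \<eta> y * L2_inner U v (shrink y 2 \<phi>)\<bar> \<le> \<eta> y * (?a * L2_norm U \<phi>)"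
        \<comment> \<open>The estimate for one contraction requires its centre to lie in U;
          elsewhere the weight vanishes.\<close>
        proof (cases "y \<in> U")
          case True
          have "\<bar>\<eta> y * L2_inner U v \<phi> - \<eta> y * L2_inner U v (shrink y 2 \<phi>)\<bar> = \<eta> y * \<bar>L2_inner U v \<phi> - L2_inner U v (shrink y 2 \<phi>)\<bar>"
            using eta(2)[of y] by (simp add: abs_mult flip: right_diff_distrib)
          then show ?thesis using step[OF True phi] eta(2)[of y] by (simp add: mult_left_mono)
        qed (simp add: test_functions_outside[OF eta(1)])
      qed (simp add: eta(2) diameter_ge_0[OF U(2)])
      also have "\<dots> = ?a * L2_norm U \<phi>" using eta(3) by simp
      finally have 1: "\<bar>L2_inner U v \<phi> - ?J\<bar> \<le> ?a * L2_norm U \<phi>" .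
      have "?J - ?c * (\<integral>y. \<phi> y \<partial>lborel) = (\<integral>y. \<phi> y * L2_inner U v (shrink y 2 \<eta>) - \<phi> y * ?c \<partial>lborel)"
        unfolding shrink_2_symmetric(2)[OF D(1) phi eta(1)]
        using phiI shrink_2_symmetric(1)[OF D(1) eta(1) phi] by (subst Bochner_Integration.integral_diff) auto
      also have "\<bar>\<dots>\<bar> \<le> (\<integral>y. \<bar>\<phi> y\<bar> * (?a * L2_norm U \<eta>) \<partial>lborel)"
      proof (rule order_trans[OF integral_abs_bound integral_mono'])
        show "integrable lborel (\<lambda>y. \<bar>\<phi> y\<bar> * (?a * L2_norm U \<eta>))" using phiI by simp
        fix y
        show "\<bar>\<phi> y * L2_inner U v (shrink y 2 \<eta>) - \<phi> y * ?c\<bar> \<le> \<bar>\<phi> y\<bar> * (?a * L2_norm U \<eta>)"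
        proof (cases "y \<in> U")
          case True
          have "\<bar>\<phi> y * L2_inner U v (shrink y 2 \<eta>) - \<phi> y * ?c\<bar> = \<bar>\<phi> y\<bar> * \<bar>?c - L2_inner U v (shrink y 2 \<eta>)\<bar>"
            by (simp add: abs_mult abs_minus_commute flip: right_diff_distrib)
          then show ?thesis using step[OF True eta(1)] by (simp add: mult_left_mono)
        qed (simp add: test_functions_outside[OF phi])
      qed (simp add: eta(2) diameter_ge_0[OF U(2)])
      also have "\<dots> = (\<integral>y. \<bar>\<phi> y\<bar> \<partial>lborel) * (?a * L2_norm U \<eta>)" by simp
      also have "(\<integral>y. \<bar>\<phi> y\<bar> \<partial>lborel) \<le> L2_norm U \<phi> * L2_norm U ?one"
      proof -
        have "(\<integral>y. \<bar>\<phi> y\<bar> \<partial>lborel) = L2_inner U (\<lambda>x. \<bar>\<phi> x\<bar>) ?one"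
          unfolding L2_inner_def inner_real_def mult_1_right
          by (rule set_integral_eq_lborel[symmetric])
            (use test_functions_continuous[OF phi] test_functions_outside[OF phi] in \<open>auto intro: continuous_on_rabs\<close>)
        also have "\<dots> \<le> L2_norm U (\<lambda>x. \<bar>\<phi> x\<bar>) * L2_norm U ?one"
          by (rule L2_inner_le[OF L2_space_abs[OF phiL] oneL])
        also have "L2_norm U (\<lambda>x. \<bar>\<phi> x\<bar>) = L2_norm U \<phi>" by (simp add: L2_norm_def L2_inner_def)
        finally show ?thesis .
      qed
      finally have 2: "\<bar>?J - ?c * (\<integral>y. \<phi> y \<partial>lborel)\<bar> \<le> L2_norm U \<phi> * L2_norm U ?one * (?a * L2_norm U \<eta>)"
        using k0 by (simp add: mult_right_mono)
      have "(\<integral>y. \<phi> y \<partial>lborel) = L2_inner U ?one \<phi>"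
        unfolding L2_inner_def inner_real_def mult_1_left
        by (rule set_integral_eq_lborel[symmetric])
          (use test_functions_continuous[OF phi] test_functions_outside[OF phi] in auto)
      then have "L2_inner U ?w \<phi> = L2_inner U v \<phi> - ?c * (\<integral>y. \<phi> y \<partial>lborel)"
        using L2_inner_diff[OF D(1) L2_space_scaled[OF oneL] phiL, of ?c] L2_inner_scaled[of U ?c ?one \<phi>] by simp
      also have "\<dots> \<le> ?a * L2_norm U \<phi> + L2_norm U \<phi> * L2_norm U ?one * (?a * L2_norm U \<eta>)"
        using 1 2 by linarith
      also have "\<dots> = ?K * L2_norm U ?G * L2_norm U \<phi>" by (simp add: algebra_simps)
      finally show "L2_inner U ?w \<phi> \<le> ?K * L2_norm U ?G * L2_norm U \<phi>" .
    qed (use K0 in simp)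
    \<comment> \<open>As v is orthogonal to the constants, subtracting a constant cannot decrease
      its norm.\<close>
    moreover have "L2_norm U v \<le> L2_norm U ?w"
    proof -
      have ov: "L2_inner U v ?one = 0" using mean by (simp add: L2_inner_def)
      have "L2_inner U ?w ?w = L2_inner U v v - 2 * ?c * L2_inner U v ?one + ?c\<^sup>2 * L2_inner U ?one ?one"
        using L2_inner_diff[OF D(1) L2_space_scaled[OF oneL] wL, of ?c]
          L2_inner_diff_right[OF D(1) L2_space_scaled[OF oneL] D(1), of ?c]
          L2_inner_diff_right[OF D(1) L2_space_scaled[OF oneL] L2_space_scaled[OF oneL], of ?c ?c]
          L2_inner_scaled[of U ?c ?one v] L2_inner_scaled[of U ?c ?one ?one]
          L2_inner_commute[of U v "\<lambda>x. ?c *\<^sub>R ?one x"] L2_inner_commute[of U v ?one]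
          L2_inner_scaled[of U ?c ?one "\<lambda>x. ?c *\<^sub>R ?one x"] L2_inner_commute[of U ?one "\<lambda>x. ?c *\<^sub>R ?one x"]
        by (simp add: power2_eq_square algebra_simps)
      then have "L2_inner U v v \<le> L2_inner U ?w ?w" unfolding ov by simp
      then show ?thesis by (simp add: L2_norm_def)
    qed
    ultimately show ?thesis by linarith
  qed
  then show ?thesis using that[OF K0] by blast
qed

end

section \<open>Affine substitutions\<close>

text \<open>The pushforward of Lebesgue measure under a linear bijection is translation invariant; comparing
  it with Lebesgue measure by Fubini's theorem shows that both are proportional.\<close>

lemma nn_integral_linear_substitution:
  fixes A :: "'a::euclidean_space \<Rightarrow> 'a"
  assumes A: "linear A" "bij A"
  obtains c where "c > 0"
    "\<And>g. g \<in> borel_measurable borel \<Longrightarrow> (\<integral>\<^sup>+x. g (A x) \<partial>lborel) = ennreal c * (\<integral>\<^sup>+x. g x \<partial>lborel)"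
proof -
  define B where "B = inv A"
  have AB: "A (B x) = x" "B (A x) = x" for x
    using A(2) by (simp_all add: B_def bij_def surj_f_inv_f inv_f_f)
  have Am[measurable]: "A \<in> borel_measurable borel"
    using A(1) by (intro borel_measurable_continuous_onI linear_continuous_on) (simp add: linear_conv_bounded_linear)
  have Blin: "linear B"
  proof (rule linearI)
    show "B (x + y) = B x + B y" for x y
      using AB(2)[of "B x + B y"] linear_add[OF A(1)] AB(1) by simp
    show "B (r *\<^sub>R x) = r *\<^sub>R B x" for r x
      using AB(2)[of "r *\<^sub>R B x"] linear_scale[OF A(1)] AB(1) by simp
  qed
  have trans: "(\<integral>\<^sup>+x. g (x + c) \<partial>lborel) = (\<integral>\<^sup>+x. g x \<partial>lborel)"
    if "g \<in> borel_measurable borel" for g :: "'a \<Rightarrow> ennreal" and c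
  proof -
    have "(\<integral>\<^sup>+x. g x \<partial>lborel) = (\<integral>\<^sup>+x. g x \<partial>distr lborel borel ((+) c))" by (simp add: lborel_distr_plus)
    also have "\<dots> = (\<integral>\<^sup>+x. g (c + x) \<partial>lborel)" using that by (intro nn_integral_distr) auto
    finally show ?thesis by (simp add: add.commute)
  qed
  have reflect: "(\<integral>\<^sup>+x. g (c - x) \<partial>lborel) = (\<integral>\<^sup>+x. g x \<partial>lborel)"
    if "g \<in> borel_measurable borel" for g :: "'a \<Rightarrow> ennreal" and c
  proof -
    have "(\<integral>\<^sup>+x. g x \<partial>lborel) = (\<integral>\<^sup>+x. g x \<partial>density (distr lborel borel (\<lambda>x. c + (-1) *\<^sub>R x)) (\<lambda>_. 1))"
      using lborel_affine[of "-1" c] by simp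
    also have "\<dots> = (\<integral>\<^sup>+x. g (c - x) \<partial>lborel)"
      using that by (subst nn_integral_density) (auto simp: nn_integral_distr)
    finally show ?thesis by simp
  qed
  \<comment> \<open>In the double integral of f(y + A x) g(A x), the shift of x by B y turns the
    integrand into f(A x) g(A x - y). Integrating over y first gives the left side before the shift
    and the right side after it.\<close>
  have swap: "(\<integral>\<^sup>+x. f x \<partial>lborel) * (\<integral>\<^sup>+x. g (A x) \<partial>lborel) = (\<integral>\<^sup>+x. f (A x) \<partial>lborel) * (\<integral>\<^sup>+x. g x \<partial>lborel)"
    if [measurable]: "f \<in> borel_measurable borel" "g \<in> borel_measurable borel" for f g :: "'a \<Rightarrow> ennreal"
  proof -
    have "(\<integral>\<^sup>+x. f x \<partial>lborel) * (\<integral>\<^sup>+x. g (A x) \<partial>lborel) = (\<integral>\<^sup>+x. (\<integral>\<^sup>+y. f (y + A x) \<partial>lborel) * g (A x) \<partial>lborel)"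
      by (simp add: trans nn_integral_cmult)
    also have "\<dots> = (\<integral>\<^sup>+x. (\<integral>\<^sup>+y. f (y + A x) * g (A x) \<partial>lborel) \<partial>lborel)"
      by (simp add: nn_integral_multc)
    also have "\<dots> = (\<integral>\<^sup>+y. (\<integral>\<^sup>+x. f (y + A x) * g (A x) \<partial>lborel) \<partial>lborel)"
      by (rule lborel_pair.Fubini'[symmetric]) measurable
    also have "\<dots> = (\<integral>\<^sup>+y. (\<integral>\<^sup>+x. f (A x) * g (A x - y) \<partial>lborel) \<partial>lborel)"
    proof (rule nn_integral_cong)
      fix y
      have "(\<integral>\<^sup>+x. f (A x) * g (A x - y) \<partial>lborel) = (\<integral>\<^sup>+x. f (A (x + B y)) * g (A (x + B y) - y) \<partial>lborel)"
        by (rule trans[symmetric]) measurable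
      then show "(\<integral>\<^sup>+x. f (y + A x) * g (A x) \<partial>lborel) = (\<integral>\<^sup>+x. f (A x) * g (A x - y) \<partial>lborel)"
        using A(1) AB(1) by (simp add: linear_add add.commute)
    qed
    also have "\<dots> = (\<integral>\<^sup>+x. (\<integral>\<^sup>+y. f (A x) * g (A x - y) \<partial>lborel) \<partial>lborel)"
      by (rule lborel_pair.Fubini') measurable
    also have "\<dots> = (\<integral>\<^sup>+x. f (A x) * (\<integral>\<^sup>+y. g y \<partial>lborel) \<partial>lborel)"
      by (simp add: nn_integral_cmult reflect)
    also have "\<dots> = (\<integral>\<^sup>+x. f (A x) \<partial>lborel) * (\<integral>\<^sup>+x. g x \<partial>lborel)"
      by (simp add: nn_integral_multc)
    finally show ?thesis .
  qed
  \<comment> \<open>The unit box has volume 1 and normalises the factor, which becomes the volume of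
    the preimage of the box.\<close>
  let ?f = "indicator (box 0 One) :: 'a \<Rightarrow> ennreal"
  let ?c = "\<integral>\<^sup>+x. ?f (A x) \<partial>lborel"
  have f1: "(\<integral>\<^sup>+x. ?f x \<partial>lborel) = 1"
    by (simp add: emeasure_lborel_box)
  have eq: "(\<integral>\<^sup>+x. g (A x) \<partial>lborel) = ?c * (\<integral>\<^sup>+x. g x \<partial>lborel)" if "g \<in> borel_measurable borel" for g
    using swap[of ?f g] that f1 by simp
  have "bounded (B ` box 0 One)"
    using Blin by (intro bounded_linear_image) (auto simp: linear_conv_bounded_linear)
  moreover have "A -` box 0 One = B ` box 0 One"
    using AB by (auto simp: image_iff) metis
  ultimately have "bounded (A -` box 0 One)" by simp
  then have "emeasure lborel (A -` box 0 One) < \<infinity>" by (rule emeasure_bounded_finite)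
  moreover have ind: "?f (A x) = indicator (A -` box 0 One) x" for x by (simp add: indicator_def)
  have vm: "A -` box 0 One \<in> sets lborel"
    using measurable_sets[OF Am, of "box 0 One"] by simp
  ultimately have fin: "?c < \<infinity>" unfolding ind using vm by simp
  \<comment> \<open>For the constant function 1 a factor 0 would equate the infinite volume of the
    space with 0.\<close>
  have "?c \<noteq> 0"
  proof
    assume "?c = 0"
    with eq[of "\<lambda>_. 1"] show False by simp
  qed
  then obtain c where "?c = ennreal c" "c > 0"
    using fin by (cases ?c) (auto simp: zero_less_iff_neq_zero top_unique)
  then show ?thesis using eq that by metis
qed

text \<open>The factor is left abstract. Each application finds it by inserting an indicator, as a
  ratio of volumes.\<close>

lemma integral_affine_substitution:
  fixes L :: "'a::euclidean_space \<Rightarrow> 'a"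
  assumes L: "linear L" "bij L" and h: "\<And>x. h x = p + L x"
  obtains c where "c > 0"
    "\<And>f::'a \<Rightarrow> real. f \<in> borel_measurable borel \<Longrightarrow> (\<integral>x. f (h x) \<partial>lborel) = c * (\<integral>x. f x \<partial>lborel)"
proof -
  obtain c where c: "c > 0" "\<And>g. g \<in> borel_measurable borel \<Longrightarrow> (\<integral>\<^sup>+x. g (L x) \<partial>lborel) = ennreal c * (\<integral>\<^sup>+x. g x \<partial>lborel)"
    using nn_integral_linear_substitution[OF L] by blast
  have Lm[measurable]: "L \<in> borel_measurable borel"
    using L(1) by (intro borel_measurable_continuous_onI linear_continuous_on) (simp add: linear_conv_bounded_linear)
  have D: "distr lborel borel L = density lborel (\<lambda>_. ennreal c)"
  proof (rule measure_eqI)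
    fix X assume "X \<in> sets (distr lborel borel L)"
    then have X[measurable]: "X \<in> sets borel" by simp
    have "emeasure (distr lborel borel L) X = (\<integral>\<^sup>+x. indicator X (L x) \<partial>lborel)"
      using X by (subst nn_integral_distr[symmetric, of L lborel borel "indicator X"]) auto
    also have "\<dots> = emeasure (density lborel (\<lambda>_. ennreal c)) X"
      using X by (simp add: c(2) emeasure_density nn_integral_cmult)
    finally show "emeasure (distr lborel borel L) X = emeasure (density lborel (\<lambda>_. ennreal c)) X" .
  qed simp
  show ?thesis
  proof (rule that[OF c(1)])
    fix f :: "'a \<Rightarrow> real" assume f[measurable]: "f \<in> borel_measurable borel"
    have "(\<integral>x. f (h x) \<partial>lborel) = (\<integral>x. f (x + p) \<partial>distr lborel borel L)"
      by (subst integral_distr) (auto simp: h add.commute)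
    also have "\<dots> = c * (\<integral>x. f (x + p) \<partial>lborel)"
      unfolding D using c(1) by (subst integral_density) auto
    also have "(\<integral>x. f (x + p) \<partial>lborel) = (\<integral>x. f x \<partial>lborel)"
      by (rule integral_translate_lborel[OF f])
    finally show "(\<integral>x. f (h x) \<partial>lborel) = c * (\<integral>x. f x \<partial>lborel)" .
  qed
qed

section \<open>Integration by parts on a simplex\<close>

lemma C1_D:
  assumes "C_k (Suc 0) \<phi>"
  shows "\<phi> differentiable (at x)" "continuous_on UNIV (gradient \<phi>)" "continuous_on UNIV \<phi>"
  using assms C_k_SucD[OF assms] by (auto simp: gradient_def[abs_def] intro!: continuous_on_vec_lambda)

lemma C1_I:
  assumes "\<And>x. (\<phi> has_derivative (\<lambda>h. g x \<bullet> h)) (at x)" and "continuous_on UNIV g"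
  shows "C_k (Suc 0) \<phi>" and "gradient \<phi> = g"
proof -
  have p: "partial_deriv i \<phi> = (\<lambda>x. g x $ i)" for i
    using partial_deriv_eqI[OF assms(1)] by (auto simp: inner_axis)
  then show "C_k (Suc 0) \<phi>"
    using assms by (auto simp: differentiable_def intro!: continuous_intros)
  show "gradient \<phi> = g" by (rule ext) (simp add: vec_eq_iff p)
qed

lemma C1_bounded:
  fixes \<phi> :: "real ^ 'n::finite \<Rightarrow> real"
  assumes "C_k (Suc 0) \<phi>"
  obtains B B' where "B \<ge> 0" "B' \<ge> 0" "\<And>x. x \<in> cball a r \<Longrightarrow> \<bar>\<phi> x\<bar> \<le> B" "\<And>x. x \<in> cball a r \<Longrightarrow> norm (gradient \<phi> x) \<le> B'"
    "\<And>x y. x \<in> cball a r \<Longrightarrow> y \<in> cball a r \<Longrightarrow> \<bar>\<phi> x - \<phi> y\<bar> \<le> B' * norm (x - y)"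
proof -
  note C = C1_D[OF assms]
  have "bounded (\<phi> ` cball a r)" "bounded (gradient \<phi> ` cball a r)"
    using C(2,3) by (auto intro!: compact_imp_bounded compact_continuous_image intro: continuous_on_subset)
  then obtain B B' where B: "\<forall>y\<in>\<phi> ` cball a r. norm y \<le> B" "\<forall>y\<in>gradient \<phi> ` cball a r. norm y \<le> B'"
    unfolding bounded_iff by (elim exE) 
  have L: "\<bar>\<phi> x - \<phi> y\<bar> \<le> max B' 0 * norm (x - y)" if "x \<in> cball a r" "y \<in> cball a r" for x y
  proof -
    have "norm (\<phi> x - \<phi> y) \<le> max B' 0 * norm (x - y)"
    proof (rule differentiable_bound[OF convex_cball _ _ that])
      fix z assume z: "z \<in> cball a r"
      show "(\<phi> has_derivative (\<lambda>h. gradient \<phi> z \<bullet> h)) (at z within cball a r)"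
        by (rule has_derivative_at_withinI[OF has_derivative_gradient[OF C(1)]])
      have "norm (gradient \<phi> z) \<le> max B' 0" using B(2) z by (simp add: le_max_iff_disj)
      then show "onorm (\<lambda>h. gradient \<phi> z \<bullet> h) \<le> max B' 0"
        by (intro onorm_le) (metis mult_right_mono norm_ge_zero order_trans Cauchy_Schwarz_ineq2 real_norm_def)
    qed
    then show ?thesis by simp
  qed
  show ?thesis
    by (rule that[of "max B 0" "max B' 0"]) (use B L in \<open>auto simp: le_max_iff_disj\<close>)
qed

text \<open>The integral over T of the divergence of \<phi>(x) (x - a). For a cone with apex a it
  stands for the integral of \<phi> over the base, multiplied by the height.\<close>

definition cone_functional :: "(real ^ 'n::finite) set \<Rightarrow> real ^ 'n \<Rightarrow> (real ^ 'n \<Rightarrow> real) \<Rightarrow> real" where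
  "cone_functional T a \<phi> =
     (\<integral>x. indicator T x * (gradient \<phi> x \<bullet> (x - a) + real CARD('n) * \<phi> x) \<partial>lborel)"

lemma integrable_on_compact:
  fixes f :: "real ^ 'n::finite \<Rightarrow> real"
  assumes "compact T" "continuous_on UNIV f"
  shows "integrable lborel (\<lambda>x. indicator T x * f x)"
  using borel_integrable_compact[OF assms(1), of f] continuous_on_subset[OF assms(2)] by simp

lemma C1_add_scaled:
  assumes "C_k (Suc 0) \<phi>" "C_k (Suc 0) \<psi>"
  shows "C_k (Suc 0) (\<lambda>x. \<phi> x + c * \<psi> x)" "gradient (\<lambda>x. \<phi> x + c * \<psi> x) = (\<lambda>x. gradient \<phi> x + c *\<^sub>R gradient \<psi> x)"
proof -
  have D: "((\<lambda>x. \<phi> x + c * \<psi> x) has_derivative (\<lambda>h. (gradient \<phi> x + c *\<^sub>R gradient \<psi> x) \<bullet> h)) (at x)" for x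
    using C1_D(1)[OF assms(1), THEN has_derivative_gradient] C1_D(1)[OF assms(2), THEN has_derivative_gradient]
    by (auto intro!: derivative_eq_intros simp: inner_add_left)
  have c: "continuous_on UNIV (\<lambda>x. gradient \<phi> x + c *\<^sub>R gradient \<psi> x)"
    using assms by (intro continuous_intros C1_D)
  show "C_k (Suc 0) (\<lambda>x. \<phi> x + c * \<psi> x)" by (rule C1_I(1)[OF D c])
  show "gradient (\<lambda>x. \<phi> x + c * \<psi> x) = (\<lambda>x. gradient \<phi> x + c *\<^sub>R gradient \<psi> x)" by (rule C1_I(2)[OF D c])
qed

lemma cone_functional_add_scaled:
  assumes T: "compact T" and "C_k (Suc 0) \<phi>" "C_k (Suc 0) \<psi>"
  shows "cone_functional T a (\<lambda>x. \<phi> x + c * \<psi> x) = cone_functional T a \<phi> + c * cone_functional T a \<psi>"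
proof -
  let ?f = "\<lambda>\<phi> x. gradient \<phi> x \<bullet> (x - a) + real CARD('a) * \<phi> x"
  have i: "integrable lborel (\<lambda>x. indicator T x * ?f \<phi> x)" if "C_k (Suc 0) \<phi>" for \<phi>
    by (rule integrable_on_compact[OF T]) (intro continuous_intros C1_D(2,3)[OF that])
  have "cone_functional T a (\<lambda>x. \<phi> x + c * \<psi> x) = (\<integral>x. indicator T x * ?f \<phi> x + c * (indicator T x * ?f \<psi> x) \<partial>lborel)"
    unfolding cone_functional_def C1_add_scaled(2)[OF assms(2,3)]
    by (rule Bochner_Integration.integral_cong) (simp_all add: algebra_simps)
  then show ?thesis using i[OF assms(2)] i[OF assms(3)] by (simp add: cone_functional_def)
qed

text \<open>With \<open>J s\<close> the integral of \<open>\<phi>\<close> over the cone scaled by \<open>s\<close> about its apex, the functional is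
  \<open>J'(1)\<close>, and \<open>J 1 - J s\<close> is of second order if \<open>\<phi>\<close> vanishes on the base.\<close>

lemma cone_functional_eq_0:
  fixes T F :: "(real ^ 'n::finite) set"
  assumes T: "compact T" and FT: "F \<subseteq> T"
    and star: "\<And>x t. x \<in> T \<Longrightarrow> 0 \<le> t \<Longrightarrow> t \<le> 1 \<Longrightarrow> a + t *\<^sub>R (x - a) \<in> T"
    and cone: "\<And>x. x \<in> T \<Longrightarrow> \<exists>y\<in>F. \<exists>r. 0 \<le> r \<and> r \<le> 1 \<and> x = a + r *\<^sub>R (y - a)"
    and phi: "C_k (Suc 0) \<phi>" and zero: "\<And>y. y \<in> F \<Longrightarrow> \<phi> y = 0"
  shows "cone_functional T a \<phi> = 0"
proof -
  let ?d = "CARD('n)"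
  note C = C1_D[OF phi]
  obtain R where R: "R \<ge> 0" "\<And>x. x \<in> T \<Longrightarrow> norm (x - a) \<le> R"
  proof -
    have "bounded ((\<lambda>x. x - a) ` T)"
      using T by (intro compact_imp_bounded compact_continuous_image continuous_intros)
    then obtain R where "\<forall>x\<in>T. norm (x - a) \<le> R" by (auto simp: bounded_iff)
    then show ?thesis using that[of "max R 0"] by (auto simp: le_max_iff_disj)
  qed
  obtain B B' where B: "B \<ge> 0" "B' \<ge> 0" "\<And>x. x \<in> cball a (2 * R) \<Longrightarrow> \<bar>\<phi> x\<bar> \<le> B"
    "\<And>x. x \<in> cball a (2 * R) \<Longrightarrow> norm (gradient \<phi> x) \<le> B'"
    "\<And>x y. x \<in> cball a (2 * R) \<Longrightarrow> y \<in> cball a (2 * R) \<Longrightarrow> \<bar>\<phi> x - \<phi> y\<bar> \<le> B' * norm (x - y)"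
    using C1_bounded[OF phi] by metis
  define J where "J s = (\<integral>x. indicator T x * (s ^ ?d * \<phi> (a + s *\<^sub>R (x - a))) \<partial>lborel)" for s
  let ?J' = "\<lambda>s x. indicator T x * (real ?d * s ^ (?d - 1) * \<phi> (a + s *\<^sub>R (x - a)) + gradient \<phi> (a + s *\<^sub>R (x - a)) \<bullet> (x - a) * s ^ ?d)"
  have cphi: "continuous_on UNIV (\<lambda>x. s ^ ?d * \<phi> (a + s *\<^sub>R (x - a)))" for s
    by (intro continuous_intros continuous_on_compose2[OF C(3)]) auto
  have "((\<lambda>s. \<integral>x. indicator T x * (s ^ ?d * \<phi> (a + s *\<^sub>R (x - a))) \<partial>lborel) has_real_derivative (\<integral>x. ?J' 1 x \<partial>lborel)) (at 1)"
  \<comment> \<open>For s below 2 the points a + s (x - a) stay in the ball of radius 2 R about a,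
    on which \<phi> and its gradient are bounded.\<close>
  proof (rule has_real_derivative_integral[where e="1/2" and w="\<lambda>x. indicator T x * (real ?d * 2 ^ (?d - 1) * B + B' * R * 2 ^ ?d)"])
    fix s :: real assume s: "\<bar>s - 1\<bar> < 1 / 2"
    then have s': "0 < s" "s \<le> 2" by arith+
    show "integrable lborel (\<lambda>x. indicator T x * (s ^ ?d * \<phi> (a + s *\<^sub>R (x - a))))"
      by (rule integrable_on_compact[OF T cphi])
    fix x
    have "((\<lambda>s. \<phi> (a + s *\<^sub>R (x - a))) has_real_derivative gradient \<phi> (a + s *\<^sub>R (x - a)) \<bullet> (x - a)) (at s)"
      by (rule has_real_derivative_along_line[OF C(1)]) (auto intro!: derivative_eq_intros)
    from DERIV_cmult[OF DERIV_mult[OF DERIV_pow[of ?d s] this], of "indicator T x"]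
    show "((\<lambda>s. indicator T x * (s ^ ?d * \<phi> (a + s *\<^sub>R (x - a)))) has_real_derivative ?J' s x) (at s)"
      by simp
    show "\<bar>?J' s x\<bar> \<le> indicator T x * (real ?d * 2 ^ (?d - 1) * B + B' * R * 2 ^ ?d)"
    proof (cases "x \<in> T")
      case True
      let ?z = "a + s *\<^sub>R (x - a)"
      have z: "?z \<in> cball a (2 * R)"
        using R(2)[OF True] s' R(1) by (simp add: dist_norm mult_mono)
      have "\<bar>gradient \<phi> ?z \<bullet> (x - a)\<bar> \<le> B' * R"
        using Cauchy_Schwarz_ineq2[of "gradient \<phi> ?z" "x - a"] mult_mono[OF B(4)[OF z] R(2)[OF True] B(2)] by (meson norm_ge_zero order_trans)
      then have "\<bar>gradient \<phi> ?z \<bullet> (x - a) * s ^ ?d\<bar> \<le> B' * R * 2 ^ ?d"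
        unfolding abs_mult using s' B R by (intro mult_mono) (auto intro: power_mono)
      moreover have "\<bar>real ?d * s ^ (?d - 1) * \<phi> ?z\<bar> \<le> real ?d * 2 ^ (?d - 1) * B"
        unfolding abs_mult using s' B(1) B(3)[OF z] by (intro mult_mono) (auto intro: power_mono)
      ultimately show ?thesis using True by simp
    qed simp
  next
    show "integrable lborel (\<lambda>x. indicator T x * (real ?d * 2 ^ (?d - 1) * B + B' * R * 2 ^ ?d))"
      by (rule integrable_on_compact[OF T]) simp
  qed simp
  then have J': "(J has_real_derivative cone_functional T a \<phi>) (at 1)"
    by (simp add: J_def[abs_def] cone_functional_def add.commute)
  define m where "m = (\<integral>x. indicator T x \<partial>lborel :: real)"
  have Tm[measurable]: "T \<in> sets borel" using T by (simp add: borel_compact)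
  \<comment> \<open>By substitution J s is the integral of \<phi> over T contracted towards a with
    ratio s. So J 1 - J s is an integral over a layer of volume m (1 - s^n), whose points have
    distance at most R (1 - s) from the base. Division by 1 - s leaves a factor that tends to
    0.\<close>
  have est: "\<bar>(J s - J 1) / (s - 1)\<bar> \<le> B' * R * m * (1 - s ^ ?d)" if s: "0 < s" "s < 1" for s
  proof -
    let ?i = "\<lambda>x. indicator T (a + (1 / s) *\<^sub>R (x - a)) :: real"
    have im[measurable]: "?i \<in> borel_measurable borel" by measurable
    have pm[measurable]: "\<phi> \<in> borel_measurable borel" by (rule borel_measurable_continuous_onI[OF C(3)])
    have arg: "a + (1 / s) *\<^sub>R ((a - s *\<^sub>R a) + s *\<^sub>R x - a) = x" "(a - s *\<^sub>R a) + s *\<^sub>R x = a + s *\<^sub>R (x - a)" for x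
      using s by (simp_all add: algebra_simps)
    have "J s = s ^ ?d * (\<integral>x. indicator T x * \<phi> (a + s *\<^sub>R (x - a)) \<partial>lborel)"
      unfolding J_def integral_mult_right_zero[symmetric]
      by (rule Bochner_Integration.integral_cong) simp_all
    then have Js: "J s = (\<integral>x. ?i x * \<phi> x \<partial>lborel)"
      using s integral_homothety[of s "\<lambda>x. ?i x * \<phi> x" "a - s *\<^sub>R a"]
      unfolding arg by simp
    have iS: "(\<integral>x. ?i x \<partial>lborel) = s ^ ?d * m"
      using s integral_homothety[of s ?i "a - s *\<^sub>R a"] unfolding arg m_def by simp
    have J1: "J 1 = (\<integral>x. indicator T x * \<phi> x \<partial>lborel)" by (simp add: J_def)
    have sub: "?i x \<le> indicator T x" for x
    proof (cases "a + (1 / s) *\<^sub>R (x - a) \<in> T")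
      case True
      from star[OF this, of s] s have "x \<in> T" by simp
      then show ?thesis using True by simp
    qed simp
    have iT: "integrable lborel (indicator T :: real ^ 'n \<Rightarrow> real)"
      using integrable_on_compact[OF T, of "\<lambda>_. 1"] by simp
    have ii: "integrable lborel ?i"
      by (rule Bochner_Integration.integrable_bound[OF iT]) (use sub in auto)
    have iTp: "integrable lborel (\<lambda>x. indicator T x * \<phi> x)" by (rule integrable_on_compact[OF T C(3)])
    have iip: "integrable lborel (\<lambda>x. ?i x * \<phi> x)"
    proof (rule Bochner_Integration.integrable_bound[OF iTp])
      have "norm (?i x * \<phi> x) \<le> norm (indicator T x * \<phi> x)" for x
        using sub[of x] by (simp add: abs_mult mult_right_mono)
      then show "AE x in lborel. norm (?i x * \<phi> x) \<le> norm (indicator T x * \<phi> x)" by (rule AE_I2)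
    qed measurable
    have "\<bar>J 1 - J s\<bar> = \<bar>\<integral>x. indicator T x * \<phi> x - ?i x * \<phi> x \<partial>lborel\<bar>"
      unfolding Js J1 using iTp iip by simp
    also have "\<dots> \<le> (\<integral>x. (indicator T x - ?i x) * (B' * (R * (1 - s))) \<partial>lborel)"
    proof (rule order_trans[OF integral_abs_bound integral_mono'])
      show "integrable lborel (\<lambda>x. (indicator T x - ?i x) * (B' * (R * (1 - s))))" using iT ii by auto
      fix x
      show "\<bar>indicator T x * \<phi> x - ?i x * \<phi> x\<bar> \<le> (indicator T x - ?i x) * (B' * (R * (1 - s)))"
      proof (cases "x \<in> T \<and> a + (1 / s) *\<^sub>R (x - a) \<notin> T")
        case True
        then obtain y r where y: "y \<in> F" "0 \<le> r" "r \<le> 1" "x = a + r *\<^sub>R (y - a)" using cone by blast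
        \<comment> \<open>Otherwise x would lie in the contracted cone, not in the layer.\<close>
        have "r > s"
        proof (rule ccontr)
          assume "\<not> r > s"
          then have "a + (r / s) *\<^sub>R (y - a) \<in> T" using star[of y "r / s"] y FT s by auto
          then show False using True y(4) by simp
        qed
        have yT: "y \<in> T" using y(1) FT by blast
        have "norm (x - y) = (1 - r) * norm (y - a)"
        proof -
          have "x - y = (r - 1) *\<^sub>R (y - a)" using y(4) by (simp add: algebra_simps)
          then show ?thesis using y(3) by simp
        qed
        also have "\<dots> \<le> (1 - s) * R" using \<open>r > s\<close> R(2)[OF yT] s by (intro mult_mono) auto
        finally have le: "norm (x - y) \<le> R * (1 - s)" by (simp add: mult.commute)
        have xy: "x \<in> cball a (2 * R)" "y \<in> cball a (2 * R)"
          using R(1) R(2)[of x] R(2)[OF yT] True by (auto simp: dist_norm norm_minus_commute)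
        have "\<bar>\<phi> x\<bar> \<le> B' * norm (x - y)" using B(5)[OF xy] zero[OF y(1)] by simp
        also have "\<dots> \<le> B' * (R * (1 - s))" by (rule mult_left_mono[OF le B(2)])
        finally have "\<bar>\<phi> x\<bar> \<le> B' * (R * (1 - s))" .
        then show ?thesis using True by simp
      next
        case False
        have "indicator T x = ?i x"
          using False sub[of x] by (auto simp: indicator_def split: if_splits)
        then show ?thesis by simp
      qed
      show "0 \<le> (indicator T x - ?i x) * (B' * (R * (1 - s)))"
        using sub[of x] B(2) R(1) s by (intro mult_nonneg_nonneg) auto
    qed
    also have "\<dots> = (m - s ^ ?d * m) * (B' * (R * (1 - s)))"
      using iT ii by (simp add: iS m_def)
    also have "\<dots> = B' * R * m * (1 - s ^ ?d) * (1 - s)" by (simp add: algebra_simps)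
    finally show ?thesis
      using s by (simp add: abs_minus_commute[of "J s"] abs_minus_commute[of s] abs_of_pos divide_le_eq)
  qed
  \<comment> \<open>The limit is taken from the left, where the contracted cone is contained in
    T.\<close>
  have "((\<lambda>s. (J s - J 1) / (s - 1)) \<longlongrightarrow> cone_functional T a \<phi>) (at_left 1)"
    using J' by (simp add: has_field_derivative_iff filterlim_at_split)
  moreover have "((\<lambda>s. (J s - J 1) / (s - 1)) \<longlongrightarrow> 0) (at_left 1)"
  proof (rule Lim_null_comparison)
    show "\<forall>\<^sub>F s in at_left 1. norm ((J s - J 1) / (s - 1)) \<le> B' * R * m * (1 - s ^ ?d)"
      using eventually_at_left_real[of 0 "1::real"] est by (auto elim!: eventually_mono)
    have "((\<lambda>s::real. B' * R * m * (1 - s ^ ?d)) \<longlongrightarrow> B' * R * m * (1 - 1 ^ ?d)) (at_left 1)"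
      by (intro tendsto_intros)
    then show "((\<lambda>s::real. B' * R * m * (1 - s ^ ?d)) \<longlongrightarrow> 0) (at_left 1)" by simp
  qed
  ultimately show ?thesis
    using tendsto_unique trivial_limit_at_left_real by blast
qed

section \<open>Affine functions on simplices\<close>

text \<open>The argument is the set of vertices; the simplex itself is its convex hull.\<close>

definition full_simplex :: "(real ^ 'n::finite) set \<Rightarrow> bool" where
  "full_simplex C \<longleftrightarrow> \<not> affine_dependent C \<and> card C = Suc CARD('n)"

lemma affine_interpolation:
  fixes C :: "'a::euclidean_space set"
  assumes "\<not> affine_dependent C"
  obtains l \<beta> where "\<And>c. c \<in> C \<Longrightarrow> l \<bullet> c + \<beta> = m c"
proof (cases "C = {}")
  case True
  then show ?thesis using that[of 0 0] by simp
next
  case False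
  then obtain a where a: "a \<in> C" by blast
  let ?B = "(\<lambda>x. - a + x) ` (C - {a})"
  have "independent ?B" using assms affine_dependent_iff_dependent2[OF a] by simp
  then obtain g :: "'a \<Rightarrow> real" where g: "linear g" "\<forall>x\<in>?B. g x = m (x + a) - m a"
    using linear_independent_extend[of ?B "\<lambda>x. m (x + a) - m a"] by blast
  \<comment> \<open>The vector that represents the linear functional g.\<close>
  let ?l = "adjoint g 1"
  have l: "?l \<bullet> x = g x" for x using adjoint_works[OF g(1), of x 1] by (simp add: inner_commute)
  have "?l \<bullet> c + (m a - ?l \<bullet> a) = m c" if c: "c \<in> C" for c
  proof (cases "c = a")
    case False
    then have "g (- a + c) = m c - m a" using g(2) c by auto
    then show ?thesis using linear_add[OF g(1), of "-a" c] linear_neg[OF g(1), of a] by (simp add: l)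
  qed simp
  then show ?thesis using that[of ?l "m a - ?l \<bullet> a"] by blast
qed

lemma affine_image_convex_hull:
  assumes "linear L" "\<And>x. h x = p + L x"
  shows "h ` (convex hull S) = convex hull (h ` S)"
proof -
  have h: "h ` X = (\<lambda>x. p + x) ` (L ` X)" for X using assms(2) by (auto simp: image_iff)
  show ?thesis unfolding h convex_hull_translation convex_hull_linear_image[OF assms(1)] ..
qed

lemma affine_map_eq_id:
  assumes "linear L" "\<And>x. h x = p + L x" "\<And>c. c \<in> S \<Longrightarrow> h c = c" "x \<in> affine hull S"
  shows "h x = x"
proof -
  have "affine {x. h x = x}"
    unfolding affine_def
  proof (intro ballI allI impI)
    fix x y and u v :: real assume xy: "x \<in> {x. h x = x}" "y \<in> {x. h x = x}" and uv: "u + v = 1"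
    have "h (u *\<^sub>R x + v *\<^sub>R y) = (u + v) *\<^sub>R p + u *\<^sub>R L x + v *\<^sub>R L y"
      using uv assms(2) linear_add[OF assms(1)] linear_scale[OF assms(1)] by simp
    also have "\<dots> = u *\<^sub>R h x + v *\<^sub>R h y" by (simp add: assms(2) algebra_simps)
    finally show "u *\<^sub>R x + v *\<^sub>R y \<in> {x. h x = x}" using xy by simp
  qed
  then have "affine hull S \<subseteq> {x. h x = x}" using assms(3) by (intro hull_minimal) auto
  then show ?thesis using assms(4) by blast
qed

lemma affine_fun_eq_0:
  fixes l :: "'a::euclidean_space"
  assumes "\<And>c. c \<in> S \<Longrightarrow> l \<bullet> c + \<beta> = 0" "x \<in> affine hull S"
  shows "l \<bullet> x + \<beta> = 0"
proof -
  have "affine {x. l \<bullet> x + \<beta> = 0}"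
  proof -
    have "{x. l \<bullet> x + \<beta> = 0} = {x. l \<bullet> x = - \<beta>}" by auto
    then show ?thesis using affine_hyperplane by metis
  qed
  then have "affine hull S \<subseteq> {x. l \<bullet> x + \<beta> = 0}" using assms(1) by (intro hull_minimal) auto
  then show ?thesis using assms(2) by blast
qed

section \<open>Geometry and integrals on a single simplex\<close>

context
  fixes C :: "(real ^ 'n::finite) set"
  assumes C: "full_simplex C"
begin

lemma simplex_finite: "finite C" and simplex_indep: "\<not> affine_dependent C" and simplex_card: "card C = Suc CARD('n)"
  using C aff_independent_finite by (auto simp: full_simplex_def)

lemma simplex_affine_hull: "affine hull C = UNIV"
proof -
  have "aff_dim C = int CARD('n)" using aff_dim_affine_independent[OF simplex_indep] simplex_card by simp
  then show ?thesis using aff_dim_eq_full[of C] by simp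
qed

lemma simplex_compact: "compact (convex hull C)"
  by (intro compact_convex_hull finite_imp_compact simplex_finite)

lemma simplex_interior: "interior (convex hull C) \<noteq> {}"
proof -
  have "C \<noteq> {}" using simplex_card by auto
  then have "rel_interior (convex hull C) \<noteq> {}" by (simp add: rel_interior_eq_empty)
  then show ?thesis using rel_interior_interior[of "convex hull C"] simplex_affine_hull by simp
qed

lemma simplex_volume_pos: "measure lborel (convex hull C) > 0"
proof -
  have "\<not> negligible (convex hull C)"
    using simplex_interior open_not_negligible[of "interior (convex hull C)"] negligible_subset[OF _ interior_subset] by blast
  moreover have fin: "emeasure lborel (convex hull C) < \<infinity>"
    using simplex_compact by (intro emeasure_bounded_finite compact_imp_bounded)
  ultimately have "emeasure lborel (convex hull C) \<noteq> 0"
    using simplex_compact by (auto simp: negligible_iff_null_sets borel_compact intro!: null_sets_completionI null_setsI)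
  then show ?thesis
    using fin by (simp add: measure_def enn2real_positive_iff zero_less_iff_neq_zero)
qed

lemma affine_fun_eq_on_simplex:
  assumes "\<And>c. c \<in> C \<Longrightarrow> l \<bullet> c + \<beta> = l' \<bullet> c + \<beta>'"
  shows "l \<bullet> x + \<beta> = l' \<bullet> x + \<beta>'"
proof -
  have "(l - l') \<bullet> x + (\<beta> - \<beta>') = 0"
    by (rule affine_fun_eq_0[of C]) (use assms simplex_affine_hull in \<open>auto simp: inner_diff_left algebra_simps\<close>)
  then show ?thesis by (simp add: inner_diff_left algebra_simps)
qed

lemma constant_on_simplex:
  assumes "\<And>b c. b \<in> C \<Longrightarrow> c \<in> C \<Longrightarrow> l \<bullet> (b - c) = 0"
  shows "l = 0"
proof -
  obtain a where a: "a \<in> C" using simplex_card by fastforce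
  have "l \<bullet> x + (- (l \<bullet> a)) = 0 \<bullet> x + 0" for x
  proof (rule affine_fun_eq_on_simplex)
    fix c assume "c \<in> C"
    from assms[OF this a] show "l \<bullet> c + (- (l \<bullet> a)) = 0 \<bullet> c + 0" by (simp add: inner_diff_right)
  qed
  \<comment> \<open>Evaluation at l + a leaves the square of the norm of l.\<close>
  then have "l \<bullet> (l + a) + (- (l \<bullet> a)) = 0" by simp
  then show ?thesis by (simp add: inner_add_right)
qed

lemma barycentric_coordinates:
  obtains l :: "real ^ 'n \<Rightarrow> real ^ 'n" and \<beta> :: "real ^ 'n \<Rightarrow> real"
  where "\<And>b c. b \<in> C \<Longrightarrow> c \<in> C \<Longrightarrow> l b \<bullet> c + \<beta> b = (if b = c then 1 else 0)"
    and "\<And>m \<gamma> x. m \<bullet> x + \<gamma> = (\<Sum>c\<in>C. (m \<bullet> c + \<gamma>) * (l c \<bullet> x + \<beta> c))"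
proof -
  have "\<exists>l \<beta>. \<forall>c\<in>C. l \<bullet> c + \<beta> = (if b = c then 1 else 0::real)" for b
  proof -
    obtain l \<beta> where "\<And>c. c \<in> C \<Longrightarrow> l \<bullet> c + \<beta> = (if b = c then 1 else 0)"
      using affine_interpolation[OF simplex_indep, of "\<lambda>c. if b = c then 1 else 0"] by blast
    then show ?thesis by (intro exI ballI)
  qed
  then have "\<forall>b. \<exists>l \<beta>. \<forall>c\<in>C. l \<bullet> c + \<beta> = (if b = c then 1 else 0::real)" by (rule allI)
  then obtain l where "\<forall>b. \<exists>\<beta>. \<forall>c\<in>C. l b \<bullet> c + \<beta> = (if b = c then 1 else 0::real)"
    unfolding choice_iff by (rule exE)
  then obtain \<beta> where l: "\<And>b c. c \<in> C \<Longrightarrow> l b \<bullet> c + \<beta> b = (if b = c then 1 else 0::real)"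
    unfolding choice_iff by blast
  have "m \<bullet> x + \<gamma> = (\<Sum>c\<in>C. (m \<bullet> c + \<gamma>) * (l c \<bullet> x + \<beta> c))" for m \<gamma> x
  proof -
    let ?l = "\<Sum>c\<in>C. (m \<bullet> c + \<gamma>) *\<^sub>R l c" and ?b = "\<Sum>c\<in>C. (m \<bullet> c + \<gamma>) * \<beta> c"
    have e: "?l \<bullet> y + ?b = (\<Sum>c\<in>C. (m \<bullet> c + \<gamma>) * (l c \<bullet> y + \<beta> c))" for y
      by (simp add: inner_sum_left sum.distrib distrib_left)
    have "m \<bullet> x + \<gamma> = ?l \<bullet> x + ?b"
    proof (rule affine_fun_eq_on_simplex)
      fix c assume c: "c \<in> C"
      have "(\<Sum>d\<in>C. (m \<bullet> d + \<gamma>) * (l d \<bullet> c + \<beta> d)) = (\<Sum>d\<in>C. if d = c then m \<bullet> c + \<gamma> else 0)"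
        by (rule sum.cong) (auto simp: l[OF c])
      then show "m \<bullet> c + \<gamma> = ?l \<bullet> c + ?b" unfolding e using simplex_finite c by simp
    qed
    then show ?thesis unfolding e .
  qed
  with l show ?thesis by (intro that)
qed

text \<open>The simplex as a cone with apex a over the opposite face, in the form in which the
  vanishing of the cone functional requires it.\<close>

lemma simplex_is_cone:
  assumes a: "a \<in> C"
  defines "T \<equiv> convex hull C" and "F \<equiv> convex hull (C - {a})"
  shows "F \<subseteq> T" and "\<And>x t. x \<in> T \<Longrightarrow> 0 \<le> t \<Longrightarrow> t \<le> 1 \<Longrightarrow> a + t *\<^sub>R (x - a) \<in> T"
    and "\<And>x. x \<in> T \<Longrightarrow> \<exists>y\<in>F. \<exists>r. 0 \<le> r \<and> r \<le> 1 \<and> x = a + r *\<^sub>R (y - a)"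
proof -
  show "F \<subseteq> T" unfolding F_def T_def by (intro hull_mono) auto
  fix x assume x: "x \<in> T"
  have aT: "a \<in> T" unfolding T_def using a by (rule hull_inc)
  show "a + t *\<^sub>R (x - a) \<in> T" if "0 \<le> t" "t \<le> 1" for t
  proof -
    have "(1 - t) *\<^sub>R a + t *\<^sub>R x \<in> T"
      using convexD_alt[OF convex_convex_hull, of a C x t] aT x that unfolding T_def by blast
    then show ?thesis by (simp add: algebra_simps)
  qed
  have ne: "C - {a} \<noteq> {}"
  proof
    assume "C - {a} = {}"
    then have "card C \<le> card {a}" by (intro card_mono) auto
    then show False using simplex_card by simp
  qed
  have "x \<in> convex hull (insert a (C - {a}))" using x a by (simp add: T_def insert_absorb)
  then obtain u v y where uv: "0 \<le> u" "0 \<le> v" "u + v = 1" and y: "y \<in> F" "x = u *\<^sub>R a + v *\<^sub>R y"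
    unfolding convex_hull_insert[OF ne] F_def by blast
  have u: "u = 1 - v" using uv(3) by simp
  have "x = a + v *\<^sub>R (y - a)" unfolding y(2) u by (simp add: algebra_simps)
  moreover have "v \<le> 1" using uv by linarith
  ultimately show "\<exists>y\<in>F. \<exists>r. 0 \<le> r \<and> r \<le> 1 \<and> x = a + r *\<^sub>R (y - a)" using y(1) uv(2) by blast
qed

lemma simplex_cone_functional_eq_0:
  assumes "a \<in> C" "C_k (Suc 0) \<phi>" "\<And>y. y \<in> convex hull (C - {a}) \<Longrightarrow> \<phi> y = 0"
  shows "cone_functional (convex hull C) a \<phi> = 0"
  by (rule cone_functional_eq_0[OF simplex_compact simplex_is_cone[OF assms(1)] assms(2,3)])

lemma affine_C1: "C_k (Suc 0) (\<lambda>x. l \<bullet> x + \<beta>)" "gradient (\<lambda>x. l \<bullet> x + \<beta>) = (\<lambda>x. l)" for l :: "real ^ 'n"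
proof -
  have D: "((\<lambda>x. l \<bullet> x + \<beta>) has_derivative (\<lambda>h. l \<bullet> h)) (at x)" for x by (auto intro!: derivative_eq_intros)
  show "C_k (Suc 0) (\<lambda>x. l \<bullet> x + \<beta>)" by (rule C1_I(1)[OF D]) simp
  show "gradient (\<lambda>x. l \<bullet> x + \<beta>) = (\<lambda>x. l)" by (rule C1_I(2)[OF D]) simp
qed

text \<open>The barycentric coordinate of a vanishes on the opposite face, hence its cone functional
  is zero. Since its gradient applied to x - a is the coordinate minus 1, this says that n + 1 times
  its integral is the volume; the general case follows by expansion in these coordinates.\<close>

lemma integral_affine_simplex:
  "(\<integral>x. indicator (convex hull C) x * (m \<bullet> x + \<gamma>) \<partial>lborel) =
     measure lborel (convex hull C) / (real CARD('n) + 1) * (\<Sum>c\<in>C. m \<bullet> c + \<gamma>)"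
proof -
  let ?T = "convex hull C" and ?n = "real CARD('n)"
  obtain l \<beta> where l: "\<And>b c. b \<in> C \<Longrightarrow> c \<in> C \<Longrightarrow> l b \<bullet> c + \<beta> b = (if b = c then 1 else 0)"
    "\<And>m \<gamma> x. m \<bullet> x + \<gamma> = (\<Sum>c\<in>C. (m \<bullet> c + \<gamma>) * (l c \<bullet> x + \<beta> c))"
    using barycentric_coordinates by blast
  have int: "integrable lborel (\<lambda>x. indicator ?T x * (l c \<bullet> x + \<beta> c))" for c
    by (rule integrable_on_compact[OF simplex_compact]) (intro continuous_intros)
  have int1: "integrable lborel (\<lambda>x. indicator ?T x :: real)"
    using integrable_on_compact[OF simplex_compact, of "\<lambda>_. 1"] by simp
  have one: "(\<integral>x. indicator ?T x * (l a \<bullet> x + \<beta> a) \<partial>lborel) = measure lborel ?T / (?n + 1)" if a: "a \<in> C" for a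
  proof -
    have "l a \<bullet> y + \<beta> a = 0" if "y \<in> convex hull (C - {a})" for y
    proof (rule affine_fun_eq_0[of "C - {a}"])
      fix c assume "c \<in> C - {a}"
      then show "l a \<bullet> c + \<beta> a = 0" using l(1)[OF a, of c] by auto
    next
      show "y \<in> affine hull (C - {a})" using that convex_hull_subset_affine_hull[of "C - {a}"] by blast
    qed
    then have "0 = cone_functional ?T a (\<lambda>x. l a \<bullet> x + \<beta> a)"
      using simplex_cone_functional_eq_0[OF a affine_C1(1)] by simp
    also have "\<dots> = (\<integral>x. (?n + 1) * (indicator ?T x * (l a \<bullet> x + \<beta> a)) - indicator ?T x \<partial>lborel)"
      unfolding cone_functional_def affine_C1(2)
    proof (rule Bochner_Integration.integral_cong[OF refl])
      fix x
      have "l a \<bullet> (x - a) = (l a \<bullet> x + \<beta> a) - 1" using l(1)[OF a a] by (simp add: inner_diff_right)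
      then show "indicator ?T x * (l a \<bullet> (x - a) + ?n * (l a \<bullet> x + \<beta> a)) =
          (?n + 1) * (indicator ?T x * (l a \<bullet> x + \<beta> a)) - indicator ?T x"
        by (simp only:) (simp add: algebra_simps)
    qed
    also have "\<dots> = (?n + 1) * (\<integral>x. indicator ?T x * (l a \<bullet> x + \<beta> a) \<partial>lborel) - measure lborel ?T"
      using int[of a] int1 by simp
    finally show ?thesis by (simp add: field_simps)
  qed
  have "(\<integral>x. indicator ?T x * (m \<bullet> x + \<gamma>) \<partial>lborel) =
      (\<integral>x. (\<Sum>c\<in>C. (m \<bullet> c + \<gamma>) * (indicator ?T x * (l c \<bullet> x + \<beta> c))) \<partial>lborel)"
    by (rule Bochner_Integration.integral_cong[OF refl]) (subst l(2), simp add: sum_distrib_left mult_ac del: sum_mult_indicator sum_indicator_mult)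
  also have "\<dots> = (\<Sum>c\<in>C. (m \<bullet> c + \<gamma>) * (\<integral>x. indicator ?T x * (l c \<bullet> x + \<beta> c) \<partial>lborel))"
    using int by simp
  also have "\<dots> = (\<Sum>c\<in>C. (m \<bullet> c + \<gamma>) * (measure lborel ?T / (?n + 1)))"
    using one by simp
  also have "\<dots> = measure lborel ?T / (?n + 1) * (\<Sum>c\<in>C. m \<bullet> c + \<gamma>)"
    unfolding sum_distrib_right[symmetric] by (rule mult.commute)
  finally show ?thesis .
qed

text \<open>The height times the area of the face opposite to c is n times the volume, so this
  quotient is the mean of \<phi> over that face.\<close>

definition face_mean :: "real ^ 'n \<Rightarrow> (real ^ 'n \<Rightarrow> real) \<Rightarrow> real" where
  "face_mean c \<phi> = cone_functional (convex hull C) c \<phi> / (real CARD('n) * measure lborel (convex hull C))"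

lemma barycentre_simplex: "barycentre (convex hull C) = (1 / (real CARD('n) + 1)) *\<^sub>R (\<Sum>c\<in>C. c)"
  using extreme_point_of_convex_hull_affine_independent[OF simplex_indep] by (simp add: barycentre_def)

text \<open>The affine function with vertex values \<open>S - n m\<^sub>c\<close>, where \<open>S\<close> is the sum of all face means \<open>m\<^sub>c\<close>,
  is the Crouzeix-Raviart interpolant: on the face opposite to \<open>c\<close> its vertex values average to \<open>m\<^sub>c\<close>.\<close>

lemma CR_interpolant:
  assumes phi: "C_k (Suc 0) \<phi>"
    and p: "\<And>c. c \<in> C \<Longrightarrow> A \<bullet> c + b = (\<Sum>c\<in>C. face_mean c \<phi>) - real CARD('n) * face_mean c \<phi>"
  shows "(\<integral>x. indicator (convex hull C) x * (gradient \<phi> x \<bullet> w) \<partial>lborel) = measure lborel (convex hull C) * (A \<bullet> w)"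
    and "(\<integral>x. indicator (convex hull C) x * (gradient \<phi> x \<bullet> (x - barycentre (convex hull C))) \<partial>lborel) =
      real CARD('n) * ((\<integral>x. indicator (convex hull C) x * (A \<bullet> x + b) \<partial>lborel) - (\<integral>x. indicator (convex hull C) x * \<phi> x \<partial>lborel))"
proof -
  let ?T = "convex hull C" and ?n = "real CARD('n)" and ?S = "\<Sum>c\<in>C. face_mean c \<phi>" and ?V = "measure lborel (convex hull C)"
  note CD = C1_D[OF phi]
  have V: "?V > 0" by (rule simplex_volume_pos)
  have n0: "?n > 0" by simp
  have N: "cone_functional ?T c \<phi> = ?n * ?V * face_mean c \<phi>" for c
    using V by (simp add: face_mean_def)
  have ig: "integrable lborel (\<lambda>x. indicator ?T x * (gradient \<phi> x \<bullet> f x))" if "continuous_on UNIV f" for f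
    by (rule integrable_on_compact[OF simplex_compact]) (intro continuous_intros CD(2) that)
  have ip: "integrable lborel (\<lambda>x. indicator ?T x * \<phi> x)"
    by (rule integrable_on_compact[OF simplex_compact CD(3)])
  have cs: "continuous_on UNIV (\<lambda>x. x - c)" for c :: "real ^ 'n" by (intro continuous_intros)
  define I where "I w = (\<integral>x. indicator ?T x * (gradient \<phi> x \<bullet> w) \<partial>lborel)" for w
  have N': "(\<integral>x. indicator ?T x * (gradient \<phi> x \<bullet> (x - c)) \<partial>lborel) = ?n * ?V * face_mean c \<phi> - ?n * (\<integral>x. indicator ?T x * \<phi> x \<partial>lborel)" for c
  proof -
    have "?n * ?V * face_mean c \<phi> = (\<integral>x. indicator ?T x * (gradient \<phi> x \<bullet> (x - c)) + ?n * (indicator ?T x * \<phi> x) \<partial>lborel)"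
      unfolding N[symmetric] cone_functional_def by (rule Bochner_Integration.integral_cong) (simp_all add: algebra_simps)
    also have "\<dots> = (\<integral>x. indicator ?T x * (gradient \<phi> x \<bullet> (x - c)) \<partial>lborel) + ?n * (\<integral>x. indicator ?T x * \<phi> x \<partial>lborel)"
      using ip ig[OF cs] by (subst Bochner_Integration.integral_add) auto
    finally show ?thesis by simp
  qed
  \<comment> \<open>The cone functionals with apices c and d differ by the integral of the gradient
    applied to d - c, so differences of face means are mean directional derivatives along
    edges.\<close>
  have diff: "I (c - d) = ?n * ?V * (face_mean d \<phi> - face_mean c \<phi>)" for c d
  proof -
    have "I (c - d) = (\<integral>x. indicator ?T x * (gradient \<phi> x \<bullet> (x - d)) - indicator ?T x * (gradient \<phi> x \<bullet> (x - c)) \<partial>lborel)"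
      unfolding I_def by (rule Bochner_Integration.integral_cong) (simp_all add: inner_diff_right algebra_simps)
    also have "\<dots> = (\<integral>x. indicator ?T x * (gradient \<phi> x \<bullet> (x - d)) \<partial>lborel) - (\<integral>x. indicator ?T x * (gradient \<phi> x \<bullet> (x - c)) \<partial>lborel)"
      by (intro Bochner_Integration.integral_diff ig cs)
    finally show ?thesis unfolding N' by (simp add: algebra_simps)
  qed
  define G where "G = (\<chi> i. I (axis i 1))"
  have G: "I w = G \<bullet> w" for w
  proof -
    have "I w = (\<integral>x. (\<Sum>i\<in>UNIV. w $ i * (indicator ?T x * (gradient \<phi> x \<bullet> axis i 1))) \<partial>lborel)"
      unfolding I_def
      by (rule Bochner_Integration.integral_cong[OF refl])
        (simp add: inner_vec_def[of _ w] inner_axis sum_distrib_left mult_ac del: sum_mult_indicator sum_indicator_mult)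
    also have "\<dots> = (\<Sum>i\<in>UNIV. w $ i * I (axis i 1))"
      unfolding I_def using ig[OF continuous_on_const] by simp
    finally show ?thesis by (simp add: G_def inner_vec_def mult.commute)
  qed
  \<comment> \<open>Both vectors have the same inner product with every edge, and the edges span the
    space.\<close>
  have "G - ?V *\<^sub>R A = 0"
  proof (rule constant_on_simplex)
    fix c d assume cd: "c \<in> C" "d \<in> C"
    have "A \<bullet> (c - d) = ?n * (face_mean d \<phi> - face_mean c \<phi>)"
      using p[OF cd(1)] p[OF cd(2)] by (simp add: inner_diff_right algebra_simps)
    moreover have "G \<bullet> (c - d) = ?n * ?V * (face_mean d \<phi> - face_mean c \<phi>)"
      unfolding G[symmetric] by (rule diff)
    ultimately show "(G - ?V *\<^sub>R A) \<bullet> (c - d) = 0"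
      by (simp only: inner_diff_left inner_scaleR_left) simp
  qed
  then have "G = ?V *\<^sub>R A" by simp
  then show "(\<integral>x. indicator ?T x * (gradient \<phi> x \<bullet> w) \<partial>lborel) = ?V * (A \<bullet> w)"
    using G[of w] by (simp add: I_def)
  have cn: "real (card C) = ?n + 1" by (simp add: simplex_card)
  \<comment> \<open>The vector x - x_T is the average of x - c over the vertices; averaging
    \<open>N'\<close> accordingly yields the first moment of the gradient about the
    barycentre.\<close>
  have xb: "x - barycentre ?T = (1 / (?n + 1)) *\<^sub>R (\<Sum>c\<in>C. x - c)" for x
  proof -
    have "(\<Sum>c\<in>C. x - c) = (?n + 1) *\<^sub>R x - (\<Sum>c\<in>C. c)"
      by (simp add: sum_subtractf sum_constant_scaleR cn del: sum_constant)
    then have "(1 / (?n + 1)) *\<^sub>R (\<Sum>c\<in>C. x - c) = ((1 / (?n + 1)) * (?n + 1)) *\<^sub>R x - (1 / (?n + 1)) *\<^sub>R (\<Sum>c\<in>C. c)"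
      by (simp only: scaleR_diff_right scaleR_scaleR)
    then show ?thesis using n0 by (simp add: barycentre_simplex)
  qed
  have "(\<integral>x. indicator ?T x * (gradient \<phi> x \<bullet> (x - barycentre ?T)) \<partial>lborel) =
      (\<integral>x. (1 / (?n + 1)) * (\<Sum>c\<in>C. indicator ?T x * (gradient \<phi> x \<bullet> (x - c))) \<partial>lborel)"
    unfolding xb by (rule Bochner_Integration.integral_cong[OF refl])
      (simp add: inner_sum_right sum_distrib_left del: sum_mult_indicator sum_indicator_mult)
  also have "\<dots> = (1 / (?n + 1)) * (\<Sum>c\<in>C. (\<integral>x. indicator ?T x * (gradient \<phi> x \<bullet> (x - c)) \<partial>lborel))"
    using ig[OF cs] by (subst integral_mult_right_zero, subst Bochner_Integration.integral_sum) auto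
  also have "\<dots> = (1 / (?n + 1)) * (?n * ?V * ?S - (?n + 1) * (?n * (\<integral>x. indicator ?T x * \<phi> x \<partial>lborel)))"
    unfolding N' by (simp add: sum_subtractf sum_distrib_left cn)
  also have "\<dots> = ?n * (?V / (?n + 1) * ?S - (\<integral>x. indicator ?T x * \<phi> x \<partial>lborel))"
    using n0 by (simp add: field_simps)
  also have "?V / (?n + 1) * ?S = (\<integral>x. indicator ?T x * (A \<bullet> x + b) \<partial>lborel)"
  proof -
    \<comment> \<open>There are n + 1 vertices, so the sum is (n + 1) S - n S = S.\<close>
    have "(\<Sum>c\<in>C. A \<bullet> c + b) = (\<Sum>c\<in>C. ?S - ?n * face_mean c \<phi>)" using p by (intro sum.cong) auto
    also have "\<dots> = ?S" by (simp add: sum_subtractf sum_distrib_left[symmetric] cn algebra_simps)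
    finally show ?thesis by (simp add: integral_affine_simplex)
  qed
  finally show "(\<integral>x. indicator ?T x * (gradient \<phi> x \<bullet> (x - barycentre ?T)) \<partial>lborel) =
      ?n * ((\<integral>x. indicator ?T x * (A \<bullet> x + b) \<partial>lborel) - (\<integral>x. indicator ?T x * \<phi> x \<partial>lborel))" .
qed

end

text \<open>The affine map h that fixes K and sends a to a' carries the first simplex onto the
  second. The function \<phi> \<circ> h - \<phi> vanishes on the common facet, so \<phi> and \<phi>
  \<circ> h have the same functional on the first simplex. Substitution by h relates the latter to
  the functional of \<phi> on the second simplex, with the ratio of the volumes as factor.\<close>

lemma cone_functional_common_face:
  fixes K :: "(real ^ 'n::finite) set"
  assumes a: "a \<notin> K" and a': "a' \<notin> K" and C: "full_simplex (insert a K)" and C': "full_simplex (insert a' K)"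
    and phi: "C_k (Suc 0) \<phi>"
  shows "cone_functional (convex hull (insert a K)) a \<phi> * measure lborel (convex hull (insert a' K)) =
    cone_functional (convex hull (insert a' K)) a' \<phi> * measure lborel (convex hull (insert a K))"
proof -
  let ?T = "convex hull (insert a K)" and ?T' = "convex hull (insert a' K)" and ?w = "a' - a"
  obtain l \<beta> where l: "\<And>c. c \<in> insert a K \<Longrightarrow> l \<bullet> c + \<beta> = (if c = a then 1 else 0)"
    using affine_interpolation[OF simplex_indep[OF C], of "\<lambda>c. if c = a then 1 else 0"] by blast
  obtain l' \<beta>' where l': "\<And>c. c \<in> insert a' K \<Longrightarrow> l' \<bullet> c + \<beta>' = (if c = a' then 1 else 0)"
    using affine_interpolation[OF simplex_indep[OF C'], of "\<lambda>c. if c = a' then 1 else 0"] by blast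
  \<comment> \<open>The coefficient is the barycentric coordinate of a: it is 0 on the facet and 1
    at a. The map h' is the analogous one in the opposite direction and turns out to be the
    inverse.\<close>
  define h where "h x = x + (l \<bullet> x + \<beta>) *\<^sub>R ?w" for x
  define h' where "h' x = x - (l' \<bullet> x + \<beta>') *\<^sub>R ?w" for x
  define L where "L x = x + (l \<bullet> x) *\<^sub>R ?w" for x
  define L' where "L' x = x - (l' \<bullet> x) *\<^sub>R ?w" for x
  have lin: "linear L" "linear L'"
    unfolding L_def L'_def by (auto intro!: linearI simp: inner_add_right algebra_simps)
  have hL: "h x = \<beta> *\<^sub>R ?w + L x" and hL': "h' x = - \<beta>' *\<^sub>R ?w + L' x" for x
    by (simp_all add: h_def L_def h'_def L'_def scaleR_add_left algebra_simps)
  have ha: "h a = a'" "h' a' = a" using l[of a] l'[of a'] by (simp_all add: h_def h'_def)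
  have hK: "h k = k" "h' k = k" if "k \<in> K" for k
    using l[of k] l'[of k] that a a' by (auto simp: h_def h'_def)
  have hh': "h' (h x) = x" for x
  proof (rule affine_map_eq_id[of "\<lambda>x. L' (L x)" "\<lambda>x. h' (h x)" "- \<beta>' *\<^sub>R ?w + L' (\<beta> *\<^sub>R ?w)" "insert a K"])
    show "linear (\<lambda>x. L' (L x))" using linear_compose[OF lin] by (simp add: o_def)
    show "h' (h x) = - \<beta>' *\<^sub>R ?w + L' (\<beta> *\<^sub>R ?w) + L' (L x)" for x
      unfolding hL hL' by (simp add: linear_add[OF lin(2)])
  qed (use ha hK simplex_affine_hull[OF C] in auto)
  have h'h: "h (h' x) = x" for x
  proof (rule affine_map_eq_id[of "\<lambda>x. L (L' x)" "\<lambda>x. h (h' x)" "\<beta> *\<^sub>R ?w + L (- \<beta>' *\<^sub>R ?w)" "insert a' K"])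
    show "linear (\<lambda>x. L (L' x))" using linear_compose[OF lin(2,1)] by (simp add: o_def)
    show "h (h' x) = \<beta> *\<^sub>R ?w + L (- \<beta>' *\<^sub>R ?w) + L (L' x)" for x
    proof -
      have "h (h' x) = \<beta> *\<^sub>R ?w + L (h' x)" by (rule hL)
      also have "L (h' x) = L (- \<beta>' *\<^sub>R ?w) + L (L' x)" by (simp only: hL' linear_add[OF lin(1)])
      finally show ?thesis by (simp only: add.assoc)
    qed
  qed (use ha hK simplex_affine_hull[OF C'] in auto)
  have "inj L"
  proof (rule injI)
    fix x y assume "L x = L y"
    then have "h x = h y" by (simp add: hL)
    then show "x = y" using hh' by metis
  qed
  then have bij: "bij L" using lin(1) by (simp add: bij_def linear_injective_imp_surjective)
  obtain c where c: "c > 0" "\<And>f::real ^ 'n \<Rightarrow> real. f \<in> borel_measurable borel \<Longrightarrow> (\<integral>x. f (h x) \<partial>lborel) = c * (\<integral>x. f x \<partial>lborel)"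
    using integral_affine_substitution[OF lin(1) bij hL] by blast
  have "h ` insert a K = insert a' K" using ha hK by force
  then have img: "h ` ?T = ?T'" using affine_image_convex_hull[OF lin(1) hL] by simp
  have mem: "h x \<in> ?T' \<longleftrightarrow> x \<in> ?T" for x
  proof
    assume "h x \<in> ?T'"
    then obtain z where z: "z \<in> ?T" "h x = h z" unfolding img[symmetric] by blast
    have "x = z" using arg_cong[OF z(2), of h'] unfolding hh' .
    with z(1) show "x \<in> ?T" by blast
  next
    assume "x \<in> ?T"
    then show "h x \<in> ?T'" unfolding img[symmetric] by (rule imageI)
  qed
  then have ind: "indicator ?T' (h x) = (indicator ?T x :: real)" for x by (simp add: indicator_def)
  have Tm[measurable]: "?T' \<in> sets borel" using simplex_compact[OF C'] by (simp add: borel_compact)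
  have vol: "measure lborel ?T = c * measure lborel ?T'"
    using c(2)[of "indicator ?T'"] by (simp add: ind)
  note CD = C1_D[OF phi]
  have D: "((\<lambda>x. \<phi> (h x)) has_derivative (\<lambda>d. (gradient \<phi> (h x) + (gradient \<phi> (h x) \<bullet> ?w) *\<^sub>R l) \<bullet> d)) (at x)" for x
  proof -
    have "(h has_derivative (\<lambda>d. d + (l \<bullet> d) *\<^sub>R ?w)) (at x)"
      unfolding h_def[abs_def] by (auto intro!: derivative_eq_intros)
    from has_derivative_compose[OF this has_derivative_gradient[OF CD(1)]]
    show ?thesis by (simp add: inner_add_left inner_add_right mult.commute)
  qed
  have hc: "continuous_on UNIV h" unfolding h_def by (intro continuous_intros)
  have gc: "continuous_on UNIV (\<lambda>x. gradient \<phi> (h x) + (gradient \<phi> (h x) \<bullet> ?w) *\<^sub>R l)"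
    by (intro continuous_intros continuous_on_compose2[OF CD(2) hc]) auto
  note hC1 = C1_I[OF D gc]
  have "cone_functional ?T a (\<lambda>x. \<phi> (h x) + (-1) * \<phi> x) = 0"
  proof (rule simplex_cone_functional_eq_0[OF C])
    show "C_k (Suc 0) (\<lambda>x. \<phi> (h x) + (-1) * \<phi> x)" by (rule C1_add_scaled(1)[OF hC1(1) phi])
    fix y assume "y \<in> convex hull (insert a K - {a})"
    then have "y \<in> affine hull K" using a convex_hull_subset_affine_hull by auto
    from affine_map_eq_id[OF lin(1) hL hK(1) this]
    show "\<phi> (h y) + (-1) * \<phi> y = 0" by simp
  qed simp
  then have "cone_functional ?T a (\<lambda>x. \<phi> (h x)) = cone_functional ?T a \<phi>"
    using cone_functional_add_scaled[OF simplex_compact[OF C] hC1(1) phi, of a "-1"] by simp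
  moreover have "cone_functional ?T a (\<lambda>x. \<phi> (h x)) = c * cone_functional ?T' a' \<phi>"
  proof -
    let ?f = "\<lambda>y. indicator ?T' y * (gradient \<phi> y \<bullet> (y - a') + real CARD('n) * \<phi> y)"
    have "(\<lambda>y. gradient \<phi> y \<bullet> (y - a') + real CARD('n) * \<phi> y) \<in> borel_measurable borel"
      by (intro borel_measurable_continuous_onI continuous_intros CD)
    then have fm: "?f \<in> borel_measurable borel" by measurable
    have "cone_functional ?T a (\<lambda>x. \<phi> (h x)) = (\<integral>x. ?f (h x) \<partial>lborel)"
      unfolding cone_functional_def hC1(2)
    proof (rule Bochner_Integration.integral_cong[OF refl])
      fix x
      \<comment> \<open>The linear part of h sends x - a to h x - a'; this makes the radial
        derivative about a that of \<phi> about a'.\<close>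
      have "h x - a' = (x - a) + (l \<bullet> (x - a)) *\<^sub>R ?w"
      proof -
        have lx: "l \<bullet> (x - a) = (l \<bullet> x + \<beta>) - 1" using l[of a] by (simp add: inner_diff_right)
        show ?thesis unfolding lx h_def scaleR_diff_left by simp
      qed
      then have "(gradient \<phi> (h x) + (gradient \<phi> (h x) \<bullet> ?w) *\<^sub>R l) \<bullet> (x - a) = gradient \<phi> (h x) \<bullet> (h x - a')"
        by (simp add: inner_add_left inner_add_right)
      then show "indicator ?T x * ((gradient \<phi> (h x) + (gradient \<phi> (h x) \<bullet> ?w) *\<^sub>R l) \<bullet> (x - a) + real CARD('n) * \<phi> (h x)) = ?f (h x)"
        by (simp add: ind)
    qed
    also have "\<dots> = c * (\<integral>x. ?f x \<partial>lborel)" by (rule c(2)[OF fm])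
    finally show ?thesis by (simp add: cone_functional_def)
  qed
  ultimately have "cone_functional ?T a \<phi> = c * cone_functional ?T' a' \<phi>" by simp
  then show ?thesis unfolding vol by (simp only: mult_ac)
qed

section \<open>Face integrals\<close>

text \<open>The normalised gradient of the barycentric coordinate of a is a witness for the choice
  in \<open>unit_normal\<close>.\<close>

lemma face_unit_normal:
  fixes C :: "(real ^ 'n::finite) set"
  assumes C: "full_simplex C" and a: "a \<in> C"
  shows "norm (unit_normal (convex hull (C - {a}))) = 1"
    and "\<And>x y. x \<in> convex hull (C - {a}) \<Longrightarrow> y \<in> convex hull (C - {a}) \<Longrightarrow> unit_normal (convex hull (C - {a})) \<bullet> (x - y) = 0"
proof -
  let ?F = "convex hull (C - {a})"
  obtain l \<beta> where l: "\<And>c. c \<in> C \<Longrightarrow> l \<bullet> c + \<beta> = (if c = a then 1 else 0)"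
    using affine_interpolation[OF simplex_indep[OF C], of "\<lambda>c. if c = a then 1 else 0"] by blast
  have "\<not> C \<subseteq> {a}"
  proof
    assume "C \<subseteq> {a}"
    then have "card C \<le> card {a}" by (intro card_mono) auto
    then show False using simplex_card[OF C] by simp
  qed
  then obtain k where k: "k \<in> C" "k \<noteq> a" by blast
  have "l \<noteq> 0" using l[OF a] l[OF k(1)] k(2) by auto
  have F0: "l \<bullet> x + \<beta> = 0" if "x \<in> ?F" for x
  proof (rule affine_fun_eq_0[of "C - {a}"])
    fix c assume "c \<in> C - {a}"
    then show "l \<bullet> c + \<beta> = 0" using l[of c] by simp
  next
    show "x \<in> affine hull (C - {a})" using that convex_hull_subset_affine_hull by blast
  qed
  let ?P = "\<lambda>\<nu>. norm \<nu> = 1 \<and> (\<forall>x\<in>?F. \<forall>y\<in>?F. \<nu> \<bullet> (x - y) = 0)"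
  have "?P ((1 / norm l) *\<^sub>R l)"
  proof (intro conjI ballI)
    show "norm ((1 / norm l) *\<^sub>R l) = 1" using \<open>l \<noteq> 0\<close> by simp
    fix x y assume "x \<in> ?F" "y \<in> ?F"
    then have "l \<bullet> (x - y) = 0" using F0[of x] F0[of y] by (simp add: inner_diff_right)
    then show "((1 / norm l) *\<^sub>R l) \<bullet> (x - y) = 0" by simp
  qed
  then have "?P (unit_normal ?F)" unfolding unit_normal_def by (rule someI[of ?P])
  then show "norm (unit_normal ?F) = 1" "\<And>x y. x \<in> ?F \<Longrightarrow> y \<in> ?F \<Longrightarrow> unit_normal ?F \<bullet> (x - y) = 0"
    by blast+
qed

context
  fixes C :: "(real ^ 'n::finite) set" and a :: "real ^ 'n" and F P :: "(real ^ 'n) set" and \<nu> :: "real ^ 'n"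
  assumes C: "full_simplex C" and a: "a \<in> C"
  defines "F \<equiv> convex hull (C - {a})" and "\<nu> \<equiv> unit_normal F"
  defines "P \<equiv> {y + t *\<^sub>R \<nu> | y t. y \<in> F \<and> 0 \<le> t \<and> t \<le> 1}"
begin

lemma face_normal: "\<nu> \<bullet> \<nu> = 1" "\<And>x y. x \<in> F \<Longrightarrow> y \<in> F \<Longrightarrow> \<nu> \<bullet> (x - y) = 0"
  using face_unit_normal[OF C a] unfolding \<nu>_def F_def by (auto simp: norm_eq_1)

lemma face_normal_hull: "x \<in> affine hull F \<Longrightarrow> y \<in> F \<Longrightarrow> \<nu> \<bullet> (x - y) = 0"
proof -
  assume x: "x \<in> affine hull F" and y: "y \<in> F"
  have "\<nu> \<bullet> x + (- (\<nu> \<bullet> y)) = 0"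
  proof (rule affine_fun_eq_0[OF _ x])
    fix c assume "c \<in> F"
    from face_normal(2)[OF this y] show "\<nu> \<bullet> c + (- (\<nu> \<bullet> y)) = 0" by (simp add: inner_diff_right)
  qed
  then show ?thesis by (simp add: inner_diff_right)
qed

lemma face_nonempty: obtains k where "k \<in> C - {a}" "k \<in> F"
proof -
  have "C - {a} \<noteq> {}"
  proof
    assume "C - {a} = {}"
    then have "card C \<le> card {a}" by (intro card_mono) auto
    then show False using simplex_card[OF C] by simp
  qed
  then obtain k where "k \<in> C - {a}" by blast
  then show ?thesis using that[of k] unfolding F_def by (auto intro: hull_inc)
qed

lemma face_compact: "compact F" "convex F"
  unfolding F_def by (simp_all add: compact_convex_hull finite_imp_compact simplex_finite[OF C])

lemma prism_eq: "P = (\<lambda>(y, t). y + t *\<^sub>R \<nu>) ` (F \<times> {0..1})"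
proof (intro set_eqI iffI)
  fix x assume "x \<in> P"
  then obtain y t where "y \<in> F" "0 \<le> t" "t \<le> 1" "x = y + t *\<^sub>R \<nu>" unfolding P_def by blast
  then show "x \<in> (\<lambda>(y, t). y + t *\<^sub>R \<nu>) ` (F \<times> {0..1})" by (intro image_eqI[of _ _ "(y, t)"]) auto
next
  fix x assume "x \<in> (\<lambda>(y, t). y + t *\<^sub>R \<nu>) ` (F \<times> {0..1})"
  then obtain y t where "y \<in> F" "0 \<le> t" "t \<le> 1" "x = y + t *\<^sub>R \<nu>" by auto
  then show "x \<in> P" unfolding P_def by blast
qed

lemma prism_compact: "compact P"
  unfolding prism_eq
  by (intro compact_continuous_image compact_Times face_compact compact_Icc)
    (auto simp: case_prod_unfold intro!: continuous_intros)

lemma prism_convex: "convex P"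
proof -
  have "linear (\<lambda>(y, t). y + t *\<^sub>R \<nu>)"
    by (auto intro!: linearI simp: algebra_simps)
  then show ?thesis
    unfolding prism_eq by (intro convex_linear_image convex_Times face_compact convex_real_interval)
qed

lemma prism_measurable [measurable]: "P \<in> sets borel"
  using prism_compact by (simp add: borel_compact)

lemma prism_closest_point:
  assumes y: "y \<in> F" shows "closest_point (affine hull F) (y + t *\<^sub>R \<nu>) = y"
proof (rule closest_point_unique[symmetric])
  show "\<forall>z\<in>affine hull F. dist (y + t *\<^sub>R \<nu>) y \<le> dist (y + t *\<^sub>R \<nu>) z"
  proof
    fix z assume z: "z \<in> affine hull F"
    have "\<nu> \<bullet> ((y + t *\<^sub>R \<nu>) - z) = t"
      using face_normal_hull[OF z y] face_normal(1) by (simp add: inner_diff_right inner_add_right)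
    then have "\<bar>t\<bar> \<le> norm \<nu> * norm ((y + t *\<^sub>R \<nu>) - z)"
      using Cauchy_Schwarz_ineq2[of \<nu> "(y + t *\<^sub>R \<nu>) - z"] by simp
    then show "dist (y + t *\<^sub>R \<nu>) y \<le> dist (y + t *\<^sub>R \<nu>) z"
      using face_normal(1) by (simp add: dist_norm norm_eq_1[symmetric])
  qed
qed (use y in \<open>auto simp: affine_imp_convex hull_inc\<close>)

text \<open>On the prism the composition with \<open>closest_point\<close> may be replaced by any
  Borel function q that extends g constantly along the normal, for instance by an affine
  one.\<close>

lemma face_integral_eq:
  assumes q: "q \<in> borel_measurable borel" and eq: "\<And>y t. y \<in> F \<Longrightarrow> q (y + t *\<^sub>R \<nu>) = g y"
  shows "face_integral F g = (\<integral>x. indicator P x * q x \<partial>lborel)"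
proof -
  have "face_integral F g = (LINT x:P|lebesgue. g (closest_point (affine hull F) x))"
    by (simp add: face_integral_def P_def \<nu>_def)
  also have "\<dots> = (\<integral>x. indicator P x * q x \<partial>lebesgue)"
    unfolding set_lebesgue_integral_def
  proof (rule Bochner_Integration.integral_cong[OF refl])
    fix x
    have "g (closest_point (affine hull F) x) = q x" if "x \<in> P"
      using that prism_closest_point eq unfolding P_def by auto
    then show "indicator P x *\<^sub>R g (closest_point (affine hull F) x) = indicator P x * q x"
      by (cases "x \<in> P") auto
  qed
  also have "\<dots> = (\<integral>x. indicator P x * q x \<partial>lborel)"
    by (rule integral_completion) (use q in measurable)
  finally show ?thesis .
qed

text \<open>The face has dimension n - 1, and a point shifted along the normal leaves its affine
  hull. So the convex prism has full dimension and nonempty interior.\<close>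

lemma prism_volume_pos: "measure lborel P > 0"
proof -
  obtain k where k: "k \<in> C - {a}" "k \<in> F" by (rule face_nonempty)
  have "k + \<nu> \<notin> affine hull F"
    using face_normal_hull[OF _ k(2), of "k + \<nu>"] face_normal(1) by (auto simp: inner_add_right)
  moreover have "aff_dim F = int CARD('n) - 1"
  proof -
    have "\<not> affine_dependent (C - {a})" using simplex_indep[OF C] affine_dependent_subset by blast
    moreover have "card (C - {a}) = CARD('n)" using simplex_card[OF C] simplex_finite[OF C] a by simp
    ultimately show ?thesis unfolding F_def using aff_dim_affine_independent[of "C - {a}"] by (simp add: aff_dim_convex_hull)
  qed
  ultimately have "aff_dim (insert (k + \<nu>) F) = int CARD('n)" by (simp add: aff_dim_insert)
  moreover have "insert (k + \<nu>) F \<subseteq> P"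
  proof -
    have "k + \<nu> \<in> P" unfolding P_def using k(2) by (intro CollectI exI[of _ k] exI[of _ "1::real"]) simp
    moreover have "y \<in> P" if "y \<in> F" for y
      unfolding P_def using that by (intro CollectI exI[of _ y] exI[of _ "0::real"]) simp
    ultimately show ?thesis by blast
  qed
  ultimately have "int CARD('n) \<le> aff_dim P" using aff_dim_subset by metis
  then have "aff_dim P = int DIM(real ^ 'n)" using aff_dim_le_DIM[of P] by simp
  then have aff: "affine hull P = UNIV" by (simp only: aff_dim_eq_full)
  then have "P \<noteq> {}" by auto
  then have "interior P \<noteq> {}"
    using rel_interior_eq_empty[OF prism_convex] rel_interior_interior[OF aff] by simp
  then have "\<not> negligible P"
    using open_not_negligible[of "interior P"] negligible_subset[OF _ interior_subset] by blast
  moreover have fin: "emeasure lborel P < \<infinity>"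
    using prism_compact by (intro emeasure_bounded_finite compact_imp_bounded)
  ultimately have "emeasure lborel P \<noteq> 0"
    by (auto simp: negligible_iff_null_sets intro!: null_sets_completionI null_setsI)
  then show ?thesis
    using fin by (simp add: measure_def enn2real_positive_iff zero_less_iff_neq_zero)
qed

lemma face_integral_const: "face_integral F (\<lambda>x. c) = c * measure lborel P"
  using face_integral_eq[of "\<lambda>x. c" "\<lambda>x. c"] by simp

text \<open>The reflection that swaps two vertices of the face maps the prism onto itself, so all barycentric
  coordinates of the face have the same mean.\<close>

lemma face_integral_affine_iff:
  "face_integral F (\<lambda>x. m \<bullet> x + \<gamma>) = 0 \<longleftrightarrow> (\<Sum>c\<in>C - {a}. m \<bullet> c + \<gamma>) = 0"
proof -
  obtain k0 where k0: "k0 \<in> C - {a}" "k0 \<in> F" by (rule face_nonempty)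
  obtain l \<beta> where l: "\<And>b c. b \<in> C \<Longrightarrow> c \<in> C \<Longrightarrow> l b \<bullet> c + \<beta> b = (if b = c then 1 else 0)"
    "\<And>m \<gamma> x. m \<bullet> x + \<gamma> = (\<Sum>c\<in>C. (m \<bullet> c + \<gamma>) * (l c \<bullet> x + \<beta> c))"
    using barycentric_coordinates[OF C] by blast
  have CF: "c \<in> F" if "c \<in> C - {a}" for c unfolding F_def using that by (rule hull_inc)
  \<comment> \<open>The orthogonal projection onto the hyperplane of the face. Below,
    \<open>q b\<close> is the barycentric coordinate of b made constant along the normal, and
    \<open>g b\<close> is the gradient of \<open>q b\<close>.\<close>
  define \<pi> where "\<pi> x = x - (\<nu> \<bullet> (x - k0)) *\<^sub>R \<nu>" for x
  have piF: "\<pi> (y + t *\<^sub>R \<nu>) = y" if "y \<in> F" for y t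
    using face_normal(1) face_normal(2)[OF that k0(2)] unfolding \<pi>_def
    by (simp add: inner_diff_right inner_add_right)
  have piF0: "\<pi> y = y" if "y \<in> F" for y using piF[OF that, of 0] by simp
  define g where "g b = l b - (l b \<bullet> \<nu>) *\<^sub>R \<nu>" for b
  define q where "q b x = l b \<bullet> \<pi> x + \<beta> b" for b x
  have q_eq: "q b (x + h) = q b x + g b \<bullet> h" for b x h
    unfolding q_def \<pi>_def g_def by (simp add: inner_diff_left inner_diff_right inner_add_right algebra_simps inner_commute)
  have qm[measurable]: "q b \<in> borel_measurable borel" for b
    unfolding q_def \<pi>_def by (intro borel_measurable_continuous_onI continuous_intros)
  have qF: "q b c = (if b = c then 1 else 0)" if "b \<in> C" "c \<in> C - {a}" for b c
    using l(1)[of b c] that piF0[OF CF[OF that(2)]] by (simp add: q_def)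
  have gn: "g b \<bullet> \<nu> = 0" for b using face_normal(1) by (simp add: g_def inner_diff_left)
  have qa: "q a x = 0" if xP: "x \<in> P" for x
  proof -
    obtain y t where y: "y \<in> F" "x = y + t *\<^sub>R \<nu>" using xP unfolding P_def by blast
    have "l a \<bullet> y + \<beta> a = 0"
    proof (rule affine_fun_eq_0[of "C - {a}"])
      fix c assume "c \<in> C - {a}"
      then show "l a \<bullet> c + \<beta> a = 0" using l(1)[OF a, of c] by auto
    next
      show "y \<in> affine hull (C - {a})" using y(1) convex_hull_subset_affine_hull unfolding F_def by blast
    qed
    then show ?thesis unfolding q_def y(2) piF[OF y(1)] .
  qed
  have swap: "(\<integral>x. indicator P x * q b x \<partial>lborel) = (\<integral>x. indicator P x * q c x \<partial>lborel)"
    if b: "b \<in> C - {a}" and c: "c \<in> C - {a}" for b c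
  proof (cases "b = c")
    case False
    let ?w = "c - b" and ?\<delta> = "\<lambda>x. q b x - q c x"
    have gw: "g b \<bullet> ?w = -1" "g c \<bullet> ?w = 1"
      using q_eq[of b b ?w] q_eq[of c b ?w] qF[of b b] qF[of b c] qF[of c b] qF[of c c] b c False by auto
    \<comment> \<open>An affine involution that moves points parallel to c - b; it exchanges b and
      c, fixes the other vertices of the face and commutes with translations along the
      normal.\<close>
    define A where "A x = x + ?\<delta> x *\<^sub>R ?w" for x
    define L where "L x = x + ((g b - g c) \<bullet> x) *\<^sub>R ?w" for x
    have AL: "A x = ?\<delta> 0 *\<^sub>R ?w + L x" for x
      using q_eq[of b 0 x] q_eq[of c 0 x] by (simp add: A_def L_def inner_diff_left algebra_simps)
    have lin: "linear L" unfolding L_def by (auto intro!: linearI simp: inner_add_right algebra_simps)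
    have qA: "q b (A x) = q c x" "q c (A x) = q b x" for x
      using gw by (simp_all add: A_def q_eq)
    have AA: "A (A x) = x" for x
    proof -
      have "A (A x) = A x + (q c x - q b x) *\<^sub>R ?w" unfolding A_def[of "A x"] qA ..
      then show ?thesis by (simp add: A_def algebra_simps)
    qed
    have "inj L"
    proof (rule injI)
      fix x y assume "L x = L y"
      then have "A x = A y" by (simp add: AL)
      from arg_cong[OF this, of A] show "x = y" unfolding AA .
    qed
    then have bij: "bij L" using lin by (simp add: bij_def linear_injective_imp_surjective)
    obtain k where kk: "k > 0" "\<And>f::real ^ 'n \<Rightarrow> real. f \<in> borel_measurable borel \<Longrightarrow> (\<integral>x. f (A x) \<partial>lborel) = k * (\<integral>x. f x \<partial>lborel)"
      using integral_affine_substitution[OF lin bij AL] by blast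
    have "A d \<in> C - {a}" if "d \<in> C - {a}" for d
      using that qF[of b d] qF[of c d] b c by (auto simp: A_def split: if_splits)
    then have "A ` (C - {a}) \<subseteq> C - {a}" by blast
    then have AF: "A ` F \<subseteq> F" unfolding F_def affine_image_convex_hull[OF lin AL] by (rule hull_mono)
    have AP: "A x \<in> P" if xP: "x \<in> P" for x
    proof -
      obtain y t where y: "y \<in> F" "0 \<le> t" "t \<le> 1" "x = y + t *\<^sub>R \<nu>" using xP unfolding P_def by blast
      have "A x = A y + t *\<^sub>R \<nu>" unfolding y(4) A_def by (simp add: q_eq gn)
      moreover have "A y \<in> F" using AF y(1) by blast
      ultimately show ?thesis unfolding P_def using y by blast
    qed
    have ind: "indicator P (A x) = (indicator P x :: real)" for x
      using AP[of x] AP[of "A x"] unfolding AA by (auto simp: indicator_def)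
    \<comment> \<open>As A maps the prism onto itself, comparing volumes determines the factor of
      the substitution.\<close>
    have "measure lborel P = k * measure lborel P" using kk(2)[of "indicator P"] by (simp add: ind)
    then have "k = 1" using prism_volume_pos by simp
    moreover have "(\<integral>x. indicator P (A x) * q b (A x) \<partial>lborel) = k * (\<integral>x. indicator P x * q b x \<partial>lborel)"
      by (rule kk(2)) measurable
    ultimately show ?thesis by (simp add: ind qA)
  qed simp
  let ?I = "\<integral>x. indicator P x * q k0 x \<partial>lborel"
  have int: "integrable lborel (\<lambda>x. indicator P x * q c x)" for c
    by (rule integrable_on_compact[OF prism_compact]) (auto simp: q_def \<pi>_def intro!: continuous_intros)
  have eq: "face_integral F (\<lambda>x. m \<bullet> x + \<gamma>) = (\<Sum>c\<in>C - {a}. m \<bullet> c + \<gamma>) * ?I" for m \<gamma>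
  proof -
    have "face_integral F (\<lambda>x. m \<bullet> x + \<gamma>) = (\<integral>x. indicator P x * (m \<bullet> \<pi> x + \<gamma>) \<partial>lborel)"
    proof (rule face_integral_eq)
      show "(\<lambda>x. m \<bullet> \<pi> x + \<gamma>) \<in> borel_measurable borel"
        unfolding \<pi>_def by (intro borel_measurable_continuous_onI continuous_intros)
    qed (simp only: piF)
    also have "\<dots> = (\<integral>x. (\<Sum>c\<in>C - {a}. (m \<bullet> c + \<gamma>) * (indicator P x * q c x)) \<partial>lborel)"
    proof (rule Bochner_Integration.integral_cong[OF refl])
      fix x
      show "indicator P x * (m \<bullet> \<pi> x + \<gamma>) = (\<Sum>c\<in>C - {a}. (m \<bullet> c + \<gamma>) * (indicator P x * q c x))"
      proof (cases "x \<in> P")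
        case True
        have "m \<bullet> \<pi> x + \<gamma> = (\<Sum>c\<in>C. (m \<bullet> c + \<gamma>) * q c x)" unfolding q_def by (rule l(2))
        also have "\<dots> = (m \<bullet> a + \<gamma>) * q a x + (\<Sum>c\<in>C - {a}. (m \<bullet> c + \<gamma>) * q c x)"
          by (rule sum.remove[OF simplex_finite[OF C] a])
        finally show ?thesis using True qa[OF True] by simp
      qed simp
    qed
    also have "\<dots> = (\<Sum>c\<in>C - {a}. (m \<bullet> c + \<gamma>) * (\<integral>x. indicator P x * q c x \<partial>lborel))"
      using int by simp
    also have "\<dots> = (\<Sum>c\<in>C - {a}. (m \<bullet> c + \<gamma>) * ?I)"
      using swap[OF _ k0(1)] by simp
    finally show ?thesis by (simp only: sum_distrib_right)
  qed
  \<comment> \<open>For the constant function 1 the face integral is the volume of the prism, so the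
    common factor cannot vanish.\<close>
  have "?I \<noteq> 0"
    using eq[of 0 1] face_integral_const[of 1] prism_volume_pos by auto
  then show ?thesis using eq by simp
qed

end

section \<open>Symmetric forms on finite-dimensional function spaces\<close>

definition fun_subspace :: "('a \<Rightarrow> real) set \<Rightarrow> bool" where
  "fun_subspace W \<longleftrightarrow> (\<lambda>x. 0) \<in> W \<and> (\<forall>v\<in>W. \<forall>w\<in>W. \<forall>c. (\<lambda>x. v x + c * w x) \<in> W)"

lemma fun_subspace_add_scaled: "fun_subspace W \<Longrightarrow> v \<in> W \<Longrightarrow> w \<in> W \<Longrightarrow> (\<lambda>x. v x + c * w x) \<in> W"
  by (simp add: fun_subspace_def)

lemma fun_subspace_zero: "fun_subspace W \<Longrightarrow> (\<lambda>x. 0) \<in> W"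
  by (simp add: fun_subspace_def)

text \<open>Functions satisfying \<open>N\<close> count as zero: they differ from \<open>0\<close> on a null set only.\<close>

lemma finite_dim_induct [consumes 3]:
  fixes b :: "'i \<Rightarrow> 'a \<Rightarrow> real"
  assumes fin: "finite I" and sub: "fun_subspace W"
    and gen: "\<And>v. v \<in> W \<Longrightarrow> \<exists>c. N (\<lambda>x. v x - (\<Sum>i\<in>I. c i * b i x))"
    and Nlin: "\<And>v w c. N v \<Longrightarrow> N w \<Longrightarrow> N (\<lambda>x. v x + c * w x)"
    and base: "\<And>W. fun_subspace W \<Longrightarrow> (\<And>v. v \<in> W \<Longrightarrow> N v) \<Longrightarrow> P W"
    and step: "\<And>W W0 w. fun_subspace W \<Longrightarrow> fun_subspace W0 \<Longrightarrow> W0 \<subseteq> W \<Longrightarrow> w \<in> W \<Longrightarrow>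
      (\<And>v. v \<in> W \<Longrightarrow> \<exists>c. (\<lambda>x. v x - c * w x) \<in> W0) \<Longrightarrow> P W0 \<Longrightarrow> P W"
  shows "P W"
  using fin sub gen
proof (induction I arbitrary: W rule: finite_induct)
  case empty
  have "N v" if "v \<in> W" for v using empty(2)[OF that] by simp
  then show ?case by (rule base[OF empty(1)])
next
  case (insert j I)
  \<comment> \<open>The functions in W that can be represented without the generator
    \<open>b j\<close>.\<close>
  define W0 where "W0 = {v \<in> W. \<exists>c. N (\<lambda>x. v x - (\<Sum>i\<in>I. c i * b i x))}"
  have comb: "\<exists>e. N (\<lambda>x. (v x + r * w x) - (\<Sum>i\<in>J. e i * b i x))"
    if "N (\<lambda>x. v x - (\<Sum>i\<in>J. c i * b i x))" "N (\<lambda>x. w x - (\<Sum>i\<in>J. d i * b i x))" for J v w c d r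
  proof
    have "(\<lambda>x. (v x + r * w x) - (\<Sum>i\<in>J. (c i + r * d i) * b i x)) =
        (\<lambda>x. (v x - (\<Sum>i\<in>J. c i * b i x)) + r * (w x - (\<Sum>i\<in>J. d i * b i x)))"
      by (simp add: algebra_simps sum.distrib sum_distrib_left)
    then show "N (\<lambda>x. (v x + r * w x) - (\<Sum>i\<in>J. (c i + r * d i) * b i x))"
      using Nlin[OF that, of r] by simp
  qed
  have sub0: "fun_subspace W0"
    unfolding fun_subspace_def
  proof (intro conjI ballI allI)
    obtain c where "N (\<lambda>x. 0 - (\<Sum>i\<in>insert j I. c i * b i x))"
      using insert.prems(2)[OF fun_subspace_zero[OF insert.prems(1)]] by blast
    from Nlin[OF this this, of "-1"] have N0: "N (\<lambda>x. 0)" by simp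
    then show "(\<lambda>x. 0) \<in> W0" using fun_subspace_zero[OF insert.prems(1)] by (auto simp: W0_def intro!: exI[of _ "\<lambda>i. 0"])
    fix v w r assume v: "v \<in> W0" and w: "w \<in> W0"
    then obtain c d where "N (\<lambda>x. v x - (\<Sum>i\<in>I. c i * b i x))" "N (\<lambda>x. w x - (\<Sum>i\<in>I. d i * b i x))"
      unfolding W0_def by blast
    from comb[OF this] show "(\<lambda>x. v x + r * w x) \<in> W0"
      using v w fun_subspace_add_scaled[OF insert.prems(1)] by (simp add: W0_def)
  qed
  have P0: "P W0" by (rule insert.IH[OF sub0]) (simp add: W0_def)
  show ?case
  proof (cases "W \<subseteq> W0")
    case True
    then have "W0 = W" by (auto simp: W0_def)
    then show ?thesis using P0 by simp
  next
    case False
    then obtain w where w: "w \<in> W" "w \<notin> W0" by blast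
    obtain d where d: "N (\<lambda>x. w x - (\<Sum>i\<in>insert j I. d i * b i x))" using insert.prems(2)[OF w(1)] by blast
    have dj: "d j \<noteq> 0"
    proof
      assume "d j = 0"
      then have "N (\<lambda>x. w x - (\<Sum>i\<in>I. d i * b i x))" using d insert.hyps by simp
      then show False using w by (auto simp: W0_def)
    qed
    show ?thesis
    proof (rule step[OF insert.prems(1) sub0 _ w(1) _ P0])
      show "W0 \<subseteq> W" by (auto simp: W0_def)
      fix v assume v: "v \<in> W"
      obtain c where c: "N (\<lambda>x. v x - (\<Sum>i\<in>insert j I. c i * b i x))" using insert.prems(2)[OF v] by blast
      \<comment> \<open>One step of Gaussian elimination: subtracting this multiple of w removes the
        coefficient of \<open>b j\<close>.\<close>
      let ?r = "c j / d j"
      have "(\<lambda>x. (v x - (\<Sum>i\<in>insert j I. c i * b i x)) + (- ?r) * (w x - (\<Sum>i\<in>insert j I. d i * b i x))) =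
          (\<lambda>x. (v x - ?r * w x) - (\<Sum>i\<in>I. (c i - ?r * d i) * b i x))"
      proof
        fix x
        have "(\<Sum>i\<in>I. (c i - ?r * d i) * b i x) = (\<Sum>i\<in>I. c i * b i x) - ?r * (\<Sum>i\<in>I. d i * b i x)"
          by (simp only: sum_subtractf sum_distrib_left left_diff_distrib mult.assoc)
        then show "(v x - (\<Sum>i\<in>insert j I. c i * b i x)) + (- ?r) * (w x - (\<Sum>i\<in>insert j I. d i * b i x)) =
            (v x - ?r * w x) - (\<Sum>i\<in>I. (c i - ?r * d i) * b i x)"
          using insert.hyps dj by (simp add: field_simps)
      qed
      then have "N (\<lambda>x. (v x - ?r * w x) - (\<Sum>i\<in>I. (c i - ?r * d i) * b i x))"
        using Nlin[OF c d, of "- ?r"] by simp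
      moreover have "(\<lambda>x. v x - ?r * w x) \<in> W"
        using fun_subspace_add_scaled[OF insert.prems(1) v w(1), of "- ?r"] by simp
      ultimately have "(\<lambda>x. v x - ?r * w x) \<in> W0"
        unfolding W0_def by (intro CollectI conjI exI[of _ "\<lambda>i. c i - ?r * d i"])
      then show "\<exists>r. (\<lambda>x. v x - r * w x) \<in> W0" by blast
    qed
  qed
qed

context
  fixes V :: "('a \<Rightarrow> real) set" and B :: "('a \<Rightarrow> real) \<Rightarrow> ('a \<Rightarrow> real) \<Rightarrow> real"
    and N :: "('a \<Rightarrow> real) \<Rightarrow> bool" and I :: "'i set" and b :: "'i \<Rightarrow> 'a \<Rightarrow> real"
  assumes V: "fun_subspace V" and fin: "finite I"
    and gen: "\<And>v. v \<in> V \<Longrightarrow> \<exists>c. N (\<lambda>x. v x - (\<Sum>i\<in>I. c i * b i x))"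
    and Nlin: "\<And>v w c. N v \<Longrightarrow> N w \<Longrightarrow> N (\<lambda>x. v x + c * w x)"
    and Badd: "\<And>u v w c. u \<in> V \<Longrightarrow> v \<in> V \<Longrightarrow> w \<in> V \<Longrightarrow> B (\<lambda>x. u x + c * v x) w = B u w + c * B v w"
    and Bsym: "\<And>u v. u \<in> V \<Longrightarrow> v \<in> V \<Longrightarrow> B u v = B v u"
    and Bpos: "\<And>v. v \<in> V \<Longrightarrow> 0 \<le> B v v"
    and BN: "\<And>v. v \<in> V \<Longrightarrow> N v \<Longrightarrow> B v v = 0"
begin

text \<open>The degenerate case of Cauchy-Schwarz for a semidefinite form: otherwise a suitable w +
  t v would have energy -1.\<close>

lemma form_null:
  assumes "v \<in> V" "w \<in> V" "B v v = 0" shows "B v w = 0"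
proof (rule ccontr)
  assume nz: "B v w \<noteq> 0"
  define t where "t = - (B w w + 1) / (2 * B v w)"
  have vw: "(\<lambda>x. w x + t * v x) \<in> V" by (rule fun_subspace_add_scaled[OF V assms(2,1)])
  have "0 \<le> B (\<lambda>x. w x + t * v x) (\<lambda>x. w x + t * v x)" by (rule Bpos[OF vw])
  also have "\<dots> = B w (\<lambda>x. w x + t * v x) + t * B v (\<lambda>x. w x + t * v x)"
    by (rule Badd[OF assms(2,1) vw])
  also have "\<dots> = B w w + 2 * t * B v w"
    using Bsym[OF assms(2) vw] Bsym[OF assms(1) vw] Badd[OF assms(2,1,2), of t] Badd[OF assms(2,1,1), of t] assms(3) Bsym[OF assms(1,2)]
    by simp
  also have "\<dots> = -1" using nz by (simp add: t_def field_simps)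
  finally show False by simp
qed

text \<open>Representation of functionals and the bound of a seminorm Q by the energy seminorm share
  one induction over the dimension. Functions of energy zero need not vanish pointwise, hence the
  premises that the functional and Q vanish on them.\<close>

lemma finite_dim_Riesz_aux:
  "(\<forall>l. (\<forall>u\<in>V. \<forall>v\<in>V. \<forall>c. l (\<lambda>x. u x + c * v x) = l u + c * l v) \<and> (\<forall>v\<in>V. B v v = 0 \<longrightarrow> l v = 0) \<longrightarrow>
      (\<exists>z\<in>V. \<forall>v\<in>V. B z v = l v)) \<and>
   (\<forall>Q. (\<forall>v\<in>V. 0 \<le> Q v) \<and> (\<forall>u\<in>V. \<forall>v\<in>V. \<forall>c. Q (\<lambda>x. u x + c * v x) \<le> Q u + \<bar>c\<bar> * Q v) \<and> (\<forall>v\<in>V. B v v = 0 \<longrightarrow> Q v = 0) \<longrightarrow>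
      (\<exists>K\<ge>0. \<forall>v\<in>V. Q v \<le> K * sqrt (B v v)))"
proof -
  define A where "A W = ((\<forall>l. (\<forall>u\<in>W. \<forall>v\<in>W. \<forall>c. l (\<lambda>x. u x + c * v x) = l u + c * l v) \<and> (\<forall>v\<in>W. B v v = 0 \<longrightarrow> l v = 0) \<longrightarrow>
      (\<exists>z\<in>W. \<forall>v\<in>W. B z v = l v)))" for W
  define E where "E W = (\<forall>Q. (\<forall>v\<in>W. 0 \<le> Q v) \<and> (\<forall>u\<in>W. \<forall>v\<in>W. \<forall>c. Q (\<lambda>x. u x + c * v x) \<le> Q u + \<bar>c\<bar> * Q v) \<and> (\<forall>v\<in>W. B v v = 0 \<longrightarrow> Q v = 0) \<longrightarrow>
      (\<exists>K\<ge>0. \<forall>v\<in>W. Q v \<le> K * sqrt (B v v)))" for W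
  have "V \<subseteq> V \<longrightarrow> A V \<and> E V"
  proof (rule finite_dim_induct[where P="\<lambda>W. W \<subseteq> V \<longrightarrow> A W \<and> E W", OF fin V gen Nlin])
    fix W assume W: "fun_subspace W" and null: "\<And>v. v \<in> W \<Longrightarrow> N v"
    show "W \<subseteq> V \<longrightarrow> A W \<and> E W"
    proof (intro impI conjI)
      assume WV: "W \<subseteq> V"
      have B0: "B v v = 0" if "v \<in> W" for v using BN null that WV by blast
      have B0': "B v w = 0" if "v \<in> W" "w \<in> W" for v w using form_null B0 that WV by blast
      show "A W" unfolding A_def using fun_subspace_zero[OF W] B0 B0' by (metis (no_types, lifting))
      show "E W" unfolding E_def using B0 by (intro allI impI exI[of _ 0]) auto
    qed
  next
    fix W W0 :: "('a \<Rightarrow> real) set" and w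
    assume W: "fun_subspace W" and W0: "fun_subspace W0" "W0 \<subseteq> W" and w: "w \<in> W"
      and dec: "\<And>v. v \<in> W \<Longrightarrow> \<exists>c. (\<lambda>x. v x - c * w x) \<in> W0" and IH: "W0 \<subseteq> V \<longrightarrow> A W0 \<and> E W0"
    show "W \<subseteq> V \<longrightarrow> A W \<and> E W"
    proof
      assume WV: "W \<subseteq> V"
      then have A0: "A W0" and E0: "E W0" using IH W0(2) by auto
      have wV: "w \<in> V" using w WV by blast
      have W0V: "v \<in> V" if "v \<in> W0" for v using that W0(2) WV by blast
      have "(\<forall>u\<in>W0. \<forall>v\<in>W0. \<forall>c. B w (\<lambda>x. u x + c * v x) = B w u + c * B w v)"
        using Badd[OF W0V W0V wV] Bsym[OF wV] W0V fun_subspace_add_scaled[OF W0(1)] by simp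
      moreover have "\<forall>v\<in>W0. B v v = 0 \<longrightarrow> B w v = 0"
        using form_null[OF W0V wV] Bsym[OF wV W0V] by simp
      \<comment> \<open>Applied to the functional \<open>B w\<close>, the induction hypothesis
        yields the projection p of w onto W0. Then q = w - p is orthogonal to W0 and spans W
        together with it.\<close>
      ultimately obtain p where p: "p \<in> W0" "\<forall>v\<in>W0. B p v = B w v"
        using A0[unfolded A_def, rule_format, of "B w"] by blast
      define q where "q = (\<lambda>x. w x + (-1) * p x)"
      have pW: "p \<in> W" using p(1) W0(2) by blast
      have qW: "q \<in> W" unfolding q_def by (rule fun_subspace_add_scaled[OF W w pW])
      then have qV: "q \<in> V" using WV by blast
      have orth: "B q v = 0" if "v \<in> W0" for v
        using Badd[OF wV W0V[OF p(1)] W0V[OF that], of "-1"] p(2) that unfolding q_def by simp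
      have split: "\<exists>u\<in>W0. \<exists>c. v = (\<lambda>x. u x + c * q x)" if v: "v \<in> W" for v
      proof -
        obtain c where c: "(\<lambda>x. v x - c * w x) \<in> W0" using dec[OF v] by blast
        have "(\<lambda>x. (v x - c * w x) + c * p x) \<in> W0" by (rule fun_subspace_add_scaled[OF W0(1) c p(1)])
        moreover have "v = (\<lambda>x. ((v x - c * w x) + c * p x) + c * q x)" by (simp add: q_def algebra_simps)
        ultimately show ?thesis
          by (intro bexI[of _ "\<lambda>x. (v x - c * w x) + c * p x"] exI[of _ c])
      qed
      show "A W \<and> E W"
      proof
        show "A W"
          unfolding A_def
        proof (intro allI impI, elim conjE)
          fix l assume lin: "\<forall>u\<in>W. \<forall>v\<in>W. \<forall>c. l (\<lambda>x. u x + c * v x) = l u + c * l v"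
            and ker: "\<forall>v\<in>W. B v v = 0 \<longrightarrow> l v = 0"
          have "\<forall>u\<in>W0. \<forall>v\<in>W0. \<forall>c. l (\<lambda>x. u x + c * v x) = l u + c * l v" "\<forall>v\<in>W0. B v v = 0 \<longrightarrow> l v = 0"
            using lin ker W0(2) by blast+
          then obtain z where z: "z \<in> W0" "\<forall>v\<in>W0. B z v = l v"
            using A0[unfolded A_def, rule_format, of l] by blast
          have zW: "z \<in> W" using z(1) W0(2) by blast
          \<comment> \<open>If \<open>B q q = 0\<close>, then \<open>l q = 0\<close> by assumption
            and c = 0 by the convention on division, so that \<open>cq\<close> holds in both
            cases.\<close>
          define c where "c = l q / B q q"
          have cq: "c * B q q = l q"
            using ker qW by (cases "B q q = 0") (auto simp: c_def)
          show "\<exists>z\<in>W. \<forall>v\<in>W. B z v = l v"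
          proof (intro bexI ballI)
            show zc: "(\<lambda>x. z x + c * q x) \<in> W" by (rule fun_subspace_add_scaled[OF W zW qW])
            fix v assume v: "v \<in> W"
            obtain u d where u: "u \<in> W0" "v = (\<lambda>x. u x + d * q x)" using split[OF v] by blast
            have uV: "u \<in> V" and vV: "v \<in> V" and zV: "z \<in> V" using u(1) v z(1) W0V WV by auto
            have Bv: "B y v = B y u + d * B y q" if "y \<in> V" for y
              using Badd[OF uV qV that, of d] Bsym[OF that vV] Bsym[OF that uV] Bsym[OF that qV] by (simp add: u(2))
            have "B (\<lambda>x. z x + c * q x) v = B z v + c * B q v" by (rule Badd[OF zV qV vV])
            also have "\<dots> = B z u + d * B z q + c * (B q u + d * B q q)" using Bv[OF zV] Bv[OF qV] by simp
            also have "\<dots> = l u + d * (c * B q q)" using z u(1) orth[OF u(1)] orth[OF z(1)] Bsym[OF zV qV] by simp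
            also have "\<dots> = l v" unfolding cq using lin u W0(2) qW by auto
            finally show "B (\<lambda>x. z x + c * q x) v = l v" .
          qed
        qed
        show "E W"
          unfolding E_def
        proof (intro allI impI, elim conjE)
          fix Q assume Q0: "\<forall>v\<in>W. 0 \<le> Q v" and Qadd: "\<forall>u\<in>W. \<forall>v\<in>W. \<forall>c. Q (\<lambda>x. u x + c * v x) \<le> Q u + \<bar>c\<bar> * Q v"
            and ker: "\<forall>v\<in>W. B v v = 0 \<longrightarrow> Q v = 0"
          have "(\<forall>v\<in>W0. 0 \<le> Q v) \<and> (\<forall>u\<in>W0. \<forall>v\<in>W0. \<forall>c. Q (\<lambda>x. u x + c * v x) \<le> Q u + \<bar>c\<bar> * Q v) \<and> (\<forall>v\<in>W0. B v v = 0 \<longrightarrow> Q v = 0)"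
            using Q0 Qadd ker W0(2) by blast
          then obtain K where K: "K \<ge> 0" "\<forall>v\<in>W0. Q v \<le> K * sqrt (B v v)"
            using E0[unfolded E_def, rule_format, of Q] by blast
          let ?s = "sqrt (B q q)"
          show "\<exists>K\<ge>0. \<forall>v\<in>W. Q v \<le> K * sqrt (B v v)"
          proof (intro exI conjI ballI)
            \<comment> \<open>By orthogonality the energies of u and of d q are at most that of v;
              this gives one summand each. If q has energy zero, the quotient is 0, and so is
              \<open>Q q\<close>.\<close>
            show "0 \<le> K + Q q / ?s" using K(1) Q0 qW Bpos[OF qV] by simp
            fix v assume v: "v \<in> W"
            obtain u d where u: "u \<in> W0" "v = (\<lambda>x. u x + d * q x)" using split[OF v] by blast
            have uV: "u \<in> V" and vV: "v \<in> V" using u(1) v W0V WV by auto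
            have "B v v = B u v + d * B q v" using Badd[OF uV qV vV, of d] by (simp add: u(2))
            also have "B u v = B u u + d * B u q"
              using Badd[OF uV qV uV, of d] Bsym[OF uV vV] Bsym[OF uV qV] by (simp add: u(2))
            also have "B q v = B q u + d * B q q"
              using Badd[OF uV qV qV, of d] Bsym[OF qV vV] Bsym[OF qV uV] by (simp add: u(2))
            finally have Bvv: "B v v = B u u + d\<^sup>2 * B q q"
              using orth[OF u(1)] Bsym[OF uV qV] by (simp add: power2_eq_square)
            have "B u u \<le> B v v" using Bvv Bpos[OF qV] by simp
            then have 1: "K * sqrt (B u u) \<le> K * sqrt (B v v)" using K(1) by (intro mult_left_mono) auto
            have 2: "\<bar>d\<bar> * Q q \<le> Q q / ?s * sqrt (B v v)"
            proof (cases "B q q = 0")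
              case True
              then show ?thesis using ker qW by simp
            next
              case False
              then have s: "?s > 0" using Bpos[OF qV] by simp
              have "d\<^sup>2 * B q q \<le> B v v" using Bvv Bpos[OF uV] by simp
              then have "sqrt (d\<^sup>2 * B q q) \<le> sqrt (B v v)" by (rule real_sqrt_le_mono)
              then have "\<bar>d\<bar> * ?s \<le> sqrt (B v v)" by (simp add: real_sqrt_mult)
              then have "\<bar>d\<bar> \<le> sqrt (B v v) / ?s" using s by (simp add: field_simps)
              then have "\<bar>d\<bar> * Q q \<le> (sqrt (B v v) / ?s) * Q q" using Q0 qW by (intro mult_right_mono) auto
              then show ?thesis by (simp add: mult.commute)
            qed
            have "Q v \<le> Q u + \<bar>d\<bar> * Q q" using Qadd u W0(2) qW by auto
            also have "\<dots> \<le> (K + Q q / ?s) * sqrt (B v v)"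
              using K(2) u(1) 1 2 unfolding distrib_right by fastforce
            finally show "Q v \<le> (K + Q q / ?s) * sqrt (B v v)" .
          qed
        qed
      qed
    qed
  qed
  then show ?thesis unfolding A_def E_def by simp
qed

lemma finite_dim_Riesz:
  assumes "\<And>u v c. u \<in> V \<Longrightarrow> v \<in> V \<Longrightarrow> l (\<lambda>x. u x + c * v x) = l u + c * l v"
    and "\<And>v. v \<in> V \<Longrightarrow> B v v = 0 \<Longrightarrow> l v = 0"
  obtains z where "z \<in> V" "\<And>v. v \<in> V \<Longrightarrow> B z v = l v"
proof -
  have "\<exists>z\<in>V. \<forall>v\<in>V. B z v = l v"
  proof (rule finite_dim_Riesz_aux[THEN conjunct1, THEN spec, THEN mp], intro conjI ballI allI impI)
    show "l (\<lambda>x. u x + c * v x) = l u + c * l v" if "u \<in> V" "v \<in> V" for u v c by (rule assms(1)[OF that])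
    show "l v = 0" if "v \<in> V" "B v v = 0" for v by (rule assms(2)[OF that])
  qed
  then show ?thesis using that by (elim bexE) simp
qed

lemma finite_dim_norm_bound:
  assumes "\<And>v. v \<in> V \<Longrightarrow> 0 \<le> Q v" and "\<And>u v c. u \<in> V \<Longrightarrow> v \<in> V \<Longrightarrow> Q (\<lambda>x. u x + c * v x) \<le> Q u + \<bar>c\<bar> * Q v"
    and "\<And>v. v \<in> V \<Longrightarrow> B v v = 0 \<Longrightarrow> Q v = 0"
  obtains K where "K \<ge> 0" "\<And>v. v \<in> V \<Longrightarrow> Q v \<le> K * sqrt (B v v)"
proof -
  have "\<exists>K\<ge>0. \<forall>v\<in>V. Q v \<le> K * sqrt (B v v)"
  proof (rule finite_dim_Riesz_aux[THEN conjunct2, THEN spec, THEN mp], intro conjI ballI allI impI)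
    show "0 \<le> Q v" if "v \<in> V" for v by (rule assms(1)[OF that])
    show "Q (\<lambda>x. u x + c * v x) \<le> Q u + \<bar>c\<bar> * Q v" if "u \<in> V" "v \<in> V" for u v c by (rule assms(2)[OF that])
    show "Q v = 0" if "v \<in> V" "B v v = 0" for v by (rule assms(3)[OF that])
  qed
  then show ?thesis using that by (elim exE conjE) simp
qed

end

section \<open>Mesh topology\<close>

text \<open>A domain that lies locally above a graph has no slits: arbitrarily close to a boundary
  point there are open sets below the graph that miss the domain, so the point is not interior to
  the closure.\<close>

lemma interior_closure_polyhedral_lipschitz_domain:
  assumes "polyhedral_lipschitz_domain \<Omega>" shows "interior (closure \<Omega>) = \<Omega>"
proof
  have o: "open \<Omega>" using assms by (simp add: polyhedral_lipschitz_domain_def)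
  then show "\<Omega> \<subseteq> interior (closure \<Omega>)" by (simp add: closure_subset interior_maximal)
  show "interior (closure \<Omega>) \<subseteq> \<Omega>"
  proof
    fix x assume x: "x \<in> interior (closure \<Omega>)"
    show "x \<in> \<Omega>"
    proof (rule ccontr)
      assume xn: "x \<notin> \<Omega>"
      have "x \<in> frontier \<Omega>"
        using x xn interior_subset o by (auto simp: frontier_def interior_open)
      then obtain r e L \<gamma> where r: "r > 0" and e: "norm e = 1" and g: "L-lipschitz_on {z. z \<bullet> e = 0} \<gamma>"
        and eq: "\<Omega> \<inter> ball x r = {y \<in> ball x r. \<gamma> (y - (y \<bullet> e) *\<^sub>R e) < y \<bullet> e}"
        using assms unfolding polyhedral_lipschitz_domain_def by blast
      have ee: "e \<bullet> e = 1" using e by (simp add: norm_eq_1)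
      define h where "h y = \<gamma> (y - (y \<bullet> e) *\<^sub>R e) - y \<bullet> e" for y
      have ch: "continuous_on UNIV h"
        unfolding h_def
        by (intro continuous_intros continuous_on_compose2[OF lipschitz_on_continuous_on[OF g]])
          (auto simp: inner_diff_left ee)
      have hx: "h x \<ge> 0" using eq xn r unfolding h_def by force
      obtain d where d: "d > 0" "ball x d \<subseteq> interior (closure \<Omega>)"
        using x open_interior open_contains_ball by blast
      define t where "t = min d r / 2"
      have t: "t > 0" "t < d" "t < r" using d(1) r by (auto simp: t_def)
      let ?y = "x - t *\<^sub>R e"
      \<comment> \<open>Moving along -e leaves the argument of \<gamma> unchanged and raises h by
        t.\<close>
      have hy: "h ?y > 0" using hx t(1) by (simp add: h_def inner_diff_left ee algebra_simps)
      have "open ({y. h y > 0} \<inter> ball x r)"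
        using ch by (intro open_Int open_ball open_Collect_less continuous_on_const) auto
      moreover have "?y \<in> {y. h y > 0} \<inter> ball x r" using hy t e by (simp add: dist_norm)
      moreover have "({y. h y > 0} \<inter> ball x r) \<inter> \<Omega> = {}"
        using eq unfolding h_def by force
      ultimately have "?y \<notin> closure \<Omega>" by (metis disjoint_iff open_Int_closure_eq_empty)
      moreover have "?y \<in> closure \<Omega>" using d(2) t e interior_subset by (force simp: dist_norm)
      ultimately show False by blast
    qed
  qed
qed

section \<open>Simplices near their facets\<close>

definition vertices :: "'a::euclidean_space set \<Rightarrow> 'a set" where
  "vertices T = {x. x extreme_point_of T}"

lemma vertices_simplex: "\<not> affine_dependent C \<Longrightarrow> vertices (convex hull C) = C"
  by (simp add: vertices_def extreme_point_of_convex_hull_affine_independent)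

lemma facet_of_simplex:
  assumes "full_simplex C" "F facet_of (convex hull C)"
  obtains a where "a \<in> C" "F = convex hull (C - {a})"
  using assms facet_of_convex_hull_affine_independent[OF simplex_indep[OF assms(1)]] by blast

text \<open>At a point in the relative interior of a facet all barycentric coordinates other than
  that of a are positive and remain so nearby; membership is then decided by the sign of the
  remaining one.\<close>

lemma near_facet_in_simplex:
  fixes C :: "(real ^ 'n::finite) set"
  assumes C: "full_simplex C" and a: "a \<in> C" and x: "x \<in> rel_interior (convex hull (C - {a}))"
    and l: "\<And>c. c \<in> C \<Longrightarrow> l \<bullet> c + \<beta> = (if c = a then 1 else 0)"
  obtains d where "d > 0" "\<And>y. y \<in> ball x d \<Longrightarrow> 0 \<le> l \<bullet> y + \<beta> \<Longrightarrow> y \<in> convex hull C"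
proof -
  let ?F = "convex hull (C - {a})"
  obtain m \<gamma> where m: "\<And>b c. b \<in> C \<Longrightarrow> c \<in> C \<Longrightarrow> m b \<bullet> c + \<gamma> b = (if b = c then 1 else 0)"
    "\<And>k \<delta> x. k \<bullet> x + \<delta> = (\<Sum>c\<in>C. (k \<bullet> c + \<delta>) * (m c \<bullet> x + \<gamma> c))"
    using barycentric_coordinates[OF C] by blast
  have xF: "x \<in> ?F" using x rel_interior_subset by blast
  have pos: "m k \<bullet> x + \<gamma> k > 0" if k: "k \<in> C - {a}" for k
  \<comment> \<open>The segment from k to x can be prolonged a little beyond x within the facet. If
    the coordinate of k were not positive at x, it would become negative there.\<close>
  proof (rule ccontr)
    assume "\<not> m k \<bullet> x + \<gamma> k > 0"
    then have le: "m k \<bullet> x + \<gamma> k \<le> 0" by simp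
    have kF: "k \<in> ?F" using k by (rule hull_inc)
    then obtain e where e: "e > 1" "(1 - e) *\<^sub>R k + e *\<^sub>R x \<in> ?F"
      using x convex_rel_interior_iff[OF convex_convex_hull, of "C - {a}" x] by blast
    have "?F \<subseteq> {y. - m k \<bullet> y \<le> \<gamma> k}"
    proof (rule hull_minimal)
      show "C - {a} \<subseteq> {y. - m k \<bullet> y \<le> \<gamma> k}"
      proof
        fix c assume "c \<in> C - {a}"
        then have "m k \<bullet> c + \<gamma> k \<ge> 0" using m(1)[of k c] k by auto
        then show "c \<in> {y. - m k \<bullet> y \<le> \<gamma> k}" by simp
      qed
    qed (rule convex_halfspace_le)
    then have "0 \<le> m k \<bullet> ((1 - e) *\<^sub>R k + e *\<^sub>R x) + \<gamma> k" using e(2) by fastforce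
    also have "\<dots> = (1 - e) * (m k \<bullet> k + \<gamma> k) + e * (m k \<bullet> x + \<gamma> k)"
      by (simp add: inner_add_right algebra_simps)
    also have "m k \<bullet> k + \<gamma> k = 1" using m(1)[of k k] k by simp
    also have "e * (m k \<bullet> x + \<gamma> k) \<le> 0" using le e(1) by (simp add: mult_nonneg_nonpos)
    finally show False using e(1) by simp
  qed
  let ?U = "\<Inter>k\<in>C - {a}. {y. 0 < m k \<bullet> y + \<gamma> k}"
  have "open ?U"
    using simplex_finite[OF C] by (intro open_INT ballI open_Collect_less continuous_intros) auto
  moreover have "x \<in> ?U" using pos by blast
  ultimately obtain d where d: "d > 0" "ball x d \<subseteq> ?U" using open_contains_ball by blast
  have la: "l \<bullet> y + \<beta> = m a \<bullet> y + \<gamma> a" for y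
    by (rule affine_fun_eq_on_simplex[OF C]) (use l m(1)[OF a] in auto)
  show ?thesis
  proof (rule that[OF d(1)])
    fix y assume y: "y \<in> ball x d" and ly: "0 \<le> l \<bullet> y + \<beta>"
    have nn: "m c \<bullet> y + \<gamma> c \<ge> 0" if "c \<in> C" for c
    proof (cases "c = a")
      case False
      then have "0 < m c \<bullet> y + \<gamma> c" using d(2) y that by blast
      then show ?thesis by simp
    qed (use ly la[of y] in simp)
    have "(\<Sum>c\<in>C. (m c \<bullet> y + \<gamma> c) *\<^sub>R c) \<in> convex hull C"
    proof (rule convex_sum[OF simplex_finite[OF C] convex_convex_hull])
      show "(\<Sum>c\<in>C. m c \<bullet> y + \<gamma> c) = 1" using m(2)[of 0 y 1] by simp
    qed (use nn in \<open>auto intro: hull_inc\<close>)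
    moreover have "y = (\<Sum>c\<in>C. (m c \<bullet> y + \<gamma> c) *\<^sub>R c)"
    proof -
      have "y $ i = (\<Sum>c\<in>C. (m c \<bullet> y + \<gamma> c) *\<^sub>R c) $ i" for i
        using m(2)[of "axis i 1" y 0] by (simp add: inner_axis' mult.commute)
      then show ?thesis by (simp add: vec_eq_iff)
    qed
    ultimately show "y \<in> convex hull C" by simp
  qed
qed

text \<open>The assumption \<open>interior_closure\<close> condenses the regularity of the boundary:
  no part of the frontier is surrounded by the domain, so the interiors of the elements lie in the
  domain itself.\<close>

locale mesh =
  fixes \<Omega> :: "(real ^ 'n::finite) set" and \<T> :: "(real ^ 'n) set set"
  assumes open_domain: "open \<Omega>" and bounded_domain: "bounded \<Omega>"
    and interior_closure: "interior (closure \<Omega>) = \<Omega>"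
    and finite_mesh: "finite \<T>"
    and simplices: "\<And>T. T \<in> \<T> \<Longrightarrow> \<exists>C. full_simplex C \<and> T = convex hull C"
    and conforming: "\<And>T T'. T \<in> \<T> \<Longrightarrow> T' \<in> \<T> \<Longrightarrow> T \<inter> T' face_of T"
    and covering: "\<Union>\<T> = closure \<Omega>"
begin

lemma mesh_simplex:
  assumes "T \<in> \<T>" shows "full_simplex (vertices T)" "T = convex hull (vertices T)"
proof -
  obtain C where "full_simplex C" "T = convex hull C" using simplices[OF assms] by blast
  then show "full_simplex (vertices T)" "T = convex hull (vertices T)"
    using vertices_simplex[of C] simplex_indep[of C] by auto
qed

lemma mesh_compact: "T \<in> \<T> \<Longrightarrow> compact T" and mesh_convex: "T \<in> \<T> \<Longrightarrow> convex T"
  and mesh_closed: "T \<in> \<T> \<Longrightarrow> closed T"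
  using mesh_simplex simplex_compact convex_convex_hull compact_imp_closed by metis+

lemma mesh_affine_hull:
  assumes "T \<in> \<T>" shows "affine hull T = UNIV"
  using simplex_affine_hull[OF mesh_simplex(1)[OF assms]] mesh_simplex(2)[OF assms]
  by (metis affine_hull_convex_hull)

lemma mesh_aff_dim: "T \<in> \<T> \<Longrightarrow> aff_dim T = int CARD('n)"
  using mesh_affine_hull[of T] aff_dim_eq_full[of T] by simp

lemma mesh_rel_interior: "T \<in> \<T> \<Longrightarrow> rel_interior T = interior T"
  by (intro rel_interior_interior mesh_affine_hull)

lemma mesh_polytope: "T \<in> \<T> \<Longrightarrow> polytope T"
  using mesh_simplex simplex_finite unfolding polytope_def by metis

lemma mesh_interior_subset: "T \<in> \<T> \<Longrightarrow> interior T \<subseteq> \<Omega>"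
  using covering interior_mono[of T "closure \<Omega>"] interior_closure by auto

lemma mesh_Int_proper:
  assumes "T \<in> \<T>" "T' \<in> \<T>" "T \<noteq> T'" shows "T \<inter> T' \<noteq> T"
proof
  assume eq: "T \<inter> T' = T"
  have "T face_of T'" using conforming[OF assms(2,1)] eq by (simp add: Int_commute)
  then have "aff_dim T < aff_dim T'" using mesh_convex[OF assms(2)] assms(3) by (intro face_of_aff_dim_lt)
  then show False using mesh_aff_dim assms by simp
qed

lemma mesh_disjoint_interior:
  assumes "T \<in> \<T>" "T' \<in> \<T>" "T \<noteq> T'" shows "interior T \<inter> T' = {}"
  using face_of_disjoint_interior[OF conforming[OF assms(1,2)] mesh_Int_proper[OF assms]] interior_subset[of T] by blast

text \<open>The intersection is a face of T that meets the relative interior of F, so it contains F.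
  It is a proper face, and its dimension leaves no room for anything larger than F.\<close>

lemma facet_shared:
  assumes T: "T \<in> \<T>" and T': "T' \<in> \<T>" and ne: "T \<noteq> T'" and F: "F facet_of T"
    and meet: "rel_interior F \<inter> T' \<noteq> {}"
  shows "T \<inter> T' = F" and "F facet_of T'"
proof -
  note Ff = facet_of_imp_face_of[OF F]
  have FT: "F \<subseteq> T" by (rule face_of_imp_subset[OF Ff])
  have "F \<subseteq> T \<inter> T'"
    using meet FT rel_interior_subset[of F] by (intro subset_of_face_of[OF conforming[OF T T'] FT]) blast
  then have FI: "F face_of T \<inter> T'" using face_of_face[OF conforming[OF T T']] Ff by blast
  have lt: "aff_dim (T \<inter> T') < aff_dim T"
    using conforming[OF T T'] mesh_Int_proper[OF T T' ne] mesh_convex[OF T] by (intro face_of_aff_dim_lt)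
  have dF: "aff_dim F = aff_dim T - 1" "F \<noteq> {}" using F by (auto simp: facet_of_def)
  show eq: "T \<inter> T' = F"
  proof (rule ccontr)
    assume "T \<inter> T' \<noteq> F"
    then have "aff_dim F < aff_dim (T \<inter> T')"
      using FI mesh_convex[OF T] mesh_convex[OF T'] by (intro face_of_aff_dim_lt) (auto intro: convex_Int)
    then show False using lt dF by simp
  qed
  have "F face_of T'" using conforming[OF T' T] eq by (simp add: Int_commute)
  then show "F facet_of T'" using dF mesh_aff_dim[OF T] mesh_aff_dim[OF T'] by (simp add: facet_of_def)
qed

lemma facet_convex: "T \<in> \<T> \<Longrightarrow> F facet_of T \<Longrightarrow> convex F"
  using facet_of_imp_face_of face_of_imp_convex by blast

lemma facet_interior_disjoint:
  assumes "T \<in> \<T>" "F facet_of T" shows "F \<inter> interior T = {}"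
proof (rule face_of_disjoint_interior[OF facet_of_imp_face_of[OF assms(2)]])
  show "F \<noteq> T" using assms(2) by auto
qed

text \<open>If no other element meets the relative interior of F, then a point of it that belonged
  to the domain would have a neighbourhood inside T, although facets do not meet the interior of
  T.\<close>

lemma facet_dichotomy:
  assumes T: "T \<in> \<T>" and F: "F facet_of T"
  shows "(\<exists>T'\<in>\<T>. T' \<noteq> T \<and> rel_interior F \<inter> T' \<noteq> {}) \<or> F \<subseteq> frontier \<Omega>"
proof (rule disjCI, rule ccontr)
  assume nF: "\<not> F \<subseteq> frontier \<Omega>" and "\<not> (\<exists>T'\<in>\<T>. T' \<noteq> T \<and> rel_interior F \<inter> T' \<noteq> {})"
  then have none: "\<And>T'. T' \<in> \<T> \<Longrightarrow> T' \<noteq> T \<Longrightarrow> rel_interior F \<inter> T' = {}" by blast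
  have FT: "F \<subseteq> T" by (rule face_of_imp_subset[OF facet_of_imp_face_of[OF F]])
  have "rel_interior F \<subseteq> frontier \<Omega>"
  proof
    fix x assume x: "x \<in> rel_interior F"
    then have xF: "x \<in> F" using rel_interior_subset by blast
    then have xc: "x \<in> closure \<Omega>" using FT T covering by blast
    have "x \<notin> \<Omega>"
    proof
      assume xO: "x \<in> \<Omega>"
      let ?U = "\<Omega> - \<Union>(\<T> - {T})"
      have "open ?U" using finite_mesh mesh_closed by (intro open_Diff open_domain closed_Union) auto
      moreover have "x \<in> ?U" using xO x none by blast
      moreover have "?U \<subseteq> T" using covering closure_subset by blast
      ultimately have "x \<in> interior T" by (rule interiorI)
      then show False using facet_interior_disjoint[OF T F] xF by blast
    qed
    then show "x \<in> frontier \<Omega>" using xc open_domain by (simp add: frontier_def interior_open)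
  qed
  then have "closure (rel_interior F) \<subseteq> frontier \<Omega>" by (rule closure_minimal) simp
  then have "F \<subseteq> frontier \<Omega>"
    using convex_closure_rel_interior[OF facet_convex[OF T F]] closure_subset by blast
  then show False using nF by blast
qed

text \<open>The two elements lie on opposite sides of the hyperplane of F, and near x each of them
  fills its half of a ball.\<close>

lemma facet_shared_interior:
  assumes T: "T \<in> \<T>" and T': "T' \<in> \<T>" and ne: "T \<noteq> T'" and F: "F facet_of T" and F': "F facet_of T'"
    and I: "T \<inter> T' = F" and x: "x \<in> rel_interior F"
  shows "x \<in> interior (T \<union> T')"
proof -
  note C = mesh_simplex[OF T] and C' = mesh_simplex[OF T']
  obtain a where a: "a \<in> vertices T" "F = convex hull (vertices T - {a})"
    using facet_of_simplex[OF C(1)] F C(2) by metis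
  obtain a' where a': "a' \<in> vertices T'" "F = convex hull (vertices T' - {a'})"
    using facet_of_simplex[OF C'(1)] F' C'(2) by metis
  have ind: "\<not> affine_dependent (vertices T - {a})" "\<not> affine_dependent (vertices T' - {a'})"
    using simplex_indep[OF C(1)] simplex_indep[OF C'(1)] affine_dependent_subset by blast+
  have K: "vertices T - {a} = vertices T' - {a'}"
    using vertices_simplex[OF ind(1)] vertices_simplex[OF ind(2)] a(2) a'(2) by simp
  obtain l \<beta> where l: "\<And>c. c \<in> vertices T \<Longrightarrow> l \<bullet> c + \<beta> = (if c = a then 1 else 0)"
    using affine_interpolation[OF simplex_indep[OF C(1)], of "\<lambda>c. if c = a then 1 else 0"] by blast
  obtain l' \<beta>' where l': "\<And>c. c \<in> vertices T' \<Longrightarrow> l' \<bullet> c + \<beta>' = (if c = a' then 1 else 0)"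
    using affine_interpolation[OF simplex_indep[OF C'(1)], of "\<lambda>c. if c = a' then 1 else 0"] by blast
  have xr: "x \<in> rel_interior (convex hull (vertices T - {a}))" "x \<in> rel_interior (convex hull (vertices T' - {a'}))"
    using x unfolding a(2)[symmetric] a'(2)[symmetric] by simp_all
  obtain d where d: "d > 0" "\<And>y. y \<in> ball x d \<Longrightarrow> 0 \<le> l \<bullet> y + \<beta> \<Longrightarrow> y \<in> T"
    using near_facet_in_simplex[OF C(1) a(1) xr(1) l] unfolding C(2)[symmetric] by blast
  obtain d' where d': "d' > 0" "\<And>y. y \<in> ball x d' \<Longrightarrow> 0 \<le> l' \<bullet> y + \<beta>' \<Longrightarrow> y \<in> T'"
    using near_facet_in_simplex[OF C'(1) a'(1) xr(2) l'] unfolding C'(2)[symmetric] by blast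
  \<comment> \<open>The barycentric coordinates of a and a' both vanish on F and are therefore
    proportional; k is the factor. Its sign tells on which side a' lies.\<close>
  define k where "k = l \<bullet> a' + \<beta>"
  have rel: "l \<bullet> y + \<beta> = k * (l' \<bullet> y + \<beta>')" for y
  proof -
    have "l \<bullet> y + \<beta> = (k *\<^sub>R l') \<bullet> y + k * \<beta>'"
    proof (rule affine_fun_eq_on_simplex[OF C'(1)])
      fix c assume c: "c \<in> vertices T'"
      have "l \<bullet> c + \<beta> = k * (l' \<bullet> c + \<beta>')"
      proof (cases "c = a'")
        case True
        then show ?thesis using l'[OF c] by (simp add: k_def)
      next
        case False
        then have "c \<in> vertices T - {a}" using c K by blast
        then show ?thesis using l[of c] l'[OF c] False by simp
      qed
      then show "l \<bullet> c + \<beta> = (k *\<^sub>R l') \<bullet> c + k * \<beta>'" by (simp add: algebra_simps)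
    qed
    then show ?thesis by (simp add: algebra_simps)
  qed
  have F0: "l \<bullet> y + \<beta> = 0" if "y \<in> F" for y
  proof (rule affine_fun_eq_0[of "vertices T - {a}"])
    fix c assume "c \<in> vertices T - {a}"
    then show "l \<bullet> c + \<beta> = 0" using l[of c] by simp
  next
    show "y \<in> affine hull (vertices T - {a})" using that a(2) convex_hull_subset_affine_hull by blast
  qed
  have xF: "x \<in> F" using x rel_interior_subset by blast
  have "k \<le> 0"
  proof (rule ccontr)
    assume "\<not> k \<le> 0"
    then have k: "k > 0" by simp
    \<comment> \<open>A step from x towards a that stays in both balls; for positive k the point
      reached would belong to both elements without lying on F. The summand 1 makes the divisor
      positive and the estimate strict.\<close>
    define e where "e = min d d' / (2 * (norm (a - x) + 1))"
    have nn: "norm (a - x) + 1 > 0" using norm_ge_zero[of "a - x"] by linarith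
    have e: "e > 0" using d(1) d'(1) nn by (simp add: e_def)
    let ?y = "x + e *\<^sub>R (a - x)"
    have "e * norm (a - x) < e * (norm (a - x) + 1)" using e by simp
    also have "\<dots> = min d d' / 2" using nn by (simp add: e_def field_simps)
    also have "\<dots> < min d d'"
    proof -
      have "min d d' > 0" using d(1) d'(1) by simp
      then show ?thesis by linarith
    qed
    finally have yb: "?y \<in> ball x d" "?y \<in> ball x d'" using e by (simp_all add: dist_norm)
    have "l \<bullet> ?y + \<beta> = (1 - e) * (l \<bullet> x + \<beta>) + e * (l \<bullet> a + \<beta>)"
      by (simp add: inner_add_right inner_diff_right algebra_simps)
    then have ly: "l \<bullet> ?y + \<beta> = e" using F0[OF xF] l[OF a(1)] by simp
    then have "l' \<bullet> ?y + \<beta>' > 0" using rel[of ?y] k e by (metis zero_less_mult_pos)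
    then have "?y \<in> T \<inter> T'" using d(2)[OF yb(1)] d'(2)[OF yb(2)] ly e by simp
    then have "?y \<in> F" using I by simp
    then show False using F0[of ?y] ly e by simp
  qed
  have "ball x (min d d') \<subseteq> T \<union> T'"
  proof
    fix y assume y: "y \<in> ball x (min d d')"
    show "y \<in> T \<union> T'"
    proof (cases "0 \<le> l \<bullet> y + \<beta>")
      case True
      then show ?thesis using d(2)[of y] y by simp
    next
      case False
      then have "0 \<le> l' \<bullet> y + \<beta>'" using rel[of y] \<open>k \<le> 0\<close> by (metis linorder_not_less mult_nonpos_nonpos less_imp_le)
      then show ?thesis using d'(2)[of y] y by simp
    qed
  qed
  then show ?thesis using d(1) d'(1) by (intro interiorI[of "ball x (min d d')"]) auto
qed

text \<open>If such a function were a nonzero constant on a union \<open>S\<close> of elements, a segment that leaves \<open>S\<close>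
  and avoids all faces of codimension two would cross the boundary of \<open>S\<close> in the relative interior of a facet.\<close>

lemma facewise_constant_eq_0:
  fixes c :: "(real ^ 'n) set \<Rightarrow> real"
  assumes shared: "\<And>T T' F. T \<in> \<T> \<Longrightarrow> T' \<in> \<T> \<Longrightarrow> T \<noteq> T' \<Longrightarrow> F facet_of T \<Longrightarrow> F facet_of T' \<Longrightarrow> c T = c T'"
    and boundary: "\<And>T F. T \<in> \<T> \<Longrightarrow> F facet_of T \<Longrightarrow> F \<subseteq> frontier \<Omega> \<Longrightarrow> c T = 0"
    and T0: "T0 \<in> \<T>"
  shows "c T0 = 0"
proof (rule ccontr)
  assume nz: "c T0 \<noteq> 0"
  define S where "S = \<Union>{T \<in> \<T>. c T = c T0}"
  let ?G = "{K. (\<exists>T\<in>\<T>. K face_of T) \<and> aff_dim K \<le> int CARD('n) - 2}"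
  have Sc: "compact S" unfolding S_def using finite_mesh mesh_compact by (intro compact_Union) auto
  have "finite {K. K face_of T}" if "T \<in> \<T>" for T using finite_polytope_faces[OF mesh_polytope[OF that]] .
  then have "finite (\<Union>T\<in>\<T>. {K. K face_of T})" using finite_mesh by blast
  then have finG: "finite ?G" by (rule rev_finite_subset) blast
  have "interior T0 \<noteq> {}" using simplex_interior[OF mesh_simplex(1)[OF T0]] mesh_simplex(2)[OF T0] by simp
  then obtain p where p: "p \<in> interior T0" by blast
  have pS: "p \<in> interior S"
  proof -
    have "T0 \<subseteq> S" using T0 by (auto simp: S_def)
    then show ?thesis using p interior_mono by blast
  qed
  \<comment> \<open>The flats through p and a face of codimension at least two are contained in
    hyperplanes. Their finite union is a null set and cannot cover the open complement of S, which
    provides q.\<close>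
  let ?H = "\<Union>K\<in>?G. affine hull (insert p K)"
  have "negligible ?H"
  proof (rule negligible_Union)
    show "finite ((\<lambda>K. affine hull (insert p K)) ` ?G)" using finG by simp
    fix X assume "X \<in> (\<lambda>K. affine hull (insert p K)) ` ?G"
    then obtain K where K: "K \<in> ?G" and X: "X = affine hull (insert p K)" by blast
    have "aff_dim (affine hull (insert p K)) \<le> int CARD('n) - 1"
      using K by (simp add: aff_dim_insert)
    then obtain u b where "u \<noteq> 0" "affine hull (insert p K) \<subseteq> {x. u \<bullet> x = b}"
      using aff_lowdim_subset_hyperplane[of "affine hull (insert p K)"] by (auto simp del: aff_dim_affine_hull)
    then show "negligible X"
      unfolding X using negligible_hyperplane negligible_subset by blast
  qed
  moreover have "open (- S)" using Sc by (simp add: compact_imp_closed open_Compl)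
  moreover have "- S \<noteq> {}"
  proof
    assume "- S = {}"
    then have "S = UNIV" by auto
    then show False using compact_imp_bounded[OF Sc] not_bounded_UNIV by simp
  qed
  ultimately obtain q where q: "q \<notin> S" "q \<notin> ?H"
    using open_not_negligible[of "- S"] negligible_subset[of ?H "- S"] by blast
  have "closed_segment p q \<inter> frontier S \<noteq> {}"
  proof (rule connected_Int_frontier)
    show "closed_segment p q \<inter> S \<noteq> {}" using pS interior_subset by auto
    show "closed_segment p q - S \<noteq> {}" using q(1) by auto
  qed auto
  then obtain x where x: "x \<in> closed_segment p q" "x \<in> frontier S" by blast
  have xS: "x \<in> S" "x \<notin> interior S" using x(2) Sc by (auto simp: frontier_def compact_imp_closed)
  then obtain T where T: "T \<in> \<T>" "c T = c T0" "x \<in> T" unfolding S_def by blast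
  have TS: "T \<subseteq> S" using T by (auto simp: S_def)
  have "x \<notin> interior T" using xS(2) TS interior_mono by blast
  then have "x \<in> T - rel_interior T" using T mesh_rel_interior by simp
  then obtain F where F: "F facet_of T" "x \<in> F"
    using rel_boundary_of_polyhedron[OF polytope_imp_polyhedron[OF mesh_polytope[OF T(1)]]] by blast
  show False
  proof (cases "x \<in> rel_interior F")
    case True
    from facet_dichotomy[OF T(1) F(1)] show False
    proof
      assume "\<exists>T'\<in>\<T>. T' \<noteq> T \<and> rel_interior F \<inter> T' \<noteq> {}"
      then obtain T' where T': "T' \<in> \<T>" "T \<noteq> T'" "rel_interior F \<inter> T' \<noteq> {}" by blast
      note sh = facet_shared[OF T(1) T'(1,2) F(1) T'(3)]
      have "c T' = c T0" using shared[OF T(1) T'(1,2) F(1) sh(2)] T(2) by simp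
      then have "T \<union> T' \<subseteq> S" using TS T'(1) by (auto simp: S_def)
      moreover have "x \<in> interior (T \<union> T')"
        by (rule facet_shared_interior[OF T(1) T'(1,2) F(1) sh(2,1) True])
      ultimately show False using xS(2) interior_mono by blast
    next
      assume "F \<subseteq> frontier \<Omega>"
      then show False using boundary[OF T(1) F(1)] T(2) nz by simp
    qed
  next
    case False
    \<comment> \<open>A relative boundary point of F lies in a face K of codimension two. As q is on
      the line through p and x, it would lie in the flat spanned by p and K, against its
      choice.\<close>
    have "polytope F" by (rule face_of_polytope_polytope[OF mesh_polytope[OF T(1)] facet_of_imp_face_of[OF F(1)]])
    then obtain K where K: "K facet_of F" "x \<in> K"
      using rel_boundary_of_polyhedron[OF polytope_imp_polyhedron, of F] F(2) False by blast
    have "K face_of T" using K(1) F(1) facet_of_imp_face_of face_of_trans by blast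
    moreover have "aff_dim K = int CARD('n) - 2"
      using K(1) F(1) mesh_aff_dim[OF T(1)] by (simp add: facet_of_def)
    ultimately have KG: "K \<in> ?G" using T(1) by auto
    have "x \<noteq> p" using pS xS(2) by blast
    obtain t where t: "x = (1 - t) *\<^sub>R p + t *\<^sub>R q" using x(1) by (auto simp: closed_segment_def)
    have t0: "t \<noteq> 0" using \<open>x \<noteq> p\<close> t by auto
    have "q = (1 - 1 / t) *\<^sub>R p + (1 / t) *\<^sub>R x" using t0 unfolding t by (simp add: algebra_simps)
    also have "\<dots> \<in> affine hull (insert p K)"
      by (rule mem_affine[OF affine_affine_hull]) (use K(2) in \<open>auto intro: hull_inc\<close>)
    finally show False using q(2) KG by blast
  qed
qed

end

section \<open>Piecewise functions on a mesh\<close>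

lemma has_weak_gradient_cong_AE:
  assumes U: "open U" "bounded U" and "has_weak_gradient U v G" "v \<in> L2_space U"
    and eq: "AE x in lebesgue. x \<in> U \<longrightarrow> v x = w x"
  shows "has_weak_gradient U w G"
  unfolding has_weak_gradient_iff
proof (intro ballI allI)
  fix \<phi> i assume phi: "\<phi> \<in> test_functions U"
  have "AE x in lebesgue. x \<in> U \<longrightarrow> v x \<bullet> partial_deriv i \<phi> x = w x \<bullet> partial_deriv i \<phi> x"
    using eq by eventually_elim simp
  then have "L2_inner U v (partial_deriv i \<phi>) = L2_inner U w (partial_deriv i \<phi>)"
    by (rule L2_inner_cong_AE) (use assms L2_space_cong_AE[OF assms(4) eq] partial_deriv_L2[OF U phi] in auto)
  then show "L2_inner U w (partial_deriv i \<phi>) = - L2_inner U (\<lambda>x. G x $ i) \<phi>"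
    using assms(3) phi by (simp add: has_weak_gradient_iff)
qed

lemma smooth_affine: "smooth (\<lambda>x. A \<bullet> x + b)"
  using C_k_affine by blast

lemma gradient_affine: "gradient (\<lambda>x. A \<bullet> x + b) = (\<lambda>x. A)"
  by (rule ext) (simp add: gradient_def vec_eq_iff)

lemma wgrad_affine:
  assumes U: "open U" "bounded U" and eq: "AE x in lebesgue. x \<in> U \<longrightarrow> v x = A \<bullet> x + b"
  shows "v \<in> H1_space U" and "AE x in lebesgue. x \<in> U \<longrightarrow> wgrad U v x = A"
proof -
  let ?p = "\<lambda>x. A \<bullet> x + b"
  have p: "?p \<in> L2_space U" by (rule continuous_L2[OF U smooth_continuous[OF smooth_affine]])
  have eq': "AE x in lebesgue. x \<in> U \<longrightarrow> ?p x = v x" using eq by eventually_elim simp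
  have v: "v \<in> L2_space U" by (rule L2_space_cong_AE[OF p eq'])
  have G: "(\<lambda>x. A) \<in> L2_space U" by (rule continuous_L2[OF U]) simp
  have w: "has_weak_gradient U v (\<lambda>x. A)"
    using has_weak_gradient_cong_AE[OF U has_weak_gradient_smooth[OF U smooth_affine] p eq']
    unfolding gradient_affine .
  show "v \<in> H1_space U" by (rule H1_I[OF U v w G])
  show "AE x in lebesgue. x \<in> U \<longrightarrow> wgrad U v x = A" by (rule wgrad_AE_eq[OF U v w G])
qed

text \<open>With \<open>offset\<close>, the coefficients of the affine function on T; they turn the
  conditions on discrete functions into linear equations.\<close>

definition slope :: "(real ^ 'n::finite) set \<Rightarrow> (real ^ 'n \<Rightarrow> real) \<Rightarrow> real ^ 'n" where
  "slope T v = (SOME A. \<exists>b. \<forall>x. elem_affine T v x = A \<bullet> x + b)"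

definition offset :: "(real ^ 'n::finite) set \<Rightarrow> (real ^ 'n \<Rightarrow> real) \<Rightarrow> real" where
  "offset T v = elem_affine T v 0"

context mesh
begin

section \<open>Splitting of integrals into contributions of the elements\<close>

lemma mesh_interior: "open (interior T)" "T \<in> \<T> \<Longrightarrow> bounded (interior T)"
  using mesh_compact compact_imp_bounded bounded_subset interior_subset by auto

lemma AE_interior: "AE x in lebesgue. x \<in> \<Omega> \<longrightarrow> (\<exists>T\<in>\<T>. x \<in> interior T)"
proof -
  have "negligible (\<Union>(frontier ` \<T>))"
    using finite_mesh mesh_convex negligible_convex_frontier by (intro negligible_Union) auto
  then have "AE x in lebesgue. x \<notin> \<Union>(frontier ` \<T>)"
    by (intro AE_not_in) (simp add: negligible_iff_null_sets)
  then show ?thesis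
  proof eventually_elim
    fix x assume x: "x \<notin> \<Union>(frontier ` \<T>)"
    show "x \<in> \<Omega> \<longrightarrow> (\<exists>T\<in>\<T>. x \<in> interior T)"
    proof
      assume "x \<in> \<Omega>"
      then obtain T where T: "T \<in> \<T>" "x \<in> T" using covering closure_subset by blast
      then have "x \<in> interior T" using x mesh_closed[OF T(1)] by (auto simp: frontier_def)
      then show "\<exists>T\<in>\<T>. x \<in> interior T" using T(1) by blast
    qed
  qed
qed

lemma AE_frontier:
  assumes "T \<in> \<T>" and "AE x in lebesgue. x \<in> interior T \<longrightarrow> P x"
  shows "AE x in lebesgue. x \<in> T \<longrightarrow> P x"
proof -
  have "AE x in lebesgue. x \<notin> frontier T"
    using negligible_convex_frontier[OF mesh_convex[OF assms(1)]] by (intro AE_not_in) (simp add: negligible_iff_null_sets)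
  then show ?thesis using assms(2)
    by eventually_elim (use mesh_closed[OF assms(1)] in \<open>auto simp: frontier_def\<close>)
qed

lemma AE_elements:
  assumes "\<And>T. T \<in> \<T> \<Longrightarrow> AE x in lebesgue. x \<in> interior T \<longrightarrow> P x"
  shows "AE x in lebesgue. x \<in> \<Omega> \<longrightarrow> P x"
proof -
  have "AE x in lebesgue. \<forall>T\<in>\<T>. x \<in> interior T \<longrightarrow> P x"
    using assms finite_mesh by (intro AE_finite_allI) auto
  then show ?thesis using AE_interior by eventually_elim blast
qed

lemma AE_element:
  assumes "AE x in lebesgue. x \<in> \<Omega> \<longrightarrow> P x" and "T \<in> \<T>"
  shows "AE x in lebesgue. x \<in> interior T \<longrightarrow> P x"
  using assms(1) by eventually_elim (use mesh_interior_subset[OF assms(2)] in blast)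

lemma sum_interior:
  fixes f :: "(real ^ 'n) set \<Rightarrow> 'b::real_vector"
  assumes T: "T \<in> \<T>" and x: "x \<in> interior T"
  shows "(\<Sum>T'\<in>\<T>. indicator (interior T') x *\<^sub>R f T') = f T"
proof -
  have "(\<Sum>T'\<in>\<T>. indicator (interior T') x *\<^sub>R f T') = (\<Sum>T'\<in>\<T>. if T' = T then f T else 0)"
  proof (rule sum.cong[OF refl])
    fix T' assume T': "T' \<in> \<T>"
    show "indicator (interior T') x *\<^sub>R f T' = (if T' = T then f T else 0)"
    proof (cases "T' = T")
      case False
      then have "x \<notin> interior T'"
        using mesh_disjoint_interior[OF T T'] x interior_subset[of T'] by blast
      then show ?thesis using False by simp
    qed (use x in simp)
  qed
  then show ?thesis using T finite_mesh by simp
qed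

text \<open>The interiors of the elements are disjoint and exhaust the domain up to their frontiers,
  which are null sets. Measurability, integrability and the values of integrals over the domain are
  all reduced to the elements by this identity.\<close>

lemma AE_indicator_sum:
  fixes w :: "real ^ 'n \<Rightarrow> 'b::real_vector"
  shows "AE x in lebesgue. (\<Sum>T\<in>\<T>. indicator (interior T) x *\<^sub>R w x) = indicator \<Omega> x *\<^sub>R w x"
  using AE_interior
proof eventually_elim
  fix x assume x: "x \<in> \<Omega> \<longrightarrow> (\<exists>T\<in>\<T>. x \<in> interior T)"
  show "(\<Sum>T\<in>\<T>. indicator (interior T) x *\<^sub>R w x) = indicator \<Omega> x *\<^sub>R w x"
  proof (cases "x \<in> \<Omega>")
    case True
    then obtain T where "T \<in> \<T>" "x \<in> interior T" using x by blast
    from sum_interior[OF this, of "\<lambda>_. w x"] show ?thesis using True by simp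
  next
    case False
    then have "x \<notin> interior T" if "T \<in> \<T>" for T using mesh_interior_subset[OF that] by blast
    then show ?thesis using False by simp
  qed
qed

lemma L2_elements:
  fixes w :: "real ^ 'n \<Rightarrow> 'b::euclidean_space"
  assumes w: "\<And>T. T \<in> \<T> \<Longrightarrow> w \<in> L2_space (interior T)"
  shows "w \<in> L2_space \<Omega>"
proof -
  have "(\<lambda>x. \<Sum>T\<in>\<T>. indicator (interior T) x *\<^sub>R w x) \<in> borel_measurable lebesgue"
    by (rule borel_measurable_sum) (use w in \<open>simp add: L2_space_iff\<close>)
  then have m: "(\<lambda>x. indicator \<Omega> x *\<^sub>R w x) \<in> borel_measurable lebesgue"
    using AE_indicator_sum by (rule borel_measurable_AE)
  have i: "integrable lebesgue (\<lambda>x. \<Sum>T\<in>\<T>. indicator (interior T) x *\<^sub>R (norm (w x))\<^sup>2)"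
    by (rule Bochner_Integration.integrable_sum) (use w in \<open>simp add: L2_space_iff\<close>)
  have e: "indicator \<Omega> x *\<^sub>R (norm (w x))\<^sup>2 = (norm (indicator \<Omega> x *\<^sub>R w x))\<^sup>2" for x
    by (simp add: indicator_def)
  have m2: "(\<lambda>x. indicator \<Omega> x *\<^sub>R (norm (w x))\<^sup>2) \<in> borel_measurable lebesgue"
    unfolding e using m by measurable
  have "integrable lebesgue (\<lambda>x. indicator \<Omega> x *\<^sub>R (norm (w x))\<^sup>2)"
    using integrable_cong_AE[OF borel_measurable_integrable[OF i] m2 AE_indicator_sum] i by blast
  then show ?thesis using m by (simp add: L2_space_iff)
qed

lemma L2_element:
  assumes "w \<in> L2_space \<Omega>" "T \<in> \<T>" shows "w \<in> L2_space (interior T)"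
  by (rule L2_space_subset[OF assms(1) mesh_interior_subset[OF assms(2)]]) simp

lemma L2_inner_elements:
  fixes v w :: "real ^ 'n \<Rightarrow> 'b::euclidean_space"
  assumes "v \<in> L2_space \<Omega>" "w \<in> L2_space \<Omega>"
  shows "L2_inner \<Omega> v w = (\<Sum>T\<in>\<T>. L2_inner (interior T) v w)"
proof -
  have i: "integrable lebesgue (\<lambda>x. indicator (interior T) x *\<^sub>R (v x \<bullet> w x))" if "T \<in> \<T>" for T
    using L2_inner_integrable[OF L2_element L2_element, OF assms(1) that assms(2) that] by (simp add: set_integrable_def)
  have j: "integrable lebesgue (\<lambda>x. indicator \<Omega> x *\<^sub>R (v x \<bullet> w x))"
    using L2_inner_integrable[OF assms] by (simp add: set_integrable_def)
  have "L2_inner \<Omega> v w = (\<integral>x. (\<Sum>T\<in>\<T>. indicator (interior T) x *\<^sub>R (v x \<bullet> w x)) \<partial>lebesgue)"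
    unfolding L2_inner_def set_lebesgue_integral_def
  proof (rule integral_cong_AE)
    show "AE x in lebesgue. indicator \<Omega> x *\<^sub>R (v x \<bullet> w x) = (\<Sum>T\<in>\<T>. indicator (interior T) x *\<^sub>R (v x \<bullet> w x))"
      using AE_indicator_sum[of "\<lambda>x. v x \<bullet> w x"] by eventually_elim simp
    show "(\<lambda>x. \<Sum>T\<in>\<T>. indicator (interior T) x *\<^sub>R (v x \<bullet> w x)) \<in> borel_measurable lebesgue"
      by (rule borel_measurable_sum) (rule borel_measurable_integrable[OF i])
  qed (rule borel_measurable_integrable[OF j])
  also have "\<dots> = (\<Sum>T\<in>\<T>. L2_inner (interior T) v w)"
    unfolding L2_inner_def set_lebesgue_integral_def by (rule Bochner_Integration.integral_sum[OF i])
  finally show ?thesis .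
qed

text \<open>Passes from the open element and Lebesgue measure to the closed simplex and
  \<open>lborel\<close>, the setting of the formulas on a simplex; the frontier of a convex set is a
  null set.\<close>

lemma element_integral:
  fixes f :: "real ^ 'n \<Rightarrow> real"
  assumes T: "T \<in> \<T>" and f: "continuous_on UNIV f"
  shows "(LINT x:interior T|lebesgue. f x) = (\<integral>x. indicator T x * f x \<partial>lborel)"
proof -
  have fm: "f \<in> borel_measurable borel" using f by (rule borel_measurable_continuous_onI)
  have Tb: "T \<in> sets borel" using mesh_closed[OF T] by simp
  have m: "(\<lambda>x. indicator T x * f x) \<in> borel_measurable lborel" using fm Tb by measurable
  have m': "(\<lambda>x. indicator (interior T) x *\<^sub>R f x) \<in> borel_measurable lborel" using fm by measurable
  have "AE x in lebesgue. x \<notin> frontier T"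
    using negligible_convex_frontier[OF mesh_convex[OF T]] by (intro AE_not_in) (simp add: negligible_iff_null_sets)
  then have "AE x in lebesgue. indicator (interior T) x *\<^sub>R f x = indicator T x * f x"
    by eventually_elim (use mesh_closed[OF T] interior_subset in \<open>auto simp: frontier_def indicator_def\<close>)
  then have "(LINT x:interior T|lebesgue. f x) = (\<integral>x. indicator T x * f x \<partial>lebesgue)"
    unfolding set_lebesgue_integral_def
    by (intro integral_cong_AE measurable_completion[OF m] measurable_completion[OF m'])
  also have "\<dots> = (\<integral>x. indicator T x * f x \<partial>lborel)" by (rule integral_completion[OF m])
  finally show ?thesis .
qed

lemma mesh_volume_pos: "T \<in> \<T> \<Longrightarrow> measure lborel T > 0"
  using simplex_volume_pos[OF mesh_simplex(1)] mesh_simplex(2) by metis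

lemma element_integral_const:
  fixes c :: real
  assumes "T \<in> \<T>" shows "(LINT x:interior T|lebesgue. c) = measure lborel T * c"
  using element_integral[OF assms, of "\<lambda>_. c"] mesh_closed[OF assms] by simp

text \<open>The zero set of an affine function other than 0 is empty or a hyperplane, whereas an
  element has positive measure.\<close>

lemma affine_AE_eq_0:
  assumes T: "T \<in> \<T>" and eq: "AE x in lebesgue. x \<in> interior T \<longrightarrow> A \<bullet> x + b = 0"
  shows "A = 0" "b = 0"
proof -
  have ni: "\<not> negligible (interior T)"
    using simplex_interior[OF mesh_simplex(1)[OF T]] mesh_simplex(2)[OF T] open_not_negligible[of "interior T"] by simp
  have no: False if "negligible {x. A \<bullet> x = - b}"
  proof -
    have "AE x in lebesgue. x \<notin> {x. A \<bullet> x = - b}"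
      using that by (intro AE_not_in) (simp add: negligible_iff_null_sets)
    then have "AE x in lebesgue. x \<notin> interior T" using eq by eventually_elim auto
    then have "interior T \<in> null_sets lebesgue"
      by (subst (asm) AE_iff_null_sets[symmetric]) auto
    then show False using ni by (simp add: negligible_iff_null_sets)
  qed
  show "A = 0" using no negligible_hyperplane[of A "- b"] by blast
  show "b = 0"
  proof (rule ccontr)
    assume "b \<noteq> 0"
    then have "negligible {x. A \<bullet> x = - b}" by (intro negligible_hyperplane) simp
    then show False by (rule no)
  qed
qed

section \<open>Coefficients of piecewise affine functions\<close>

lemma elem_affine_exists:
  assumes v: "v \<in> piecewise_affine \<T>" and T: "T \<in> \<T>"
  shows "elem_affine T v x = slope T v \<bullet> x + offset T v"
    and "AE x in lebesgue. x \<in> interior T \<longrightarrow> v x = slope T v \<bullet> x + offset T v"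
proof -
  have "\<exists>p. is_affine_fun p \<and> (AE x in lebesgue. x \<in> T \<longrightarrow> v x = p x)"
    using v T by (simp add: piecewise_affine_def)
  from someI_ex[OF this] have e: "is_affine_fun (elem_affine T v)" "AE x in lebesgue. x \<in> T \<longrightarrow> v x = elem_affine T v x"
    unfolding elem_affine_def[symmetric] by auto
  then have "\<exists>A. \<exists>b. \<forall>x. elem_affine T v x = A \<bullet> x + b" by (simp add: is_affine_fun_def)
  from someI_ex[OF this] obtain b where b: "\<And>x. elem_affine T v x = slope T v \<bullet> x + b"
    unfolding slope_def[symmetric] by blast
  then show eq: "elem_affine T v x = slope T v \<bullet> x + offset T v" for x
    by (simp add: offset_def)
  show "AE x in lebesgue. x \<in> interior T \<longrightarrow> v x = slope T v \<bullet> x + offset T v"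
    using e(2) by eventually_elim (use eq interior_subset[of T] in auto)
qed

lemma piecewise_affineI:
  assumes "\<And>T. T \<in> \<T> \<Longrightarrow> AE x in lebesgue. x \<in> interior T \<longrightarrow> v x = A T \<bullet> x + b T"
  shows "v \<in> piecewise_affine \<T>"
  unfolding piecewise_affine_def
proof (intro CollectI ballI exI conjI)
  fix T assume T: "T \<in> \<T>"
  show "is_affine_fun (\<lambda>x. A T \<bullet> x + b T)" by (auto simp: is_affine_fun_def)
  show "AE x in lebesgue. x \<in> T \<longrightarrow> v x = A T \<bullet> x + b T" by (rule AE_frontier[OF T assms[OF T]])
qed

lemma elem_affine_unique:
  assumes v: "v \<in> piecewise_affine \<T>" and T: "T \<in> \<T>"
    and eq: "AE x in lebesgue. x \<in> interior T \<longrightarrow> v x = A \<bullet> x + b"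
  shows "slope T v = A" "offset T v = b"
proof -
  have "AE x in lebesgue. x \<in> interior T \<longrightarrow> (slope T v - A) \<bullet> x + (offset T v - b) = 0"
    using eq elem_affine_exists(2)[OF v T] by eventually_elim (auto simp: inner_diff_left algebra_simps)
  from affine_AE_eq_0[OF T this] show "slope T v = A" "offset T v = b" by simp_all
qed

lemma piecewise_affine_add_scaled:
  assumes v: "v \<in> piecewise_affine \<T>" and w: "w \<in> piecewise_affine \<T>"
  shows "(\<lambda>x. v x + c * w x) \<in> piecewise_affine \<T>"
    and "T \<in> \<T> \<Longrightarrow> slope T (\<lambda>x. v x + c * w x) = slope T v + c *\<^sub>R slope T w"
    and "T \<in> \<T> \<Longrightarrow> offset T (\<lambda>x. v x + c * w x) = offset T v + c * offset T w"
proof -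
  have eq: "AE x in lebesgue. x \<in> interior T \<longrightarrow> v x + c * w x = (slope T v + c *\<^sub>R slope T w) \<bullet> x + (offset T v + c * offset T w)"
    if "T \<in> \<T>" for T
    using elem_affine_exists(2)[OF v that] elem_affine_exists(2)[OF w that]
    by eventually_elim (auto simp: inner_add_left algebra_simps)
  show m: "(\<lambda>x. v x + c * w x) \<in> piecewise_affine \<T>"
    by (rule piecewise_affineI[where A="\<lambda>T. slope T v + c *\<^sub>R slope T w", OF eq])
  show "slope T (\<lambda>x. v x + c * w x) = slope T v + c *\<^sub>R slope T w" if "T \<in> \<T>"
    by (rule elem_affine_unique(1)[OF m that eq[OF that]])
  show "offset T (\<lambda>x. v x + c * w x) = offset T v + c * offset T w" if "T \<in> \<T>"
    by (rule elem_affine_unique(2)[OF m that eq[OF that]])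
qed

lemma L2_AE_continuous:
  fixes w :: "real ^ 'n \<Rightarrow> 'b::euclidean_space"
  assumes "\<And>T. T \<in> \<T> \<Longrightarrow> AE x in lebesgue. x \<in> interior T \<longrightarrow> w x = f T x"
    and "\<And>T. T \<in> \<T> \<Longrightarrow> continuous_on UNIV (f T)"
  shows "w \<in> L2_space \<Omega>"
proof (rule L2_elements)
  fix T assume T: "T \<in> \<T>"
  have "AE x in lebesgue. x \<in> interior T \<longrightarrow> f T x = w x" using assms(1)[OF T] by eventually_elim simp
  then show "w \<in> L2_space (interior T)"
    by (rule L2_space_cong_AE[OF continuous_L2[OF mesh_interior(1) mesh_interior(2)[OF T] assms(2)[OF T]]])
qed

lemma piecewise_affine_L2: "v \<in> piecewise_affine \<T> \<Longrightarrow> v \<in> L2_space \<Omega>"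
  using elem_affine_exists(2) by (rule L2_AE_continuous) (auto intro!: continuous_intros)

text \<open>Discrete functions are known almost everywhere only. On each element they are replaced
  by continuous functions, to which the formulas on a simplex apply.\<close>

lemma L2_inner_AE_continuous:
  fixes v w :: "real ^ 'n \<Rightarrow> 'b::euclidean_space"
  assumes v: "\<And>T. T \<in> \<T> \<Longrightarrow> AE x in lebesgue. x \<in> interior T \<longrightarrow> v x = f T x" "\<And>T. T \<in> \<T> \<Longrightarrow> continuous_on UNIV (f T)"
    and w: "\<And>T. T \<in> \<T> \<Longrightarrow> AE x in lebesgue. x \<in> interior T \<longrightarrow> w x = g T x" "\<And>T. T \<in> \<T> \<Longrightarrow> continuous_on UNIV (g T)"
  shows "L2_inner \<Omega> v w = (\<Sum>T\<in>\<T>. \<integral>x. indicator T x * (f T x \<bullet> g T x) \<partial>lborel)"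
proof -
  have vL: "v \<in> L2_space \<Omega>" by (rule L2_AE_continuous[OF v])
  have wL: "w \<in> L2_space \<Omega>" by (rule L2_AE_continuous[OF w])
  have "L2_inner (interior T) v w = (\<integral>x. indicator T x * (f T x \<bullet> g T x) \<partial>lborel)" if T: "T \<in> \<T>" for T
  proof -
    have "AE x in lebesgue. x \<in> interior T \<longrightarrow> v x \<bullet> w x = f T x \<bullet> g T x"
      using v(1)[OF T] w(1)[OF T] by eventually_elim simp
    then have "L2_inner (interior T) v w = L2_inner (interior T) (f T) (g T)"
      by (rule L2_inner_cong_AE)
        (use T vL wL v(2) w(2) mesh_interior in \<open>auto intro: L2_element continuous_L2\<close>)
    also have "\<dots> = (\<integral>x. indicator T x * (f T x \<bullet> g T x) \<partial>lborel)"
      unfolding L2_inner_def by (rule element_integral[OF T]) (intro continuous_intros v(2) w(2) T)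
    finally show ?thesis .
  qed
  then show ?thesis unfolding L2_inner_elements[OF vL wL] by simp
qed

lemma broken_grad_AE:
  assumes v: "v \<in> piecewise_affine \<T>" and T: "T \<in> \<T>"
  shows "AE x in lebesgue. x \<in> interior T \<longrightarrow> broken_grad \<T> v x = slope T v"
proof -
  have "AE x in lebesgue. x \<in> interior T \<longrightarrow> wgrad (interior T) v x = slope T v"
    by (rule wgrad_affine(2)[OF mesh_interior(1) mesh_interior(2)[OF T] elem_affine_exists(2)[OF v T]])
  then show ?thesis
    by eventually_elim (simp add: broken_grad_def sum_interior[OF T])
qed

lemma broken_grad_L2: "v \<in> piecewise_affine \<T> \<Longrightarrow> broken_grad \<T> v \<in> L2_space \<Omega>"
  using broken_grad_AE by (rule L2_AE_continuous) auto

lemma broken_grad_inner: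
  assumes "v \<in> piecewise_affine \<T>" "w \<in> piecewise_affine \<T>"
  shows "L2_inner \<Omega> (broken_grad \<T> v) (broken_grad \<T> w) = (\<Sum>T\<in>\<T>. measure lborel T * (slope T v \<bullet> slope T w))"
proof -
  have "L2_inner \<Omega> (broken_grad \<T> v) (broken_grad \<T> w) = (\<Sum>T\<in>\<T>. \<integral>x. indicator T x * (slope T v \<bullet> slope T w) \<partial>lborel)"
    by (rule L2_inner_AE_continuous[where f="\<lambda>T x. slope T v" and g="\<lambda>T x. slope T w"])
      (use broken_grad_AE[OF assms(1)] broken_grad_AE[OF assms(2)] in auto)
  also have "\<dots> = (\<Sum>T\<in>\<T>. measure lborel T * (slope T v \<bullet> slope T w))"
    by (rule sum.cong[OF refl]) (use mesh_closed in simp)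
  finally show ?thesis .
qed

text \<open>For each element the generators are the constant 1 and the coordinate functions,
  extended by zero. The vector 0, which is not in \<open>Basis\<close>, serves as label of the
  constant.\<close>

lemma piecewise_affine_finite_dim:
  assumes v: "v \<in> piecewise_affine \<T>"
  shows "\<exists>c. AE x in lebesgue. x \<in> \<Omega> \<longrightarrow> v x -
    (\<Sum>i\<in>\<T> \<times> insert 0 Basis. c i * (indicator (interior (fst i)) x * (if snd i = 0 then 1 else snd i \<bullet> x))) = 0"
proof (intro exI AE_elements)
  let ?c = "\<lambda>i::(real ^ 'n) set \<times> (real ^ 'n). if snd i = 0 then offset (fst i) v else slope (fst i) v \<bullet> snd i"
  fix T assume T: "T \<in> \<T>"
  have "(\<Sum>i\<in>\<T> \<times> insert 0 Basis. ?c i * (indicator (interior (fst i)) x * (if snd i = 0 then 1 else snd i \<bullet> x)))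
      = slope T v \<bullet> x + offset T v" if x: "x \<in> interior T" for x
  proof -
    have "(\<Sum>i\<in>\<T> \<times> insert 0 Basis. ?c i * (indicator (interior (fst i)) x * (if snd i = 0 then 1 else snd i \<bullet> x))) =
        (\<Sum>T\<in>\<T>. \<Sum>u\<in>insert 0 Basis. ?c (T, u) * (indicator (interior T) x * (if u = 0 then 1 else u \<bullet> x)))"
      unfolding sum.cartesian_product by (rule sum.cong) auto
    also have "\<dots> = (\<Sum>T\<in>\<T>. indicator (interior T) x *\<^sub>R (slope T v \<bullet> x + offset T v))"
    proof (rule sum.cong[OF refl])
      fix T
      have "(\<Sum>u\<in>Basis. ?c (T, u) * (indicator (interior T) x * (if u = 0 then 1 else u \<bullet> x))) =
          (\<Sum>u\<in>Basis. indicator (interior T) x * ((slope T v \<bullet> u) * (x \<bullet> u)))"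
        by (rule sum.cong) (auto simp: inner_commute)
      also have "\<dots> = indicator (interior T) x * (slope T v \<bullet> x)"
        unfolding sum_distrib_left[symmetric] euclidean_inner[of "slope T v" x] ..
      finally have e: "(\<Sum>u\<in>Basis. ?c (T, u) * (indicator (interior T) x * (if u = 0 then 1 else u \<bullet> x))) =
          indicator (interior T) x * (slope T v \<bullet> x)" .
      have "(\<Sum>u\<in>insert 0 Basis. ?c (T, u) * (indicator (interior T) x * (if u = 0 then 1 else u \<bullet> x))) =
          offset T v * indicator (interior T) x + (\<Sum>u\<in>Basis. ?c (T, u) * (indicator (interior T) x * (if u = 0 then 1 else u \<bullet> x)))"
        by (subst sum.insert) (use nonzero_Basis in auto)
      then show "(\<Sum>u\<in>insert 0 Basis. ?c (T, u) * (indicator (interior T) x * (if u = 0 then 1 else u \<bullet> x))) =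
          indicator (interior T) x *\<^sub>R (slope T v \<bullet> x + offset T v)"
        unfolding e by (simp only: real_scaleR_def distrib_left mult.commute add.commute)
    qed
    also have "\<dots> = slope T v \<bullet> x + offset T v" by (rule sum_interior[OF T x])
    finally show ?thesis .
  qed
  then show "AE x in lebesgue. x \<in> interior T \<longrightarrow> v x -
      (\<Sum>i\<in>\<T> \<times> insert 0 Basis. ?c i * (indicator (interior (fst i)) x * (if snd i = 0 then 1 else snd i \<bullet> x))) = 0"
    using elem_affine_exists(2)[OF v T] by (auto elim!: eventually_mono)
qed

section \<open>The Crouzeix-Raviart space and the Marini flux\<close>

lemma mesh_facet:
  assumes T: "T \<in> \<T>" and F: "F facet_of T"
  obtains a where "a \<in> vertices T" "vertices F = vertices T - {a}" "F = convex hull (vertices T - {a})"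
    "card (vertices F) = CARD('n)"
proof -
  note C = mesh_simplex[OF T]
  obtain a where a: "a \<in> vertices T" "F = convex hull (vertices T - {a})"
    using facet_of_simplex[OF C(1)] F C(2) by metis
  have "\<not> affine_dependent (vertices T - {a})"
    using simplex_indep[OF C(1)] affine_dependent_subset by blast
  then have v: "vertices F = vertices T - {a}" using vertices_simplex a(2) by simp
  moreover have "card (vertices F) = CARD('n)"
    unfolding v using simplex_card[OF C(1)] simplex_finite[OF C(1)] a(1) by simp
  ultimately show ?thesis using that a by blast
qed

lemma facet_integral_affine_iff:
  assumes T: "T \<in> \<T>" and F: "F facet_of T"
  shows "face_integral F (\<lambda>x. m \<bullet> x + \<gamma>) = 0 \<longleftrightarrow> (\<Sum>c\<in>vertices F. m \<bullet> c + \<gamma>) = 0"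
proof -
  obtain a where a: "a \<in> vertices T" "vertices F = vertices T - {a}" "F = convex hull (vertices T - {a})"
    using mesh_facet[OF T F] by blast
  show ?thesis
    using face_integral_affine_iff[OF mesh_simplex(1)[OF T] a(1), of m \<gamma>] unfolding a(2) a(3)[symmetric] .
qed

text \<open>A face integral of an affine function vanishes exactly if its values at the vertices of
  the face sum to zero. This makes membership a finite system of linear equations in the
  coefficients.\<close>

lemma CR_space_iff:
  "v \<in> CR_space \<Omega> \<T> \<longleftrightarrow> v \<in> piecewise_affine \<T> \<and>
     (\<forall>T\<in>\<T>. \<forall>T'\<in>\<T>. \<forall>F. T \<noteq> T' \<and> F facet_of T \<and> F facet_of T' \<longrightarrow>
        (\<Sum>c\<in>vertices F. (slope T v - slope T' v) \<bullet> c + (offset T v - offset T' v)) = 0) \<and>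
     (\<forall>T\<in>\<T>. \<forall>F. F facet_of T \<and> F \<subseteq> frontier \<Omega> \<longrightarrow> (\<Sum>c\<in>vertices F. slope T v \<bullet> c + offset T v) = 0)"
proof (cases "v \<in> piecewise_affine \<T>")
  case True
  have d: "face_integral F (\<lambda>x. elem_affine T v x - elem_affine T' v x) = 0 \<longleftrightarrow>
      (\<Sum>c\<in>vertices F. (slope T v - slope T' v) \<bullet> c + (offset T v - offset T' v)) = 0"
    if "T \<in> \<T>" "T' \<in> \<T>" "F facet_of T" for T T' F
  proof -
    have "(\<lambda>x. elem_affine T v x - elem_affine T' v x) = (\<lambda>x. (slope T v - slope T' v) \<bullet> x + (offset T v - offset T' v))"
      using elem_affine_exists(1)[OF True] that by (auto simp: inner_diff_left)
    then show ?thesis using facet_integral_affine_iff[OF that(1,3)] by simp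
  qed
  have s: "face_integral F (elem_affine T v) = 0 \<longleftrightarrow> (\<Sum>c\<in>vertices F. slope T v \<bullet> c + offset T v) = 0"
    if "T \<in> \<T>" "F facet_of T" for T F
  proof -
    have "elem_affine T v = (\<lambda>x. slope T v \<bullet> x + offset T v)"
      using elem_affine_exists(1)[OF True that(1)] by auto
    then show ?thesis using facet_integral_affine_iff[OF that] by simp
  qed
  show ?thesis unfolding CR_space_def using True d s by (simp cong: conj_cong)
qed (simp add: CR_space_def)

lemma CR_piecewise_affine: "v \<in> CR_space \<Omega> \<T> \<Longrightarrow> v \<in> piecewise_affine \<T>"
  by (simp add: CR_space_def)

lemma CR_facet_sum_eq_0:
  assumes "v \<in> CR_space \<Omega> \<T>"
  shows "T \<in> \<T> \<Longrightarrow> T' \<in> \<T> \<Longrightarrow> T \<noteq> T' \<Longrightarrow> F facet_of T \<Longrightarrow> F facet_of T' \<Longrightarrow>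
      (\<Sum>c\<in>vertices F. (slope T v - slope T' v) \<bullet> c + (offset T v - offset T' v)) = 0"
    and "T \<in> \<T> \<Longrightarrow> F facet_of T \<Longrightarrow> F \<subseteq> frontier \<Omega> \<Longrightarrow> (\<Sum>c\<in>vertices F. slope T v \<bullet> c + offset T v) = 0"
  using CR_space_iff[THEN iffD1, OF assms, THEN conjunct2, THEN conjunct1, rule_format]
    CR_space_iff[THEN iffD1, OF assms, THEN conjunct2, THEN conjunct2, rule_format] by simp_all

lemma CR_subspace: "fun_subspace (CR_space \<Omega> \<T>)"
  unfolding fun_subspace_def
proof (intro conjI ballI allI)
  have z: "(\<lambda>x. 0) \<in> piecewise_affine \<T>"
    by (rule piecewise_affineI[where A="\<lambda>_. 0" and b="\<lambda>_. 0"]) simp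
  have "slope T (\<lambda>x. 0) = 0" "offset T (\<lambda>x. 0) = 0" if "T \<in> \<T>" for T
    using elem_affine_unique[OF z that, of 0 0] by simp_all
  then show "(\<lambda>x. 0) \<in> CR_space \<Omega> \<T>" using z by (simp add: CR_space_iff)
  fix v w c assume v: "v \<in> CR_space \<Omega> \<T>" and w: "w \<in> CR_space \<Omega> \<T>"
  note pv = CR_piecewise_affine[OF v] and pw = CR_piecewise_affine[OF w]
  note lin = piecewise_affine_add_scaled[OF pv pw, where c=c]
  show "(\<lambda>x. v x + c * w x) \<in> CR_space \<Omega> \<T>"
    unfolding CR_space_iff
  proof (intro conjI ballI allI impI lin(1))
    fix T T' F assume T: "T \<in> \<T>" "T' \<in> \<T>" and F: "T \<noteq> T' \<and> F facet_of T \<and> F facet_of T'"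
    let ?s = "\<lambda>v. \<Sum>c\<in>vertices F. (slope T v - slope T' v) \<bullet> c + (offset T v - offset T' v)"
    have "?s (\<lambda>x. v x + c * w x) = (\<Sum>d\<in>vertices F. ((slope T v - slope T' v) \<bullet> d + (offset T v - offset T' v))
        + c * ((slope T w - slope T' w) \<bullet> d + (offset T w - offset T' w)))"
      unfolding lin(2,3)[OF T(1)] lin(2,3)[OF T(2)]
      by (rule sum.cong) (simp_all add: inner_add_left inner_diff_left algebra_simps)
    also have "\<dots> = ?s v + c * ?s w" by (subst sum.distrib, subst sum_distrib_left[symmetric]) (rule refl)
    also have "\<dots> = 0" using CR_facet_sum_eq_0(1)[OF v T] CR_facet_sum_eq_0(1)[OF w T] F by simp
    finally show "?s (\<lambda>x. v x + c * w x) = 0" .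
  next
    fix T F assume T: "T \<in> \<T>" and F: "F facet_of T \<and> F \<subseteq> frontier \<Omega>"
    let ?s = "\<lambda>v. \<Sum>c\<in>vertices F. slope T v \<bullet> c + offset T v"
    have "?s (\<lambda>x. v x + c * w x) = (\<Sum>d\<in>vertices F. (slope T v \<bullet> d + offset T v) + c * (slope T w \<bullet> d + offset T w))"
      unfolding lin(2,3)[OF T] by (rule sum.cong) (simp_all add: inner_add_left algebra_simps)
    also have "\<dots> = ?s v + c * ?s w" by (subst sum.distrib, subst sum_distrib_left[symmetric]) (rule refl)
    also have "\<dots> = 0" using CR_facet_sum_eq_0(2)[OF v T] CR_facet_sum_eq_0(2)[OF w T] F by simp
    finally show "?s (\<lambda>x. v x + c * w x) = 0" .
  qed
qed

text \<open>Without broken gradient the function is constant on each element. The facet conditions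
  equate the constants of neighbours and annihilate those at the boundary, and connectedness through
  facets does the rest.\<close>

lemma CR_grad_eq_0:
  assumes v: "v \<in> CR_space \<Omega> \<T>" and B: "L2_inner \<Omega> (broken_grad \<T> v) (broken_grad \<T> v) = 0"
  shows "AE x in lebesgue. x \<in> \<Omega> \<longrightarrow> v x = 0"
proof -
  note pv = CR_piecewise_affine[OF v]
  have s0: "slope T v = 0" if T: "T \<in> \<T>" for T
  proof -
    have "(\<Sum>T\<in>\<T>. measure lborel T * (slope T v \<bullet> slope T v)) = 0"
      using B broken_grad_inner[OF pv pv] by simp
    then have "measure lborel T * (slope T v \<bullet> slope T v) = 0"
      using T finite_mesh by (subst (asm) sum_nonneg_eq_0_iff) auto
    then show ?thesis using mesh_volume_pos[OF T] by simp
  qed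
  have b0: "offset T v = 0" if "T \<in> \<T>" for T
  proof (rule facewise_constant_eq_0[of "\<lambda>T. offset T v", OF _ _ that])
    fix T T' F assume T: "T \<in> \<T>" "T' \<in> \<T>" "T \<noteq> T'" and F: "F facet_of T" "F facet_of T'"
    have "card (vertices F) = CARD('n)" using mesh_facet[OF T(1) F(1)] by blast
    moreover have "(\<Sum>c\<in>vertices F. (slope T v - slope T' v) \<bullet> c + (offset T v - offset T' v)) = 0"
      by (rule CR_facet_sum_eq_0(1)[OF v T F])
    ultimately show "offset T v = offset T' v" by (simp add: s0 T)
  next
    fix T F assume T: "T \<in> \<T>" and F: "F facet_of T" "F \<subseteq> frontier \<Omega>"
    have "card (vertices F) = CARD('n)" using mesh_facet[OF T F(1)] by blast
    moreover have "(\<Sum>c\<in>vertices F. slope T v \<bullet> c + offset T v) = 0"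
      by (rule CR_facet_sum_eq_0(2)[OF v T F])
    ultimately show "offset T v = 0" by (simp add: s0 T)
  qed
  show ?thesis
  proof (rule AE_elements)
    fix T assume T: "T \<in> \<T>"
    show "AE x in lebesgue. x \<in> interior T \<longrightarrow> v x = 0"
      using elem_affine_exists(2)[OF pv T] s0[OF T] b0[OF T] by simp
  qed
qed

lemma CR_form:
  assumes "u \<in> piecewise_affine \<T>" "v \<in> piecewise_affine \<T>" "w \<in> piecewise_affine \<T>"
  shows "L2_inner \<Omega> (broken_grad \<T> (\<lambda>x. u x + c * v x)) (broken_grad \<T> w) =
    L2_inner \<Omega> (broken_grad \<T> u) (broken_grad \<T> w) + c * L2_inner \<Omega> (broken_grad \<T> v) (broken_grad \<T> w)"
  unfolding broken_grad_inner[OF piecewise_affine_add_scaled(1)[OF assms(1,2)] assms(3)]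
    broken_grad_inner[OF assms(1,3)] broken_grad_inner[OF assms(2,3)] sum_distrib_left sum.distrib[symmetric]
  by (rule sum.cong) (simp_all add: piecewise_affine_add_scaled[OF assms(1,2)] inner_add_left algebra_simps)

lemma CR_AE_0:
  assumes v: "v \<in> piecewise_affine \<T>" and eq: "AE x in lebesgue. x \<in> \<Omega> \<longrightarrow> v x = 0"
  shows "L2_inner \<Omega> (broken_grad \<T> v) (broken_grad \<T> v) = 0"
proof -
  have "slope T v = 0" if T: "T \<in> \<T>" for T
    using elem_affine_unique(1)[OF v T, of 0 0] AE_element[OF eq T] by simp
  then show ?thesis unfolding broken_grad_inner[OF v v] by simp
qed

lemma AE_0_add_scaled:
  assumes "AE x in lebesgue. x \<in> \<Omega> \<longrightarrow> v x = (0::real)" "AE x in lebesgue. x \<in> \<Omega> \<longrightarrow> w x = 0"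
  shows "AE x in lebesgue. x \<in> \<Omega> \<longrightarrow> v x + c * w x = 0"
  using assms by eventually_elim simp

lemma finite_index: "finite (\<T> \<times> insert 0 (Basis :: (real ^ 'n) set))"
  using finite_mesh by simp

lemmas CR_finite_dim =
  CR_subspace finite_index piecewise_affine_finite_dim[OF CR_piecewise_affine] AE_0_add_scaled
  CR_form[OF CR_piecewise_affine CR_piecewise_affine CR_piecewise_affine]

lemma z_CR:
  assumes g: "g \<in> L2_space \<Omega>"
  shows "z_CR \<Omega> \<T> g \<in> CR_space \<Omega> \<T>"
    and "v \<in> CR_space \<Omega> \<T> \<Longrightarrow> L2_inner \<Omega> (broken_grad \<T> (z_CR \<Omega> \<T> g)) (broken_grad \<T> v) = L2_inner \<Omega> g v"
proof -
  have L: "v \<in> L2_space \<Omega>" if "v \<in> CR_space \<Omega> \<T>" for v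
    by (rule piecewise_affine_L2[OF CR_piecewise_affine[OF that]])
  obtain z where "z \<in> CR_space \<Omega> \<T>"
    "\<And>v. v \<in> CR_space \<Omega> \<T> \<Longrightarrow> L2_inner \<Omega> (broken_grad \<T> z) (broken_grad \<T> v) = L2_inner \<Omega> g v"
  proof (rule finite_dim_Riesz[where B="\<lambda>u v. L2_inner \<Omega> (broken_grad \<T> u) (broken_grad \<T> v)"
        and N="\<lambda>v. AE x in lebesgue. x \<in> \<Omega> \<longrightarrow> v x = 0" and l="L2_inner \<Omega> g", OF CR_finite_dim])
    show "L2_inner \<Omega> g (\<lambda>x. u x + c * v x) = L2_inner \<Omega> g u + c * L2_inner \<Omega> g v"
      if "u \<in> CR_space \<Omega> \<T>" "v \<in> CR_space \<Omega> \<T>" for u v c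
      using L2_inner_add_scaled_right[OF L[OF that(1)] L[OF that(2)] g, of c] by simp
    show "L2_inner \<Omega> g v = 0" if v: "v \<in> CR_space \<Omega> \<T>"
      and "L2_inner \<Omega> (broken_grad \<T> v) (broken_grad \<T> v) = 0" for v
    proof -
      have "L2_norm \<Omega> v = 0" using CR_grad_eq_0[OF that] L2_norm_eq_0_iff[OF L[OF v]] by blast
      then show ?thesis using L2_Cauchy_Schwarz[OF g L[OF v]] by simp
    qed
  qed (auto intro: L2_inner_commute CR_AE_0 CR_piecewise_affine)
  then have "\<exists>z. z \<in> CR_space \<Omega> \<T> \<and>
     (\<forall>v\<in>CR_space \<Omega> \<T>. L2_inner \<Omega> (broken_grad \<T> z) (broken_grad \<T> v) = L2_inner \<Omega> g v)" by blast
  from someI_ex[OF this] show "z_CR \<Omega> \<T> g \<in> CR_space \<Omega> \<T>"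
    "v \<in> CR_space \<Omega> \<T> \<Longrightarrow> L2_inner \<Omega> (broken_grad \<T> (z_CR \<Omega> \<T> g)) (broken_grad \<T> v) = L2_inner \<Omega> g v"
    unfolding z_CR_def[symmetric] by auto
qed

text \<open>Equivalence of norms in finite dimension. The constant may depend on the mesh in any
  way, as it only serves to show that \<open>\<kappa>_M\<close> is finite.\<close>

lemma CR_Poincare:
  obtains K where "K \<ge> 0" "\<And>v. v \<in> CR_space \<Omega> \<T> \<Longrightarrow> L2_norm \<Omega> v \<le> K * L2_norm \<Omega> (broken_grad \<T> v)"
proof -
  have L: "v \<in> L2_space \<Omega>" if "v \<in> CR_space \<Omega> \<T>" for v
    by (rule piecewise_affine_L2[OF CR_piecewise_affine[OF that]])
  obtain K where "K \<ge> 0" "\<And>v. v \<in> CR_space \<Omega> \<T> \<Longrightarrow> L2_norm \<Omega> v \<le> K * sqrt (L2_inner \<Omega> (broken_grad \<T> v) (broken_grad \<T> v))"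
  proof (rule finite_dim_norm_bound[where B="\<lambda>u v. L2_inner \<Omega> (broken_grad \<T> u) (broken_grad \<T> v)"
        and N="\<lambda>v. AE x in lebesgue. x \<in> \<Omega> \<longrightarrow> v x = 0" and Q="L2_norm \<Omega>", OF CR_finite_dim])
    show "L2_norm \<Omega> (\<lambda>x. u x + c * v x) \<le> L2_norm \<Omega> u + \<bar>c\<bar> * L2_norm \<Omega> v"
      if "u \<in> CR_space \<Omega> \<T>" "v \<in> CR_space \<Omega> \<T>" for u v c
      using L2_norm_triangle[OF L[OF that(1)] L2_space_scaled[OF L[OF that(2)], of c]] L2_norm_scaled[of \<Omega> c v] by simp
    show "L2_norm \<Omega> v = 0" if v: "v \<in> CR_space \<Omega> \<T>"
      and "L2_inner \<Omega> (broken_grad \<T> v) (broken_grad \<T> v) = 0" for v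
      using CR_grad_eq_0[OF that] L2_norm_eq_0_iff[OF L[OF v]] by blast
  qed (auto intro: L2_inner_commute CR_AE_0 CR_piecewise_affine)
  then show ?thesis using that unfolding L2_norm_def[of _ "broken_grad _ _"] by blast
qed

section \<open>Interpolation of test functions and equilibration of the flux\<close>

lemma piecewise_constant_value:
  assumes "g \<in> piecewise_constant \<T>"
  obtains c where "\<And>T. T \<in> \<T> \<Longrightarrow> AE x in lebesgue. x \<in> interior T \<longrightarrow> g x = c T"
proof -
  have "\<forall>T\<in>\<T>. \<exists>c. AE x in lebesgue. x \<in> T \<longrightarrow> g x = c" using assms by (simp add: piecewise_constant_def)
  then obtain c where c: "\<forall>T\<in>\<T>. AE x in lebesgue. x \<in> T \<longrightarrow> g x = c T" by (rule bchoice[THEN exE])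
  have "AE x in lebesgue. x \<in> interior T \<longrightarrow> g x = c T" if "T \<in> \<T>" for T
    using c[rule_format, OF that] by eventually_elim (use interior_subset[of T] in blast)
  then show ?thesis by (rule that)
qed

lemma piecewise_constant_L2: "g \<in> piecewise_constant \<T> \<Longrightarrow> g \<in> L2_space \<Omega>"
proof -
  assume "g \<in> piecewise_constant \<T>"
  then obtain c where "\<And>T. T \<in> \<T> \<Longrightarrow> AE x in lebesgue. x \<in> interior T \<longrightarrow> g x = c T"
    using piecewise_constant_value by blast
  then show ?thesis by (rule L2_AE_continuous[where f="\<lambda>T x. c T"]) auto
qed

lemma marini_flux_AE:
  assumes g: "g \<in> piecewise_constant \<T>" and T: "T \<in> \<T>"
    and c: "AE x in lebesgue. x \<in> interior T \<longrightarrow> g x = c"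
  shows "AE x in lebesgue. x \<in> interior T \<longrightarrow> marini_flux \<Omega> \<T> g x =
    slope T (z_CR \<Omega> \<T> g) - (c / real CARD('n)) *\<^sub>R (x - barycentre T)"
proof -
  have z: "z_CR \<Omega> \<T> g \<in> piecewise_affine \<T>"
    by (rule CR_piecewise_affine[OF z_CR(1)[OF piecewise_constant_L2[OF g]]])
  show ?thesis
    using broken_grad_AE[OF z T] c
  proof eventually_elim
    fix x assume b: "x \<in> interior T \<longrightarrow> broken_grad \<T> (z_CR \<Omega> \<T> g) x = slope T (z_CR \<Omega> \<T> g)"
      and gx: "x \<in> interior T \<longrightarrow> g x = c"
    show "x \<in> interior T \<longrightarrow> marini_flux \<Omega> \<T> g x = slope T (z_CR \<Omega> \<T> g) - (c / real CARD('n)) *\<^sub>R (x - barycentre T)"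
    proof
      assume x: "x \<in> interior T"
      show "marini_flux \<Omega> \<T> g x = slope T (z_CR \<Omega> \<T> g) - (c / real CARD('n)) *\<^sub>R (x - barycentre T)"
        unfolding marini_flux_def sum_interior[OF T x] using b gx x by simp
    qed
  qed
qed

lemma marini_flux_L2:
  assumes g: "g \<in> piecewise_constant \<T>" shows "marini_flux \<Omega> \<T> g \<in> L2_space \<Omega>"
proof -
  obtain c where c: "\<And>T. T \<in> \<T> \<Longrightarrow> AE x in lebesgue. x \<in> interior T \<longrightarrow> g x = c T"
    using piecewise_constant_value[OF g] by blast
  show ?thesis
    by (rule L2_AE_continuous[OF marini_flux_AE[OF g _ c]]) (auto intro!: continuous_intros)
qed

text \<open>The interpolants on the single elements fit together because the vertex values on a
  facet sum to n times the mean of \<phi> there, which both neighbours compute alike. On boundary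
  facets the mean is zero, since test functions vanish on the frontier.\<close>

lemma CR_interpolation:
  assumes phi: "\<phi> \<in> test_functions \<Omega>"
  obtains v where "v \<in> CR_space \<Omega> \<T>"
    "\<And>T w. T \<in> \<T> \<Longrightarrow> (\<integral>x. indicator T x * (gradient \<phi> x \<bullet> w) \<partial>lborel) = measure lborel T * (slope T v \<bullet> w)"
    "\<And>T. T \<in> \<T> \<Longrightarrow> (\<integral>x. indicator T x * (gradient \<phi> x \<bullet> (x - barycentre T)) \<partial>lborel) =
      real CARD('n) * ((\<integral>x. indicator T x * (slope T v \<bullet> x + offset T v) \<partial>lborel) - (\<integral>x. indicator T x * \<phi> x \<partial>lborel))"
proof -
  let ?n = "real CARD('n)"
  have C1: "C_k (Suc 0) \<phi>" using test_functions_smooth[OF phi] by blast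
  let ?m = "\<lambda>T c. face_mean (vertices T) c \<phi>"
  let ?val = "\<lambda>T c. (\<Sum>c\<in>vertices T. ?m T c) - ?n * ?m T c"
  have "\<forall>T\<in>\<T>. \<exists>A. \<exists>b. \<forall>c\<in>vertices T. A \<bullet> c + b = ?val T c"
  proof
    fix T assume T: "T \<in> \<T>"
    obtain A b where "\<And>c. c \<in> vertices T \<Longrightarrow> A \<bullet> c + b = ?val T c"
      using affine_interpolation[OF simplex_indep[OF mesh_simplex(1)[OF T]], of "?val T"] by blast
    then show "\<exists>A. \<exists>b. \<forall>c\<in>vertices T. A \<bullet> c + b = ?val T c" by (intro exI ballI)
  qed
  then obtain A where "\<forall>T\<in>\<T>. \<exists>b. \<forall>c\<in>vertices T. A T \<bullet> c + b = ?val T c" by (rule bchoice[THEN exE])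
  then obtain b where Ab: "\<forall>T\<in>\<T>. \<forall>c\<in>vertices T. A T \<bullet> c + b T = ?val T c" by (rule bchoice[THEN exE])
  define v where "v x = (\<Sum>T\<in>\<T>. indicator (interior T) x *\<^sub>R (A T \<bullet> x + b T))" for x
  have vT: "AE x in lebesgue. x \<in> interior T \<longrightarrow> v x = A T \<bullet> x + b T" if T: "T \<in> \<T>" for T
    unfolding v_def sum_interior[OF T] by (intro AE_I2 impI) (rule sum_interior[OF T])
  have pv: "v \<in> piecewise_affine \<T>" by (rule piecewise_affineI[OF vT])
  have sl: "slope T v = A T" "offset T v = b T" if "T \<in> \<T>" for T
    using elem_affine_unique[OF pv that vT[OF that]] by simp_all
  \<comment> \<open>With S the sum of all face means, the n remaining vertices contribute n S - n (S
    - m_a) = n m_a.\<close>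
  have facet_sum: "(\<Sum>c\<in>vertices T - {a}. A T \<bullet> c + b T) = ?n * ?m T a"
    if T: "T \<in> \<T>" and a: "a \<in> vertices T" for T a
  proof -
    note S = mesh_simplex(1)[OF T]
    have cn: "card (vertices T - {a}) = CARD('n)" using simplex_card[OF S] simplex_finite[OF S] a by simp
    have "(\<Sum>c\<in>vertices T - {a}. A T \<bullet> c + b T) = (\<Sum>c\<in>vertices T - {a}. ?val T c)"
      using Ab T by (intro sum.cong) auto
    also have "\<dots> = ?n * (\<Sum>c\<in>vertices T. ?m T c) - ?n * (\<Sum>c\<in>vertices T - {a}. ?m T c)"
      by (simp add: sum_subtractf sum_distrib_left cn)
    also have "(\<Sum>c\<in>vertices T. ?m T c) = ?m T a + (\<Sum>c\<in>vertices T - {a}. ?m T c)"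
      by (rule sum.remove[OF simplex_finite[OF S] a])
    finally show ?thesis by (simp add: algebra_simps)
  qed
  have mean_eq: "?m T a = ?m T' a'"
    if T: "T \<in> \<T>" "T' \<in> \<T>" and a: "a \<in> vertices T" "a' \<in> vertices T'" and K: "vertices T - {a} = vertices T' - {a'}" for T T' a a'
  proof -
    let ?K = "vertices T - {a}"
    have i: "insert a ?K = vertices T" "insert a' ?K = vertices T'" using a K by auto
    have nK: "a \<notin> ?K" "a' \<notin> ?K" using K by auto
    have "cone_functional T a \<phi> * measure lborel T' = cone_functional T' a' \<phi> * measure lborel T"
      using cone_functional_common_face[OF nK _ _ C1] mesh_simplex[OF T(1)] mesh_simplex[OF T(2)] unfolding i by metis
    then show ?thesis
      unfolding face_mean_def[OF mesh_simplex(1)[OF T(1)]] face_mean_def[OF mesh_simplex(1)[OF T(2)]]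
        mesh_simplex(2)[OF T(1), symmetric] mesh_simplex(2)[OF T(2), symmetric]
      using mesh_volume_pos[OF T(1)] mesh_volume_pos[OF T(2)] by (simp add: field_simps)
  qed
  have "v \<in> CR_space \<Omega> \<T>"
    unfolding CR_space_iff
  proof (intro conjI ballI allI impI pv)
    fix T T' F assume T: "T \<in> \<T>" "T' \<in> \<T>" and "T \<noteq> T' \<and> F facet_of T \<and> F facet_of T'"
    then have F: "T \<noteq> T'" "F facet_of T" "F facet_of T'" by simp_all
    obtain a where a: "a \<in> vertices T" "vertices F = vertices T - {a}" by (rule mesh_facet[OF T(1) F(2)]) (rule that)
    obtain a' where a': "a' \<in> vertices T'" "vertices F = vertices T' - {a'}" by (rule mesh_facet[OF T(2) F(3)]) (rule that)
    have "(\<Sum>c\<in>vertices F. (A T - A T') \<bullet> c + (b T - b T')) =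
        (\<Sum>c\<in>vertices T - {a}. A T \<bullet> c + b T) - (\<Sum>c\<in>vertices T' - {a'}. A T' \<bullet> c + b T')"
      unfolding a(2)[symmetric] a'(2)[symmetric] sum_subtractf[symmetric]
      by (rule sum.cong) (simp_all add: inner_diff_left)
    also have "\<dots> = 0"
      unfolding facet_sum[OF T(1) a(1)] facet_sum[OF T(2) a'(1)] using mean_eq[OF T a(1) a'(1)] a(2) a'(2) by simp
    finally show "(\<Sum>c\<in>vertices F. (slope T v - slope T' v) \<bullet> c + (offset T v - offset T' v)) = 0"
      unfolding sl[OF T(1)] sl[OF T(2)] .
  next
    fix T F assume T: "T \<in> \<T>" and "F facet_of T \<and> F \<subseteq> frontier \<Omega>"
    then have F: "F facet_of T" "F \<subseteq> frontier \<Omega>" by simp_all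
    note S = mesh_simplex[OF T]
    obtain a where a: "a \<in> vertices T" "vertices F = vertices T - {a}" "F = convex hull (vertices T - {a})"
      by (rule mesh_facet[OF T F(1)]) (rule that)
    have "cone_functional (convex hull (vertices T)) a \<phi> = 0"
    proof (rule simplex_cone_functional_eq_0[OF S(1) a(1) C1])
      fix y assume "y \<in> convex hull (vertices T - {a})"
      then have "y \<in> frontier \<Omega>" using F(2) unfolding a(3) by blast
      then have "y \<notin> \<Omega>" using open_domain by (auto simp: frontier_def interior_open)
      then show "\<phi> y = 0" by (rule test_functions_outside[OF phi])
    qed
    then have "?m T a = 0" by (simp add: face_mean_def[OF S(1)])
    then show "(\<Sum>c\<in>vertices F. slope T v \<bullet> c + offset T v) = 0"
      unfolding sl[OF T] a(2) facet_sum[OF T a(1)] by simp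
  qed
  moreover have "(\<integral>x. indicator T x * (gradient \<phi> x \<bullet> w) \<partial>lborel) = measure lborel T * (slope T v \<bullet> w)"
    "(\<integral>x. indicator T x * (gradient \<phi> x \<bullet> (x - barycentre T)) \<partial>lborel) =
      ?n * ((\<integral>x. indicator T x * (slope T v \<bullet> x + offset T v) \<partial>lborel) - (\<integral>x. indicator T x * \<phi> x \<partial>lborel))"
    if T: "T \<in> \<T>" for T w
    using CR_interpolant[OF mesh_simplex(1)[OF T] C1, of "A T" "b T"] Ab T
    unfolding mesh_simplex(2)[OF T, symmetric] sl[OF T] by auto
  ultimately show ?thesis by (rule that)
qed

text \<open>The mean gradients of \<phi> and of its interpolant v agree, so the constant part of the
  flux yields the broken form of the discrete solution with v, which is (g, v). The linear
  correction sees the moment of the gradient of \<phi> about the barycentre and contributes (g,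
  \<phi>) - (g, v).\<close>

lemma marini_flux_test:
  assumes g: "g \<in> piecewise_constant \<T>" and phi: "\<phi> \<in> test_functions \<Omega>"
  shows "L2_inner \<Omega> (marini_flux \<Omega> \<T> g) (gradient \<phi>) = L2_inner \<Omega> g \<phi>"
proof -
  let ?n = "real CARD('n)" and ?z = "z_CR \<Omega> \<T> g"
  obtain c where c: "\<And>T. T \<in> \<T> \<Longrightarrow> AE x in lebesgue. x \<in> interior T \<longrightarrow> g x = c T"
    using piecewise_constant_value[OF g] by blast
  obtain v where v: "v \<in> CR_space \<Omega> \<T>"
    "\<And>T w. T \<in> \<T> \<Longrightarrow> (\<integral>x. indicator T x * (gradient \<phi> x \<bullet> w) \<partial>lborel) = measure lborel T * (slope T v \<bullet> w)"
    "\<And>T. T \<in> \<T> \<Longrightarrow> (\<integral>x. indicator T x * (gradient \<phi> x \<bullet> (x - barycentre T)) \<partial>lborel) =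
      ?n * ((\<integral>x. indicator T x * (slope T v \<bullet> x + offset T v) \<partial>lborel) - (\<integral>x. indicator T x * \<phi> x \<partial>lborel))"
    using CR_interpolation[OF phi] by blast
  note pv = CR_piecewise_affine[OF v(1)]
  note z = z_CR[OF piecewise_constant_L2[OF g]]
  have cg: "continuous_on UNIV (gradient \<phi>)" and cp: "continuous_on UNIV \<phi>"
    by (rule continuous_gradient[OF phi], rule test_functions_continuous[OF phi])
  have int: "integrable lborel (\<lambda>x. indicator T x * (gradient \<phi> x \<bullet> f x))" if "T \<in> \<T>" "continuous_on UNIV f" for T f
    by (rule integrable_on_compact[OF mesh_compact[OF that(1)]]) (intro continuous_intros cg that(2))
  have "L2_inner \<Omega> (marini_flux \<Omega> \<T> g) (gradient \<phi>) =
      (\<Sum>T\<in>\<T>. \<integral>x. indicator T x * ((slope T ?z - (c T / ?n) *\<^sub>R (x - barycentre T)) \<bullet> gradient \<phi> x) \<partial>lborel)"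
    by (rule L2_inner_AE_continuous[OF marini_flux_AE[OF g _ c]]) (auto intro!: continuous_intros cg)
  also have "\<dots> = (\<Sum>T\<in>\<T>. measure lborel T * (slope T ?z \<bullet> slope T v)
      - c T * (\<integral>x. indicator T x * (slope T v \<bullet> x + offset T v) \<partial>lborel) + c T * (\<integral>x. indicator T x * \<phi> x \<partial>lborel))"
  proof (rule sum.cong[OF refl])
    fix T assume T: "T \<in> \<T>"
    have "(\<integral>x. indicator T x * ((slope T ?z - (c T / ?n) *\<^sub>R (x - barycentre T)) \<bullet> gradient \<phi> x) \<partial>lborel) =
        (\<integral>x. indicator T x * (gradient \<phi> x \<bullet> slope T ?z) - (c T / ?n) * (indicator T x * (gradient \<phi> x \<bullet> (x - barycentre T))) \<partial>lborel)"
      by (rule Bochner_Integration.integral_cong[OF refl]) (simp add: inner_diff_left inner_diff_right inner_commute algebra_simps)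
    also have "\<dots> = (\<integral>x. indicator T x * (gradient \<phi> x \<bullet> slope T ?z) \<partial>lborel)
        - (c T / ?n) * (\<integral>x. indicator T x * (gradient \<phi> x \<bullet> (x - barycentre T)) \<partial>lborel)"
    proof -
      have "continuous_on UNIV (\<lambda>x. x - barycentre T)" by (intro continuous_intros)
      from int[OF T this] int[OF T, of "\<lambda>x. slope T ?z"] show ?thesis
        by (subst Bochner_Integration.integral_diff) auto
    qed
    also have "\<dots> = measure lborel T * (slope T ?z \<bullet> slope T v)
      - c T * (\<integral>x. indicator T x * (slope T v \<bullet> x + offset T v) \<partial>lborel) + c T * (\<integral>x. indicator T x * \<phi> x \<partial>lborel)"
      unfolding v(2)[OF T] v(3)[OF T] by (simp add: inner_commute algebra_simps)
    finally show "(\<integral>x. indicator T x * ((slope T ?z - (c T / ?n) *\<^sub>R (x - barycentre T)) \<bullet> gradient \<phi> x) \<partial>lborel) =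
      measure lborel T * (slope T ?z \<bullet> slope T v)
      - c T * (\<integral>x. indicator T x * (slope T v \<bullet> x + offset T v) \<partial>lborel) + c T * (\<integral>x. indicator T x * \<phi> x \<partial>lborel)" .
  qed
  also have "\<dots> = L2_inner \<Omega> (broken_grad \<T> ?z) (broken_grad \<T> v) - L2_inner \<Omega> g v + L2_inner \<Omega> g \<phi>"
  proof -
    have 1: "L2_inner \<Omega> g v = (\<Sum>T\<in>\<T>. c T * (\<integral>x. indicator T x * (slope T v \<bullet> x + offset T v) \<partial>lborel))"
    proof -
      have "L2_inner \<Omega> g v = (\<Sum>T\<in>\<T>. \<integral>x. indicator T x * (c T \<bullet> (slope T v \<bullet> x + offset T v)) \<partial>lborel)"
        by (rule L2_inner_AE_continuous[where f="\<lambda>T x. c T", OF c _ elem_affine_exists(2)[OF pv]]) (auto intro!: continuous_intros)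
      also have "\<dots> = (\<Sum>T\<in>\<T>. \<integral>x. c T * (indicator T x * (slope T v \<bullet> x + offset T v)) \<partial>lborel)"
        by (simp add: mult.left_commute)
      finally show ?thesis by simp
    qed
    have 2: "L2_inner \<Omega> g \<phi> = (\<Sum>T\<in>\<T>. c T * (\<integral>x. indicator T x * \<phi> x \<partial>lborel))"
    proof -
      have "L2_inner \<Omega> g \<phi> = (\<Sum>T\<in>\<T>. \<integral>x. indicator T x * (c T \<bullet> \<phi> x) \<partial>lborel)"
        by (rule L2_inner_AE_continuous[where f="\<lambda>T x. c T" and g="\<lambda>T. \<phi>", OF c]) (auto intro: cp)
      also have "\<dots> = (\<Sum>T\<in>\<T>. \<integral>x. c T * (indicator T x * \<phi> x) \<partial>lborel)"
        by (simp add: mult.left_commute)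
      finally show ?thesis by simp
    qed
    show ?thesis
      unfolding 1 2 broken_grad_inner[OF CR_piecewise_affine[OF z(1)] pv] by (simp add: sum.distrib sum_subtractf)
  qed
  also have "\<dots> = L2_inner \<Omega> g \<phi>" using z(2)[OF v(1)] by simp
  finally show ?thesis .
qed

end

section \<open>Error estimates\<close>

lemma L2_norm_mono:
  fixes v :: "'a::euclidean_space \<Rightarrow> 'b::euclidean_space" and w :: "'a \<Rightarrow> 'c::euclidean_space"
  assumes v: "v \<in> L2_space S" and w: "w \<in> L2_space S"
    and le: "AE x in lebesgue. x \<in> S \<longrightarrow> norm (v x) \<le> norm (w x)"
  shows "L2_norm S v \<le> L2_norm S w"
proof -
  have "L2_inner S v v \<le> L2_inner S w w"
    unfolding L2_inner_def set_lebesgue_integral_def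
  proof (rule integral_mono_AE)
    show "integrable lebesgue (\<lambda>x. indicator S x *\<^sub>R (v x \<bullet> v x))" "integrable lebesgue (\<lambda>x. indicator S x *\<^sub>R (w x \<bullet> w x))"
      using L2_inner_integrable[OF v v] L2_inner_integrable[OF w w] by (simp_all add: set_integrable_def)
    show "AE x in lebesgue. indicator S x *\<^sub>R (v x \<bullet> v x) \<le> indicator S x *\<^sub>R (w x \<bullet> w x)"
      using le
    proof eventually_elim
      fix x assume x: "x \<in> S \<longrightarrow> norm (v x) \<le> norm (w x)"
      show "indicator S x *\<^sub>R (v x \<bullet> v x) \<le> indicator S x *\<^sub>R (w x \<bullet> w x)"
        using x by (cases "x \<in> S") (simp_all add: norm_le)
    qed
  qed
  then show ?thesis by (simp add: L2_norm_def)
qed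

text \<open>By Lagrange's identity the squares of both sides differ by the square of c b - k
  a.\<close>

lemma Cauchy_Schwarz_2: "c * a + k * b \<le> sqrt (c\<^sup>2 + k\<^sup>2) * sqrt (a\<^sup>2 + b\<^sup>2)" for a b c k :: real
proof -
  have "(c * a + k * b)\<^sup>2 \<le> (c\<^sup>2 + k\<^sup>2) * (a\<^sup>2 + b\<^sup>2)"
    using zero_le_power2[of "c * b - k * a"] by (simp add: power2_eq_square algebra_simps)
  then have "c * a + k * b \<le> sqrt ((c\<^sup>2 + k\<^sup>2) * (a\<^sup>2 + b\<^sup>2))" by (rule real_le_rsqrt)
  then show ?thesis by (simp add: real_sqrt_mult)
qed

text \<open>The derivatives of \<phi> are test functions again, so the weak gradient may be tested
  with each of them. The integration by parts is the origin of the minus sign in the load.\<close>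

lemma distr_laplacian_wgrad:
  fixes u w :: "real ^ 'n::finite \<Rightarrow> real"
  assumes U: "open U" "bounded U" and u: "u \<in> H1_space U" and lap: "has_distr_laplacian U u w"
    and phi: "\<phi> \<in> test_functions U"
  shows "L2_inner U (wgrad U u) (gradient \<phi>) = L2_inner U (\<lambda>x. - w x) \<phi>"
proof -
  note D = H1_D[OF U u]
  note d = test_functions_partial_deriv[OF phi]
  have int: "set_integrable lebesgue U (\<lambda>x. u x * partial_deriv i (partial_deriv i \<phi>) x)" for i
    using L2_inner_integrable[OF D(1) partial_deriv_L2[OF U d]] by simp
  have "L2_inner U (wgrad U u) (gradient \<phi>) = (\<Sum>i\<in>UNIV. L2_inner U (\<lambda>x. wgrad U u x $ i) (partial_deriv i \<phi>))"
    using L2_inner_eq_sum_components[OF D(2) gradient_L2[OF phi U]] by simp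
  also have "\<dots> = (\<Sum>i\<in>UNIV. - L2_inner U u (partial_deriv i (partial_deriv i \<phi>)))"
    using D(3) d by (simp add: has_weak_gradient_iff)
  also have "\<dots> = - (LINT x:U|lebesgue. u x * (\<Sum>i\<in>UNIV. partial_deriv i (partial_deriv i \<phi>) x))"
    unfolding L2_inner_def set_lebesgue_integral_def sum_negf
    using int by (subst Bochner_Integration.integral_sum[symmetric])
      (simp_all add: set_integrable_def sum_distrib_left del: sum_mult_indicator sum_indicator_mult)
  also have "\<dots> = - (LINT x:U|lebesgue. w x * \<phi> x)" using lap phi by (simp add: has_distr_laplacian_def)
  also have "\<dots> = L2_inner U (\<lambda>x. - w x) \<phi>" by (simp add: L2_inner_def set_lebesgue_integral_def)
  finally show ?thesis .
qed

context mesh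
begin

section \<open>The conforming discrete problems\<close>

lemma conforming_H10: "v \<in> conforming_space \<Omega> \<T> \<Longrightarrow> v \<in> H10_space \<Omega>"
  and conforming_piecewise_affine: "v \<in> conforming_space \<Omega> \<T> \<Longrightarrow> v \<in> piecewise_affine \<T>"
  by (simp_all add: conforming_space_def)

lemmas H10_H1' = H10_H1[OF open_domain bounded_domain]
lemmas H1_D' = H1_D[OF open_domain bounded_domain]

lemma conforming_subspace: "fun_subspace (conforming_space \<Omega> \<T>)"
  unfolding fun_subspace_def conforming_space_def
proof (intro conjI ballI allI IntI)
  show "(\<lambda>x. 0) \<in> H10_space \<Omega>" by (rule H10_zero[OF open_domain bounded_domain])
  show "(\<lambda>x. 0) \<in> piecewise_affine \<T>" by (rule piecewise_affineI[where A="\<lambda>_. 0" and b="\<lambda>_. 0"]) simp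
  fix v w c assume "v \<in> H10_space \<Omega> \<inter> piecewise_affine \<T>" "w \<in> H10_space \<Omega> \<inter> piecewise_affine \<T>"
  then show "(\<lambda>x. v x + c * w x) \<in> H10_space \<Omega>" "(\<lambda>x. v x + c * w x) \<in> piecewise_affine \<T>"
    using H10_add_scaled[OF open_domain bounded_domain] piecewise_affine_add_scaled(1) by auto
qed

lemma conforming_form:
  assumes "u \<in> conforming_space \<Omega> \<T>" "v \<in> conforming_space \<Omega> \<T>" "w \<in> conforming_space \<Omega> \<T>"
  shows "L2_inner \<Omega> (wgrad \<Omega> (\<lambda>x. u x + c * v x)) (wgrad \<Omega> w) =
    L2_inner \<Omega> (wgrad \<Omega> u) (wgrad \<Omega> w) + c * L2_inner \<Omega> (wgrad \<Omega> v) (wgrad \<Omega> w)"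
  using assms[THEN conforming_H10, THEN H10_H1']
  by (intro L2_inner_wgrad_add_scaled[OF open_domain bounded_domain] H1_D'(2))

lemma wgrad_AE_0:
  assumes "AE x in lebesgue. x \<in> \<Omega> \<longrightarrow> v x = 0"
  shows "L2_inner \<Omega> (wgrad \<Omega> v) (wgrad \<Omega> v) = 0"
proof -
  have eq: "AE x in lebesgue. x \<in> \<Omega> \<longrightarrow> v x = 0 \<bullet> x + 0" using assms by simp
  note w = wgrad_affine[OF open_domain bounded_domain eq]
  show ?thesis
    using L2_norm_eq_0_iff[OF H1_D'(2)[OF w(1)]] w(2) by (simp add: L2_norm_def)
qed

text \<open>A common source for the discrete solutions, whose data is an L^2 load, and the Ritz
  projection, whose data is an energy functional.\<close>

lemma conforming_Riesz:
  assumes lin: "\<And>u v c. u \<in> conforming_space \<Omega> \<T> \<Longrightarrow> v \<in> conforming_space \<Omega> \<T> \<Longrightarrow> l (\<lambda>x. u x + c * v x) = l u + c * l v"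
    and ker: "\<And>v. v \<in> conforming_space \<Omega> \<T> \<Longrightarrow> L2_norm \<Omega> (wgrad \<Omega> v) = 0 \<Longrightarrow> l v = 0"
  shows "\<exists>z. z \<in> conforming_space \<Omega> \<T> \<and> (\<forall>v\<in>conforming_space \<Omega> \<T>. L2_inner \<Omega> (wgrad \<Omega> z) (wgrad \<Omega> v) = l v)"
proof -
  obtain z where "z \<in> conforming_space \<Omega> \<T>"
    "\<And>v. v \<in> conforming_space \<Omega> \<T> \<Longrightarrow> L2_inner \<Omega> (wgrad \<Omega> z) (wgrad \<Omega> v) = l v"
  proof (rule finite_dim_Riesz[where B="\<lambda>u v. L2_inner \<Omega> (wgrad \<Omega> u) (wgrad \<Omega> v)"
        and N="\<lambda>v. AE x in lebesgue. x \<in> \<Omega> \<longrightarrow> v x = 0" and l=l,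
        OF conforming_subspace finite_index piecewise_affine_finite_dim[OF conforming_piecewise_affine] AE_0_add_scaled conforming_form])
    show "l (\<lambda>x. u x + c * v x) = l u + c * l v"
      if "u \<in> conforming_space \<Omega> \<T>" "v \<in> conforming_space \<Omega> \<T>" for u v c by (rule lin[OF that])
    show "l v = 0" if v: "v \<in> conforming_space \<Omega> \<T>" and "L2_inner \<Omega> (wgrad \<Omega> v) (wgrad \<Omega> v) = 0" for v
      using ker[OF v] that(2) by (simp add: L2_norm_def)
  qed (auto intro: L2_inner_commute wgrad_AE_0)
  then show ?thesis by blast
qed

lemma conforming_null:
  assumes v: "v \<in> conforming_space \<Omega> \<T>" and "L2_norm \<Omega> (wgrad \<Omega> v) = 0" and g: "g \<in> L2_space \<Omega>"
  shows "L2_inner \<Omega> g v = 0"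
proof -
  obtain K where "L2_norm \<Omega> v \<le> K * L2_norm \<Omega> (wgrad \<Omega> v)"
    using Friedrichs[OF open_domain bounded_domain] conforming_H10[OF v] by metis
  then have "L2_norm \<Omega> v = 0" using assms(2) L2_norm_nonneg[of \<Omega> v] by simp
  then show ?thesis using L2_Cauchy_Schwarz[OF g H1_D'(1)[OF H10_H1'[OF conforming_H10[OF v]]]] by simp
qed

lemma z_conf:
  assumes g: "g \<in> L2_space \<Omega>"
  shows "z_conf \<Omega> \<T> g \<in> conforming_space \<Omega> \<T>"
    and "v \<in> conforming_space \<Omega> \<T> \<Longrightarrow> L2_inner \<Omega> (wgrad \<Omega> (z_conf \<Omega> \<T> g)) (wgrad \<Omega> v) = L2_inner \<Omega> g v"
proof -
  have L: "v \<in> L2_space \<Omega>" if "v \<in> conforming_space \<Omega> \<T>" for v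
    by (rule H1_D'(1)[OF H10_H1'[OF conforming_H10[OF that]]])
  have "\<exists>z. z \<in> conforming_space \<Omega> \<T> \<and> (\<forall>v\<in>conforming_space \<Omega> \<T>. L2_inner \<Omega> (wgrad \<Omega> z) (wgrad \<Omega> v) = L2_inner \<Omega> g v)"
  proof (rule conforming_Riesz)
    show "L2_inner \<Omega> g (\<lambda>x. u x + c * v x) = L2_inner \<Omega> g u + c * L2_inner \<Omega> g v"
      if "u \<in> conforming_space \<Omega> \<T>" "v \<in> conforming_space \<Omega> \<T>" for u v c
      using L2_inner_add_scaled_right[OF L[OF that(1)] L[OF that(2)] g, of c] by simp
  qed (rule conforming_null[OF _ _ g])
  from someI_ex[OF this] show "z_conf \<Omega> \<T> g \<in> conforming_space \<Omega> \<T>"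
    "v \<in> conforming_space \<Omega> \<T> \<Longrightarrow> L2_inner \<Omega> (wgrad \<Omega> (z_conf \<Omega> \<T> g)) (wgrad \<Omega> v) = L2_inner \<Omega> g v"
    unfolding z_conf_def[symmetric] by auto
qed

lemma ritz_proj:
  assumes u: "u \<in> H10_space \<Omega>"
  shows "ritz_proj \<Omega> \<T> u \<in> conforming_space \<Omega> \<T>"
    and "v \<in> conforming_space \<Omega> \<T> \<Longrightarrow> L2_inner \<Omega> (wgrad \<Omega> (ritz_proj \<Omega> \<T> u)) (wgrad \<Omega> v) = L2_inner \<Omega> (wgrad \<Omega> u) (wgrad \<Omega> v)"
proof -
  note uG = H1_D'(2)[OF H10_H1'[OF u]]
  have "\<exists>z. z \<in> conforming_space \<Omega> \<T> \<and>
      (\<forall>v\<in>conforming_space \<Omega> \<T>. L2_inner \<Omega> (wgrad \<Omega> z) (wgrad \<Omega> v) = L2_inner \<Omega> (wgrad \<Omega> u) (wgrad \<Omega> v))"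
  proof (rule conforming_Riesz)
    show "L2_inner \<Omega> (wgrad \<Omega> u) (wgrad \<Omega> (\<lambda>x. y x + c * v x)) = L2_inner \<Omega> (wgrad \<Omega> u) (wgrad \<Omega> y) + c * L2_inner \<Omega> (wgrad \<Omega> u) (wgrad \<Omega> v)"
      if "y \<in> conforming_space \<Omega> \<T>" "v \<in> conforming_space \<Omega> \<T>" for y v c
      unfolding L2_inner_commute[of \<Omega> "wgrad \<Omega> u"]
      by (rule L2_inner_wgrad_add_scaled[OF open_domain bounded_domain])
        (use that conforming_H10 H10_H1' uG in auto)
    show "L2_inner \<Omega> (wgrad \<Omega> u) (wgrad \<Omega> v) = 0"
      if v: "v \<in> conforming_space \<Omega> \<T>" and "L2_norm \<Omega> (wgrad \<Omega> v) = 0" for v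
      using L2_Cauchy_Schwarz[OF uG H1_D'(2)[OF H10_H1'[OF conforming_H10[OF v]]]] that(2) by simp
  qed
  from someI_ex[OF this] show "ritz_proj \<Omega> \<T> u \<in> conforming_space \<Omega> \<T>"
    "v \<in> conforming_space \<Omega> \<T> \<Longrightarrow> L2_inner \<Omega> (wgrad \<Omega> (ritz_proj \<Omega> \<T> u)) (wgrad \<Omega> v) = L2_inner \<Omega> (wgrad \<Omega> u) (wgrad \<Omega> v)"
    unfolding ritz_proj_def[symmetric] by auto
qed

lemma marini_flux_H10:
  assumes g: "g \<in> piecewise_constant \<T>" and v: "v \<in> H10_space \<Omega>"
  shows "L2_inner \<Omega> (marini_flux \<Omega> \<T> g) (wgrad \<Omega> v) = L2_inner \<Omega> g v"
  by (rule H10_test_extension[OF open_domain bounded_domain piecewise_constant_L2[OF g] marini_flux_L2[OF g] marini_flux_test[OF g] v])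

text \<open>The difference consists of the broken gradient of the nonconforming solution, the linear
  correction and the gradient of the conforming solution. Testing each discrete equation with its
  own solution bounds the gradients by g, and the correction is g times a bounded field.\<close>

lemma flux_difference_bounded:
  obtains K where "\<And>g. g \<in> piecewise_constant \<T> \<Longrightarrow>
    L2_norm \<Omega> (\<lambda>x. marini_flux \<Omega> \<T> g x - wgrad \<Omega> (z_conf \<Omega> \<T> g) x) \<le> K * L2_norm \<Omega> g"
proof -
  obtain K1 where K1: "\<And>v. v \<in> CR_space \<Omega> \<T> \<Longrightarrow> L2_norm \<Omega> v \<le> K1 * L2_norm \<Omega> (broken_grad \<T> v)"
    using CR_Poincare by blast
  obtain K2 where K2: "\<And>v. v \<in> H10_space \<Omega> \<Longrightarrow> L2_norm \<Omega> v \<le> K2 * L2_norm \<Omega> (wgrad \<Omega> v)"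
    using Friedrichs[OF open_domain bounded_domain] by blast
  obtain R where R: "\<And>x. x \<in> \<Omega> \<Longrightarrow> norm x \<le> R" using bounded_domain by (auto simp: bounded_iff)
  \<comment> \<open>A bound for the distance of a point of any element from the barycentre of that
    element.\<close>
  let ?D = "\<bar>R\<bar> + (\<Sum>T\<in>\<T>. norm (barycentre T))" and ?n = "real CARD('n)"
  have cancel: "a \<le> K * c" if "a\<^sup>2 \<le> c * (K * a)" "a \<ge> 0" "c * K \<ge> 0" for a c K :: real
  proof (cases "a = 0")
    case False
    then have "a * a \<le> (K * c) * a" "a > 0" using that by (auto simp: power2_eq_square mult_ac)
    then show ?thesis by simp
  qed (use that in \<open>simp add: mult.commute\<close>)
  show ?thesis
  proof (rule that)
    fix g assume g: "g \<in> piecewise_constant \<T>"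
    note gL = piecewise_constant_L2[OF g]
    let ?z = "z_CR \<Omega> \<T> g" and ?y = "z_conf \<Omega> \<T> g"
    note z = z_CR[OF gL] and y = z_conf[OF gL]
    note pz = CR_piecewise_affine[OF z(1)]
    note zL = piecewise_affine_L2[OF pz] and bL = broken_grad_L2[OF pz]
    note yH = conforming_H10[OF y(1)]
    note yD = H1_D'[OF H10_H1'[OF yH]]
    have b1: "L2_norm \<Omega> (broken_grad \<T> ?z) \<le> \<bar>K1\<bar> * L2_norm \<Omega> g"
    proof (rule cancel)
      have "(L2_norm \<Omega> (broken_grad \<T> ?z))\<^sup>2 = L2_inner \<Omega> g ?z" using z(2)[OF z(1)] by (simp add: L2_norm_square)
      also have "\<dots> \<le> L2_norm \<Omega> g * L2_norm \<Omega> ?z" by (rule L2_inner_le[OF gL zL])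
      also have "\<dots> \<le> L2_norm \<Omega> g * (\<bar>K1\<bar> * L2_norm \<Omega> (broken_grad \<T> ?z))"
        by (rule mult_left_mono[OF order_trans[OF K1[OF z(1)] mult_right_mono]]) auto
      finally show "(L2_norm \<Omega> (broken_grad \<T> ?z))\<^sup>2 \<le> L2_norm \<Omega> g * (\<bar>K1\<bar> * L2_norm \<Omega> (broken_grad \<T> ?z))" .
    qed auto
    have b2: "L2_norm \<Omega> (wgrad \<Omega> ?y) \<le> \<bar>K2\<bar> * L2_norm \<Omega> g"
    proof (rule cancel)
      have "(L2_norm \<Omega> (wgrad \<Omega> ?y))\<^sup>2 = L2_inner \<Omega> g ?y" using y(2)[OF y(1)] by (simp add: L2_norm_square)
      also have "\<dots> \<le> L2_norm \<Omega> g * L2_norm \<Omega> ?y" by (rule L2_inner_le[OF gL yD(1)])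
      also have "\<dots> \<le> L2_norm \<Omega> g * (\<bar>K2\<bar> * L2_norm \<Omega> (wgrad \<Omega> ?y))"
        by (rule mult_left_mono[OF order_trans[OF K2[OF yH] mult_right_mono]]) auto
      finally show "(L2_norm \<Omega> (wgrad \<Omega> ?y))\<^sup>2 \<le> L2_norm \<Omega> g * (\<bar>K2\<bar> * L2_norm \<Omega> (wgrad \<Omega> ?y))" .
    qed auto
    let ?r = "\<lambda>x. marini_flux \<Omega> \<T> g x - broken_grad \<T> ?z x"
    have rL: "?r \<in> L2_space \<Omega>" by (intro L2_space_diff marini_flux_L2 g bL)
    have "L2_norm \<Omega> ?r \<le> L2_norm \<Omega> (\<lambda>x. (?D / ?n) *\<^sub>R g x)"
    proof (rule L2_norm_mono[OF rL L2_space_scaled[OF gL]])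
      have "norm (?r x) \<le> norm ((?D / ?n) *\<^sub>R g x)" if T: "T \<in> \<T>" and x: "x \<in> interior T" for T x
      proof -
        have "?r x = - ((g x / ?n) *\<^sub>R (x - barycentre T))"
          unfolding marini_flux_def sum_interior[OF T x] by simp
        then have "norm (?r x) = \<bar>g x\<bar> / ?n * norm (x - barycentre T)" by simp
        also have "\<dots> \<le> \<bar>g x\<bar> / ?n * ?D"
        proof (rule mult_left_mono)
          have "norm (barycentre T) \<le> (\<Sum>T\<in>\<T>. norm (barycentre T))"
            by (rule member_le_sum[OF T]) (use finite_mesh in auto)
          moreover have "norm x \<le> \<bar>R\<bar>" using R[of x] mesh_interior_subset[OF T] x by fastforce
          ultimately show "norm (x - barycentre T) \<le> ?D"
            using norm_triangle_ineq4[of x "barycentre T"] by linarith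
        qed simp
        also have "\<dots> = norm ((?D / ?n) *\<^sub>R g x)"
          by (simp add: abs_mult sum_nonneg)
        finally show ?thesis .
      qed
      then show "AE x in lebesgue. x \<in> \<Omega> \<longrightarrow> norm (?r x) \<le> norm ((?D / ?n) *\<^sub>R g x)"
        by (intro AE_elements AE_I2 impI)
    qed
    then have b3: "L2_norm \<Omega> ?r \<le> \<bar>?D / ?n\<bar> * L2_norm \<Omega> g" unfolding L2_norm_scaled .
    have "L2_norm \<Omega> (\<lambda>x. marini_flux \<Omega> \<T> g x - wgrad \<Omega> ?y x) \<le> L2_norm \<Omega> (marini_flux \<Omega> \<T> g) + L2_norm \<Omega> (wgrad \<Omega> ?y)"
      by (rule L2_norm_diff_le[OF marini_flux_L2[OF g] yD(2)])
    moreover have "L2_norm \<Omega> (marini_flux \<Omega> \<T> g) \<le> L2_norm \<Omega> ?r + L2_norm \<Omega> (broken_grad \<T> ?z)"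
      using L2_norm_triangle[OF rL bL] by simp
    ultimately show "L2_norm \<Omega> (\<lambda>x. marini_flux \<Omega> \<T> g x - wgrad \<Omega> ?y x) \<le> (\<bar>?D / ?n\<bar> + \<bar>K1\<bar> + \<bar>K2\<bar>) * L2_norm \<Omega> g"
      using b1 b2 b3 unfolding distrib_right by linarith
  qed
qed

text \<open>The supremum is an upper bound once the quotients are known to be bounded. For g of norm
  zero there is no quotient in the set, and the bound by K shows that the left side vanishes as
  well.\<close>

lemma kappa_bound:
  assumes g: "g \<in> piecewise_constant \<T>"
  shows "L2_norm \<Omega> (\<lambda>x. marini_flux \<Omega> \<T> g x - wgrad \<Omega> (z_conf \<Omega> \<T> g) x) \<le> \<kappa>_M \<Omega> \<T> * L2_norm \<Omega> g"
proof -
  let ?N = "\<lambda>g. L2_norm \<Omega> (\<lambda>x. marini_flux \<Omega> \<T> g x - wgrad \<Omega> (z_conf \<Omega> \<T> g) x)"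
  let ?X = "{?N g / L2_norm \<Omega> g | g. g \<in> piecewise_constant \<T> \<and> \<not> (AE x in lebesgue. x \<in> \<Omega> \<longrightarrow> g x = 0)}"
  obtain K where K: "\<And>g. g \<in> piecewise_constant \<T> \<Longrightarrow> ?N g \<le> K * L2_norm \<Omega> g"
    using flux_difference_bounded by blast
  show ?thesis
  proof (cases "L2_norm \<Omega> g = 0")
    case True
    then show ?thesis using K[OF g] by simp
  next
    case False
    have pos: "L2_norm \<Omega> h > 0" if "h \<in> piecewise_constant \<T>" "\<not> (AE x in lebesgue. x \<in> \<Omega> \<longrightarrow> h x = 0)" for h
      using L2_norm_eq_0_iff[OF piecewise_constant_L2[OF that(1)]] that(2) L2_norm_nonneg[of \<Omega> h] by linarith
    have bdd: "bdd_above ?X"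
    proof (rule bdd_aboveI)
      fix r assume "r \<in> ?X"
      then obtain h where h: "h \<in> piecewise_constant \<T>" "\<not> (AE x in lebesgue. x \<in> \<Omega> \<longrightarrow> h x = 0)" "r = ?N h / L2_norm \<Omega> h"
        by blast
      show "r \<le> K" using K[OF h(1)] pos[OF h(1,2)] unfolding h(3) by (simp add: divide_le_eq)
    qed
    have ng: "\<not> (AE x in lebesgue. x \<in> \<Omega> \<longrightarrow> g x = 0)"
      using False L2_norm_eq_0_iff[OF piecewise_constant_L2[OF g]] by simp
    have "?N g / L2_norm \<Omega> g \<le> \<kappa>_M \<Omega> \<T>"
      unfolding \<kappa>_M_def by (rule cSup_upper[OF _ bdd]) (use g ng in blast)
    then show ?thesis using pos[OF g ng] by (simp add: divide_le_eq)
  qed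
qed

text \<open>The inequality on convex domains bounds the set of quotients. Nonnegativity of its
  supremum calls for an element of the set.\<close>

lemma poincare_const:
  assumes T: "T \<in> \<T>"
  shows "0 \<le> poincare_const T"
    and "v \<in> H1_space (interior T) \<Longrightarrow> (LINT x:interior T|lebesgue. v x) = 0 \<Longrightarrow>
      L2_norm (interior T) v \<le> poincare_const T * L2_norm (interior T) (wgrad (interior T) v)"
proof -
  let ?U = "interior T"
  note U = mesh_interior(1) mesh_interior(2)[OF T]
  let ?r = "\<lambda>v. L2_norm ?U v / L2_norm ?U (wgrad ?U v)"
  let ?X = "{?r v | v. v \<in> H1_space ?U \<and> \<not> (AE x in lebesgue. x \<in> ?U \<longrightarrow> v x = 0) \<and> (LINT x:?U|lebesgue. v x) = 0}"
  have ne: "?U \<noteq> {}" using simplex_interior[OF mesh_simplex(1)[OF T]] mesh_simplex(2)[OF T] by simp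
  obtain K where K: "K \<ge> 0" "\<And>v. v \<in> H1_space ?U \<Longrightarrow> (LINT x:?U|lebesgue. v x) = 0 \<Longrightarrow> L2_norm ?U v \<le> K * L2_norm ?U (wgrad ?U v)"
    using Poincare_convex[OF U convex_interior[OF mesh_convex[OF T]] ne] by blast
  have bdd: "bdd_above ?X"
  proof (rule bdd_aboveI)
    fix r assume "r \<in> ?X"
    then obtain v where v: "v \<in> H1_space ?U" "(LINT x:?U|lebesgue. v x) = 0" "r = ?r v" by blast
    show "r \<le> K"
    \<comment> \<open>A quotient with denominator 0 is 0 by convention, which K bounds too.\<close>
    proof (cases "L2_norm ?U (wgrad ?U v) = 0")
      case False
      then have "L2_norm ?U (wgrad ?U v) > 0" using L2_norm_nonneg[of ?U "wgrad ?U v"] by linarith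
      then show ?thesis using K(2)[OF v(1,2)] unfolding v(3) by (simp add: divide_le_eq)
    qed (use K(1) v(3) in simp)
  qed
  \<comment> \<open>The element of the set is a coordinate function minus its mean.\<close>
  fix i :: 'n
  let ?A = "axis i 1 :: real ^ 'n"
  let ?b = "- (LINT x:?U|lebesgue. ?A \<bullet> x + 0) / measure lborel T"
  let ?v = "\<lambda>x. ?A \<bullet> x + ?b"
  have vH: "?v \<in> H1_space ?U" by (rule smooth_H1(1)[OF U smooth_affine])
  have cL: "(\<lambda>x. c) \<in> L2_space ?U" for c :: real by (rule continuous_L2[OF U]) simp
  have aL: "(\<lambda>x. ?A \<bullet> x + 0) \<in> L2_space ?U" by (rule continuous_L2[OF U]) (intro continuous_intros)
  have Ulm: "?U \<in> lmeasurable" using U by (simp add: lmeasurable_open)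
  have "(LINT x:?U|lebesgue. ?v x) = (LINT x:?U|lebesgue. (?A \<bullet> x + 0) + ?b)" by simp
  also have "\<dots> = (LINT x:?U|lebesgue. ?A \<bullet> x + 0) + (LINT x:?U|lebesgue. ?b)"
    by (rule set_integral_add(2)[OF L2_integrable[OF aL Ulm] L2_integrable[OF cL Ulm]])
  also have "\<dots> = 0" unfolding element_integral_const[OF T] using mesh_volume_pos[OF T] by simp
  finally have v0: "(LINT x:?U|lebesgue. ?v x) = 0" .
  have "\<not> (AE x in lebesgue. x \<in> ?U \<longrightarrow> ?v x = 0)"
    using affine_AE_eq_0(1)[OF T, of ?A ?b] by (auto simp: axis_eq_0_iff)
  then have "?r ?v \<in> ?X" using vH v0 by blast
  then have "?r ?v \<le> poincare_const T" unfolding poincare_const_def by (rule cSup_upper[OF _ bdd])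
  moreover have "0 \<le> ?r ?v" by simp
  ultimately show nn: "0 \<le> poincare_const T" by linarith
  show "L2_norm ?U v \<le> poincare_const T * L2_norm ?U (wgrad ?U v)"
    if v: "v \<in> H1_space ?U" "(LINT x:?U|lebesgue. v x) = 0"
  proof (cases "L2_norm ?U (wgrad ?U v) = 0 \<or> L2_norm ?U v = 0")
    case True
    then have "L2_norm ?U v = 0" using K(2)[OF v] L2_norm_nonneg[of ?U v] by (auto intro: antisym)
    then show ?thesis using nn by simp
  next
    case False
    then have "\<not> (AE x in lebesgue. x \<in> ?U \<longrightarrow> v x = 0)" using L2_norm_eq_0_iff[OF H1_D(1)[OF U v(1)]] by simp
    then have "?r v \<in> ?X" using v by blast
    then have "?r v \<le> poincare_const T" unfolding poincare_const_def by (rule cSup_upper[OF _ bdd])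
    moreover have "L2_norm ?U (wgrad ?U v) > 0" using False L2_norm_nonneg[of ?U "wgrad ?U v"] by linarith
    ultimately show ?thesis by (simp add: divide_le_eq)
  qed
qed

lemma C_0h: "T \<in> \<T> \<Longrightarrow> poincare_const T \<le> C_0h \<T>" "\<T> \<noteq> {} \<Longrightarrow> 0 \<le> C_0h \<T>"
proof -
  show le: "poincare_const T \<le> C_0h \<T>" if "T \<in> \<T>" for T
    unfolding C_0h_def by (rule Max_ge) (use finite_mesh that in auto)
  show "0 \<le> C_0h \<T>" if "\<T> \<noteq> {}"
    using that poincare_const(1) le order_trans by blast
qed

lemma indicator_piecewise_constant:
  assumes T: "T \<in> \<T>" shows "indicator (interior T) \<in> piecewise_constant \<T>"
  unfolding piecewise_constant_def
proof (intro CollectI ballI)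
  fix T' assume T': "T' \<in> \<T>"
  show "\<exists>c. AE x in lebesgue. x \<in> T' \<longrightarrow> indicator (interior T) x = c"
  proof (cases "T' = T")
    case True
    then show ?thesis using AE_frontier[OF T, of "\<lambda>x. indicator (interior T) x = 1"] by (intro exI[of _ 1]) simp
  next
    case False
    then have "indicator (interior T) x = 0" if "x \<in> T'" for x
      using mesh_disjoint_interior[OF T T'] that by (auto simp: indicator_def)
    then show ?thesis by (intro exI[of _ 0] AE_I2 impI)
  qed
qed

lemma inner_indicator:
  assumes "T \<in> \<T>" shows "L2_inner \<Omega> v (indicator (interior T)) = (LINT x:interior T|lebesgue. v x)"
  unfolding L2_inner_def set_lebesgue_integral_def
  by (rule Bochner_Integration.integral_cong) (use mesh_interior_subset[OF assms] in \<open>auto simp: indicator_def\<close>)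

lemma element_inner_const:
  assumes T: "T \<in> \<T>" and v: "v \<in> L2_space \<Omega>" and w: "w \<in> L2_space \<Omega>"
    and c: "AE x in lebesgue. x \<in> interior T \<longrightarrow> w x = (c::real)"
  shows "L2_inner (interior T) v w = c * (LINT x:interior T|lebesgue. v x)"
proof -
  have "AE x in lebesgue. x \<in> interior T \<longrightarrow> v x \<bullet> w x = v x \<bullet> c"
    using c by eventually_elim simp
  then have "L2_inner (interior T) v w = L2_inner (interior T) v (\<lambda>x. c)"
    by (rule L2_inner_cong_AE)
      (intro L2_element[OF v T] L2_element[OF w T] continuous_L2[OF mesh_interior(1) mesh_interior(2)[OF T]] continuous_on_const)+
  then show ?thesis by (simp add: L2_inner_def mult.commute)
qed

text \<open>The elementwise mean is the witness. The function picked by \<open>SOME\<close> is known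
  through membership and the orthogonality relation alone.\<close>

lemma L2_proj:
  assumes f: "f \<in> L2_space \<Omega>"
  shows "L2_proj \<Omega> \<T> f \<in> piecewise_constant \<T>"
    and "w \<in> piecewise_constant \<T> \<Longrightarrow> L2_inner \<Omega> (L2_proj \<Omega> \<T> f) w = L2_inner \<Omega> f w"
proof -
  define m where "m T = (LINT x:interior T|lebesgue. f x) / measure lborel T" for T
  define g where "g x = (\<Sum>T\<in>\<T>. indicator (interior T) x *\<^sub>R m T)" for x
  have gT: "AE x in lebesgue. x \<in> interior T \<longrightarrow> g x = m T" if T: "T \<in> \<T>" for T
    by (intro AE_I2 impI) (simp only: g_def sum_interior[OF T])
  have gP: "g \<in> piecewise_constant \<T>"
    unfolding piecewise_constant_def using AE_frontier[OF _ gT] by blast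
  note gL = piecewise_constant_L2[OF gP]
  have "L2_inner \<Omega> g w = L2_inner \<Omega> f w" if w: "w \<in> piecewise_constant \<T>" for w
  proof -
    note wL = piecewise_constant_L2[OF w]
    obtain c where c: "\<And>T. T \<in> \<T> \<Longrightarrow> AE x in lebesgue. x \<in> interior T \<longrightarrow> w x = c T"
      using piecewise_constant_value[OF w] by blast
    have "(LINT x:interior T|lebesgue. g x) = (LINT x:interior T|lebesgue. f x)" if T: "T \<in> \<T>" for T
    proof -
      have "(LINT x:interior T|lebesgue. g x) = (LINT x:interior T|lebesgue. m T)"
        by (rule set_lebesgue_integral_cong) (use sum_interior[OF T, of _ m] in \<open>auto simp: g_def\<close>)
      also have "\<dots> = (LINT x:interior T|lebesgue. f x)"
        unfolding element_integral_const[OF T] using mesh_volume_pos[OF T] by (simp add: m_def)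
      finally show ?thesis .
    qed
    then show ?thesis
      unfolding L2_inner_elements[OF gL wL] L2_inner_elements[OF f wL]
      by (intro sum.cong refl) (simp add: element_inner_const[OF _ gL wL c] element_inner_const[OF _ f wL c])
  qed
  then have "\<exists>g. g \<in> piecewise_constant \<T> \<and> (\<forall>w\<in>piecewise_constant \<T>. L2_inner \<Omega> g w = L2_inner \<Omega> f w)"
    using gP by blast
  from someI_ex[OF this] show "L2_proj \<Omega> \<T> f \<in> piecewise_constant \<T>"
    "w \<in> piecewise_constant \<T> \<Longrightarrow> L2_inner \<Omega> (L2_proj \<Omega> \<T> f) w = L2_inner \<Omega> f w"
    unfolding L2_proj_def[symmetric] by auto
qed

lemmas L2_proj_L2 = piecewise_constant_L2[OF L2_proj(1)]

lemma L2_proj_orthogonal: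
  assumes f: "f \<in> L2_space \<Omega>" and w: "w \<in> piecewise_constant \<T>"
  shows "L2_inner \<Omega> (\<lambda>x. f x - L2_proj \<Omega> \<T> f x) w = 0"
  using L2_inner_diff[OF f L2_proj_L2[OF f] piecewise_constant_L2[OF w]] L2_proj(2)[OF f w] by simp

lemma L2_proj_Pythagoras:
  assumes f: "f \<in> L2_space \<Omega>"
  shows "(L2_norm \<Omega> (\<lambda>x. f x - L2_proj \<Omega> \<T> f x))\<^sup>2 + (L2_norm \<Omega> (L2_proj \<Omega> \<T> f))\<^sup>2 = (L2_norm \<Omega> f)\<^sup>2"
proof -
  note P = L2_proj_L2[OF f]
  note fP = L2_space_diff[OF f P]
  have "L2_inner \<Omega> (\<lambda>x. f x - L2_proj \<Omega> \<T> f x) (\<lambda>x. f x - L2_proj \<Omega> \<T> f x) = L2_inner \<Omega> (\<lambda>x. f x - L2_proj \<Omega> \<T> f x) f"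
    using L2_inner_diff_right[OF f P fP] L2_proj_orthogonal[OF f L2_proj(1)[OF f]] by simp
  also have "\<dots> = L2_inner \<Omega> f f - L2_inner \<Omega> (L2_proj \<Omega> \<T> f) (L2_proj \<Omega> \<T> f)"
    using L2_inner_diff[OF f P f] L2_proj(2)[OF f L2_proj(1)[OF f]] L2_inner_commute[of \<Omega> f "L2_proj \<Omega> \<T> f"] by simp
  finally show ?thesis by (simp add: L2_norm_square)
qed

text \<open>On each element the projection is a constant with the same integral as v, so the
  Poincare inequality applies to the difference, which has the gradient of v. The squares are summed
  with the largest of the constants.\<close>

lemma L2_proj_error:
  assumes ne: "\<T> \<noteq> {}" and v: "v \<in> H1_space \<Omega>"
  shows "L2_norm \<Omega> (\<lambda>x. v x - L2_proj \<Omega> \<T> v x) \<le> C_0h \<T> * L2_norm \<Omega> (wgrad \<Omega> v)"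
proof -
  note D = H1_D'[OF v]
  let ?P = "L2_proj \<Omega> \<T> v"
  note PL = L2_proj_L2[OF D(1)]
  note C0 = C_0h(2)[OF ne]
  obtain c where c: "\<And>T. T \<in> \<T> \<Longrightarrow> AE x in lebesgue. x \<in> interior T \<longrightarrow> ?P x = c T"
    using piecewise_constant_value[OF L2_proj(1)[OF D(1)]] by blast
  have el: "L2_inner (interior T) (\<lambda>x. v x - ?P x) (\<lambda>x. v x - ?P x) \<le> (C_0h \<T>)\<^sup>2 * L2_inner (interior T) (wgrad \<Omega> v) (wgrad \<Omega> v)"
    if T: "T \<in> \<T>" for T
  proof -
    let ?U = "interior T"
    note U = mesh_interior(1) mesh_interior(2)[OF T]
    note sub = H1_subset[OF open_domain bounded_domain mesh_interior(1) mesh_interior_subset[OF T] v]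
    let ?w = "\<lambda>x. v x + (- c T) * 1"
    have cL: "(\<lambda>x. c) \<in> L2_space ?U" for c :: real by (rule continuous_L2[OF U]) simp
    have oneH: "(\<lambda>x. 1) \<in> H1_space ?U" and one0: "AE x in lebesgue. x \<in> ?U \<longrightarrow> wgrad ?U (\<lambda>x. 1) x = 0"
      using wgrad_affine[OF U, of "\<lambda>x. 1" 0 1] by auto
    note w = H1_add_scaled[OF U sub(1) oneH, of "- c T"]
    have Ulm: "?U \<in> lmeasurable" using U by (simp add: lmeasurable_open)
    \<comment> \<open>The defining relation of the projection, tested with the indicator of the
      element.\<close>
    have "(LINT x:?U|lebesgue. v x) = (LINT x:?U|lebesgue. ?P x)"
      using L2_proj(2)[OF D(1) indicator_piecewise_constant[OF T]] inner_indicator[OF T] by metis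
    also have "\<dots> = measure lborel T * c T"
    proof -
      have "L2_inner ?U (\<lambda>x. 1) ?P = c T * (LINT x:?U|lebesgue. 1)"
        using element_inner_const[OF T one_L2[OF open_domain bounded_domain] PL c[OF T]] .
      then show ?thesis using element_integral_const[OF T, of 1] by (simp add: L2_inner_def mult.commute)
    qed
    finally have vint: "(LINT x:?U|lebesgue. v x) = measure lborel T * c T" .
    have "(LINT x:?U|lebesgue. ?w x) = (LINT x:?U|lebesgue. v x) + (LINT x:?U|lebesgue. (- c T) * 1)"
      by (rule set_integral_add(2)[OF L2_integrable[OF L2_element[OF D(1) T] Ulm] L2_integrable[OF cL Ulm]])
    also have "\<dots> = 0" unfolding vint element_integral_const[OF T] by simp
    finally have "L2_norm ?U ?w \<le> poincare_const T * L2_norm ?U (wgrad ?U ?w)"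
      by (rule poincare_const(2)[OF T w(1)])
    also have "L2_norm ?U (wgrad ?U ?w) = L2_norm ?U (wgrad \<Omega> v)"
    proof (rule L2_norm_cong_AE[OF _ H1_D(2)[OF U w(1)]])
      show "AE x in lebesgue. x \<in> ?U \<longrightarrow> wgrad ?U ?w x = wgrad \<Omega> v x"
        using w(2) one0 sub(2) by eventually_elim simp
    qed
    also have "poincare_const T * L2_norm ?U (wgrad \<Omega> v) \<le> C_0h \<T> * L2_norm ?U (wgrad \<Omega> v)"
      by (rule mult_right_mono[OF C_0h(1)[OF T]]) simp
    also have "L2_norm ?U ?w = L2_norm ?U (\<lambda>x. v x - ?P x)"
    proof (rule L2_norm_cong_AE[OF _ H1_D(1)[OF U w(1)]])
      show "AE x in lebesgue. x \<in> ?U \<longrightarrow> ?w x = v x - ?P x"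
        using c[OF T] by eventually_elim simp
    qed
    finally have "(L2_norm ?U (\<lambda>x. v x - ?P x))\<^sup>2 \<le> (C_0h \<T> * L2_norm ?U (wgrad \<Omega> v))\<^sup>2"
      by (rule power_mono) simp
    then show ?thesis by (simp add: power_mult_distrib L2_norm_square)
  qed
  have "L2_inner \<Omega> (\<lambda>x. v x - ?P x) (\<lambda>x. v x - ?P x) \<le> (C_0h \<T>)\<^sup>2 * L2_inner \<Omega> (wgrad \<Omega> v) (wgrad \<Omega> v)"
    unfolding L2_inner_elements[OF L2_space_diff[OF D(1) PL] L2_space_diff[OF D(1) PL]] L2_inner_elements[OF D(2) D(2)] sum_distrib_left
    by (rule sum_mono[OF el])
  then have "(L2_norm \<Omega> (\<lambda>x. v x - ?P x))\<^sup>2 \<le> (C_0h \<T> * L2_norm \<Omega> (wgrad \<Omega> v))\<^sup>2"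
    by (simp add: power_mult_distrib L2_norm_square)
  then show ?thesis by (rule power2_le_imp_le) (simp add: C0)
qed

section \<open>The estimates in the energy norm and in L^2\<close>

lemma H10_diff: "u \<in> H10_space \<Omega> \<Longrightarrow> v \<in> H10_space \<Omega> \<Longrightarrow> (\<lambda>x. u x - v x) \<in> H10_space \<Omega>"
  using H10_add_scaled[OF open_domain bounded_domain, of u v "-1"] by simp

lemma wgrad_diff_inner:
  assumes "u \<in> H10_space \<Omega>" "v \<in> H10_space \<Omega>" "G \<in> L2_space \<Omega>"
  shows "L2_inner \<Omega> (wgrad \<Omega> (\<lambda>x. u x - v x)) G = L2_inner \<Omega> (wgrad \<Omega> u) G - L2_inner \<Omega> (wgrad \<Omega> v) G"
  using L2_inner_wgrad_add_scaled[OF open_domain bounded_domain H10_H1'[OF assms(1)] H10_H1'[OF assms(2)] assms(3), of "-1"] by simp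

text \<open>The common core of both estimates: split \<open>f\<close> into its elementwise mean and the oscillation,
  and represent the mean by the equilibrated flux.\<close>

lemma load_bound:
  assumes ne: "\<T> \<noteq> {}" and f: "f \<in> L2_space \<Omega>" and e: "e \<in> H10_space \<Omega>"
  shows "L2_inner \<Omega> f e - L2_inner \<Omega> (wgrad \<Omega> (z_conf \<Omega> \<T> (L2_proj \<Omega> \<T> f))) (wgrad \<Omega> e)
    \<le> error_bound \<Omega> \<T> f * L2_norm \<Omega> (wgrad \<Omega> e)"
proof -
  let ?g = "L2_proj \<Omega> \<T> f" and ?P = "L2_proj \<Omega> \<T> e"
  let ?z = "z_conf \<Omega> \<T> ?g" and ?s = "marini_flux \<Omega> \<T> ?g"
  note eH = H10_H1'[OF e]
  note D = H1_D'[OF eH]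
  note g = L2_proj(1)[OF f] and gL = L2_proj_L2[OF f]
  note zL = H1_D'(2)[OF H10_H1'[OF conforming_H10[OF z_conf(1)[OF gL]]]]
  note sL = marini_flux_L2[OF g]
  note fg = L2_space_diff[OF f gL]
  have "L2_inner \<Omega> f e = L2_inner \<Omega> (\<lambda>x. f x - ?g x) e + L2_inner \<Omega> ?g e"
    using L2_inner_diff[OF f gL D(1)] by simp
  also have "L2_inner \<Omega> (\<lambda>x. f x - ?g x) e = L2_inner \<Omega> (\<lambda>x. f x - ?g x) (\<lambda>x. e x - ?P x)"
    using L2_inner_diff_right[OF D(1) L2_proj_L2[OF D(1)] fg] L2_proj_orthogonal[OF f L2_proj(1)[OF D(1)]] by simp
  also have "L2_inner \<Omega> ?g e = L2_inner \<Omega> ?s (wgrad \<Omega> e)" using marini_flux_H10[OF g e] by simp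
  finally have "L2_inner \<Omega> f e - L2_inner \<Omega> (wgrad \<Omega> ?z) (wgrad \<Omega> e) =
      L2_inner \<Omega> (\<lambda>x. f x - ?g x) (\<lambda>x. e x - ?P x) + L2_inner \<Omega> (\<lambda>x. ?s x - wgrad \<Omega> ?z x) (wgrad \<Omega> e)"
    using L2_inner_diff[OF sL zL D(2)] by simp
  also have "\<dots> \<le> L2_norm \<Omega> (\<lambda>x. f x - ?g x) * (C_0h \<T> * L2_norm \<Omega> (wgrad \<Omega> e)) + (\<kappa>_M \<Omega> \<T> * L2_norm \<Omega> ?g) * L2_norm \<Omega> (wgrad \<Omega> e)"
  proof (rule add_mono)
    show "L2_inner \<Omega> (\<lambda>x. f x - ?g x) (\<lambda>x. e x - ?P x) \<le> L2_norm \<Omega> (\<lambda>x. f x - ?g x) * (C_0h \<T> * L2_norm \<Omega> (wgrad \<Omega> e))"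
      by (rule order_trans[OF L2_inner_le[OF fg L2_space_diff[OF D(1) L2_proj_L2[OF D(1)]]] mult_left_mono[OF L2_proj_error[OF ne eH]]]) simp
    show "L2_inner \<Omega> (\<lambda>x. ?s x - wgrad \<Omega> ?z x) (wgrad \<Omega> e) \<le> (\<kappa>_M \<Omega> \<T> * L2_norm \<Omega> ?g) * L2_norm \<Omega> (wgrad \<Omega> e)"
      by (rule order_trans[OF L2_inner_le[OF L2_space_diff[OF sL zL] D(2)] mult_right_mono[OF kappa_bound[OF g]]]) simp
  qed
  also have "\<dots> = error_bound \<Omega> \<T> f * L2_norm \<Omega> (wgrad \<Omega> e)"
    by (simp add: error_bound_def algebra_simps)
  finally show ?thesis .
qed

lemma error_bound_nonneg:
  assumes "\<T> \<noteq> {}" "f \<in> L2_space \<Omega>" shows "0 \<le> error_bound \<Omega> \<T> f"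
proof -
  have "0 \<le> \<kappa>_M \<Omega> \<T> * L2_norm \<Omega> (L2_proj \<Omega> \<T> f)"
    using kappa_bound[OF L2_proj(1)[OF assms(2)]] L2_norm_nonneg order_trans by blast
  then show ?thesis using C_0h(2)[OF assms(1)] by (simp add: error_bound_def)
qed

lemma error_bound_le:
  assumes "f \<in> L2_space \<Omega>" shows "error_bound \<Omega> \<T> f \<le> M_h \<Omega> \<T> * L2_norm \<Omega> f"
proof -
  have "error_bound \<Omega> \<T> f \<le> M_h \<Omega> \<T> * sqrt ((L2_norm \<Omega> (\<lambda>x. f x - L2_proj \<Omega> \<T> f x))\<^sup>2 + (L2_norm \<Omega> (L2_proj \<Omega> \<T> f))\<^sup>2)"
    unfolding error_bound_def M_h_def by (rule Cauchy_Schwarz_2)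
  then show ?thesis unfolding L2_proj_Pythagoras[OF assms] by simp
qed

lemma M_h_nonneg: "0 \<le> M_h \<Omega> \<T>"
  by (simp add: M_h_def)

lemma energy_error:
  assumes ne: "\<T> \<noteq> {}" and f: "f \<in> L2_space \<Omega>" and u: "u \<in> H10_space \<Omega>" and uh: "u\<^sub>h \<in> conforming_space \<Omega> \<T>"
    and eq: "\<And>v. v \<in> H10_space \<Omega> \<Longrightarrow> L2_inner \<Omega> (wgrad \<Omega> u) (wgrad \<Omega> v) = L2_inner \<Omega> f v"
    and eqh: "\<And>v. v \<in> conforming_space \<Omega> \<T> \<Longrightarrow> L2_inner \<Omega> (wgrad \<Omega> u\<^sub>h) (wgrad \<Omega> v) = L2_inner \<Omega> f v"
  shows "H1_seminorm \<Omega> (\<lambda>x. u x - u\<^sub>h x) \<le> error_bound \<Omega> \<T> f"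
proof -
  let ?z = "z_conf \<Omega> \<T> (L2_proj \<Omega> \<T> f)"
  let ?e = "\<lambda>x. u x - ?z x" and ?w = "\<lambda>x. u x - u\<^sub>h x"
  note zc = z_conf(1)[OF L2_proj_L2[OF f]]
  note z = conforming_H10[OF zc] and uhH = conforming_H10[OF uh]
  note e = H10_diff[OF u z] and w = H10_diff[OF u uhH]
  note eG = H1_D'(2)[OF H10_H1'[OF e]] and wG = H1_D'(2)[OF H10_H1'[OF w]]
  have cancel: "a \<le> b" if "a\<^sup>2 \<le> b * a" "a \<ge> 0" "b \<ge> 0" for a b :: real
  proof (cases "a = 0")
    case False
    then have "a * a \<le> b * a" "a > 0" using that by (auto simp: power2_eq_square)
    then show ?thesis by simp
  qed (use that in simp)
  have "L2_norm \<Omega> (wgrad \<Omega> ?e) \<le> error_bound \<Omega> \<T> f"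
  proof (rule cancel)
    have "(L2_norm \<Omega> (wgrad \<Omega> ?e))\<^sup>2 = L2_inner \<Omega> f ?e - L2_inner \<Omega> (wgrad \<Omega> ?z) (wgrad \<Omega> ?e)"
      unfolding L2_norm_square wgrad_diff_inner[OF u z eG] eq[OF e] ..
    then show "(L2_norm \<Omega> (wgrad \<Omega> ?e))\<^sup>2 \<le> error_bound \<Omega> \<T> f * L2_norm \<Omega> (wgrad \<Omega> ?e)"
      using load_bound[OF ne f e] by simp
  qed (use error_bound_nonneg[OF ne f] in auto)
  moreover have "L2_norm \<Omega> (wgrad \<Omega> ?w) \<le> L2_norm \<Omega> (wgrad \<Omega> ?e)"
  proof (rule cancel)
    let ?d = "\<lambda>x. u\<^sub>h x - ?z x"
    have d: "?d \<in> conforming_space \<Omega> \<T>"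
      using fun_subspace_add_scaled[OF conforming_subspace uh zc, of "-1"] by simp
    note dH = conforming_H10[OF d]
    \<comment> \<open>The error u - \<open>u\<^sub>h\<close> differs from e by the discrete function
      d and is orthogonal to it in energy. So its squared norm is its energy product with e, and
      Cauchy-Schwarz gives the best approximation property.\<close>
    have we: "?w = (\<lambda>x. ?e x - ?d x)" by auto
    have "L2_inner \<Omega> (wgrad \<Omega> ?d) (wgrad \<Omega> ?w) = L2_inner \<Omega> (wgrad \<Omega> ?w) (wgrad \<Omega> ?d)" by (rule L2_inner_commute)
    also have "\<dots> = 0"
      unfolding wgrad_diff_inner[OF u uhH H1_D'(2)[OF H10_H1'[OF dH]]] eq[OF dH] eqh[OF d] by simp
    finally have "(L2_norm \<Omega> (wgrad \<Omega> ?w))\<^sup>2 = L2_inner \<Omega> (wgrad \<Omega> ?e) (wgrad \<Omega> ?w)"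
      using wgrad_diff_inner[OF e dH wG] unfolding we[symmetric] L2_norm_square by simp
    then show "(L2_norm \<Omega> (wgrad \<Omega> ?w))\<^sup>2 \<le> L2_norm \<Omega> (wgrad \<Omega> ?e) * L2_norm \<Omega> (wgrad \<Omega> ?w)"
      using L2_inner_le[OF eG wG] by simp
  qed auto
  ultimately show ?thesis by (simp add: H1_seminorm_def)
qed

text \<open>Taking the error itself as load makes the solution of a dual problem unnecessary.\<close>

lemma L2_error:
  assumes ne: "\<T> \<noteq> {}" and w: "w \<in> H10_space \<Omega>"
    and orth: "\<And>v. v \<in> conforming_space \<Omega> \<T> \<Longrightarrow> L2_inner \<Omega> (wgrad \<Omega> w) (wgrad \<Omega> v) = 0"
  shows "L2_norm \<Omega> w \<le> M_h \<Omega> \<T> * H1_seminorm \<Omega> w"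
proof -
  note wL = H1_D'(1)[OF H10_H1'[OF w]]
  have "L2_inner \<Omega> (wgrad \<Omega> (z_conf \<Omega> \<T> (L2_proj \<Omega> \<T> w))) (wgrad \<Omega> w) = 0"
    using orth[OF z_conf(1)[OF L2_proj_L2[OF wL]]] by (simp add: L2_inner_commute)
  then have "(L2_norm \<Omega> w)\<^sup>2 \<le> error_bound \<Omega> \<T> w * H1_seminorm \<Omega> w"
    using load_bound[OF ne wL w] by (simp add: L2_norm_square H1_seminorm_def)
  also have "\<dots> \<le> (M_h \<Omega> \<T> * L2_norm \<Omega> w) * H1_seminorm \<Omega> w"
    by (rule mult_right_mono[OF error_bound_le[OF wL]]) (simp add: H1_seminorm_def)
  finally have le: "L2_norm \<Omega> w * L2_norm \<Omega> w \<le> (M_h \<Omega> \<T> * H1_seminorm \<Omega> w) * L2_norm \<Omega> w"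
    by (simp add: power2_eq_square mult_ac)
  show ?thesis
  proof (cases "L2_norm \<Omega> w = 0")
    case True
    then show ?thesis using M_h_nonneg by (simp add: H1_seminorm_def)
  next
    case False
    then have "L2_norm \<Omega> w > 0" using L2_norm_nonneg[of \<Omega> w] by linarith
    then show ?thesis using le by simp
  qed
qed

lemma error_estimates:
  assumes ne: "\<T> \<noteq> {}" and f: "f \<in> L2_space \<Omega>" and u: "u \<in> H10_space \<Omega>" and uh: "u\<^sub>h \<in> conforming_space \<Omega> \<T>"
    and eq: "\<And>v. v \<in> H10_space \<Omega> \<Longrightarrow> L2_inner \<Omega> (wgrad \<Omega> u) (wgrad \<Omega> v) = L2_inner \<Omega> f v"
    and eqh: "\<And>v. v \<in> conforming_space \<Omega> \<T> \<Longrightarrow> L2_inner \<Omega> (wgrad \<Omega> u\<^sub>h) (wgrad \<Omega> v) = L2_inner \<Omega> f v"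
  shows "L2_norm \<Omega> (\<lambda>x. u x - u\<^sub>h x) \<le> M_h \<Omega> \<T> * H1_seminorm \<Omega> (\<lambda>x. u x - u\<^sub>h x)"
    and "M_h \<Omega> \<T> * H1_seminorm \<Omega> (\<lambda>x. u x - u\<^sub>h x) \<le> M_h \<Omega> \<T> * error_bound \<Omega> \<T> f"
    and "M_h \<Omega> \<T> * error_bound \<Omega> \<T> f \<le> (M_h \<Omega> \<T>)\<^sup>2 * L2_norm \<Omega> f"
proof -
  note uhH = conforming_H10[OF uh]
  show "L2_norm \<Omega> (\<lambda>x. u x - u\<^sub>h x) \<le> M_h \<Omega> \<T> * H1_seminorm \<Omega> (\<lambda>x. u x - u\<^sub>h x)"
  proof (rule L2_error[OF ne H10_diff[OF u uhH]])
    fix v assume v: "v \<in> conforming_space \<Omega> \<T>"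
    note vH = conforming_H10[OF v]
    show "L2_inner \<Omega> (wgrad \<Omega> (\<lambda>x. u x - u\<^sub>h x)) (wgrad \<Omega> v) = 0"
      unfolding wgrad_diff_inner[OF u uhH H1_D'(2)[OF H10_H1'[OF vH]]] eq[OF vH] eqh[OF v] by simp
  qed
  show "M_h \<Omega> \<T> * H1_seminorm \<Omega> (\<lambda>x. u x - u\<^sub>h x) \<le> M_h \<Omega> \<T> * error_bound \<Omega> \<T> f"
    by (rule mult_left_mono[OF energy_error[OF ne f u uh eq eqh] M_h_nonneg])
  show "M_h \<Omega> \<T> * error_bound \<Omega> \<T> f \<le> (M_h \<Omega> \<T>)\<^sup>2 * L2_norm \<Omega> f"
    using mult_left_mono[OF error_bound_le[OF f] M_h_nonneg] by (simp add: power2_eq_square)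
qed

end

lemma mesh_conforming_triangulation:
  assumes "polyhedral_lipschitz_domain \<Omega>" "conforming_triangulation \<Omega> \<T>"
  shows "mesh \<Omega> \<T>"
proof
  show "open \<Omega>" "bounded \<Omega>" using assms(1) by (auto simp: polyhedral_lipschitz_domain_def)
  show "interior (closure \<Omega>) = \<Omega>" by (rule interior_closure_polyhedral_lipschitz_domain[OF assms(1)])
  show "finite \<T>" "\<Union>\<T> = closure \<Omega>" using assms(2) by (auto simp: conforming_triangulation_def triangulation_def)
  show "T \<inter> T' face_of T" if "T \<in> \<T>" "T' \<in> \<T>" for T T'
    using assms(2) that by (auto simp: conforming_triangulation_def triangulation_def)
  show "\<exists>C. full_simplex C \<and> T = convex hull C" if "T \<in> \<T>" for T
  proof -
    have "int CARD('a) simplex T" using assms(2) that by (auto simp: conforming_triangulation_def)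
    then obtain C where C: "\<not> affine_dependent C" "int (card C) = int CARD('a) + 1" "T = convex hull C"
      unfolding simplex_def by blast
    then have "full_simplex C" by (simp add: full_simplex_def)
    then show ?thesis using C(3) by blast
  qed
qed

theorem theorem4p3:
  fixes \<Omega> :: "(real ^ 'n) set" and \<T> :: "(real ^ 'n) set set"
  assumes "CARD('n) \<in> {2, 3}"
    and "polyhedral_lipschitz_domain \<Omega>"
    and "conforming_triangulation \<Omega> \<T>"
  shows "(\<forall>f\<in>L2_space \<Omega>. \<forall>u\<in>H10_space \<Omega>. \<forall>u\<^sub>h\<in>conforming_space \<Omega> \<T>.
            (\<forall>v\<in>H10_space \<Omega>. L2_inner \<Omega> (wgrad \<Omega> u) (wgrad \<Omega> v) = L2_inner \<Omega> f v) \<longrightarrow>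
            (\<forall>v\<in>conforming_space \<Omega> \<T>. L2_inner \<Omega> (wgrad \<Omega> u\<^sub>h) (wgrad \<Omega> v) = L2_inner \<Omega> f v) \<longrightarrow>
            L2_norm \<Omega> (\<lambda>x. u x - u\<^sub>h x) \<le> M_h \<Omega> \<T> * H1_seminorm \<Omega> (\<lambda>x. u x - u\<^sub>h x) \<and>
            M_h \<Omega> \<T> * H1_seminorm \<Omega> (\<lambda>x. u x - u\<^sub>h x) \<le> M_h \<Omega> \<T> * error_bound \<Omega> \<T> f \<and>
            M_h \<Omega> \<T> * error_bound \<Omega> \<T> f \<le> (M_h \<Omega> \<T>)\<^sup>2 * L2_norm \<Omega> f)
       \<and> (\<forall>u\<in>H10_space \<Omega>. \<forall>w\<in>L2_space \<Omega>. has_distr_laplacian \<Omega> u w \<longrightarrow>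
            L2_norm \<Omega> (\<lambda>x. u x - ritz_proj \<Omega> \<T> u x) \<le> (M_h \<Omega> \<T>)\<^sup>2 * L2_norm \<Omega> w)"
proof -
  interpret mesh \<Omega> \<T> by (rule mesh_conforming_triangulation[OF assms(2,3)])
  have "\<Omega> \<noteq> {}" using assms(2) by (simp add: polyhedral_lipschitz_domain_def)
  then have ne: "\<T> \<noteq> {}" using covering closure_subset by auto
  show ?thesis
  proof (intro conjI ballI impI)
    fix u w assume u: "u \<in> H10_space \<Omega>" and w: "w \<in> L2_space \<Omega>" and lap: "has_distr_laplacian \<Omega> u w"
    \<comment> \<open>A function with Laplacian w solves the weak equation with load -w.\<close>
    let ?f = "\<lambda>x. - w x"
    have f: "?f \<in> L2_space \<Omega>" using L2_space_scaled[OF w, of "-1"] by simp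
    have eq: "L2_inner \<Omega> (wgrad \<Omega> u) (wgrad \<Omega> v) = L2_inner \<Omega> ?f v" if v: "v \<in> H10_space \<Omega>" for v
      by (rule H10_test_extension[OF open_domain bounded_domain f H1_D'(2)[OF H10_H1'[OF u]] _ v])
        (rule distr_laplacian_wgrad[OF open_domain bounded_domain H10_H1'[OF u] lap])
    note r = ritz_proj[OF u]
    have eqh: "L2_inner \<Omega> (wgrad \<Omega> (ritz_proj \<Omega> \<T> u)) (wgrad \<Omega> v) = L2_inner \<Omega> ?f v"
      if "v \<in> conforming_space \<Omega> \<T>" for v
      unfolding r(2)[OF that] by (rule eq[OF conforming_H10[OF that]])
    note est = error_estimates[OF ne f u r(1) eq eqh]
    have "L2_norm \<Omega> (\<lambda>x. u x - ritz_proj \<Omega> \<T> u x) \<le> (M_h \<Omega> \<T>)\<^sup>2 * L2_norm \<Omega> ?f"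
      by (rule order_trans[OF est(1) order_trans[OF est(2,3)]])
    then show "L2_norm \<Omega> (\<lambda>x. u x - ritz_proj \<Omega> \<T> u x) \<le> (M_h \<Omega> \<T>)\<^sup>2 * L2_norm \<Omega> w"
      using L2_norm_scaled[of \<Omega> "-1" w] by simp
  qed (use error_estimates[OF ne] in blast)+
qed

end
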